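(* Let $p \geq 3$ be a prime. For $p \equiv 1 \pmod{4}$, write $p = x^2+4y^2$ with $x, y \in \mathbb{Z}$. Let $\chi_{-4}$ denote the non-principal Dirichlet character modulo $4$. Then for $m \in \mathbb{Z}$, \[ H_{m,8}(p) = \begin{cases} \frac{p+1}{4}+\frac{1}{2}\chi_{-4}(x)x&\text{if }m \equiv 0 \pmod{8},\ p \equiv 1 \pmod{4},\\ \frac{p+1}{3}&\text{if }m \equiv 0 \pmod{8},\ p \equiv 3 \pmod{8},\\ \frac{p-3}{2}&\text{if }m \equiv 0 \pmod{8},\ p \equiv 7 \pmod{8},\\ \frac{5p-7}{12}&\text{if }m \equiv 2, 6 \pmod{8},\ p \equiv 1 \pmod{4},\\ \frac{p+1}{4}&\text{if }m \equiv 2,6 \pmod{8},\ p \equiv 3 \pmod{4},\\ \frac{p+1}{4}-\frac{1}{2}\chi_{-4}(x)x&\text{if }m \equiv 4 \pmod{8},\ p \equiv 1 \pmod{4},\\ \frac{p-3}{2}&\text{if }m \equiv 4 \pmod{8},\ p \equiv 3 \pmod{8},\\ \frac{p+1}{3}&\text{if }m \equiv 4 \pmod{8},\ p \equiv 7 \pmod{8}. \end{cases} \]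
   Context: For an integer $n>0$ with $n \equiv 0,3 \pmod 4$, the Hurwitz class number $H(n)$ is $\sum_{Q}1/\omega_Q$, where $Q$ runs over $\mathrm{SL}_2(\mathbb{Z})$-equivalence classes of positive definite binary integral quadratic forms of discriminant $-n$, and $\omega_Q = 2$ if $Q$ is equivalent to $a(x^2+y^2)$, $\omega_Q=3$ if $Q$ is equivalent to $a(x^2+xy+y^2)$, and $\omega_Q=1$ otherwise. Also $H(0) = -\frac{1}{12}$ and $H(n)=0$ if $n<0$ or $n \equiv 1,2 \pmod 4$. For $m \in \mathbb{Z}$, $M \in \mathbb{Z}_{\geq 1}$, $n \in \mathbb{Z}_{\geq 0}$, define $H_{m,M}(n) := \sum_{t \in \mathbb{Z},\, t \equiv m \pmod{M}} H(4n-t^2)$. *)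

theory Defs
  imports "HOL-Analysis.Analysis" "HOL-Number_Theory.Number_Theory"
begin

text \<open>The triple \<open>(a, b, c)\<close> stands for the form \<open>a x\<^sup>2 + b x y + c y\<^sup>2\<close>; forms are not
  required to be primitive.\<close>

type_synonym bqf = "int \<times> int \<times> int"

fun bqf_eval :: "bqf \<Rightarrow> int \<Rightarrow> int \<Rightarrow> int" where
  "bqf_eval (a, b, c) x y = a * x\<^sup>2 + b * x * y + c * y\<^sup>2"

fun bqf_disc :: "bqf \<Rightarrow> int" where
  "bqf_disc (a, b, c) = b\<^sup>2 - 4 * a * c"

definition bqf_pos_def :: "bqf \<Rightarrow> bool" where
  "bqf_pos_def Q \<longleftrightarrow> (\<forall>x y. (x, y) \<noteq> (0, 0) \<longrightarrow> bqf_eval Q x y > 0)"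

definition bqf_SL2_equiv :: "bqf \<Rightarrow> bqf \<Rightarrow> bool" where
  "bqf_SL2_equiv Q Q' \<longleftrightarrow>
     (\<exists>\<alpha> \<beta> \<gamma> \<delta> :: int. \<alpha> * \<delta> - \<beta> * \<gamma> = 1 \<and>
        (\<forall>x y. bqf_eval Q' x y = bqf_eval Q (\<alpha> * x + \<beta> * y) (\<gamma> * x + \<delta> * y)))"

definition pos_def_forms :: "int \<Rightarrow> bqf set" where
  "pos_def_forms D = {Q. bqf_pos_def Q \<and> bqf_disc Q = D}"

definition form_classes :: "int \<Rightarrow> bqf set set" where
  "form_classes D =
     pos_def_forms D // {(Q, Q'). Q \<in> pos_def_forms D \<and> Q' \<in> pos_def_forms D \<and> bqf_SL2_equiv Q Q'}"

text \<open>The weight depends only on the class of \<open>Q\<close>, so it is defined on classes.\<close>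

definition class_weight :: "bqf set \<Rightarrow> nat" where
  "class_weight C =
     (if \<exists>a. (a, 0, a) \<in> C then 2
      else if \<exists>a. (a, a, a) \<in> C then 3
      else 1)"

definition hurwitz_H :: "int \<Rightarrow> real" where
  "hurwitz_H n =
     (if n = 0 then - 1 / 12
      else if n < 0 \<or> [n = 1] (mod 4) \<or> [n = 2] (mod 4) then 0
      else (\<Sum>C\<in>form_classes (- n). 1 / real (class_weight C)))"

text \<open>All but finitely many terms vanish, since \<open>hurwitz_H\<close> is zero on negative integers.\<close>

definition hurwitz_sum :: "int \<Rightarrow> nat \<Rightarrow> nat \<Rightarrow> real" where
  "hurwitz_sum m M n =
     (\<Sum>\<^sub>\<infinity>t\<in>{t :: int. [t = m] (mod int M)}. hurwitz_H (4 * int n - t\<^sup>2))"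

definition chi_m4 :: "int \<Rightarrow> int" where
  "chi_m4 x = (if [x = 1] (mod 4) then 1 else if [x = 3] (mod 4) then - 1 else 0)"

lemma equiv_bqf_SL2_equiv:
  "equiv (pos_def_forms D)
     {(Q, Q'). Q \<in> pos_def_forms D \<and> Q' \<in> pos_def_forms D \<and> bqf_SL2_equiv Q Q'}"
proof (rule equivI)
  have "bqf_SL2_equiv Q Q" for Q
    unfolding bqf_SL2_equiv_def by (rule exI[of _ 1], rule exI[of _ 0], rule exI[of _ 0], rule exI[of _ 1]) simp
  then show "refl_on (pos_def_forms D)
     {(Q, Q'). Q \<in> pos_def_forms D \<and> Q' \<in> pos_def_forms D \<and> bqf_SL2_equiv Q Q'}"
    by (auto simp: refl_on_def)
  have "bqf_SL2_equiv Q' Q" if QQ': "bqf_SL2_equiv Q Q'" for Q Q'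
  proof -
    from QQ' obtain a b c d where det: "a * d - b * c = 1"
      and *: "\<And>x y. bqf_eval Q' x y = bqf_eval Q (a * x + b * y) (c * x + d * y)"
      unfolding bqf_SL2_equiv_def by blast
    have "bqf_eval Q x y = bqf_eval Q' (d * x + (- b) * y) ((- c) * x + a * y)" for x y
    proof -
      have "a * (d * x + (- b) * y) + b * ((- c) * x + a * y) = (a * d - b * c) * x"
        and "c * (d * x + (- b) * y) + d * ((- c) * x + a * y) = (a * d - b * c) * y"
        by (simp_all add: algebra_simps)
      then show ?thesis by (simp only: * det) simp
    qed
    moreover have "d * a - (- b) * (- c) = 1" using det by (simp add: algebra_simps)
    ultimately show ?thesis unfolding bqf_SL2_equiv_def by blast
  qed
  then show "sym {(Q, Q'). Q \<in> pos_def_forms D \<and> Q' \<in> pos_def_forms D \<and> bqf_SL2_equiv Q Q'}"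
    by (auto simp: sym_def)
  have "bqf_SL2_equiv Q Q''" if 1: "bqf_SL2_equiv Q Q'" and 2: "bqf_SL2_equiv Q' Q''" for Q Q' Q''
  proof -
    from 1 obtain a b c d where det: "a * d - b * c = 1"
      and *: "\<And>x y. bqf_eval Q' x y = bqf_eval Q (a * x + b * y) (c * x + d * y)"
      unfolding bqf_SL2_equiv_def by blast
    from 2 obtain e f g h where det': "e * h - f * g = 1"
      and **: "\<And>x y. bqf_eval Q'' x y = bqf_eval Q' (e * x + f * y) (g * x + h * y)"
      unfolding bqf_SL2_equiv_def by blast
    have "bqf_eval Q'' x y =
      bqf_eval Q ((a * e + b * g) * x + (a * f + b * h) * y) ((c * e + d * g) * x + (c * f + d * h) * y)"
      for x y by (simp add: * ** algebra_simps)
    moreover have "(a * e + b * g) * (c * f + d * h) - (a * f + b * h) * (c * e + d * g)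
        = (a * d - b * c) * (e * h - f * g)" by (simp add: algebra_simps)
    ultimately show ?thesis unfolding bqf_SL2_equiv_def det det' by (metis mult_1)
  qed
  then show "trans {(Q, Q'). Q \<in> pos_def_forms D \<and> Q' \<in> pos_def_forms D \<and> bqf_SL2_equiv Q Q'}"
    by (auto simp: trans_def)
qed auto

end

theory Submission
  imports Defs "HOL-Computational_Algebra.Formal_Power_Series"
begin

text \<open>Writing a reduced form as \<open>(x + z, \<plusminus> 2 z, y + z)\<close> identifies \<open>3 H(4 n)\<close> with the weighted number of
  triples \<open>x, y, z \<ge> 0\<close> with \<open>x y + y z + z x = n\<close>, which splits into \<open>3 U(n) + V(n)\<close> according to the
  parities of \<open>x, y, z\<close>.  The sums of \<open>U(N - s\<^sup>2)\<close> and \<open>V(N - s\<^sup>2)\<close> over \<open>s\<close> count the integral matrices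
  of determinant \<open>\<plusminus> N\<close> that fix a point inside the ideal quadrilateral with vertices \<open>0, \<infinity>, 1, - 1\<close> of
  the hyperbolic plane.  The reflections in its sides generate a congruence group, and every coset of
  this group contains exactly one such matrix up to sign (the one of least displacement), unless a
  cusp is attracting; counting cosets gives divisor sums.

  To separate the residues of \<open>s\<close> modulo 4 for \<open>N = p\<close> with \<open>p \<equiv> 1 (mod 4)\<close>, the four squares theorem
  (from Liouville's identity) shows that \<open>4 U(n)\<close> is the number of representations
  \<open>n = a\<^sup>2 + 4 b\<^sup>2 + 4 c\<^sup>2\<close> with \<open>a\<close> odd, and Jacobi's identity for the cube of the eta function evaluates the
  alternating sum of these numbers as \<open>4 \<chi>(x) x\<close>.  For \<open>p \<equiv> 3 (mod 4)\<close>, an elementary bijection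
  gives \<open>V = U\<close> on \<open>3\<close> and \<open>V = 3 U\<close> on \<open>7\<close> modulo 8.\<close>

section \<open>Fixed forms of integral matrices\<close>

text \<open>A matrix with rows \<open>(s + w, - (x + \<bar>w\<bar>))\<close> and
  \<open>(y + \<bar>w\<bar>, s - w)\<close> has trace \<open>2 * s\<close> and determinant
  \<open>s\<^sup>2 + x * y + y * z + z * x\<close> with \<open>z = \<bar>w\<bar>\<close>, and its
  fixed point lies in the closed quadrilateral iff \<open>x, y \<ge> 0\<close>. This is why matrices
  of determinant \<open>N\<close> count the triples for \<open>N - s\<^sup>2\<close>. The halved
  weights of triples with a zero entry come from fixed points on the sides; the reflections of
  determinant \<open>- N\<close> turn these halves into whole matrices. The obstacle is that the
  quadrilateral is not compact: the least displacement of a coset might be approached only at a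
  cusp. An attracting cusp indeed excludes a fixed point; every other case needs a bound on heights.
  The matrices separate the values of \<open>s\<close> only by parity. For p \<equiv> 3 (mod 4) the
  residue of \<open>p - s\<^sup>2\<close> modulo 8 supplies the missing equation. For p \<equiv> 1
  (mod 4) the sum V vanishes at every even \<open>s\<close>, no such equation is left, and theta
  series have to replace it. Identifying their coefficients is an induction over all n \<equiv> 1
  (mod 4), so one of the coset counts has to hold for composite \<open>N\<close> and for squares
  too.\<close>

text \<open>\<open>(p, r, q)\<close> is the symmetric matrix with rows \<open>(p, r)\<close> and \<open>(r, q)\<close>, and \<open>(a, b, c, d)\<close> the matrix with
  rows \<open>(a, b)\<close> and \<open>(c, d)\<close>; the latter act by \<open>T \<mapsto> Y T Y\<^sup>T\<close>.\<close>

type_synonym qform = "real \<times> real \<times> real"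
type_synonym imat = "int \<times> int \<times> int \<times> int"

section \<open>Binary forms as a Lorentzian space\<close>

text \<open>The determinant of the symmetric matrix has signature (1, 2), so positive definite forms
  up to scaling are a model of the hyperbolic plane.\<close>

fun fQ :: "qform \<Rightarrow> real" where "fQ (p, r, q) = p * q - r\<^sup>2"

text \<open>The polar form of \<open>fQ\<close>, normalised by \<open>fB T T = 2 * fQ T\<close>. For
  positive definite forms of common determinant \<open>u\<close> it is \<open>2 * u\<close> times
  the hyperbolic cosine of their distance, so \<open>fB T (act Y T) / fQ T\<close> measures the
  displacement of \<open>T\<close> under \<open>Y\<close>.\<close>

fun fB :: "qform \<Rightarrow> qform \<Rightarrow> real" where
  "fB (p, r, q) (p', r', q') = p * q' + q * p' - 2 * r * r'"

fun mdet :: "imat \<Rightarrow> int" where "mdet (a, b, c, d) = a * d - b * c"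

fun mmul :: "imat \<Rightarrow> imat \<Rightarrow> imat" where
  "mmul (a, b, c, d) (a', b', c', d') =
     (a * a' + b * c', a * b' + b * d', c * a' + d * c', c * b' + d * d')"

fun mvec :: "imat \<Rightarrow> int \<times> int \<Rightarrow> int \<times> int" where
  "mvec (a, b, c, d) (x, y) = (a * x + b * y, c * x + d * y)"

fun vdet :: "int \<times> int \<Rightarrow> int \<times> int \<Rightarrow> int" where
  "vdet (x, y) (x', y') = x * y' - y * x'"

fun act :: "imat \<Rightarrow> qform \<Rightarrow> qform" where
  "act (a, b, c, d) (p, r, q) =
     (a\<^sup>2 * p + 2 * a * b * r + b\<^sup>2 * q,
      a * c * p + (a * d + b * c) * r + b * d * q,
      c\<^sup>2 * p + 2 * c * d * r + d\<^sup>2 * q)"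

text \<open>The null vector \<open>v v\<^sup>T\<close>, that is, an ideal point of the plane.
  \<open>fB T (cusp v)\<close> is the value at \<open>v\<close> of the adjugate form of
  \<open>T\<close>; relative to \<open>fQ T\<close> it is small when \<open>T\<close> is close to
  this cusp.\<close>

fun cusp :: "int \<times> int \<Rightarrow> qform" where
  "cusp (x, y) = ((of_int x)\<^sup>2, of_int x * of_int y, (of_int y)\<^sup>2)"

fun psd :: "qform \<Rightarrow> bool" where
  "psd (p, r, q) \<longleftrightarrow> p \<ge> 0 \<and> q \<ge> 0 \<and> r\<^sup>2 \<le> p * q"

lemma act_mmul: "act (mmul g Y) T = act g (act Y T)"
  by (cases g; cases Y; cases T) (simp add: algebra_simps power2_eq_square)

lemma mdet_mmul: "mdet (mmul g Y) = mdet g * mdet Y"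
  by (cases g; cases Y) (simp add: algebra_simps)

lemma mvec_mmul: "mvec (mmul g Y) v = mvec g (mvec Y v)"
  by (cases g; cases Y; cases v) (simp add: algebra_simps)

lemma mmul_assoc: "mmul (mmul g h) Y = mmul g (mmul h Y)"
  by (cases g; cases h; cases Y) (simp add: algebra_simps)

lemma vdet_mvec: "vdet (mvec g v) (mvec g w) = mdet g * vdet v w"
  by (cases g; cases v; cases w) (simp add: algebra_simps)

lemma fQ_act: "fQ (act Y T) = (of_int (mdet Y))\<^sup>2 * fQ T"
  by (cases Y; cases T) (simp add: algebra_simps power2_eq_square)

lemma fB_act: "fB (act Y T) (act Y S) = (of_int (mdet Y))\<^sup>2 * fB T S"
  by (cases Y; cases T; cases S) (simp add: algebra_simps power2_eq_square)

lemma act_cusp: "act Y (cusp v) = cusp (mvec Y v)"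
  by (cases Y; cases v) (simp add: algebra_simps power2_eq_square)

lemma fB_cusp: "fB (cusp v) (cusp w) = (of_int (vdet v w))\<^sup>2"
  by (cases v; cases w) (simp add: algebra_simps power2_eq_square)

lemma act_add: "act Y (S + T) = act Y S + act Y T"
  by (cases Y; cases S; cases T) (simp add: algebra_simps)

lemma act_scale: "act Y (k *\<^sub>R T) = k *\<^sub>R act Y T"
  by (cases Y; cases T) (simp add: algebra_simps)

lemma act_diff: "act Y (S - T) = act Y S - act Y T"
  by (cases Y; cases S; cases T) (simp add: algebra_simps)

lemma fB_add_left: "fB (S + T) U = fB S U + fB T U"
  by (cases S; cases T; cases U) (simp add: algebra_simps)

lemma fB_diff_left: "fB (S - T) U = fB S U - fB T U"
  by (cases S; cases T; cases U) (simp add: algebra_simps)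

lemma fB_scale_left: "fB (k *\<^sub>R S) U = k * fB S U"
  by (cases S; cases U) (simp add: algebra_simps)

lemma fB_commute: "fB S T = fB T S"
  by (cases S; cases T) (simp add: algebra_simps)

lemma fB_add_right: "fB U (S + T) = fB U S + fB U T"
  by (metis fB_commute fB_add_left)

lemma fB_diff_right: "fB U (S - T) = fB U S - fB U T"
  by (metis fB_commute fB_diff_left)

lemma fB_scale_right: "fB U (k *\<^sub>R S) = k * fB U S"
  by (metis fB_commute fB_scale_left)

lemmas fB_linear = fB_add_left fB_add_right fB_diff_left fB_diff_right fB_scale_left fB_scale_right

lemma fB_self: "fB T T = 2 * fQ T"
  by (cases T) (simp add: algebra_simps power2_eq_square)

lemma fQ_add: "fQ (S + T) = fQ S + fQ T + fB S T"
  by (cases S; cases T) (simp add: algebra_simps power2_eq_square)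

lemma fQ_diff: "fQ (S - T) = fQ S + fQ T - fB S T"
  by (cases S; cases T) (simp add: algebra_simps power2_eq_square)

lemma fQ_scale: "fQ (k *\<^sub>R T) = k\<^sup>2 * fQ T"
  by (cases T) (simp add: algebra_simps power2_eq_square)

text \<open>Two vectors of the closed forward light cone pair nonnegatively:
  \<open>(r * r')\<^sup>2\<close> is at most \<open>(p * q') * (q * p')\<close>, and the
  arithmetic-geometric mean inequality bounds this by the square of half of
  \<open>p * q' + q * p'\<close>.\<close>

lemma fB_psd_nonneg:
  assumes "psd S" "psd T" shows "fB S T \<ge> 0"
proof -
  obtain p r q p' r' q' where S: "S = (p, r, q)" and T: "T = (p', r', q')" by (cases S; cases T)
  have h: "p \<ge> 0" "q \<ge> 0" "r\<^sup>2 \<le> p * q" "p' \<ge> 0" "q' \<ge> 0" "r'\<^sup>2 \<le> p' * q'"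
    using assms by (auto simp: S T)
  have "(2 * r * r')\<^sup>2 = 4 * (r\<^sup>2 * r'\<^sup>2)" by (simp add: power_mult_distrib)
  also have "\<dots> \<le> 4 * ((p * q) * (p' * q'))"
    using h by (intro mult_left_mono mult_mono) auto
  also have "\<dots> = (p * q' + q * p')\<^sup>2 - (p * q' - q * p')\<^sup>2"
    by (simp add: algebra_simps power2_eq_square)
  also have "\<dots> \<le> (p * q' + q * p')\<^sup>2" by simp
  finally have "\<bar>2 * r * r'\<bar> \<le> \<bar>p * q' + q * p'\<bar>" by (simp add: abs_le_square_iff)
  moreover have "p * q' + q * p' \<ge> 0" using h by simp
  ultimately show ?thesis by (simp add: S T)
qed

lemma psd_act: assumes "psd T" shows "psd (act Y T)"
proof -
  obtain p r q where T: "T = (p, r, q)" by (cases T)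
  obtain a b c d where Y: "Y = (a, b, c, d)" by (cases Y)
  have key: "x\<^sup>2 * p + 2 * x * y * r + y\<^sup>2 * q \<ge> 0" for x y :: real
  proof -
    \<comment> \<open>The rank one form whose pairing with \<open>T\<close> is the value of
      \<open>T\<close> at \<open>(x, y)\<close>.\<close>
    have "psd (y\<^sup>2, - x * y, x\<^sup>2)" by (simp add: power_mult_distrib mult.commute)
    from fB_psd_nonneg[OF this assms] show ?thesis by (simp add: T algebra_simps)
  qed
  have "fQ (act Y T) \<ge> 0" unfolding fQ_act using assms by (simp add: T)
  then show ?thesis using key[of a b] key[of c d] by (simp add: T Y)
qed

lemma psd_cusp: "psd (cusp v)"
  by (cases v) (simp add: power_mult_distrib)

text \<open>Signature (1, 2): the orthogonal complement of a positive vector is negative definite.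
  Eliminating \<open>z\<close> by orthogonality writes \<open>p\<^sup>2 * fQ E\<close> as minus a
  sum of two squares with positive coefficients.\<close>

lemma fB_posdef_orthogonal:
  assumes "psd T" "fQ T > 0" "fB E T = 0"
  shows "fQ E \<le> 0" and "fQ E = 0 \<Longrightarrow> E = 0"
proof -
  obtain p r q x y z where T: "T = (p, r, q)" and E: "E = (x, y, z)" by (cases T; cases E)
  have p: "p > 0" using assms by (auto simp: T less_eq_real_def)
  have "p * z = 2 * r * y - q * x" using assms(3) by (simp add: T E algebra_simps)
  then have "x * (p * z) = x * (2 * r * y - q * x)" by simp
  then have "p * fQ E = - (q * x\<^sup>2 - 2 * r * x * y + p * y\<^sup>2)"
    by (simp add: E algebra_simps power2_eq_square)
  then have "p * (p * fQ E) = p * - (q * x\<^sup>2 - 2 * r * x * y + p * y\<^sup>2)" by simp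
  then have "p\<^sup>2 * fQ E = - (p * (q * x\<^sup>2 - 2 * r * x * y + p * y\<^sup>2))"
    by (simp only: power2_eq_square mult.assoc mult_minus_right)
  also have "\<dots> = - ((p * y - r * x)\<^sup>2 + fQ T * x\<^sup>2)"
    by (simp add: T algebra_simps power2_eq_square)
  finally have *: "p\<^sup>2 * fQ E = - ((p * y - r * x)\<^sup>2 + fQ T * x\<^sup>2)" .
  have "(p * y - r * x)\<^sup>2 + fQ T * x\<^sup>2 \<ge> 0" using assms by simp
  then have "p\<^sup>2 * fQ E \<le> 0" using * by linarith
  then show "fQ E \<le> 0" using p by (simp add: mult_le_0_iff)
  assume "fQ E = 0"
  then have z: "(p * y - r * x)\<^sup>2 + fQ T * x\<^sup>2 = 0" using * by simp
  have "fQ T * x\<^sup>2 \<ge> 0" using assms by simp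
  then have "fQ T * x\<^sup>2 = 0" "(p * y - r * x)\<^sup>2 = 0"
    using z zero_le_power2[of "p * y - r * x"] by linarith+
  then have x: "x = 0" and "p * y - r * x = 0" using assms by auto
  then have y: "y = 0" using p by simp
  have "z = 0" using \<open>p * z = 2 * r * y - q * x\<close> p x y by simp
  then show "E = 0" by (simp add: E x y zero_prod_def)
qed

text \<open>The reversed Cauchy-Schwarz inequality: split off from \<open>S\<close> its component
  \<open>k *\<^sub>R T\<close> and apply negativity to the orthogonal remainder.\<close>

lemma fB_ge_fQ:
  assumes "psd S" "psd T" "fQ S = u" "fQ T = u" "u > 0"
  shows "fB S T \<ge> 2 * u"
proof -
  define k where "k = fB S T / (2 * u)"
  have "fB (S - k *\<^sub>R T) T = 0" using assms by (simp add: fB_linear fB_self k_def)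
  then have "fQ (S - k *\<^sub>R T) \<le> 0" using fB_posdef_orthogonal[of T] assms by auto
  moreover have "fQ (S - k *\<^sub>R T) = u - k * fB S T + k\<^sup>2 * u"
    using assms by (simp add: fQ_diff fQ_scale fB_linear)
  ultimately have "u - k * fB S T + k\<^sup>2 * u \<le> 0" by simp
  moreover have "fB S T = 2 * u * k" using assms by (simp add: k_def)
  ultimately have "u * (1 - k\<^sup>2) \<le> 0" by (simp add: algebra_simps power2_eq_square)
  then have "1 \<le> k\<^sup>2" using assms by (simp add: mult_le_0_iff)
  moreover have "k \<ge> 0" using fB_psd_nonneg[OF assms(1,2)] assms by (simp add: k_def)
  ultimately have "1 \<le> k" by (metis abs_of_nonneg abs_one abs_square_le_1 le_cases one_power2 order_antisym power2_le_imp_le zero_le_one)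
  then show ?thesis using assms by (simp add: k_def field_simps)
qed

text \<open>The coefficient is chosen so that \<open>fQ\<close> of the difference is 0. Thus
  \<open>T\<close> is a sum of two null vectors of the forward cone, one of them along the given
  cusp.\<close>

lemma psd_split_cusp:
  assumes "psd T" "fQ T > 0" "fB T (cusp v) > 0"
  shows "psd (T - (fQ T / fB T (cusp v)) *\<^sub>R cusp v)"
proof -
  obtain p r q where T: "T = (p, r, q)" by (cases T)
  obtain i j where v: "v = (i, j)" by (cases v)
  define x y where "x = real_of_int i" and "y = real_of_int j"
  define b where "b = fB T (cusp v)"
  define k where "k = fQ T / b"
  have b: "b > 0" "b = p * y\<^sup>2 + q * x\<^sup>2 - 2 * r * (x * y)"
    using assms by (simp_all add: b_def T v x_def y_def)
  have Qk: "fQ T = k * b" using b by (simp add: k_def)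
  have "b * (p - k * x\<^sup>2) = p * b - fQ T * x\<^sup>2" by (simp add: Qk algebra_simps)
  also have "\<dots> = (p * y - r * x)\<^sup>2" by (simp add: b(2) T algebra_simps power2_eq_square)
  finally have "b * (p - k * x\<^sup>2) \<ge> 0" by simp
  then have 1: "p - k * x\<^sup>2 \<ge> 0" using b by (simp add: zero_le_mult_iff)
  have "b * (q - k * y\<^sup>2) = q * b - fQ T * y\<^sup>2" by (simp add: Qk algebra_simps)
  also have "\<dots> = (q * x - r * y)\<^sup>2" by (simp add: b(2) T algebra_simps power2_eq_square)
  finally have "b * (q - k * y\<^sup>2) \<ge> 0" by simp
  then have 2: "q - k * y\<^sup>2 \<ge> 0" using b by (simp add: zero_le_mult_iff)
  have "(p - k * x\<^sup>2) * (q - k * y\<^sup>2) - (r - k * (x * y))\<^sup>2 = fQ T - k * b"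
    by (simp add: b(2) T algebra_simps power2_eq_square)
  then have 3: "(r - k * (x * y))\<^sup>2 \<le> (p - k * x\<^sup>2) * (q - k * y\<^sup>2)" using Qk by simp
  show ?thesis using 1 2 3 by (simp add: T v flip: k_def b_def x_def y_def) (simp add: b_def k_def T v x_def y_def)
qed

lemma fB_ge_split:
  assumes "psd S" "psd T" "fQ T > 0" "fB T (cusp v) > 0"
  shows "fQ T / fB T (cusp v) * fB S (cusp v) \<le> fB S T"
proof -
  let ?k = "fQ T / fB T (cusp v)"
  have "0 \<le> fB S (T - ?k *\<^sub>R cusp v)"
    using fB_psd_nonneg[OF assms(1) psd_split_cusp[OF assms(2-4)]] .
  then show ?thesis by (simp add: fB_linear)
qed

text \<open>Both copies of \<open>T\<close> are replaced by their component along the cusp, and the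
  discarded terms are pairings of semidefinite forms. Hence a matrix that does not fix the line of
  \<open>v\<close> moves points close to the cusp \<open>v\<close> very far.\<close>

lemma fB_act_ge_split:
  assumes "psd T" "fQ T > 0" "fB T (cusp v) > 0"
  shows "(fQ T / fB T (cusp v))\<^sup>2 * (of_int (vdet v (mvec Y v)))\<^sup>2 \<le> fB T (act Y T)"
proof -
  let ?k = "fQ T / fB T (cusp v)"
  let ?T = "T - ?k *\<^sub>R cusp v"
  have p: "psd ?T" by (rule psd_split_cusp[OF assms])
  have k: "?k \<ge> 0" using assms by simp
  have "0 \<le> fB ?T (act Y T)" by (intro fB_psd_nonneg p psd_act assms)
  moreover have "0 \<le> ?k * fB (cusp v) (act Y ?T)"
    by (intro mult_nonneg_nonneg k fB_psd_nonneg p psd_act psd_cusp)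
  ultimately have "0 \<le> fB T (act Y T) - ?k\<^sup>2 * fB (cusp v) (act Y (cusp v))"
    by (simp add: fB_linear act_diff act_scale power2_eq_square algebra_simps)
  then show ?thesis by (simp add: act_cusp fB_cusp)
qed

section \<open>The ideal quadrilateral and the reflections in its sides\<close>

definition verts :: "(int \<times> int) set" where "verts = {(1, 0), (0, 1), (1, 1), (1, - 1)}"

text \<open>The cone over the closed quadrilateral, spanned by the cusps of the four vertices
  (\<open>inC_decompose\<close>).\<close>

fun inC :: "qform \<Rightarrow> bool" where "inC (p, r, q) \<longleftrightarrow> \<bar>r\<bar> \<le> p \<and> \<bar>r\<bar> \<le> q"

fun ftr :: "qform \<Rightarrow> real" where "ftr (p, r, q) = p + q"

text \<open>Linear forms that vanish on the sides. Walls 0 and 1 join \<open>(0, 1)\<close> to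
  \<open>(1, 1)\<close> and to \<open>(1, - 1)\<close>; walls 2 and 3 join \<open>(1, 0)\<close> to
  the same two vertices.\<close>

fun wall :: "nat \<Rightarrow> qform \<Rightarrow> real" where
  "wall i (p, r, q) = (if i = 0 then p - r else if i = 1 then p + r else if i = 2 then q - r else q + r)"

definition refl_mat :: "nat \<Rightarrow> imat" where
  "refl_mat i = (if i = 0 then (1, 0, 2, - 1) else if i = 1 then (1, 0, - 2, - 1)
     else if i = 2 then (- 1, 2, 0, 1) else (- 1, - 2, 0, 1))"

lemma inC_wall: "inC T \<longleftrightarrow> (\<forall>i < 4. wall i T \<ge> 0)"
  by (cases T) (auto simp: numeral_eq_Suc less_Suc_eq all_conj_distrib)

lemma mdet_refl: "mdet (refl_mat i) = - 1" by (simp add: refl_mat_def)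

text \<open>The extra term has the sign of \<open>wall i S * wall i T\<close>. Reflecting
  \<open>T\<close> therefore brings it closer to \<open>S\<close> exactly when the wall separates
  the two, which is the basis of every folding argument below.\<close>

lemma fB_refl: "i < 4 \<Longrightarrow> fB S (act (refl_mat i) T) = fB S T + 4 * (wall i S * wall i T)"
  by (cases S; cases T) (auto simp: refl_mat_def algebra_simps)

lemma wall_refl: "i < 4 \<Longrightarrow> wall i (act (refl_mat i) T) = - wall i T"
  by (cases T) (auto simp: refl_mat_def algebra_simps)

lemma refl_fix: "i < 4 \<Longrightarrow> wall i T = 0 \<Longrightarrow> act (refl_mat i) T = T"
  by (cases T) (auto simp: refl_mat_def algebra_simps)

lemma refl_refl: "mmul (refl_mat i) (mmul (refl_mat i) Y) = Y"
  by (cases Y) (auto simp: refl_mat_def)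

lemma wall_add: "wall i (S + T) = wall i S + wall i T" by (cases S; cases T) simp
lemma wall_scale: "wall i (k *\<^sub>R S) = k * wall i S" by (cases S) (simp add: algebra_simps)
lemma ftr_scale: "ftr (k *\<^sub>R S) = k * ftr S" by (cases S) (simp add: algebra_simps)
lemma ftr_diff: "ftr (S - T) = ftr S - ftr T" by (cases S; cases T) simp

lemma inC_add: "inC S \<Longrightarrow> inC T \<Longrightarrow> inC (S + T)"
  by (auto simp: inC_wall wall_add)

lemma inC_scale: "inC T \<Longrightarrow> k \<ge> 0 \<Longrightarrow> inC (k *\<^sub>R T)"
  by (auto simp: inC_wall wall_scale)

lemma inC_psd: assumes "inC T" shows "psd T"
proof -
  obtain p r q where T: "T = (p, r, q)" by (cases T)
  have h: "\<bar>r\<bar> \<le> p" "\<bar>r\<bar> \<le> q" using assms by (auto simp: T)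
  have "\<bar>r\<bar> * \<bar>r\<bar> \<le> p * q" using h by (intro mult_mono) auto
  then show ?thesis using h by (auto simp: T power2_eq_square)
qed

text \<open>Two sides meet at most in an ideal vertex, where \<open>fQ\<close> vanishes, so a point
  of the plane lies on at most one wall.\<close>

lemma two_walls:
  assumes "inC T" "fQ T > 0" "i < 4" "j < 4" "i \<noteq> j" "wall i T = 0"
  shows "wall j T > 0"
proof (rule ccontr)
  assume "\<not> wall j T > 0"
  then have j: "wall j T = 0" using assms by (force simp: inC_wall)
  obtain p r q where T: "T = (p, r, q)" by (cases T)
  have w: "wall 0 T = p - r" "wall 1 T = p + r" "wall 2 T = q - r" "wall 3 T = q + r"
    by (simp_all add: T)
  have ge: "p - r \<ge> 0" "p + r \<ge> 0" "q - r \<ge> 0" "q + r \<ge> 0"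
    using assms(1) by (auto simp: T abs_le_iff)
  have "i = 0 \<or> i = 1 \<or> i = 2 \<or> i = 3" "j = 0 \<or> j = 1 \<or> j = 2 \<or> j = 3" using assms by auto
  then have z: "p - r = 0 \<and> p + r = 0 \<or> p - r = 0 \<and> q - r = 0 \<or> p - r = 0 \<and> q + r = 0 \<or>
      p + r = 0 \<and> q - r = 0 \<or> p + r = 0 \<and> q + r = 0 \<or> q - r = 0 \<and> q + r = 0"
    using assms(5,6) j w by metis
  then have "p = 0 \<or> q = 0 \<or> (p = r \<and> q = r) \<or> (p = - r \<and> q = - r)"
    using ge by argo
  then have "fQ T \<le> 0" by (auto simp: T power2_eq_square)
  then show False using assms by simp
qed

section \<open>Heights at the cusps, compactness and minimal displacement\<close>

text \<open>The only way to infinity inside the quadrilateral is through a vertex. By symmetry 0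
  \<le> r \<le> p \<le> q; then \<open>(0, 1)\<close> serves if
  \<open>4 * (q - r) \<ge> p + q\<close>, and \<open>(1, 1)\<close> serves otherwise.\<close>

lemma ftr_le_fQ:
  assumes "inC T" "fQ T > 0"
  shows "\<exists>v\<in>verts. ftr T * fB T (cusp v) \<le> 8 * fQ T"
proof -
  have gen: "p * (p + q) \<le> 8 * (p * q - r\<^sup>2) \<or> (p + q) * (p + q - 2 * r) \<le> 8 * (p * q - r\<^sup>2)"
    if "0 \<le> r" "r \<le> p" "p \<le> q" for p q r :: real
  proof (cases "4 * (q - r) \<ge> p + q")
    case True
    have "p * (p + q) \<le> p * (4 * (q - r))" using True that by (intro mult_left_mono) auto
    also have "\<dots> \<le> 8 * (p * (q - r))"
      using mult_nonneg_nonneg[of p "q - r"] that by (simp add: algebra_simps)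
    also have "p * (q - r) \<le> p * q - r\<^sup>2"
      using that mult_right_mono[of r p r] by (simp add: algebra_simps power2_eq_square)
    finally show ?thesis by simp
  next
    case False
    then have p: "4 * p \<ge> p + q" using that by (smt (verit))
    have "(p + q) * (p + q - 2 * r) \<le> (4 * p) * (2 * (q - r))"
      using that p by (intro mult_mono) auto
    also have "p * (q - r) \<le> p * q - r\<^sup>2"
      using that mult_right_mono[of r p r] by (simp add: algebra_simps power2_eq_square)
    then have "(4 * p) * (2 * (q - r)) \<le> 8 * (p * q - r\<^sup>2)" by (simp add: algebra_simps)
    finally show ?thesis by simp
  qed
  obtain p r q where T: "T = (p, r, q)" by (cases T)
  have h: "\<bar>r\<bar> \<le> p" "\<bar>r\<bar> \<le> q" using assms by (auto simp: T)
  show ?thesis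
  proof (cases "p \<le> q")
    case True
    from gen[of "\<bar>r\<bar>" p q] h True show ?thesis
      by (cases "r \<ge> 0") (auto simp: T verts_def algebra_simps)
  next
    case False
    from gen[of "\<bar>r\<bar>" q p] h False show ?thesis
      by (cases "r \<ge> 0") (auto simp: T verts_def algebra_simps)
  qed
qed

lemma fB_cusp_pos:
  assumes "psd T" "fQ T > 0" "v \<noteq> (0, 0)"
  shows "fB T (cusp v) > 0"
proof -
  have "fB T (cusp v) \<ge> 0" by (intro fB_psd_nonneg assms psd_cusp)
  moreover have "fB T (cusp v) \<noteq> 0"
  proof
    assume "fB T (cusp v) = 0"
    then have "fB (cusp v) T = 0" by (simp add: fB_commute)
    moreover have "fQ (cusp v) = 0" by (cases v) (simp add: power_mult_distrib)
    ultimately have "cusp v = 0" using fB_posdef_orthogonal(2)[of T] assms by auto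
    then show False using assms(3) by (cases v) (simp add: zero_prod_def)
  qed
  ultimately show ?thesis by simp
qed

lemma vdet_fixed:
  assumes "v \<in> verts" "vdet v (mvec Y v) = 0"
  shows "\<exists>l. mvec Y v = (l * fst v, l * snd v)"
  using assms by (cases Y) (auto simp: verts_def intro: exI[of _ "fst (mvec Y v)"])

text \<open>Away from the vertices, where the square of the height \<open>fQ T / (fB T (cusp v))\<^sup>2\<close> is at most \<open>L\<close>.\<close>

definition low :: "real \<Rightarrow> qform \<Rightarrow> bool" where
  "low L T \<longleftrightarrow> inC T \<and> fQ T > 0 \<and> (\<forall>v\<in>verts. fQ T \<le> L * (fB T (cusp v))\<^sup>2)"

lemma low_scale: "low L T \<Longrightarrow> k > 0 \<Longrightarrow> low L (k *\<^sub>R T)"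
  unfolding low_def by (auto simp: inC_scale fQ_scale fB_linear power_mult_distrib intro: mult_left_mono)

text \<open>A bound on the heights at all four vertices confines the trace: combine the height bound
  at the vertex given by \<open>ftr_le_fQ\<close> with the square of that inequality.\<close>

lemma low_ftr:
  assumes "low L T" "L > 0"
  shows "(ftr T)\<^sup>2 \<le> 64 * L * fQ T"
proof -
  have T: "inC T" "fQ T > 0" using assms by (auto simp: low_def)
  obtain v where v: "v \<in> verts" "ftr T * fB T (cusp v) \<le> 8 * fQ T" using ftr_le_fQ[OF T] by blast
  have b: "fB T (cusp v) > 0" using v T by (intro fB_cusp_pos inC_psd) (auto simp: verts_def)
  have t: "ftr T \<ge> 0" using T by (cases T) auto
  have "(ftr T)\<^sup>2 * fQ T \<le> (ftr T)\<^sup>2 * (L * (fB T (cusp v))\<^sup>2)"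
    using assms v by (intro mult_left_mono) (auto simp: low_def)
  also have "\<dots> = L * (ftr T * fB T (cusp v))\<^sup>2" by (simp add: power_mult_distrib)
  also have "\<dots> \<le> L * (8 * fQ T)\<^sup>2"
    using v b t assms by (intro mult_left_mono power_mono) auto
  also have "\<dots> = (64 * L * fQ T) * fQ T" by (simp add: power2_eq_square)
  finally show ?thesis using T by simp
qed

text \<open>With trace 1 the smaller eigenvalue of \<open>T\<close> is at least the determinant, so
  \<open>T - fQ T *\<^sub>R I\<close> is semidefinite. Replacing both copies of \<open>T\<close> by
  \<open>fQ T *\<^sub>R I\<close> leaves the squared Frobenius norm of the matrix, and only finitely
  many integral matrices keep it bounded.\<close>

lemma fB_act_ge_norm:
  assumes "inC T" "ftr T = 1" "fQ T > 0"
  shows "(fQ T)\<^sup>2 * (real_of_int (a\<^sup>2 + b\<^sup>2 + c\<^sup>2 + d\<^sup>2)) \<le> fB T (act (a, b, c, d) T)"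
proof -
  let ?Y = "(a, b, c, d)" and ?I = "(1, 0, 1) :: qform"
  obtain p r q where T: "T = (p, r, q)" by (cases T)
  have pq: "p \<ge> 0" "q \<ge> 0" "p + q = 1" using assms by (auto simp: T)
  define k where "k = fQ T"
  have k: "k > 0" "k = p * q - r\<^sup>2" using assms by (auto simp: k_def T)
  have "k \<le> p * q" using k by simp
  also have "p * q \<le> p * 1" using pq by (intro mult_left_mono) auto
  finally have kp: "k \<le> p" by simp
  have "k \<le> p * q" using k by simp
  also have "p * q \<le> 1 * q" using pq by (intro mult_right_mono) auto
  finally have kq: "k \<le> q" by simp
  have "(p - k) * (q - k) - r\<^sup>2 = k - k * (p + q) + k * k"
    by (subst (2) k(2)) (simp add: algebra_simps)
  also have "\<dots> \<ge> 0" using pq k by simp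
  finally have ps: "psd (T - k *\<^sub>R ?I)" using kp kq by (simp add: T)
  have "0 \<le> fB (T - k *\<^sub>R ?I) (act ?Y T)"
    using assms by (intro fB_psd_nonneg ps psd_act inC_psd)
  moreover have "0 \<le> k * fB ?I (act ?Y (T - k *\<^sub>R ?I))"
    using k by (intro mult_nonneg_nonneg fB_psd_nonneg psd_act ps) auto
  ultimately have "0 \<le> fB T (act ?Y T) - k\<^sup>2 * fB ?I (act ?Y ?I)"
    by (simp only: fB_linear act_diff act_scale power2_eq_square) (simp add: algebra_simps)
  then show ?thesis by (simp add: k_def algebra_simps)
qed

lemma finite_imat_bounded: "finite {(a::int, b::int, c::int, d::int). a\<^sup>2 + b\<^sup>2 + c\<^sup>2 + d\<^sup>2 \<le> K}"
proof (rule finite_subset)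
  have le: "\<bar>x\<bar> \<le> x\<^sup>2" for x :: int
    by (cases "x = 0") (use mult_left_mono[of 1 "\<bar>x\<bar>" "\<bar>x\<bar>"] in \<open>auto simp: power2_eq_square\<close>)
  show "{(a::int, b::int, c::int, d::int). a\<^sup>2 + b\<^sup>2 + c\<^sup>2 + d\<^sup>2 \<le> K} \<subseteq> {-K..K} \<times> {-K..K} \<times> {-K..K} \<times> {-K..K}"
  proof clarify
    fix a b c d :: int assume h: "a\<^sup>2 + b\<^sup>2 + c\<^sup>2 + d\<^sup>2 \<le> K"
    have "\<bar>a\<bar> \<le> K" "\<bar>b\<bar> \<le> K" "\<bar>c\<bar> \<le> K" "\<bar>d\<bar> \<le> K"
      using h le[of a] le[of b] le[of c] le[of d]
        zero_le_power2[of a] zero_le_power2[of b] zero_le_power2[of c] zero_le_power2[of d] by linarith+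
    then show "a \<in> {-K..K} \<and> (b, c, d) \<in> {-K..K} \<times> {-K..K} \<times> {-K..K}" by (auto simp: abs_le_iff)
  qed
qed simp

lemma inC_alt: "inC T \<longleftrightarrow> \<bar>fst (snd T)\<bar> \<le> fst T \<and> \<bar>fst (snd T)\<bar> \<le> snd (snd T)"
  by (cases T) simp
lemma ftr_alt: "ftr T = fst T + snd (snd T)" by (cases T) simp
lemma fQ_alt: "fQ T = fst T * snd (snd T) - (fst (snd T))\<^sup>2" by (cases T) simp
lemma fB_cusp_alt: "fB T (cusp v) = fst T * (of_int (snd v))\<^sup>2 + snd (snd T) * (of_int (fst v))\<^sup>2
     - 2 * fst (snd T) * (of_int (fst v) * of_int (snd v))"
  by (cases T; cases v) simp

lemma continuous_fB_act: "continuous_on UNIV (\<lambda>T. fB T (act Y T))"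
proof -
  obtain a b c d where Y: "Y = (a, b, c, d)" by (cases Y)
  have "continuous_on UNIV (\<lambda>T::qform. fst T * (c\<^sup>2 * fst T + 2 * c * d * fst (snd T) + d\<^sup>2 * snd (snd T))
     + snd (snd T) * (a\<^sup>2 * fst T + 2 * a * b * fst (snd T) + b\<^sup>2 * snd (snd T))
     - 2 * fst (snd T) * (a * c * fst T + (a * d + b * c) * fst (snd T) + b * d * snd (snd T)))"
    by (intro continuous_intros)
  then show ?thesis
    by (rule continuous_on_eq) (auto simp: Y)
qed

text \<open>The open condition \<open>fQ T > 0\<close> can be replaced by the closed one
  \<open>fQ T \<ge> 1 / (64 * L)\<close>, which \<open>low_ftr\<close> makes automatic at trace
  1.\<close>

lemma compact_low:
  assumes "L > 0"
  shows "compact {T. low L T \<and> ftr T = 1}"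
proof -
  have eq: "{T. low L T \<and> ftr T = 1} =
     {T. \<bar>fst (snd T)\<bar> \<le> fst T} \<inter> {T. \<bar>fst (snd T)\<bar> \<le> snd (snd T)} \<inter> {T. fst T + snd (snd T) = 1}
     \<inter> {T. 1 / (64 * L) \<le> fst T * snd (snd T) - (fst (snd T))\<^sup>2}
     \<inter> (\<Inter>v\<in>verts. {T. fst T * snd (snd T) - (fst (snd T))\<^sup>2
          \<le> L * (fst T * (of_int (snd v))\<^sup>2 + snd (snd T) * (of_int (fst v))\<^sup>2
     - 2 * fst (snd T) * (of_int (fst v) * of_int (snd v)))\<^sup>2})" (is "?A = ?B")
  proof (rule Set.set_eqI)
    fix T
    have pos: "1 / (64 * L) > 0" using assms by simp
    have lowb: "1 / (64 * L) \<le> fQ T" if "low L T" "ftr T = 1"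
      using low_ftr[OF that(1) assms] that(2) assms by (simp add: field_simps)
    have mem: "T \<in> ?B \<longleftrightarrow> inC T \<and> ftr T = 1 \<and> 1 / (64 * L) \<le> fQ T \<and>
        (\<forall>v\<in>verts. fQ T \<le> L * (fB T (cusp v))\<^sup>2)"
      by (simp only: inC_alt ftr_alt fQ_alt fB_cusp_alt Int_iff INT_iff mem_Collect_eq conj_assoc)
    have A: "T \<in> ?A \<longleftrightarrow> low L T \<and> ftr T = 1" by (simp only: mem_Collect_eq)
    show "T \<in> ?A \<longleftrightarrow> T \<in> ?B"
      unfolding mem A using lowb less_le_trans[OF pos, of "fQ T"] unfolding low_def by blast
  qed
  have cl: "closed ?B"
    by (intro closed_Int closed_INT ballI closed_Collect_le closed_Collect_eq continuous_intros)
  have "?A \<subseteq> {0..1} \<times> {-1..1} \<times> {0..1}" by (auto simp: low_def abs_le_iff)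
  moreover have "bounded ({0..1} \<times> {-1..1} \<times> {0..1} :: qform set)"
    by (intro bounded_Times bounded_closed_interval)
  ultimately have "bounded ?A" using bounded_subset by blast
  then show ?thesis using cl eq by (simp add: compact_eq_bounded_closed)
qed

text \<open>The ratio \<open>fB T (act Y T) / fQ T\<close> is unchanged by scaling \<open>T\<close>,
  so it suffices to minimise over the compact slice of trace 1. There only finitely many matrices
  reach a value of at most \<open>M\<close>.\<close>

lemma minimum_displacement:
  assumes L: "L > 0" and start: "low L T0" "Y0 \<in> \<Y>" "fB T0 (act Y0 T0) \<le> M * fQ T0"
  shows "\<exists>\<mu> S Y. low L S \<and> Y \<in> \<Y> \<and> fB S (act Y S) = \<mu> * fQ S \<and> \<mu> \<le> M \<and>
    (\<forall>T Z. low L T \<longrightarrow> Z \<in> \<Y> \<longrightarrow> \<mu> * fQ T \<le> fB T (act Z T))"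
proof -
  define K where "K = {T. low L T \<and> ftr T = 1}"
  define g where "g Y T = fB T (act Y T) / fQ T" for Y T
  have trpos: "ftr T > 0" if "low L T" for T
  proof -
    obtain p r q where T: "T = (p, r, q)" by (cases T)
    have "p \<ge> 0" "q \<ge> 0" using that by (auto simp: low_def T)
    moreover have "p * q > 0"
      using that le_less_trans[OF zero_le_power2[of r], of "p * q"] unfolding low_def T by simp
    ultimately show ?thesis by (auto simp: T zero_less_mult_iff)
  qed
  have norm: "(1 / ftr T) *\<^sub>R T \<in> K" if "low L T" for T
    using that trpos[OF that] low_scale[OF that, of "1 / ftr T"] by (simp add: K_def ftr_scale)
  have g_norm: "g Y (k *\<^sub>R T) = g Y T" if "k > 0" for k T Y
    using that by (simp add: g_def act_scale fB_linear fQ_scale power2_eq_square)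
  have Qpos: "fQ T > 0" if "low L T" for T using that by (simp add: low_def)
  define \<Z> where "\<Z> = {Y \<in> \<Y>. \<exists>T\<in>K. g Y T \<le> M}"
  have "finite \<Z>"
  proof (rule finite_subset[OF _ finite_imat_bounded])
    show "\<Z> \<subseteq> {(a, b, c, d). a\<^sup>2 + b\<^sup>2 + c\<^sup>2 + d\<^sup>2 \<le> \<lceil>M * (64 * L)\<^sup>2\<rceil>}"
    proof clarify
      fix a b c d assume "(a, b, c, d) \<in> \<Z>"
      then obtain T where T: "low L T" "ftr T = 1" "g (a, b, c, d) T \<le> M"
        by (auto simp: \<Z>_def K_def)
      let ?n = "real_of_int (a\<^sup>2 + b\<^sup>2 + c\<^sup>2 + d\<^sup>2)"
      have q: "fQ T > 0" "inC T" using T by (auto simp: low_def)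
      have Q1: "1 \<le> 64 * L * fQ T" using low_ftr[OF T(1) L] T(2) by simp
      have qle: "fQ T \<le> 1"
      proof -
        obtain p r s where t: "T = (p, r, s)" by (cases T)
        have "p * s \<le> 1 * 1" using q T(2) by (intro mult_mono) (auto simp: t)
        then show ?thesis by (simp add: t) (smt (verit) zero_le_power2)
      qed
      have n0: "?n \<ge> 0" by (simp add: add_nonneg_nonneg)
      have "(fQ T)\<^sup>2 * ?n \<le> fB T (act (a, b, c, d) T)" by (rule fB_act_ge_norm[OF q(2) T(2) q(1)])
      also have "\<dots> \<le> M * fQ T" using T(3) q by (simp add: g_def field_simps)
      finally have le: "fQ T * ?n \<le> M" using q by (simp add: power2_eq_square mult.assoc mult.commute)
      have M: "M \<ge> 0" using le n0 q by (smt (verit) mult_nonneg_nonneg)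
      have "?n \<le> (64 * L * fQ T) * ?n" using Q1 n0 mult_right_mono[of 1 "64 * L * fQ T" ?n] by simp
      also have "\<dots> = 64 * L * (fQ T * ?n)" by simp
      also have "\<dots> \<le> 64 * L * M" using le L by (intro mult_left_mono) auto
      also have "\<dots> \<le> M * (64 * L)\<^sup>2"
      proof -
        have "1 \<le> 64 * L" using Q1 qle L by (smt (verit) mult_left_le)
        then show ?thesis using M L mult_left_mono[of 1 "64 * L" "64 * L * M"] by (simp add: power2_eq_square)
      qed
      finally show "a\<^sup>2 + b\<^sup>2 + c\<^sup>2 + d\<^sup>2 \<le> \<lceil>M * (64 * L)\<^sup>2\<rceil>" by linarith
    qed
  qed
  have "g Y0 T0 \<le> M" using start(3) Qpos[OF start(1)] by (simp add: g_def field_simps)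
  then have "g Y0 ((1 / ftr T0) *\<^sub>R T0) \<le> M" using g_norm[of "1 / ftr T0"] trpos[OF start(1)] by simp
  then have "Y0 \<in> \<Z>" unfolding \<Z>_def using start(2) norm[OF start(1)] by blast
  have "compact K" unfolding K_def by (rule compact_low[OF L])
  have "K \<noteq> {}" using norm[OF start(1)] by auto
  have cont: "continuous_on K (g Y)" for Y
    unfolding g_def
  proof (intro continuous_on_divide)
    show "continuous_on K (\<lambda>T. fB T (act Y T))" by (rule continuous_on_subset[OF continuous_fB_act]) simp
    show "continuous_on K fQ" unfolding fQ_alt by (intro continuous_intros)
    show "\<forall>T\<in>K. fQ T \<noteq> 0" using Qpos by (force simp: K_def)
  qed
  have "\<forall>Y. \<exists>T\<in>K. \<forall>T'\<in>K. g Y T \<le> g Y T'"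
    using continuous_attains_inf[OF \<open>compact K\<close> \<open>K \<noteq> {}\<close> cont] by blast
  then obtain m where m: "\<And>Y. m Y \<in> K" "\<And>Y T'. T' \<in> K \<Longrightarrow> g Y (m Y) \<le> g Y T'" by metis
  obtain Y where Y: "Y \<in> \<Z>" "\<And>Z. Z \<in> \<Z> \<Longrightarrow> g Y (m Y) \<le> g Z (m Z)"
    using \<open>finite \<Z>\<close> \<open>Y0 \<in> \<Z>\<close> arg_min_if_finite(1)[of \<Z> "\<lambda>Y. g Y (m Y)"]
      arg_min_least[of \<Z> _ "\<lambda>Y. g Y (m Y)"] by (metis empty_iff)
  define \<mu> where "\<mu> = g Y (m Y)"
  have low: "low L (m Y)" using m(1) by (simp add: K_def)
  have muM: "\<mu> \<le> M"
  proof -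
    obtain T where "T \<in> K" "g Y T \<le> M" using Y(1) unfolding \<Z>_def by blast
    then show ?thesis using m(2)[of T Y] unfolding \<mu>_def by linarith
  qed
  have le: "\<mu> \<le> g Z T" if "T \<in> K" "Z \<in> \<Y>" for Z T
  proof (cases "Z \<in> \<Z>")
    case True then show ?thesis using Y(2) m(2) that unfolding \<mu>_def by (meson order_trans)
  next
    case False then show ?thesis using that muM unfolding \<Z>_def by force
  qed
  have "\<mu> * fQ T \<le> fB T (act Z T)" if "low L T" "Z \<in> \<Y>" for T Z
  proof -
    have "\<mu> \<le> g Z ((1 / ftr T) *\<^sub>R T)" using le norm that by blast
    then have "\<mu> \<le> g Z T" using g_norm trpos that by simp
    then show ?thesis using Qpos[OF that(1)] by (simp add: g_def field_simps)
  qed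
  moreover have "fB (m Y) (act Y (m Y)) = \<mu> * fQ (m Y)"
    using Qpos[OF low] by (simp add: \<mu>_def g_def)
  moreover have "Y \<in> \<Y>" using Y by (simp add: \<Z>_def)
  ultimately show ?thesis using low muM by blast
qed

text \<open>A minimiser \<open>S\<close> of the displacement \<open>fB T (act Y T) / fQ T\<close> is compared with its image and with
  the midpoint of the two; equality there forces the orbit of \<open>S\<close> onto a geodesic.\<close>

lemma displacement_step:
  assumes N: "N > 0" and detA: "\<forall>Y\<in>\<Y>. \<bar>mdet Y\<bar> = N"
    and fixedA: "\<forall>Y\<in>\<Y>. \<forall>v\<in>verts. \<forall>l. mvec Y v = (l * fst v, l * snd v) \<longrightarrow>
        l\<^sup>2 < N \<and> 2 + M / N \<le> (1 + N / (of_int l)\<^sup>2)\<^sup>2"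
    and L: "L > 0" "(2 + M / N) * M \<le> L" "M * (M / N)\<^sup>2 \<le> L"
    and \<mu>: "\<mu> \<le> M" "\<forall>T Z. low L T \<longrightarrow> Z \<in> \<Y> \<longrightarrow> \<mu> * fQ T \<le> fB T (act Z T)"
    and S: "low L S" and Y: "Y \<in> \<Y>" and eq: "fB S (act Y S) = \<mu> * fQ S"
    and S1: "S1 = (1 / of_int N) *\<^sub>R act Y S" and C: "inC S1"
  shows "low L S1" and "(1 / of_int N) *\<^sub>R act Y S1 = (\<mu> / N) *\<^sub>R S1 - S" and "fQ S1 = fQ S"
    and "\<mu> / N \<ge> 2"
proof -
  note det = detA[rule_format]
  have fixed: "2 + M / N \<le> (1 + N / (of_int l)\<^sup>2)\<^sup>2" and fixed2: "l\<^sup>2 < N"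
    if "Y \<in> \<Y>" "v \<in> verts" "mvec Y v = (l * fst v, l * snd v)" for Y v l
    using fixedA that by blast+
  define n where "n = real_of_int N"
  define q where "q = fQ S"
  define c where "c = \<mu> / n"
  have n: "n > 0" using N by (simp add: n_def)
  have d2: "(real_of_int (mdet Y))\<^sup>2 = n\<^sup>2" using det[OF Y] N by (metis n_def power2_abs of_int_abs)
  have Sp: "inC S" "psd S" "q > 0" using S inC_psd by (auto simp: low_def q_def)
  have S1': "S1 = (1 / n) *\<^sub>R act Y S" by (simp add: S1 n_def)
  show Q1: "fQ S1 = fQ S" using n by (simp add: S1' fQ_scale fQ_act d2 field_simps)
  have pS1: "psd S1" using C by (rule inC_psd)
  have BS: "fB S S1 = c * q" using eq n by (simp add: S1' fB_linear c_def q_def)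
  have c2: "c \<ge> 2"
    using fB_ge_fQ[OF Sp(2) pS1 q_def[symmetric] _ Sp(3)] Q1 BS Sp(3) by (simp add: q_def)
  show "\<mu> / N \<ge> 2" using c2 by (simp add: c_def n_def)
  define S2 where "S2 = (1 / n) *\<^sub>R act Y S1"
  have BS12: "fB S1 S2 = c * q"
  proof -
    have "fB S1 S2 = (1 / n)\<^sup>2 * fB (act Y S) (act Y S1)"
      by (simp add: S2_def fB_linear S1' act_scale power2_eq_square)
    also have "\<dots> = fB S S1" using n by (simp add: fB_act d2 field_simps)
    finally show ?thesis using BS by simp
  qed
  have Q2: "fQ S2 = q" using n Q1 by (simp add: S2_def fQ_scale fQ_act d2 field_simps q_def)
  have cM: "c \<le> M / n" using \<mu>(1) n by (simp add: c_def divide_right_mono)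
  \<comment> \<open>Minimality of \<open>\<mu>\<close> may be invoked only at forms below the height
    bound, so the image and the midpoint must be shown not to climb too high towards any
    vertex.\<close>
  have mulow: "low L S1 \<and> low L (S + S1)"
  proof -
    have mid: "inC (S + S1)" using Sp C by (simp add: inC_add)
    have Qm: "fQ (S + S1) = (2 + c) * q" using Q1 BS by (simp add: fQ_add q_def algebra_simps)
    have both: "q \<le> L * (fB S1 (cusp v))\<^sup>2 \<and> (2 + c) * q \<le> L * (fB (S + S1) (cusp v))\<^sup>2"
      if v: "v \<in> verts" for v
    proof -
      have v0: "v \<noteq> (0, 0)" using v by (auto simp: verts_def)
      define b0 b1 where "b0 = fB S (cusp v)" and "b1 = fB S1 (cusp v)"
      have b: "b0 > 0" "b1 > 0"
        using fB_cusp_pos[OF Sp(2) _ v0] fB_cusp_pos[OF pS1 _ v0] Sp(3) Q1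
        by (auto simp: b0_def b1_def q_def)
      have bm: "fB (S + S1) (cusp v) = b0 + b1" by (simp add: b0_def b1_def fB_linear)
      have low0: "q \<le> L * b0\<^sup>2" using S v by (auto simp: low_def q_def b0_def)
      show ?thesis
      \<comment> \<open>If \<open>Y\<close> fixes the vertex, \<open>l\<^sup>2 < N\<close> makes it
        repelling: the image is lower than \<open>S\<close>, and the other half of
        \<open>fixedA\<close> controls the midpoint. If not, the integer determinant is at least 1
        in absolute value, so the displacement already bounds the height of \<open>S\<close> by
        \<open>M\<close>, and the image is at bounded distance from \<open>S\<close>.\<close>
      proof (cases "vdet v (mvec Y v) = 0")
        case True
        then obtain l where l: "mvec Y v = (l * fst v, l * snd v)" using vdet_fixed[OF v] by blast
        define x where "x = (real_of_int l)\<^sup>2"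
        have "l \<noteq> 0"
        proof
          assume "l = 0"
          then have "mdet Y * vdet v w = 0" for w
            using vdet_mvec[of Y v w] l by (cases "mvec Y w") simp
          moreover have "mdet Y \<noteq> 0" using det[OF Y] N by auto
          ultimately have "vdet v w = 0" for w by simp
          from this[of "(0, 1)"] this[of "(1, 0)"] v0 show False by (cases v) auto
        qed
        then have x: "x > 0" by (simp add: x_def)
        have cv: "act Y (cusp v) = x *\<^sub>R cusp v"
          unfolding act_cusp l by (cases v) (simp add: x_def power2_eq_square)
        have "n\<^sup>2 * b0 = fB (act Y S) (act Y (cusp v))" by (simp add: fB_act d2 b0_def)
        also have "\<dots> = x * (n * b1)" using n by (simp add: cv fB_linear b1_def S1')
        finally have b1: "b1 = (n / x) * b0" using n x by (simp add: field_simps power2_eq_square)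
        have "x < n" using fixed2[OF Y v l] by (simp add: x_def n_def flip: of_int_power)
        then have "b0 \<le> b1" using b x by (simp add: b1 field_simps)
        then have "b0\<^sup>2 \<le> b1\<^sup>2" using b by (intro power_mono) auto
        then have 1: "q \<le> L * b1\<^sup>2" using low0 L(1) by (smt (verit) mult_left_mono)
        have "(2 + c) * q \<le> (1 + n / x)\<^sup>2 * (L * b0\<^sup>2)"
          using fixed[OF Y v l] cM c2 low0 Sp(3) by (intro mult_mono) (auto simp: n_def x_def)
        also have "\<dots> = L * (b0 + b1)\<^sup>2" by (simp add: b1 power2_eq_square algebra_simps)
        finally show ?thesis using 1 bm b1_def by simp
      next
        case False
        then have "0 < (vdet v (mvec Y v))\<^sup>2" by simp
        then have "1 \<le> (vdet v (mvec Y v))\<^sup>2" by linarith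
        then have one: "1 \<le> (real_of_int (vdet v (mvec Y v)))\<^sup>2"
          by (metis of_int_1_le_iff of_int_power)
        have "(q / b0)\<^sup>2 * 1 \<le> (q / b0)\<^sup>2 * (real_of_int (vdet v (mvec Y v)))\<^sup>2"
          using one by (intro mult_left_mono) auto
        also have "\<dots> \<le> fB S (act Y S)"
          using fB_act_ge_split[OF Sp(2), of v Y] Sp(3) b by (simp add: q_def b0_def)
        also have "\<dots> \<le> M * q" using eq \<mu>(1) Sp(3) by (simp add: q_def mult_right_mono)
        finally have "q * q \<le> (M * b0\<^sup>2) * q" using b by (simp add: power_divide field_simps power2_eq_square)
        then have qM: "q \<le> M * b0\<^sup>2" using Sp(3) by simp
        have M0: "M \<ge> 0" using cM c2 n by (smt (verit) divide_less_0_iff)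
        have "q / b1 * b0 \<le> fB S S1"
          using fB_ge_split[OF Sp(2) pS1, of v] Q1 Sp(3) b by (simp add: q_def b0_def b1_def)
        then have "q * b0 \<le> q * (c * b1)" using BS b by (simp add: field_simps)
        then have bc: "b0 \<le> c * b1" using Sp(3) by simp
        have "q \<le> M * (c * b1)\<^sup>2" using qM bc b M0
          by (smt (verit) mult_left_mono power_mono)
        also have "\<dots> = M * c\<^sup>2 * b1\<^sup>2" by (simp add: power_mult_distrib)
        also have "\<dots> \<le> M * (M / n)\<^sup>2 * b1\<^sup>2"
          using M0 cM c2 by (intro mult_right_mono mult_left_mono power_mono) auto
        also have "\<dots> \<le> L * b1\<^sup>2" using L(3) by (intro mult_right_mono) (auto simp: n_def)
        finally have 1: "q \<le> L * b1\<^sup>2" .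
        have "(2 + c) * q \<le> (2 + M / n) * (M * b0\<^sup>2)"
          using cM c2 qM Sp(3) by (intro mult_mono) auto
        also have "\<dots> = ((2 + M / n) * M) * b0\<^sup>2" by simp
        also have "\<dots> \<le> L * b0\<^sup>2" using L(2) by (intro mult_right_mono) (auto simp: n_def)
        also have "\<dots> \<le> L * (b0 + b1)\<^sup>2" using b L(1) by (intro mult_left_mono power_mono) auto
        finally show ?thesis using 1 bm b1_def by simp
      qed
    qed
    show ?thesis unfolding low_def using both mid C Sp(3) Q1 Qm c2 by (auto simp: q_def)
  qed
  then show "low L S1" by simp
  \<comment> \<open>\<open>E\<close> vanishes iff \<open>S\<close>, \<open>S1\<close>,
    \<open>S2\<close> are equally spaced on a geodesic. It is orthogonal to \<open>S1\<close>, and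
    minimality at the midpoint \<open>S + S1\<close> gives \<open>fQ E \<ge> 0\<close>; negativity
    on the complement of \<open>S1\<close> then leaves only 0.\<close>
  define E where "E = S2 + S - c *\<^sub>R S1"
  have "c * n * fQ (S + S1) \<le> fB (S + S1) (act Y (S + S1))"
    using \<mu>(2)[rule_format, OF conjunct2[OF mulow] Y] n by (simp add: c_def)
  also have "act Y (S + S1) = n *\<^sub>R (S1 + S2)" using n by (simp add: act_add S1' S2_def scaleR_add_right)
  also have "fB (S + S1) (n *\<^sub>R (S1 + S2)) = n * (2 * c * q + fB S S2 + 2 * q)"
    using BS BS12 Q1 by (simp add: fB_linear fB_self q_def algebra_simps)
  finally have "n * (c * fQ (S + S1)) \<le> n * (2 * c * q + fB S S2 + 2 * q)" by (simp add: algebra_simps)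
  then have "c * fQ (S + S1) \<le> 2 * c * q + fB S S2 + 2 * q" using n by simp
  moreover have "fQ (S + S1) = (2 + c) * q" using Q1 BS by (simp add: fQ_add q_def algebra_simps)
  ultimately have mid: "c\<^sup>2 * q \<le> fB S S2 + 2 * q" by (simp add: algebra_simps power2_eq_square)
  have QE: "fQ E = 2 * q + fB S S2 - c\<^sup>2 * q"
    using BS BS12 Q1 Q2
    by (simp add: E_def fQ_diff fQ_add fQ_scale fB_linear fB_commute[of S2] q_def power2_eq_square algebra_simps)
  have "fB E S1 = 0"
    using BS BS12 Q1 by (simp add: E_def fB_linear fB_self fB_commute[of S2] q_def)
  from fB_posdef_orthogonal[OF pS1 _ this] QE mid Q1 Sp(3) have "E = 0" by (auto simp: q_def)
  then show "(1 / of_int N) *\<^sub>R act Y S1 = (\<mu> / N) *\<^sub>R S1 - S"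
    unfolding E_def S2_def c_def n_def by (simp add: algebra_simps)
qed

text \<open>Closure under the reflections allows the image of a minimiser to be folded back into the
  tile, and so does every further image. The orbit obeys the recurrence of
  \<open>displacement_step\<close> with coefficient \<open>c = \<mu> / N \<ge> 2\<close>. A
  coefficient above 2 would make the traces unbounded, against the height bound, and coefficient 2
  means that the minimiser is not moved at all.\<close>

theorem fixed_form_exists:
  assumes N: "N > 0" and detA: "\<forall>Y\<in>\<Y>. \<bar>mdet Y\<bar> = N"
    and refl: "\<And>Y i. Y \<in> \<Y> \<Longrightarrow> i < 4 \<Longrightarrow> mmul (refl_mat i) Y \<in> \<Y>"
    and fixedA: "\<forall>Y\<in>\<Y>. \<forall>v\<in>verts. \<forall>l. mvec Y v = (l * fst v, l * snd v) \<longrightarrow>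
        l\<^sup>2 < N \<and> 2 + M / N \<le> (1 + N / (of_int l)\<^sup>2)\<^sup>2"
    and start: "inC T0" "fQ T0 > 0" "Y0 \<in> \<Y>" "fB T0 (act Y0 T0) \<le> M * fQ T0"
  shows "\<exists>Y\<in>\<Y>. \<exists>T. inC T \<and> fQ T > 0 \<and> act Y T = of_int N *\<^sub>R T"
proof -
  note det = detA[rule_format]
  define n where "n = real_of_int N"
  have n: "n > 0" using N by (simp add: n_def)
  have fv: "finite verts" by (simp add: verts_def)
  \<comment> \<open>The summands are the two bounds demanded by \<open>displacement_step\<close> and
    the heights of \<open>T0\<close> at the four vertices.\<close>
  define L where "L = 1 + \<bar>(2 + M / N) * M\<bar> + \<bar>M * (M / N)\<^sup>2\<bar> + (\<Sum>v\<in>verts. fQ T0 / (fB T0 (cusp v))\<^sup>2)"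
  have sum0: "(\<Sum>v\<in>verts. fQ T0 / (fB T0 (cusp v))\<^sup>2) \<ge> 0" using start by (intro sum_nonneg) auto
  have L: "L > 0" "(2 + M / N) * M \<le> L" "M * (M / N)\<^sup>2 \<le> L" using sum0 by (auto simp: L_def)
  have "low L T0"
  proof -
    have "fQ T0 \<le> L * (fB T0 (cusp v))\<^sup>2" if v: "v \<in> verts" for v
    proof -
      have b: "fB T0 (cusp v) > 0"
        using start v by (intro fB_cusp_pos inC_psd) (auto simp: verts_def)
      have "fQ T0 / (fB T0 (cusp v))\<^sup>2 \<le> (\<Sum>v\<in>verts. fQ T0 / (fB T0 (cusp v))\<^sup>2)"
        using start by (intro member_le_sum v fv) auto
      also have "\<dots> \<le> L" by (auto simp: L_def)
      finally show ?thesis using b by (simp add: field_simps)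
    qed
    then show ?thesis using start by (simp add: low_def)
  qed
  from minimum_displacement[OF L(1) this start(3,4)] obtain \<mu> S Y1 where
    \<mu>: "\<mu> \<le> M" "\<forall>T Z. low L T \<longrightarrow> Z \<in> \<Y> \<longrightarrow> \<mu> * fQ T \<le> fB T (act Z T)"
    and S: "low L S" and Y1: "Y1 \<in> \<Y>" "fB S (act Y1 S) = \<mu> * fQ S" by blast
  define c where "c = \<mu> / N"
  have Spos: "fQ S > 0" using S by (simp add: low_def)
  note step = displacement_step[OF N detA fixedA L \<mu>]
  \<comment> \<open>If wall \<open>i\<close> separated \<open>T\<close> from its image, reflecting
    the image would give a matrix of the class with displacement below the minimum.\<close>
  have fold: "wall i (act Z T) \<ge> 0" if "low L T" "Z \<in> \<Y>" "fB T (act Z T) = \<mu> * fQ T" "i < 4" "wall i T > 0"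
    for i T Z
  proof (rule ccontr)
    assume "\<not> wall i (act Z T) \<ge> 0"
    then have "fB T (act (mmul (refl_mat i) Z) T) < \<mu> * fQ T"
      using that fB_refl[OF that(4), of T "act Z T"] mult_pos_neg[of "wall i T" "wall i (act Z T)"]
      by (simp add: act_mmul)
    then show False using \<mu>(2) that(1) refl[OF that(2,4)] by (meson not_le)
  qed
  obtain Y where Y: "Y \<in> \<Y>" "fB S (act Y S) = \<mu> * fQ S" "inC (act Y S)"
  proof (cases "\<exists>i<4. wall i S = 0 \<and> wall i (act Y1 S) < 0")
    case False
    then have "\<forall>i<4. wall i (act Y1 S) \<ge> 0"
      using fold[OF S Y1] S unfolding low_def inC_wall by (metis less_eq_real_def not_less)
    then show ?thesis using that Y1 by (simp add: inC_wall)
  next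
    case True
    then obtain i where i: "i < 4" "wall i S = 0" "wall i (act Y1 S) < 0" by blast
    let ?Y = "mmul (refl_mat i) Y1"
    have Y: "?Y \<in> \<Y>" using refl Y1 i by simp
    have eq: "fB S (act ?Y S) = \<mu> * fQ S" using fB_refl[OF i(1)] i Y1 by (simp add: act_mmul)
    have "wall j (act ?Y S) \<ge> 0" if "j < 4" for j
    proof (cases "j = i")
      case True then show ?thesis using i by (simp add: act_mmul wall_refl)
    next
      case False
      then have "wall j S > 0" using two_walls[of S i j] S i that by (auto simp: low_def)
      then show ?thesis using fold[OF S Y eq that] by simp
    qed
    then show ?thesis using that[OF Y eq] by (simp add: inC_wall)
  qed
  define f where "f k = ((\<lambda>T. (1 / n) *\<^sub>R act Y T) ^^ k) S" for k
  have f0: "f 0 = S" and fSuc: "f (Suc k) = (1 / n) *\<^sub>R act Y (f k)" for k by (simp_all add: f_def)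
  have inv: "low L (f k) \<and> fB (f k) (act Y (f k)) = \<mu> * fQ (f k) \<and> inC (act Y (f k)) \<and> fQ (f k) = fQ S" for k
  proof (induction k)
    case 0 then show ?case using S Y by (simp add: f0)
  next
    case (Suc k)
    let ?T = "f k" and ?U = "f (Suc k)"
    have U: "?U = (1 / real_of_int N) *\<^sub>R act Y ?T" by (simp add: fSuc n_def)
    have CU: "inC ?U" using Suc n by (simp add: fSuc inC_scale)
    have T: "low L ?T" "fB ?T (act Y ?T) = \<mu> * fQ ?T" using Suc by auto
    note st = step[OF T(1) Y(1) T(2) U CU]
    have dY: "(real_of_int (mdet Y))\<^sup>2 = n\<^sup>2" using det[OF Y(1)] N by (metis n_def power2_abs of_int_abs)
    have "fB ?U (act Y ?U) = (1 / n)\<^sup>2 * fB (act Y ?T) (act Y (act Y ?T))"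
      by (simp add: fSuc act_scale fB_linear power2_eq_square)
    also have "\<dots> = fB ?T (act Y ?T)" using n by (simp add: fB_act dY field_simps)
    finally have eqU: "fB ?U (act Y ?U) = \<mu> * fQ ?U" using T(2) st(3) by simp
    have "wall i (act Y ?U) \<ge> 0" if i: "i < 4" for i
    proof (cases "wall i ?U > 0")
      case True then show ?thesis using fold[OF st(1) Y(1) eqU i] by simp
    next
      case False
      then have z: "wall i ?U = 0" using CU i by (force simp: inC_wall)
      \<comment> \<open>When the new point lies on wall \<open>i\<close>, the matrices
        \<open>Y\<close> and \<open>?Z\<close> both send the previous point to it. The recurrence
        then predicts the same next point for both, so that point is fixed by the reflection and
        lies on the wall as well.\<close>
      let ?Z = "mmul (refl_mat i) Y"
      have Z: "?Z \<in> \<Y>" using refl Y i by simp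
      have z': "wall i (act Y ?T) = 0" using z n by (simp add: fSuc wall_scale)
      have aZ: "act ?Z ?T = act Y ?T" by (simp add: act_mmul refl_fix[OF i z'])
      have U': "?U = (1 / real_of_int N) *\<^sub>R act ?Z ?T" by (simp add: U aZ)
      have e: "fB ?T (act ?Z ?T) = \<mu> * fQ ?T" using aZ T by simp
      have "(1 / real_of_int N) *\<^sub>R act Y ?U = (1 / real_of_int N) *\<^sub>R act ?Z ?U"
        using st(2) step(2)[OF T(1) Z e U' CU] by simp
      then have "act Y ?U = act ?Z ?U" using N by simp
      then have "wall i (act Y ?U) = wall i (act (refl_mat i) (act Y ?U))" unfolding act_mmul by (rule arg_cong)
      then have "wall i (act Y ?U) = - wall i (act Y ?U)" unfolding wall_refl[OF i] .
      then show ?thesis by simp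
    qed
    then have "inC (act Y ?U)" by (simp add: inC_wall)
    then show ?case using st(1,3) eqU Suc by simp
  qed
  have rec: "f (Suc (Suc k)) = c *\<^sub>R f (Suc k) - f k" for k
    using step(2)[of "f k" Y "f (Suc k)"] inv[of k] inv[of "Suc k"] Y(1)
    by (auto simp: fSuc n_def c_def low_def inC_scale)
  have S1: "f 1 = (1 / real_of_int N) *\<^sub>R act Y S" using fSuc[of 0] by (simp add: f0 n_def)
  have C1: "inC (f 1)" using inv[of 1] by (simp add: low_def)
  have c2: "c \<ge> 2" using step(4)[OF S Y(1,2) S1 C1] by (simp add: c_def)
  define t where "t k = ftr (f k)" for k
  have tb: "(t k)\<^sup>2 \<le> 64 * L * fQ S" for k using low_ftr[of L "f k"] inv[of k] L(1) by (simp add: t_def)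
  have tlow: "fQ S \<le> (t k)\<^sup>2" "t k \<ge> 0" for k
  proof -
    obtain p r q where fk: "f k = (p, r, q)" by (cases "f k")
    have pq: "p \<ge> 0" "q \<ge> 0" using inv[of k] by (auto simp: low_def fk)
    have "fQ S = p * q - r\<^sup>2" using inv[of k] by (simp add: fk)
    also have "\<dots> \<le> (p + q)\<^sup>2" using pq mult_nonneg_nonneg[OF pq] by (simp add: power2_eq_square algebra_simps)
    finally show "fQ S \<le> (t k)\<^sup>2" by (simp add: t_def fk)
    show "t k \<ge> 0" using pq by (simp add: t_def fk)
  qed
  define e where "e = sqrt (fQ S)"
  have e: "e > 0" "t k \<ge> e" for k using Spos tlow[of k] by (auto simp: e_def intro: real_le_lsqrt)
  have "c = 2"
  proof (rule ccontr)
    assume "c \<noteq> 2"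
    then have c: "c > 2" using c2 by simp
    define \<epsilon> where "\<epsilon> = (c - 2) * e"
    have \<epsilon>: "\<epsilon> > 0" using c e(1) by (simp add: \<epsilon>_def)
    \<comment> \<open>The second differences of the traces are bounded below by a positive constant,
      since every trace is at least \<open>e\<close>, the square root of the common
      determinant.\<close>
    have trec: "t (Suc (Suc k)) - t (Suc k) \<ge> t (Suc k) - t k + \<epsilon>" for k
    proof -
      have "t (Suc (Suc k)) = c * t (Suc k) - t k" by (simp add: t_def rec ftr_diff ftr_scale)
      moreover have "(c - 2) * t (Suc k) \<ge> (c - 2) * e" using c e(2) by (intro mult_left_mono) auto
      ultimately show ?thesis by (simp add: \<epsilon>_def algebra_simps)
    qed
    have d: "t (Suc k) - t k \<ge> (t 1 - t 0) + of_nat k * \<epsilon>" for k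
    proof (induction k)
      case (Suc k) then show ?case using trec[of k] by (simp add: algebra_simps)
    qed simp
    define B where "B = sqrt (64 * L * fQ S)"
    have tB: "t k \<le> B" for k using tb[of k] by (simp add: B_def real_le_rsqrt)
    obtain k where k: "of_nat k * \<epsilon> > B + 1 + \<bar>t 1 - t 0\<bar>" using \<epsilon> reals_Archimedean3 by blast
    have "t (Suc k) - t k > B" using d[of k] k by linarith
    then show False using tB[of "Suc k"] tlow(2)[of k] by simp
  qed
  have "fB S (f 1) = 2 * fQ S"
    unfolding S1 fB_scale_right Y(2) using \<open>c = 2\<close> N by (simp add: c_def field_simps)
  moreover have Qf1: "fQ (f 1) = fQ S" using inv[of 1] by simp
  ultimately have "fQ (f 1 - S) = 0" and "fB (f 1 - S) S = 0"
    by (simp_all only: fQ_diff fB_commute[of "f 1" S] fB_diff_left fB_self)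
  moreover have SC: "inC S" using S unfolding low_def by blast
  ultimately have "f 1 - S = 0" using fB_posdef_orthogonal(2)[OF inC_psd[OF SC] Spos] by blast
  then have "(1 / real_of_int N) *\<^sub>R act Y S = S" using S1 by simp
  then have "act Y S = real_of_int N *\<^sub>R S" using N
    by (metis divide_self_if mult.commute of_int_eq_0_iff order_less_irrefl scaleR_one scaleR_scaleR times_divide_eq_left mult_1)
  then show ?thesis using Y(1) SC Spos by blast
qed

text \<open>The four orbits of the reflection group \<open>inW\<close> on integral vectors that are not divisible by 2,
  numbered by the vertices \<open>(1, 0)\<close>, \<open>(0, 1)\<close>, \<open>(1, 1)\<close>, \<open>(1, - 1)\<close>.\<close>

fun vt :: "int \<times> int \<Rightarrow> nat" where
  "vt (x, y) = (if odd x then (if even y then 1 else if 4 dvd x - y then 3 else 4)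
     else if odd y then 2 else 0)"

section \<open>The congruence group, and uniqueness of the fixed form in a coset\<close>

text \<open>The unimodular matrices that preserve the type of the first three vertices. By
  \<open>vt_inW\<close> they preserve the type of every integral vector, in particular of
  \<open>(1, - 1)\<close>.\<close>

definition inW :: "imat \<Rightarrow> bool" where
  "inW g \<longleftrightarrow> \<bar>mdet g\<bar> = 1 \<and> vt (mvec g (1, 0)) = 1 \<and> vt (mvec g (0, 1)) = 2 \<and> vt (mvec g (1, 1)) = 3"

lemma inW_iff:
  "inW (a, b, c, d) \<longleftrightarrow> \<bar>a * d - b * c\<bar> = 1 \<and> odd a \<and> even b \<and> even c \<and> odd d \<and> 4 dvd a + b - c - d"
  unfolding inW_def by (auto simp: algebra_simps)

lemma vt_inW:
  assumes "inW g" shows "vt (mvec g v) = vt v"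
proof -
  obtain a b c d where g: "g = (a, b, c, d)" by (cases g)
  obtain x y where v: "v = (x, y)" by (cases v)
  have h: "odd a" "even b" "even c" "odd d" "4 dvd a + b - c - d" using assms by (auto simp: g inW_iff)
  obtain a' b' c' d' where e: "a = 2 * a' + 1" "b = 2 * b'" "c = 2 * c'" "d = 2 * d' + 1"
    using h by (meson evenE oddE)
  have "2 * (a' + b' - c' - d') = a + b - c - d" using e by simp
  then have "4 dvd 2 * (a' + b' - c' - d')" using h by simp
  then have ev: "even (a' + b' - c' - d')" by presburger
  have p: "even (a * x + b * y) \<longleftrightarrow> even x" "even (c * x + d * y) \<longleftrightarrow> even y" using h by auto
  have "4 dvd (a * x + b * y) - (c * x + d * y) \<longleftrightarrow> 4 dvd x - y" if o: "odd x" "odd y"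
  proof -
    have "(a * x + b * y) - (c * x + d * y) = (x - y) + 2 * (a' * x + b' * y - c' * x - d' * y)"
      by (simp add: e algebra_simps)
    moreover have "even (a' * x + b' * y - c' * x - d' * y)" using ev o by auto
    then have "4 dvd 2 * (a' * x + b' * y - c' * x - d' * y)" by presburger
    ultimately show ?thesis by (metis dvd_add_left_iff)
  qed
  then show ?thesis using p by (auto simp: g v)
qed

lemma inW_mmul: "inW g \<Longrightarrow> inW h \<Longrightarrow> inW (mmul g h)"
proof -
  assume g: "inW g" and h: "inW h"
  show ?thesis unfolding inW_def mdet_mmul mvec_mmul vt_inW[OF g] abs_mult
    using g h unfolding inW_def by auto
qed

lemma inW_refl: "inW (refl_mat i)"
  by (simp add: refl_mat_def inW_iff)

lemma inW_uminus_one: "inW (- 1, 0, 0, - 1)" by (simp add: inW_iff)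

lemma inW_inverse:
  assumes "inW g" obtains h where "inW h" "\<And>Y. mmul h (mmul g Y) = Y"
proof -
  obtain a b c d where g: "g = (a, b, c, d)" by (cases g)
  define e where "e = a * d - b * c"
  have e: "e = 1 \<or> e = - 1" using assms by (auto simp: g inW_iff e_def)
  then have ee: "e * e = 1" by auto
  let ?h = "(e * d, - e * b, - e * c, e * a)"
  have "inW ?h"
  proof -
    have "(e * d) * (e * a) - (- e * b) * (- e * c) = (e * e) * e" by (simp add: e_def algebra_simps)
    moreover have "4 dvd e * d + - e * b - - e * c - e * a"
    proof -
      have "e * d + - e * b - - e * c - e * a = - e * (a + b - c - d)" by (simp add: algebra_simps)
      then show ?thesis using assms by (simp add: g inW_iff)
    qed
    ultimately show ?thesis using assms e ee by (auto simp: g inW_iff)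
  qed
  moreover have "mmul ?h (mmul g Y) = Y" for Y
  proof -
    have 1: "e * d * (a * x + b * y) - e * b * (c * x + d * y) = x" for x y
    proof -
      have "e * d * (a * x + b * y) - e * b * (c * x + d * y) = (e * e) * x"
        by (simp add: e_def algebra_simps)
      then show ?thesis using ee by simp
    qed
    have 2: "e * a * (c * x + d * y) - e * c * (a * x + b * y) = y" for x y
    proof -
      have "e * a * (c * x + d * y) - e * c * (a * x + b * y) = (e * e) * y"
        by (simp add: e_def algebra_simps)
      then show ?thesis using ee by simp
    qed
    show ?thesis by (cases Y) (simp add: g 1 2)
  qed
  ultimately show ?thesis using that by blast
qed

text \<open>The types fix the determinant of two vectors modulo 2, and for types 3 and 4 they force
  it to be 2 modulo 4. Between different types it is thus at least 1, respectively 2, in absolute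
  value, and the vertices attain these bounds.\<close>

lemma vdet_type_le:
  assumes "u \<in> verts" "w \<in> verts" "vt v = vt w"
  shows "(vdet u w)\<^sup>2 \<le> (vdet u v)\<^sup>2"
proof -
  obtain x y where v: "v = (x, y)" by (cases v)
  have odd1: "1 \<le> k\<^sup>2" if "odd k" for k :: int
  proof -
    have "k \<noteq> 0" using that by auto
    then have "0 < k\<^sup>2" by simp
    then show ?thesis by linarith
  qed
  have four: "4 \<le> k\<^sup>2" if "even k" "\<not> 4 dvd k" for k :: int
  proof -
    have "2 \<le> \<bar>k\<bar>" using that by presburger
    then have "2\<^sup>2 \<le> \<bar>k\<bar>\<^sup>2" by (intro power_mono) auto
    then show ?thesis by simp
  qed
  consider "w = (1, 0)" | "w = (0, 1)" | "w = (1, 1)" | "w = (1, - 1)" using assms(2) by (auto simp: verts_def)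
  then show ?thesis
  proof cases
    case 1
    then have "odd x" "even y" using assms(3) by (auto simp: v split: if_splits)
    then show ?thesis using assms(1) odd1[of x] odd1[of "y + x"] odd1[of "y - x"]
      unfolding verts_def 1 by (auto simp: v)
  next
    case 2
    then have "even x" "odd y" using assms(3) by (auto simp: v split: if_splits)
    then show ?thesis using assms(1) odd1[of y] odd1[of "y + x"] odd1[of "y - x"]
      unfolding verts_def 2 by (auto simp: v)
  next
    case 3
    then have "odd x" "odd y" "4 dvd x - y" using assms(3) by (auto simp: v split: if_splits)
    then have "even (y + x)" "\<not> 4 dvd y + x" by (simp, presburger)
    then show ?thesis using assms(1) \<open>odd x\<close> \<open>odd y\<close> odd1[of x] odd1[of y] four[of "y + x"]
      unfolding verts_def 3 by (auto simp: v)
  next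
    case 4
    then have "odd x" "odd y" "\<not> 4 dvd x - y" using assms(3) by (auto simp: v split: if_splits)
    then have "even (y - x)" "\<not> 4 dvd y - x" by (simp, presburger)
    then show ?thesis using assms(1) \<open>odd x\<close> \<open>odd y\<close> odd1[of x] odd1[of y] four[of "y - x"]
      unfolding verts_def 4 by (auto simp: v)
  qed
qed

fun inCi :: "qform \<Rightarrow> bool" where "inCi (p, r, q) \<longleftrightarrow> \<bar>r\<bar> < p \<and> \<bar>r\<bar> < q"

lemma inCi_inC: "inCi T \<Longrightarrow> inC T" by (cases T) auto

lemma inCi_fQ: assumes "inCi T" shows "fQ T > 0"
proof -
  obtain p r q where T: "T = (p, r, q)" by (cases T)
  have "\<bar>r\<bar> * \<bar>r\<bar> < p * q" using assms by (intro mult_strict_mono') (auto simp: T)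
  then show ?thesis by (simp add: T power2_eq_square)
qed

text \<open>The diagonal \<open>r = 0\<close> cuts the quadrilateral into two ideal triangles. The
  coefficients are barycentric coordinates in the triangle that contains \<open>T\<close>; for
  interior \<open>T\<close> both ends of the diagonal get positive weight.\<close>

lemma inC_decompose:
  assumes "inC T"
  obtains s where "\<And>w. s w \<ge> 0" "T = (\<Sum>w\<in>verts. s w *\<^sub>R cusp w)"
    "inCi T \<Longrightarrow> s (1, 0) > 0 \<and> s (0, 1) > 0"
proof -
  obtain p r q where T: "T = (p, r, q)" by (cases T)
  define s :: "int \<times> int \<Rightarrow> real" where
    "s w = (if w = (1, 0) then p - \<bar>r\<bar> else if w = (0, 1) then q - \<bar>r\<bar> else
            if w = (1, 1) then max r 0 else max (- r) 0)" for w
  have "s w \<ge> 0" for w using assms by (auto simp: s_def T)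
  moreover have "T = (\<Sum>w\<in>verts. s w *\<^sub>R cusp w)" by (auto simp: T verts_def s_def max_def)
  moreover have "s (1, 0) > 0 \<and> s (0, 1) > 0" if "inCi T" using that by (auto simp: s_def T)
  ultimately show ?thesis using that by blast
qed

lemma fB_sum_left: "finite A \<Longrightarrow> fB (\<Sum>w\<in>A. s w *\<^sub>R cusp w) U = (\<Sum>w\<in>A. s w * fB (cusp w) U)"
  by (induction A rule: finite_induct) (auto simp: fB_linear zero_prod_def, cases U, simp)

lemma act_sum: "finite A \<Longrightarrow> act g (\<Sum>w\<in>A. s w *\<^sub>R cusp w) = (\<Sum>w\<in>A. s w *\<^sub>R cusp (mvec g w))"
  by (induction A rule: finite_induct) (auto simp: act_add act_scale act_cusp zero_prod_def, cases g, simp)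

lemma finite_verts: "finite verts" by (simp add: verts_def)

text \<open>Seen from any point of the tile, the vertex is the nearest cusp of its type: expand
  \<open>T\<close> in the vertices and compare term by term with
  \<open>vdet_type_le\<close>.\<close>

lemma fB_cusp_type_le:
  assumes "inC T" "w \<in> verts" "vt v = vt w"
  shows "fB T (cusp w) \<le> fB T (cusp v)"
proof -
  obtain s where s: "\<And>w. s w \<ge> 0" "T = (\<Sum>w\<in>verts. s w *\<^sub>R cusp w)" using inC_decompose[OF assms(1)] by metis
  have "fB T (cusp w) = (\<Sum>u\<in>verts. s u * (of_int (vdet u w))\<^sup>2)"
    by (simp add: s(2) fB_sum_left[OF finite_verts] fB_cusp)
  also have "\<dots> \<le> (\<Sum>u\<in>verts. s u * (of_int (vdet u v))\<^sup>2)"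
  proof (intro sum_mono mult_left_mono s)
    fix u assume "u \<in> verts"
    from vdet_type_le[OF this assms(2,3)] have "real_of_int ((vdet u w)\<^sup>2) \<le> real_of_int ((vdet u v)\<^sup>2)"
      by (simp only: of_int_le_iff)
    then show "(real_of_int (vdet u w))\<^sup>2 \<le> (real_of_int (vdet u v))\<^sup>2" by simp
  qed
  also have "\<dots> = fB T (cusp v)"
    by (simp add: s(2) fB_sum_left[OF finite_verts] fB_cusp)
  finally show ?thesis .
qed

text \<open>Equality forces equality in every term of positive weight. The weights at
  \<open>(1, 0)\<close> and \<open>(0, 1)\<close> are positive, and these terms are the squared
  coordinates of the vector.\<close>

lemma fB_cusp_type_eq:
  assumes "inCi T" "w \<in> verts" "vt v = vt w" "fB T (cusp v) = fB T (cusp w)"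
  shows "(snd v)\<^sup>2 = (snd w)\<^sup>2 \<and> (fst v)\<^sup>2 = (fst w)\<^sup>2"
proof -
  obtain s where s: "\<And>w. s w \<ge> 0" "T = (\<Sum>w\<in>verts. s w *\<^sub>R cusp w)" "s (1, 0) > 0" "s (0, 1) > 0"
    using inC_decompose[OF inCi_inC[OF assms(1)]] assms(1) by metis
  let ?d = "\<lambda>u. s u * ((of_int (vdet u v))\<^sup>2 - (of_int (vdet u w))\<^sup>2)"
  have le: "real_of_int ((vdet u w)\<^sup>2) \<le> real_of_int ((vdet u v)\<^sup>2)" if "u \<in> verts" for u
    using vdet_type_le[OF that assms(2,3)] by (simp only: of_int_le_iff)
  have "(\<Sum>u\<in>verts. ?d u) = fB T (cusp v) - fB T (cusp w)"
    by (simp add: s(2) fB_sum_left[OF finite_verts] fB_cusp right_diff_distrib sum_subtractf)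
  then have z: "(\<Sum>u\<in>verts. ?d u) = 0" using assms by simp
  have "\<forall>u\<in>verts. ?d u = 0"
    using z le s(1) by (subst (asm) sum_nonneg_eq_0_iff[OF finite_verts]) auto
  then have "?d (1, 0) = 0" "?d (0, 1) = 0" by (auto simp: verts_def)
  then have "(real_of_int (snd v))\<^sup>2 = (real_of_int (snd w))\<^sup>2" "(real_of_int (fst v))\<^sup>2 = (real_of_int (fst w))\<^sup>2"
    using s(3,4) by (cases v; cases w; simp)+
  then show ?thesis by (simp flip: of_int_power)
qed

text \<open>As \<open>mmul g Y\<close> scales all pairings alike, \<open>T\<close> and
  \<open>act g T\<close> are equally far from \<open>T'\<close>. Each vertex is the nearest cusp of
  its type and \<open>g\<close> preserves types, so \<open>g\<close> must send \<open>(1, 0)\<close>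
  and \<open>(0, 1)\<close> to themselves up to sign; the congruence modulo 4 then makes the two
  signs equal.\<close>

theorem fixed_form_unique:
  assumes "N > 0" "\<bar>mdet Y\<bar> = N" "inW g"
    and T: "inCi T" "act Y T = of_int N *\<^sub>R T"
    and T': "inCi T'" "act (mmul g Y) T' = of_int N *\<^sub>R T'"
  shows "mmul g Y = Y \<or> mmul g Y = mmul (- 1, 0, 0, - 1) Y"
proof -
  define n where "n = real_of_int N"
  have n: "n > 0" using assms by (simp add: n_def)
  have "\<bar>mdet (mmul g Y)\<bar> = N" using assms by (auto simp: mdet_mmul abs_mult inW_def)
  then have d: "(real_of_int (mdet (mmul g Y)))\<^sup>2 = n\<^sup>2" by (metis n_def power2_abs of_int_abs)
  have "n\<^sup>2 * fB T' T = fB (act (mmul g Y) T') (act (mmul g Y) T)" by (simp only: fB_act d)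
  also have "act (mmul g Y) T = n *\<^sub>R act g T" by (simp add: act_mmul T(2) act_scale n_def)
  also have "fB (act (mmul g Y) T') (n *\<^sub>R act g T) = n\<^sup>2 * fB T' (act g T)"
    by (simp add: T'(2) fB_linear n_def power2_eq_square)
  finally have eq: "fB T' T = fB T' (act g T)" using n by simp
  obtain s where s: "\<And>w. s w \<ge> 0" "T = (\<Sum>w\<in>verts. s w *\<^sub>R cusp w)" "s (1, 0) > 0" "s (0, 1) > 0"
    using inC_decompose[OF inCi_inC[OF T(1)]] T(1) by metis
  have fsum: "fB T' (\<Sum>w\<in>verts. s w *\<^sub>R h w) = (\<Sum>w\<in>verts. s w * fB T' (h w))" for h
  proof -
    have "fB T' (\<Sum>w\<in>A. s w *\<^sub>R h w) = (\<Sum>w\<in>A. s w * fB T' (h w))" if "finite A" for A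
      using that by (induction A rule: finite_induct) (auto simp: fB_linear zero_prod_def, cases T', simp)
    then show ?thesis using finite_verts by blast
  qed
  have "fB T' T = (\<Sum>w\<in>verts. s w * fB T' (cusp w))" by (subst s(2)) (rule fsum)
  moreover have "fB T' (act g T) = (\<Sum>w\<in>verts. s w * fB T' (cusp (mvec g w)))"
    by (subst s(2)) (simp only: act_sum[OF finite_verts] fsum)
  ultimately have z: "(\<Sum>w\<in>verts. s w * (fB T' (cusp (mvec g w)) - fB T' (cusp w))) = 0"
    using eq by (simp add: right_diff_distrib sum_subtractf)
  have "\<forall>w\<in>verts. s w * (fB T' (cusp (mvec g w)) - fB T' (cusp w)) = 0"
    using z s(1) fB_cusp_type_le[OF inCi_inC[OF T'(1)]] vt_inW[OF assms(3)]
    by (subst (asm) sum_nonneg_eq_0_iff[OF finite_verts]) auto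
  then have e: "fB T' (cusp (mvec g (1, 0))) = fB T' (cusp (1, 0))"
    "fB T' (cusp (mvec g (0, 1))) = fB T' (cusp (0, 1))"
    using s(3,4) by (auto simp: verts_def)
  obtain a b c d where g: "g = (a, b, c, d)" by (cases g)
  have "a\<^sup>2 = 1 \<and> c = 0" "b = 0 \<and> d\<^sup>2 = 1"
    using fB_cusp_type_eq[OF T'(1) _ vt_inW[OF assms(3)] e(1)] fB_cusp_type_eq[OF T'(1) _ vt_inW[OF assms(3)] e(2)]
    by (auto simp: g verts_def)
  then have "(a = 1 \<or> a = - 1) \<and> (d = 1 \<or> d = - 1) \<and> b = 0 \<and> c = 0" by (auto simp: power2_eq_1_iff)
  moreover have "4 dvd a + b - c - d" using assms(3) by (simp add: g inW_iff)
  ultimately have "g = (1, 0, 0, 1) \<or> g = (- 1, 0, 0, - 1)" by (auto simp: g)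
  then show ?thesis by (cases Y) auto
qed

text \<open>A fixed form \<open>T\<close> would give
  \<open>fB T (cusp w) = N * fB T (cusp v)\<close> for a vector \<open>v\<close> of the type of
  \<open>w\<close>, whereas the vertex \<open>w\<close> is the nearest cusp of its type.\<close>

lemma attracting_no_fixed_form:
  assumes "N > 1" "odd N" "\<bar>mdet R\<bar> = N" "inW g" "w \<in> verts" "vt (mvec R w) = vt w"
    and dv: "N dvd fst (mvec R w)" "N dvd snd (mvec R w)"
    and T: "inCi T" "act (mmul g R) T = of_int N *\<^sub>R T"
  shows False
proof -
  define n where "n = real_of_int N"
  have n: "n > 1" using assms by (simp add: n_def)
  obtain x y where xy: "mvec R w = (N * x, N * y)" using dv by (metis dvdE prod.collapse)
  have "4 dvd N * x - N * y \<longleftrightarrow> 4 dvd x - y"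
  proof -
    have "coprime (2 ^ 2) N" using assms(2) by (simp only: coprime_power_left_iff) simp
    then have "coprime 4 N" by simp
    then show ?thesis by (metis coprime_dvd_mult_right_iff right_diff_distrib)
  qed
  then have "vt (x, y) = vt (mvec R w)" using assms(2) by (simp add: xy)
  then have t: "vt (mvec g (x, y)) = vt w" using assms by (simp add: vt_inW)
  have "\<bar>mdet (mmul g R)\<bar> = N" using assms by (auto simp: mdet_mmul abs_mult inW_def)
  then have d: "(real_of_int (mdet (mmul g R)))\<^sup>2 = n\<^sup>2" by (metis n_def power2_abs of_int_abs)
  have m: "mvec g (N * x, N * y) = (N * fst (mvec g (x, y)), N * snd (mvec g (x, y)))"
    by (cases g) (simp add: algebra_simps)
  have cs: "cusp (N * u, N * v) = n\<^sup>2 *\<^sub>R cusp (u, v)" for u v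
    by (simp add: n_def power2_eq_square)
  have "n\<^sup>2 * fB T (cusp w) = fB (act (mmul g R) T) (act (mmul g R) (cusp w))" by (simp only: fB_act d)
  also have "act (mmul g R) (cusp w) = n\<^sup>2 *\<^sub>R cusp (mvec g (x, y))"
    by (simp only: act_cusp mvec_mmul xy m cs prod.collapse)
  also have "fB (act (mmul g R) T) (n\<^sup>2 *\<^sub>R cusp (mvec g (x, y))) = n\<^sup>2 * (n * fB T (cusp (mvec g (x, y))))"
    by (simp add: T(2) fB_linear n_def)
  finally have "fB T (cusp w) = n * fB T (cusp (mvec g (x, y)))" using n by simp
  moreover have "fB T (cusp w) \<le> fB T (cusp (mvec g (x, y)))"
    by (rule fB_cusp_type_le[OF inCi_inC[OF T(1)] assms(5) t])
  moreover have "fB T (cusp w) > 0"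
    using T(1) assms(5) by (intro fB_cusp_pos inC_psd inCi_inC inCi_fQ) (auto simp: verts_def)
  ultimately show False using n mult_strict_right_mono[of 1 n "fB T (cusp (mvec g (x, y)))"] by linarith
qed

section \<open>Axes of reflections and existence of interior fixed forms\<close>

text \<open>For a trace zero matrix of negative determinant, which acts as a reflection,
  \<open>lf Z T = 0\<close> is the equation of its axis. The sign of \<open>lf Z (cusp w)\<close>
  tells on which side of the axis the vertex \<open>w\<close> lies.\<close>

fun lf :: "imat \<Rightarrow> qform \<Rightarrow> real" where
  "lf (a, b, c, d) (p, r, q) = c * p + (d - a) * r - b * q"

lemma lf_cusp: "lf Z (cusp w) = of_int (vdet w (mvec Z w))"
  by (cases Z; cases w) (simp add: algebra_simps power2_eq_square)

lemma lf_add: "lf Z (S + T) = lf Z S + lf Z T"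
  by (cases Z; cases S; cases T) (simp add: algebra_simps)

lemma lf_scale: "lf Z (k *\<^sub>R T) = k * lf Z T"
  by (cases Z; cases T) (simp add: algebra_simps)

lemma lf_sum: "finite A \<Longrightarrow> lf Z (\<Sum>w\<in>A. s w *\<^sub>R cusp w) = (\<Sum>w\<in>A. s w * lf Z (cusp w))"
  by (induction A rule: finite_induct) (auto simp: lf_add lf_scale zero_prod_def, cases Z, simp)

text \<open>Multiplying \<open>Y T Y\<^sup>T = N T\<close> by the adjugate of
  \<open>Y\<^sup>T\<close> turns the quadratic conditions on the matrix into linear ones.\<close>

lemma fixed_form_equations:
  fixes p r q :: real
  assumes "act (a, b, c, d) (p, r, q) = of_int N *\<^sub>R (p, r, q)"
  shows "of_int (a * d - b * c) * (a * p + b * r) = of_int N * (d * p - b * r)"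
    and "of_int (a * d - b * c) * (c * p + d * r) = of_int N * (d * r - b * q)"
proof -
  have e: "a\<^sup>2 * p + 2 * a * b * r + b\<^sup>2 * q = N * p"
    "a * c * p + (a * d + b * c) * r + b * d * q = N * r"
    "c\<^sup>2 * p + 2 * c * d * r + d\<^sup>2 * q = N * q"
    using assms by simp_all
  have "of_int (a * d - b * c) * (a * p + b * r) =
      d * (a\<^sup>2 * p + 2 * a * b * r + b\<^sup>2 * q) - b * (a * c * p + (a * d + b * c) * r + b * d * q)"
    by (simp add: algebra_simps power2_eq_square)
  also have "\<dots> = N * (d * p - b * r)" unfolding e by (simp add: algebra_simps)
  finally show "of_int (a * d - b * c) * (a * p + b * r) = of_int N * (d * p - b * r)" .
  have "of_int (a * d - b * c) * (c * p + d * r) =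
      d * (a * c * p + (a * d + b * c) * r + b * d * q) - b * (c\<^sup>2 * p + 2 * c * d * r + d\<^sup>2 * q)"
    by (simp add: algebra_simps power2_eq_square)
  also have "\<dots> = N * (d * r - b * q)" unfolding e by (simp add: algebra_simps)
  finally show "of_int (a * d - b * c) * (c * p + d * r) = of_int N * (d * r - b * q)" .
qed

text \<open>An orientation reversing isometry with a fixed point is a reflection, so its trace is
  zero and the point is on its axis.\<close>

lemma fixed_form_neg_det:
  assumes "N > 0" "mdet (a, b, c, d) = - N" "act (a, b, c, d) T = of_int N *\<^sub>R T" "inC T" "fQ T > 0"
  shows "d = - a" "lf (a, b, c, d) T = 0"
proof -
  obtain p r q where T: "T = (p, r, q)" by (cases T)
  have p: "p > 0"
  proof (rule ccontr)
    assume "\<not> p > 0"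
    then have "p = 0" "r = 0" using assms(4) by (auto simp: T)
    then show False using assms(5) by (simp add: T)
  qed
  have n: "real_of_int N > 0" using assms by simp
  have D: "real_of_int (a * d - b * c) = - of_int N" using assms(2) by (metis mdet.simps of_int_minus)
  note e = fixed_form_equations[OF assms(3)[unfolded T], unfolded D]
  have "of_int N * (- (a * p + b * r)) = of_int N * (d * p - b * r)"
    using e(1) by (simp only: mult_minus_left mult_minus_right)
  then have "- (a * p + b * r) = d * p - b * r" using n by (metis mult_left_cancel less_irrefl)
  then have "(of_int (a + d)) * p = 0" by (simp add: algebra_simps)
  then have "real_of_int (a + d) = 0" using p by simp
  then have ad: "a + d = 0" by (simp only: of_int_eq_0_iff)
  then show d: "d = - a" by simp
  have "of_int N * (- (c * p + d * r)) = of_int N * (d * r - b * q)"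
    using e(2) by (simp only: mult_minus_left mult_minus_right)
  then have "- (c * p + d * r) = d * r - b * q" using n by (metis mult_left_cancel less_irrefl)
  then show "lf (a, b, c, d) T = 0" by (simp add: T d algebra_simps)
qed

lemma fixed_form_trace_zero:
  assumes "mdet (a, b, c, - a) = - N" "lf (a, b, c, - a) T = 0"
  shows "act (a, b, c, - a) T = of_int N *\<^sub>R T"
proof -
  obtain p r q where T: "T = (p, r, q)" by (cases T)
  have N: "real_of_int N = a\<^sup>2 + b * c"
  proof -
    have "N = a\<^sup>2 + b * c" using assms(1) by (simp add: power2_eq_square)
    then show ?thesis by simp
  qed
  have e: "b * q = c * p - 2 * a * r" using assms(2) by (simp add: T algebra_simps)
  have 1: "b * (b * q) = b * (c * p - 2 * a * r)" "a * (b * q) = a * (c * p - 2 * a * r)"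
    "c * (b * q) = c * (c * p - 2 * a * r)" using e by simp_all
  show ?thesis using 1 by (simp add: T N algebra_simps power2_eq_square)
qed

text \<open>From the centre \<open>T0\<close> of the tile move towards a vertex where
  \<open>lf Z\<close> has the opposite sign; the axis is met at an interior point.\<close>

lemma mixed_signs_interior:
  assumes "w \<in> verts" "w' \<in> verts" "lf Z (cusp w) > 0" "lf Z (cusp w') < 0"
  shows "\<exists>T. inCi T \<and> lf Z T = 0"
proof -
  define T0 :: qform where "T0 = (3, 0, 3)"
  have I: "inCi (T0 + k *\<^sub>R cusp u)" if "k \<ge> 0" "u \<in> verts" for k u
    using that by (auto simp: T0_def verts_def abs_if)
  show ?thesis
  proof (cases "lf Z T0 \<ge> 0")
    case True
    define k where "k = lf Z T0 / - lf Z (cusp w')"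
    have "k \<ge> 0" using True assms by (simp add: k_def divide_nonneg_nonpos flip: minus_divide_right)
    moreover have "lf Z (T0 + k *\<^sub>R cusp w') = 0" unfolding lf_add lf_scale using assms by (simp add: k_def)
    ultimately show ?thesis using I assms(2) by blast
  next
    case False
    define k where "k = - lf Z T0 / lf Z (cusp w)"
    have "k \<ge> 0" using False assms by (auto simp: k_def intro!: divide_nonpos_pos)
    moreover have "lf Z (T0 + k *\<^sub>R cusp w) = 0" unfolding lf_add lf_scale using assms by (simp add: k_def)
    ultimately show ?thesis using I assms(1) by blast
  qed
qed

text \<open>\<open>lf Z T\<close> is a combination of the vertex values with nonnegative
  coefficients that are not all zero, so it cannot vanish if those values are nonzero and share one
  sign.\<close>

lemma interior_mixed_signs:
  assumes "inC T" "fQ T > 0" "lf Z T = 0" "\<forall>w\<in>verts. lf Z (cusp w) \<noteq> 0"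
  shows "\<exists>w\<in>verts. \<exists>w'\<in>verts. lf Z (cusp w) > 0 \<and> lf Z (cusp w') < 0"
proof (rule ccontr)
  assume n: "\<not> ?thesis"
  obtain s where s: "\<And>w. s w \<ge> 0" "T = (\<Sum>w\<in>verts. s w *\<^sub>R cusp w)" using inC_decompose[OF assms(1)] by metis
  obtain e :: real where e: "e \<noteq> 0" "\<forall>w\<in>verts. e * lf Z (cusp w) > 0"
  proof (cases "\<exists>w\<in>verts. lf Z (cusp w) > 0")
    case True then show ?thesis using n assms(4) that[of 1] by force
  next
    case False then show ?thesis using assms(4) that[of "- 1"] by force
  qed
  have "(\<Sum>w\<in>verts. s w * (e * lf Z (cusp w))) = e * lf Z T"
    by (simp add: s(2) lf_sum[OF finite_verts] sum_distrib_left algebra_simps)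
  then have "(\<Sum>w\<in>verts. s w * (e * lf Z (cusp w))) = 0" using assms by simp
  then have "\<forall>w\<in>verts. s w * (e * lf Z (cusp w)) = 0"
    using s(1) e(2) by (subst (asm) sum_nonneg_eq_0_iff[OF finite_verts]) (auto intro: less_imp_le)
  then have "\<forall>w\<in>verts. s w = 0" using e(2) by force
  then have "T = 0" by (simp add: s(2))
  then show False using assms(2) by (simp add: zero_prod_def)
qed

text \<open>Two things remain after \<open>fixed_form_exists\<close>. If the coset contains a matrix
  fixing a vertex, a starting form of small enough displacement must be found. And a fixed form on
  the boundary must be moved into the interior.\<close>

theorem coset_fixed_form_exists:
  assumes N: "N > 0" and R: "\<bar>mdet R\<bar> = N"
    and H: "\<And>g w l. inW g \<Longrightarrow> w \<in> verts \<Longrightarrow> mvec (mmul g R) w = (l * fst w, l * snd w) \<Longrightarrow> l\<^sup>2 = 1 \<and> N > 1"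
  shows "\<exists>g T. inW g \<and> inCi T \<and> act (mmul g R) T = of_int N *\<^sub>R T"
proof -
  define \<Y> where "\<Y> = {mmul g R | g. inW g}"
  have det: "\<bar>mdet Y\<bar> = N" if "Y \<in> \<Y>" for Y
    using that R by (auto simp: \<Y>_def mdet_mmul abs_mult inW_def)
  have refl: "mmul (refl_mat i) Y \<in> \<Y>" if Y: "Y \<in> \<Y>" for Y i
  proof -
    obtain g where g: "inW g" "Y = mmul g R" using Y unfolding \<Y>_def by blast
    have "mmul (refl_mat i) Y = mmul (mmul (refl_mat i) g) R" by (simp add: g mmul_assoc)
    then show ?thesis using inW_mmul[OF inW_refl g(1)] unfolding \<Y>_def by blast
  qed
  have H': "l\<^sup>2 = 1" "N > 1" if "Y \<in> \<Y>" "w \<in> verts" "mvec Y w = (l * fst w, l * snd w)" for Y w l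
    using that H unfolding \<Y>_def by blast+
  define n where "n = real_of_int N"
  have "\<exists>Y\<in>\<Y>. \<exists>T. inC T \<and> fQ T > 0 \<and> act Y T = of_int N *\<^sub>R T"
  proof (cases "\<exists>Y\<in>\<Y>. \<exists>w\<in>verts. \<exists>l. mvec Y w = (l * fst w, l * snd w)")
    case True
    then obtain Y w l where Y: "Y \<in> \<Y>" "w \<in> verts" "mvec Y w = (l * fst w, l * snd w)" by blast
    have n: "n \<ge> 2" using H'(2)[OF Y] by (simp add: n_def)
    have l2: "(real_of_int l)\<^sup>2 = 1" using H'(1)[OF Y] by (metis of_int_1 of_int_power)
    define I :: qform where "I = (1, 0, 1)"
    define \<beta> where "\<beta> = fB (cusp w) I"
    have \<beta>: "\<beta> > 0" using Y(2) by (auto simp: \<beta>_def I_def verts_def)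
    have cY: "act Y (cusp w) = cusp w"
    proof -
      have "act Y (cusp w) = (real_of_int l)\<^sup>2 *\<^sub>R cusp w"
        unfolding act_cusp Y(3) by (cases w) (simp add: power2_eq_square)
      then show ?thesis by (simp add: l2)
    qed
    have d2: "(real_of_int (mdet Y))\<^sup>2 = n\<^sup>2" using det[OF Y(1)] by (metis n_def power2_abs of_int_abs)
    \<comment> \<open>Far out towards \<open>w\<close> the displacement ratio tends to
      \<open>n\<^sup>2 + 1\<close>; this \<open>t\<close> brings it below
      \<open>M = n\<^sup>2 + 2\<close>. For this \<open>M\<close> the condition at fixed vertices,
      \<open>2 + M / n \<le> (1 + n)\<^sup>2\<close>, still holds because
      \<open>n \<ge> 2\<close>.\<close>
    define t where "t = \<bar>fB I (act Y I)\<bar> / \<beta>"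
    have t: "t \<ge> 0" using \<beta> by (simp add: t_def)
    let ?T = "t *\<^sub>R cusp w + I"
    have c1: "fB (cusp w) (act Y I) = n\<^sup>2 * \<beta>"
    proof -
      have "fB (act Y (cusp w)) (act Y I) = n\<^sup>2 * \<beta>" by (simp only: fB_act d2 \<beta>_def)
      then show ?thesis by (simp only: cY)
    qed
    have q0: "fQ (cusp w) = 0" by (cases w) (simp add: power_mult_distrib)
    have e1: "fB ?T (act Y ?T) = t * ((n\<^sup>2 + 1) * \<beta>) + fB I (act Y I)"
      using c1 q0 by (simp add: act_add act_scale cY fB_linear fB_self fB_commute[of I "cusp w"] algebra_simps flip: \<beta>_def)
    have e2: "fQ ?T = t * \<beta> + 1"
      using q0 by (simp add: fQ_add fQ_scale fB_linear I_def flip: \<beta>_def) (simp add: \<beta>_def I_def)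
    have e3: "fB I (act Y I) \<le> t * \<beta>" using \<beta> by (simp add: t_def)
    have e4: "(n\<^sup>2 + 2) * (t * \<beta> + 1) = t * ((n\<^sup>2 + 1) * \<beta>) + t * \<beta> + (n\<^sup>2 + 2)"
      by (simp add: algebra_simps)
    have start: "fB ?T (act Y ?T) \<le> (n\<^sup>2 + 2) * fQ ?T"
      unfolding e1 e2 e4 using e3 zero_le_power2[of n] by linarith
    have "inC ?T" using t Y(2) by (intro inC_add inC_scale) (auto simp: I_def verts_def)
    moreover have "fQ ?T > 0" using t \<beta> e2 mult_nonneg_nonneg[of t \<beta>] by linarith
    moreover have "2 + (n\<^sup>2 + 2) / n \<le> (1 + n)\<^sup>2"
    proof -
      have "(n\<^sup>2 + 2) / n \<le> n + 1" using n by (simp add: field_simps power2_eq_square)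
      moreover have "n * n \<ge> 2" using n mult_mono[of 2 n 1 n] by simp
      ultimately show ?thesis using n by (simp add: power2_eq_square algebra_simps)
    qed
    moreover have "\<forall>Y\<in>\<Y>. \<forall>v\<in>verts. \<forall>l. mvec Y v = (l * fst v, l * snd v) \<longrightarrow>
        l\<^sup>2 < N \<and> 2 + (n\<^sup>2 + 2) / N \<le> (1 + N / (of_int l)\<^sup>2)\<^sup>2"
    proof (intro ballI allI impI)
      fix Y v l assume "Y \<in> \<Y>" "v \<in> verts" "mvec Y v = (l * fst v, l * snd v)"
      from H'[OF this] have l: "l\<^sup>2 = 1" "N > 1" by blast+
      then have "(real_of_int l)\<^sup>2 = 1" by (metis of_int_1 of_int_power)
      then show "l\<^sup>2 < N \<and> 2 + (n\<^sup>2 + 2) / N \<le> (1 + N / (of_int l)\<^sup>2)\<^sup>2"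
        using \<open>2 + (n\<^sup>2 + 2) / n \<le> (1 + n)\<^sup>2\<close> l by (simp add: n_def)
    qed
    ultimately show ?thesis
      using fixed_form_exists[of N \<Y> "n\<^sup>2 + 2" ?T Y] N det refl start Y(1) by blast
  next
    case False
    have "R \<in> \<Y>"
      unfolding \<Y>_def by (rule CollectI, rule exI[of _ "(1, 0, 0, 1)"]) (cases R, simp add: inW_iff)
    then show ?thesis
      using fixed_form_exists[of N \<Y> "fB (1, 0, 1) (act R (1, 0, 1))" "(1, 0, 1)" R] N det refl False by simp
  qed
  then obtain Y T where Y: "Y \<in> \<Y>" and T: "inC T" "fQ T > 0" "act Y T = of_int N *\<^sub>R T" by blast
  have "\<exists>Z\<in>\<Y>. \<exists>T. inCi T \<and> act Z T = of_int N *\<^sub>R T"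
  proof (cases "inCi T")
    case True then show ?thesis using Y T by blast
  next
    case False
    have "\<exists>i<4. wall i T = 0"
    proof (rule ccontr)
      assume "\<not> ?thesis"
      then have "\<forall>i<4. wall i T > 0" using T(1) by (force simp: inC_wall)
      from this[rule_format, of 0] this[rule_format, of 1] this[rule_format, of 2] this[rule_format, of 3]
      show False using False by (cases T) auto
    qed
    then obtain i where i: "i < 4" "wall i T = 0" by blast
    \<comment> \<open>A fixed form on a wall stays fixed after composition with the reflection in
      that wall, so the determinant can be taken to be \<open>- N\<close>. The fixed points of
      \<open>Z\<close> then form a whole axis, which is shown to enter the interior.\<close>
    obtain Z where Z: "Z \<in> \<Y>" "mdet Z = - N" "act Z T = of_int N *\<^sub>R T"
    proof (cases "mdet Y = - N")
      case True then show ?thesis using that Y T by blast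
    next
      case False
      then have "mdet Y = N" using det[OF Y] by auto
      then show ?thesis using that[of "mmul (refl_mat i) Y"] refl[OF Y] T(3) refl_fix[OF i]
        by (simp add: mdet_mmul mdet_refl act_mmul act_scale)
    qed
    obtain a b c d where Zs: "Z = (a, b, c, d)" by (cases Z)
    have d: "d = - a" and l0: "lf Z T = 0"
      using fixed_form_neg_det[of N a b c d T] N Z T by (auto simp: Zs)
    have aN: "a * a + b * c = N" using Z(2) by (simp add: Zs d)
    \<comment> \<open>As \<open>Z\<close> has trace zero, its square is multiplication by
      \<open>N\<close>. A vertex on the axis would be an eigenvector with
      \<open>l\<^sup>2 = N\<close>, against \<open>l\<^sup>2 = 1 < N\<close>.\<close>
    have "lf Z (cusp w) \<noteq> 0" if w: "w \<in> verts" for w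
    proof
      assume "lf Z (cusp w) = 0"
      then have "vdet w (mvec Z w) = 0" by (simp add: lf_cusp)
      then obtain l where l: "mvec Z w = (l * fst w, l * snd w)" using vdet_fixed[OF w] by blast
      then have "l\<^sup>2 = 1" and N1: "N > 1" using H'[OF Z(1) w] by blast+
      have "mvec Z (mvec Z w) = (N * fst w, N * snd w)"
        unfolding aN[symmetric] by (cases w) (simp add: Zs d algebra_simps)
      moreover have "mvec Z (mvec Z w) = (l * fst (mvec Z w), l * snd (mvec Z w))"
      proof -
        have "mvec Z (l * x, l * y) = (l * fst (mvec Z (x, y)), l * snd (mvec Z (x, y)))" for x y
          by (simp add: Zs algebra_simps)
        from this[of "fst w" "snd w"] show ?thesis by (subst l) simp
      qed
      ultimately have "(N * fst w, N * snd w) = (l\<^sup>2 * fst w, l\<^sup>2 * snd w)" by (simp add: l power2_eq_square)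
      then have "N = 1" using w \<open>l\<^sup>2 = 1\<close> by (auto simp: verts_def)
      then show False using N1 by simp
    qed
    from interior_mixed_signs[OF T(1,2) l0] this mixed_signs_interior[of _ _ Z]
    obtain T' where T': "inCi T'" "lf Z T' = 0" by blast
    have "act Z T' = of_int N *\<^sub>R T'" using fixed_form_trace_zero[of a b c N T'] Z(2) T'(2) d by (simp add: Zs)
    then show ?thesis using Z(1) T'(1) by blast
  qed
  then show ?thesis unfolding \<Y>_def by blast
qed

text \<open>Up to scaling the only candidate is \<open>(- 2 * b, a - d, 2 * c)\<close>, the form
  attached to the matrix; the inequalities say that it, or its negative, is interior to the
  tile.\<close>

lemma fixed_form_pos_det:
  assumes "N > 0" "a * d - b * c = N" "b \<noteq> 0"
  shows "(\<exists>T. inCi T \<and> act (a, b, c, d) T = of_int N *\<^sub>R T) \<longleftrightarrow>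
     b * c < 0 \<and> \<bar>a - d\<bar> < 2 * \<bar>b\<bar> \<and> \<bar>a - d\<bar> < 2 * \<bar>c\<bar>"
proof
  assume "\<exists>T. inCi T \<and> act (a, b, c, d) T = of_int N *\<^sub>R T"
  then obtain p r q where C: "\<bar>r\<bar> < p" "\<bar>r\<bar> < q" and e: "act (a, b, c, d) (p, r, q) = of_int N *\<^sub>R (p, r, q)"
    by auto
  have n: "real_of_int N > 0" using assms by simp
  have pq: "p > 0" "q > 0" using C by auto
  note eq = fixed_form_equations[OF e, unfolded assms(2)]
  have "a * p + b * r = d * p - b * r" using eq(1) n by (metis mult_left_cancel less_irrefl)
  then have 1: "(d - a) * p = 2 * b * r" by (simp add: algebra_simps)
  have "c * p + d * r = d * r - b * q" using eq(2) n by (metis mult_left_cancel less_irrefl)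
  then have 2: "c * p = - b * q" by simp
  have "real_of_int (b * c) * p = b * (c * p)" by simp
  also have "\<dots> = - (b\<^sup>2 * q)" unfolding 2 by (simp add: power2_eq_square)
  also have "\<dots> < 0" using pq assms(3) by simp
  finally have "real_of_int (b * c) < 0" using pq by (simp add: mult_less_0_iff)
  then have bc: "b * c < 0" by (simp only: of_int_less_0_iff)
  have "\<bar>real_of_int (a - d)\<bar> * p = \<bar>(d - a) * p\<bar>" using pq by (simp add: abs_mult abs_minus_commute)
  also have "\<dots> = 2 * \<bar>b\<bar> * \<bar>r\<bar>" unfolding 1 by (simp add: abs_mult)
  finally have 3: "\<bar>real_of_int (a - d)\<bar> * p = 2 * \<bar>b\<bar> * \<bar>r\<bar>" .
  also have "\<dots> < 2 * \<bar>b\<bar> * p" using C assms(3) by simp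
  finally have "\<bar>real_of_int (a - d)\<bar> < real_of_int (2 * \<bar>b\<bar>)" using pq by simp
  then have 4: "\<bar>a - d\<bar> < 2 * \<bar>b\<bar>" by (simp only: of_int_abs[symmetric] of_int_less_iff)
  have "2 * \<bar>b\<bar> * \<bar>r\<bar> < 2 * (\<bar>b\<bar> * q)" using C assms(3) by simp
  also have "\<bar>b\<bar> * q = \<bar>c * p\<bar>" unfolding 2 using pq by (simp add: abs_mult)
  also have "\<dots> = \<bar>c\<bar> * p" using pq by (simp add: abs_mult)
  finally have "\<bar>real_of_int (a - d)\<bar> * p < (2 * \<bar>c\<bar>) * p" using 3 by simp
  then have "\<bar>real_of_int (a - d)\<bar> < real_of_int (2 * \<bar>c\<bar>)" using pq by simp
  then have 5: "\<bar>a - d\<bar> < 2 * \<bar>c\<bar>" by (simp only: of_int_abs[symmetric] of_int_less_iff)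
  show "b * c < 0 \<and> \<bar>a - d\<bar> < 2 * \<bar>b\<bar> \<and> \<bar>a - d\<bar> < 2 * \<bar>c\<bar>" using bc 4 5 by blast
next
  assume h: "b * c < 0 \<and> \<bar>a - d\<bar> < 2 * \<bar>b\<bar> \<and> \<bar>a - d\<bar> < 2 * \<bar>c\<bar>"
  have nN: "real_of_int N = a * d - b * c" using assms(2) by (metis of_int_diff of_int_mult)
  define F :: "real \<Rightarrow> qform" where
    "F k = (k * (- 2 * of_int b), k * (of_int a - of_int d), k * (2 * of_int c))" for k
  have fixk: "act (a, b, c, d) (F k) = of_int N *\<^sub>R F k" for k
    unfolding nN F_def by (simp add: algebra_simps power2_eq_square)
  have r: "\<bar>real_of_int a - d\<bar> < 2 * \<bar>real_of_int b\<bar>" "\<bar>real_of_int a - d\<bar> < 2 * \<bar>real_of_int c\<bar>"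
  proof -
    have "real_of_int \<bar>a - d\<bar> < real_of_int (2 * \<bar>b\<bar>)" "real_of_int \<bar>a - d\<bar> < real_of_int (2 * \<bar>c\<bar>)"
      using h by (simp_all only: of_int_less_iff)
    then show "\<bar>real_of_int a - d\<bar> < 2 * \<bar>real_of_int b\<bar>" "\<bar>real_of_int a - d\<bar> < 2 * \<bar>real_of_int c\<bar>"
      by simp_all
  qed
  have "b < 0 \<and> c > 0 \<or> b > 0 \<and> c < 0" using h by (auto simp: mult_less_0_iff)
  then show "\<exists>T. inCi T \<and> act (a, b, c, d) T = of_int N *\<^sub>R T"
  proof
    assume s: "b < 0 \<and> c > 0"
    have "inCi (F 1)" using r s by (simp add: F_def)
    then show ?thesis using fixk[of 1] by blast
  next
    assume s: "b > 0 \<and> c < 0"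
    have "inCi (F (- 1))" using r s by (simp add: F_def abs_minus_commute)
    then show ?thesis using fixk[of "- 1"] by blast
  qed
qed

section \<open>Counting cosets by upper triangular representatives\<close>

definition cls :: "nat \<Rightarrow> nat \<Rightarrow> nat \<Rightarrow> imat \<Rightarrow> bool" where
  "cls i j k Y \<longleftrightarrow> vt (mvec Y (1, 0)) = i \<and> vt (mvec Y (0, 1)) = j \<and> vt (mvec Y (1, 1)) = k"

lemma cls_inW: "inW g \<Longrightarrow> cls i j k (mmul g Y) \<longleftrightarrow> cls i j k Y"
  by (simp add: cls_def mvec_mmul vt_inW)

text \<open>Hermite normal forms for left multiplication by the group. The entry \<open>b\<close> is
  reduced modulo \<open>4 * d\<close> because the unipotent matrix with rows \<open>(1, q)\<close>
  and \<open>(0, 1)\<close> belongs to \<open>inW\<close> iff 4 divides \<open>q\<close>.\<close>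

definition upper_reps :: "nat \<Rightarrow> int \<Rightarrow> imat set" where
  "upper_reps k N = {(a, b, c, d). c = 0 \<and> a > 0 \<and> d > 0 \<and> a * d = N \<and> 0 \<le> b \<and> b < 4 * d \<and> cls 1 2 k (a, b, c, d)}"

text \<open>The usual Euclidean reduction of the first column, with the Bezout coefficients adjusted
  so that the reducing matrix lies in \<open>inW\<close>.\<close>

lemma upper_rep_exists:
  assumes "N > 0" "\<bar>mdet Y\<bar> = N" "cls 1 2 k Y"
  shows "\<exists>R\<in>upper_reps k N. \<exists>g. inW g \<and> Y = mmul g R"
proof -
  obtain a b c d where Y: "Y = (a, b, c, d)" by (cases Y)
  have par: "odd a" "even c" using assms(3) by (auto simp: Y cls_def split: if_splits)
  define e where "e = gcd a c"
  have e: "e > 0" using par by (auto simp: e_def)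
  obtain u v where uv: "a = e * u" "c = e * v" "coprime u v"
    using e by (metis e_def gcd_coprime_exists less_irrefl mult.commute)
  have odd: "odd u" "odd e" "even v" using par uv by auto
  obtain s t where st0: "s * u + t * v = 1" using uv(3) by (metis bezout_int coprime_iff_gcd_eq_1)
  \<comment> \<open>Bezout pairs may be replaced by \<open>(s + k * v, t - k * u)\<close>. Taking
    \<open>k = t\<close> makes the second entry even as \<open>u\<close> is odd; passing from
    \<open>k\<close> to \<open>k + 2\<close> changes the other sum by \<open>2 * (v - u)\<close>,
    which is 2 modulo 4.\<close>
  have "\<exists>k. even (t - k * u) \<and> 4 dvd (s + k * v) + (t - k * u) + v - u"
  proof -
    define k0 where "k0 = t"
    have k0: "even (t - k0 * u)" using odd by (simp add: k0_def)
    define s0 t0 where "s0 = s + k0 * v" and "t0 = t - k0 * u"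
    have "s0 * u + t0 * v = 1" using st0 by (simp add: s0_def t0_def algebra_simps)
    then have "odd s0" using odd by (metis even_add even_mult_iff odd_one)
    have ev: "even (s0 + t0 + v - u)" using \<open>odd s0\<close> k0 odd by (auto simp: t0_def)
    show ?thesis
    proof (cases "4 dvd s0 + t0 + v - u")
      case True then show ?thesis using k0 by (auto simp: s0_def t0_def intro!: exI[of _ k0])
    next
      case False
      have "odd (v - u)" using odd by simp
      moreover have "4 dvd x + 2 * y" if "even x" "\<not> 4 dvd x" "odd y" for x y :: int using that by presburger
      ultimately have "4 dvd (s0 + t0 + v - u) + 2 * (v - u)" using False ev by blast
      moreover have "(s + (k0 + 2) * v) + (t - (k0 + 2) * u) + v - u = (s0 + t0 + v - u) + 2 * (v - u)"
        by (simp add: s0_def t0_def algebra_simps)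
      moreover have "even (t - (k0 + 2) * u)" using k0 by (simp add: algebra_simps)
      ultimately show ?thesis by metis
    qed
  qed
  then obtain k1 where k1: "even (t - k1 * u)" "4 dvd (s + k1 * v) + (t - k1 * u) + v - u" by blast
  define s1 t1 where "s1 = s + k1 * v" and "t1 = t - k1 * u"
  have st: "s1 * u + t1 * v = 1" using st0 by (simp add: s1_def t1_def algebra_simps)
  have s1: "odd s1" using st odd by (metis even_add even_mult_iff odd_one)
  define h where "h = (s1, t1, - v, u)"
  have h: "inW h" using st s1 odd k1 by (simp add: h_def inW_iff s1_def t1_def algebra_simps)
  define d1 where "d1 = - v * b + u * d"
  define b1 where "b1 = s1 * b + t1 * d"
  have "s1 * a + t1 * c = e * (s1 * u + t1 * v)" by (simp add: uv algebra_simps)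
  then have hY: "mmul h Y = (e, b1, 0, d1)" using st by (simp add: h_def Y b1_def d1_def uv)
  have dY: "\<bar>e * d1\<bar> = N"
  proof -
    have "\<bar>mdet (mmul h Y)\<bar> = N" using h assms(2) by (simp add: mdet_mmul abs_mult inW_def)
    then show ?thesis by (simp add: hY)
  qed
  have "\<exists>g b2 d2. inW g \<and> mmul g (e, b1, 0, d1) = (e, b2, 0, d2) \<and> d2 > 0 \<and> e * d2 = N"
  proof (cases "d1 > 0")
    case True
    then have "inW (1, 0, 0, 1) \<and> mmul (1, 0, 0, 1) (e, b1, 0, d1) = (e, b1, 0, d1) \<and> d1 > 0 \<and> e * d1 = N"
      using dY e by (simp add: inW_iff abs_mult)
    then show ?thesis by blast
  next
    case False
    then have "d1 < 0" using dY assms(1) e by (cases "d1 = 0") auto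
    \<comment> \<open>This element of the group reverses the sign of the lower right entry; the
      entry 2 restores the congruence modulo 4.\<close>
    then have "inW (1, 2, 0, - 1) \<and> mmul (1, 2, 0, - 1) (e, b1, 0, d1) = (e, b1 + 2 * d1, 0, - d1) \<and> - d1 > 0 \<and> e * (- d1) = N"
      using dY e by (simp add: inW_iff abs_mult)
    then show ?thesis by blast
  qed
  then obtain g2 b2 d2 where g2: "inW g2" "mmul g2 (e, b1, 0, d1) = (e, b2, 0, d2)" "d2 > 0" "e * d2 = N" by blast
  define g3 where "g3 = (1 :: int, - 4 * (b2 div (4 * d2)), 0 :: int, 1 :: int)"
  have g3: "inW g3" by (simp add: g3_def inW_iff)
  define R where "R = (e, b2 mod (4 * d2), 0 :: int, d2)"
  have "b2 + - 4 * (b2 div (4 * d2)) * d2 = b2 mod (4 * d2)"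
    by (simp add: minus_mult_div_eq_mod[symmetric] algebra_simps)
  then have R: "mmul g3 (e, b2, 0, d2) = R" by (simp add: g3_def R_def)
  define g where "g = mmul g3 (mmul g2 h)"
  have g: "inW g" unfolding g_def by (intro inW_mmul g3 g2 h)
  have gY: "mmul g Y = R" by (simp add: g_def mmul_assoc hY g2 R)
  have "cls 1 2 k R" using cls_inW[OF g, of 1 2 k Y] assms(3) gY by simp
  then have "R \<in> upper_reps k N" using g2 e by (simp add: upper_reps_def R_def)
  moreover obtain g' where "inW g'" "\<And>Z. mmul g' (mmul g Z) = Z" using inW_inverse[OF g] by blast
  ultimately show ?thesis using gY by metis
qed

lemma upper_rep_unique:
  assumes "R \<in> upper_reps k N" "R' \<in> upper_reps k N" "inW g" "R = mmul g R'"
  shows "R = R'"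
proof -
  obtain a b d a' b' d' where R: "R = (a, b, 0, d)" "R' = (a', b', 0, d')"
    "a > 0" "d > 0" "a' > 0" "d' > 0" "0 \<le> b" "b < 4 * d" "0 \<le> b'" "b' < 4 * d'"
    using assms(1,2) by (auto simp: upper_reps_def)
  obtain p q r s where g: "g = (p, q, r, s)" by (cases g)
  have e: "a = p * a'" "r * a' = 0" "b = p * b' + q * d'" "d = r * b' + s * d'" using assms(4) by (auto simp: R g)
  have r: "r = 0" using e R by auto
  have ps: "\<bar>p * s\<bar> = 1" and q4: "4 dvd p + q - r - s" using assms(3) by (auto simp: g inW_iff r)
  have "p > 0" using e(1) R by (metis zero_less_mult_pos2)
  moreover have "s > 0" using e(4) r R by (simp, metis zero_less_mult_pos2)
  ultimately have ps1: "p = 1" "s = 1" using ps by (auto simp: abs_mult zmult_eq_1_iff)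
  then have d: "d = d'" and b: "b = b' + q * d" using e r by auto
  obtain m where m: "q = 4 * m" using q4 ps1 r by auto
  have bm: "b = b' + 4 * d * m" using b m by simp
  have "m = 0"
  proof (rule ccontr)
    assume "m \<noteq> 0"
    then have "m \<ge> 1 \<or> m \<le> - 1" by linarith
    then have "4 * d * m \<ge> 4 * d \<or> 4 * d * m \<le> - (4 * d)"
      using R mult_left_mono[of 1 m "4 * d"] mult_left_mono[of m "- 1" "4 * d"] by auto
    then show False using bm R d by linarith
  qed
  then show ?thesis using e(1) ps1 d bm by (simp add: R)
qed

definition fixers :: "nat \<Rightarrow> nat \<Rightarrow> nat \<Rightarrow> int \<Rightarrow> imat set" where
  "fixers i j k N = {Y. cls i j k Y \<and> \<bar>mdet Y\<bar> = N \<and> (\<exists>T. inCi T \<and> act Y T = of_int N *\<^sub>R T)}"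

definition good_coset :: "int \<Rightarrow> imat \<Rightarrow> bool" where
  "good_coset N R \<longleftrightarrow> (\<exists>g T. inW g \<and> inCi T \<and> act (mmul g R) T = of_int N *\<^sub>R T)"

text \<open>By \<open>fixed_form_unique\<close> the members of a good coset that fix an interior
  form are exactly \<open>f R\<close> and its negative, which are different because the determinant
  is nonzero.\<close>

lemma card_fixers:
  assumes "N > 0" "finite \<R>"
    and ex: "\<And>Y. cls i j k Y \<Longrightarrow> \<bar>mdet Y\<bar> = N \<Longrightarrow> \<exists>R\<in>\<R>. \<exists>g. inW g \<and> Y = mmul g R"
    and un: "\<And>R R' g. R \<in> \<R> \<Longrightarrow> R' \<in> \<R> \<Longrightarrow> inW g \<Longrightarrow> R = mmul g R' \<Longrightarrow> R = R'"
    and \<R>: "\<And>R. R \<in> \<R> \<Longrightarrow> cls i j k R \<and> \<bar>mdet R\<bar> = N"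
  shows "finite (fixers i j k N)" "card (fixers i j k N) = 2 * card {R \<in> \<R>. good_coset N R}"
proof -
  let ?neg = "mmul (- 1, 0, 0, - 1)"
  define G where "G = {R \<in> \<R>. good_coset N R}"
  have finG: "finite G" using assms(2) by (simp add: G_def)
  have "\<forall>R\<in>G. \<exists>Y. (\<exists>g. inW g \<and> Y = mmul g R) \<and> (\<exists>T. inCi T \<and> act Y T = of_int N *\<^sub>R T)"
    unfolding G_def good_coset_def by blast
  then obtain f where f: "\<And>R. R \<in> G \<Longrightarrow> (\<exists>g. inW g \<and> f R = mmul g R) \<and> (\<exists>T. inCi T \<and> act (f R) T = of_int N *\<^sub>R T)"
    by metis
  have negneg: "?neg (?neg Y) = Y" for Y by (cases Y) simp
  have actneg: "act (?neg Y) T = act Y T" for Y T by (cases Y; cases T) simp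
  have detneg: "mdet (?neg Y) = mdet Y" for Y by (cases Y) simp
  have ne: "?neg Y \<noteq> Y" if d: "\<bar>mdet Y\<bar> = N" for Y
    using d assms(1) by (cases Y) auto
  have fF: "f R \<in> fixers i j k N" if R: "R \<in> G" for R
  proof -
    obtain g where g: "inW g" "f R = mmul g R" using f[OF R] by blast
    have RR: "cls i j k R" "\<bar>mdet R\<bar> = N" using \<R> R by (auto simp: G_def)
    have "cls i j k (f R)" using RR g cls_inW by simp
    moreover have "\<bar>mdet (f R)\<bar> = N" using RR g by (simp add: mdet_mmul abs_mult inW_def)
    ultimately show ?thesis using f[OF R] by (simp add: fixers_def)
  qed
  have nF: "?neg Y \<in> fixers i j k N" if "Y \<in> fixers i j k N" for Y
    using that cls_inW[OF inW_uminus_one, of i j k Y] unfolding fixers_def mem_Collect_eq actneg detneg by blast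
  have eq: "fixers i j k N = (\<Union>R\<in>G. {f R, ?neg (f R)})"
  proof
    show "(\<Union>R\<in>G. {f R, ?neg (f R)}) \<subseteq> fixers i j k N" using fF nF by blast
    show "fixers i j k N \<subseteq> (\<Union>R\<in>G. {f R, ?neg (f R)})"
    proof
      fix Y assume Y: "Y \<in> fixers i j k N"
      then obtain T where T: "inCi T" "act Y T = of_int N *\<^sub>R T" and c: "cls i j k Y" "\<bar>mdet Y\<bar> = N"
        unfolding fixers_def by blast
      obtain R g where R: "R \<in> \<R>" "inW g" "Y = mmul g R" using ex[OF c] by blast
      then have RG: "R \<in> G" using T unfolding G_def good_coset_def by blast
      obtain g1 T1 where g1: "inW g1" "f R = mmul g1 R" "inCi T1" "act (f R) T1 = of_int N *\<^sub>R T1"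
        using f[OF RG] by blast
      obtain g' where g': "inW g'" "\<And>Z. mmul g' (mmul g Z) = Z" using inW_inverse[OF R(2)] by blast
      have fR: "f R = mmul (mmul g1 g') Y" by (simp add: g1(2) R(3) mmul_assoc g'(2))
      have "f R = Y \<or> f R = ?neg Y"
        using fixed_form_unique[OF assms(1) c(2) inW_mmul[OF g1(1) g'(1)] T g1(3)] g1(4) unfolding fR by blast
      then have "Y = f R \<or> Y = ?neg (f R)" using negneg by metis
      then show "Y \<in> (\<Union>R\<in>G. {f R, ?neg (f R)})" using RG by blast
    qed
  qed
  show "finite (fixers i j k N)" unfolding eq using finG by blast
  have same: "R = R'" if R: "R \<in> G" "R' \<in> G" and i: "{f R, ?neg (f R)} \<inter> {f R', ?neg (f R')} \<noteq> {}" for R R'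
  proof -
    obtain g where g: "inW g" "f R = mmul g R" using f[OF R(1)] by blast
    obtain g1 where g1: "inW g1" "f R' = mmul g1 R'" using f[OF R(2)] by blast
    have "f R = f R' \<or> f R = ?neg (f R') \<or> ?neg (f R) = f R' \<or> ?neg (f R) = ?neg (f R')" using i by blast
    then have or: "f R = f R' \<or> f R = ?neg (f R')"
      by (elim disjE) (metis negneg)+
    have "\<exists>h. inW h \<and> f R = mmul h R'"
    proof (cases "f R = f R'")
      case True then show ?thesis using g1 by metis
    next
      case False
      then have "f R = ?neg (f R')" using or by blast
      then have "f R = mmul (mmul (- 1, 0, 0, - 1) g1) R'" unfolding g1(2) mmul_assoc .
      then show ?thesis using inW_mmul[OF inW_uminus_one g1(1)] by blast
    qed
    then obtain h where h: "inW h" "f R = mmul h R'" by blast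
    obtain g' where g': "inW g'" "\<And>Z. mmul g' (mmul g Z) = Z" using inW_inverse[OF g(1)] by blast
    have "R = mmul (mmul g' h) R'" using g'(2)[of R] g(2) h(2) by (simp add: mmul_assoc)
    then show ?thesis using un inW_mmul[OF g'(1) h(1)] R by (auto simp: G_def)
  qed
  have "card (fixers i j k N) = (\<Sum>R\<in>G. card {f R, ?neg (f R)})"
    unfolding eq by (intro card_UN_disjoint finG ballI impI) (simp, use same in blast)
  also have "\<dots> = (\<Sum>R\<in>G. 2)"
  proof (rule sum.cong[OF refl])
    fix R assume "R \<in> G"
    then have "\<bar>mdet (f R)\<bar> = N" using fF unfolding fixers_def by blast
    then have "f R \<noteq> ?neg (f R)" using ne by metis
    then show "card {f R, ?neg (f R)} = 2" by simp
  qed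
  finally show "card (fixers i j k N) = 2 * card {R \<in> \<R>. good_coset N R}" by (simp add: G_def)
qed

lemma vt_scale: assumes "odd l" shows "vt (l * x, l * y) = vt (x, y)"
proof -
  have "coprime (2 ^ 2) l" using assms by (simp only: coprime_power_left_iff) simp
  then have "coprime 4 l" by simp
  then have "4 dvd l * x - l * y \<longleftrightarrow> 4 dvd x - y" by (metis coprime_dvd_mult_right_iff right_diff_distrib)
  then show ?thesis using assms by simp
qed

lemma vt_iff: "vt (x, y) = 1 \<longleftrightarrow> odd x \<and> even y" "vt (x, y) = 2 \<longleftrightarrow> even x \<and> odd y"
  "vt (x, y) = 3 \<longleftrightarrow> odd x \<and> odd y \<and> 4 dvd x - y" "vt (x, y) = 4 \<longleftrightarrow> odd x \<and> odd y \<and> \<not> 4 dvd x - y"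
  by auto

lemma cls_iff:
  "cls 1 2 3 (a, b, c, d) \<longleftrightarrow> odd a \<and> even b \<and> even c \<and> odd d \<and> 4 dvd a + b - c - d"
  "cls 1 2 4 (a, b, c, d) \<longleftrightarrow> odd a \<and> even b \<and> even c \<and> odd d \<and> \<not> 4 dvd a + b - c - d"
  "cls 2 1 3 (a, b, c, d) \<longleftrightarrow> even a \<and> odd b \<and> odd c \<and> even d \<and> 4 dvd a + b - c - d"
  "cls 2 1 4 (a, b, c, d) \<longleftrightarrow> even a \<and> odd b \<and> odd c \<and> even d \<and> \<not> 4 dvd a + b - c - d"
proof -
  have e: "a + b - (c + d) = a + b - c - d" by simp
  show "cls 1 2 3 (a, b, c, d) \<longleftrightarrow> odd a \<and> even b \<and> even c \<and> odd d \<and> 4 dvd a + b - c - d"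
    "cls 1 2 4 (a, b, c, d) \<longleftrightarrow> odd a \<and> even b \<and> even c \<and> odd d \<and> \<not> 4 dvd a + b - c - d"
    "cls 2 1 3 (a, b, c, d) \<longleftrightarrow> even a \<and> odd b \<and> odd c \<and> even d \<and> 4 dvd a + b - c - d"
    "cls 2 1 4 (a, b, c, d) \<longleftrightarrow> even a \<and> odd b \<and> odd c \<and> even d \<and> \<not> 4 dvd a + b - c - d"
    unfolding cls_def mvec.simps mult_1_right mult_zero_right add_0_right add_0_left vt_iff e by auto
qed

lemma cls_parity:
  assumes "cls i j k (a, b, c, d)" "i = 1 \<and> j = 2 \<or> i = 2 \<and> j = 1" "k = 3 \<or> k = 4"
  shows "i = 1 \<Longrightarrow> odd a \<and> even b \<and> even c \<and> odd d" "i = 2 \<Longrightarrow> even a \<and> odd b \<and> odd c \<and> even d"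
    "k = 3 \<longleftrightarrow> 4 dvd a + b - c - d"
  using assms cls_iff[of a b c d] by (elim disjE conjE; simp)+

text \<open>The images of \<open>(1, 1)\<close> and \<open>(1, - 1)\<close> differ by twice the
  second column, whose coordinates have odd difference; this exchanges the types 3 and 4, whose sum
  is 7.\<close>

lemma cls_fourth:
  assumes "cls i j k Y" "i = 1 \<and> j = 2 \<or> i = 2 \<and> j = 1" "k = 3 \<or> k = 4"
  shows "vt (mvec Y (1, - 1)) = 7 - k"
proof -
  obtain a b c d where Y: "Y = (a, b, c, d)" by (cases Y)
  note p = cls_parity[OF assms(1)[unfolded Y] assms(2,3)]
  have o: "odd (a - b)" "odd (c - d)" "odd (b - d)" using p assms(2) by auto
  have ev: "even (a + b - c - d)" using p assms(2) by auto
  have "4 dvd x - 2 * y \<longleftrightarrow> \<not> 4 dvd x" if "even x" "odd y" for x y :: int using that by presburger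
  from this[OF ev o(3)] have "4 dvd (a - b) - (c - d) \<longleftrightarrow> \<not> 4 dvd a + b - c - d"
    by (simp add: algebra_simps)
  then show ?thesis using p(3) o(1,2) assms(3) by (auto simp: Y)
qed

text \<open>The arithmetic form of an attracting vertex: \<open>w\<close> is sent to
  \<open>N\<close> times a vector of its own type. It is a property of the coset, although stated
  for a representative.\<close>

definition bad_coset :: "int \<Rightarrow> imat \<Rightarrow> bool" where
  "bad_coset N R \<longleftrightarrow> (\<exists>w\<in>verts. vt (mvec R w) = vt w \<and> N dvd fst (mvec R w) \<and> N dvd snd (mvec R w))"

text \<open>If \<open>mmul g R\<close> sends a vertex \<open>w\<close> to \<open>l\<close> times
  itself, then \<open>l\<close> is odd and the type of \<open>w\<close> is preserved, so by the last
  hypothesis \<open>N\<close> is prime. Moreover \<open>l\<close> divides \<open>N\<close>, hence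
  \<bar>l\<bar> is 1 or \<open>N\<close>. The value \<open>N\<close> is the excluded attracting
  case, and 1 is admissible in \<open>coset_fixed_form_exists\<close>.\<close>

lemma good_coset_iff:
  assumes N: "N > 0" "odd N" and R: "\<bar>mdet R\<bar> = N" and nz: "\<And>w. w \<in> verts \<Longrightarrow> vt (mvec R w) \<noteq> 0"
    and pr: "prime N \<or> (\<forall>w\<in>verts. vt (mvec R w) \<noteq> vt w)"
  shows "good_coset N R \<longleftrightarrow> \<not> bad_coset N R"
proof
  assume "good_coset N R"
  then obtain g T where g: "inW g" "inCi T" "act (mmul g R) T = of_int N *\<^sub>R T" unfolding good_coset_def by blast
  show "\<not> bad_coset N R"
  proof
    assume "bad_coset N R"
    then obtain w where w: "w \<in> verts" "vt (mvec R w) = vt w" "N dvd fst (mvec R w)" "N dvd snd (mvec R w)"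
      unfolding bad_coset_def by blast
    have "N > 1" using pr w prime_gt_1_int by blast
    from attracting_no_fixed_form[OF this N(2) R g(1) w g(2,3)] show False .
  qed
next
  assume nb: "\<not> bad_coset N R"
  have "l\<^sup>2 = 1 \<and> N > 1" if g: "inW g" and w: "w \<in> verts" and e: "mvec (mmul g R) w = (l * fst w, l * snd w)" for g w l
  proof -
    have t: "vt (mvec R w) = vt (l * fst w, l * snd w)" using vt_inW[OF g, of "mvec R w"] e by (simp add: mvec_mmul)
    have "odd l" using nz[OF w] t by (auto split: if_splits)
    then have tw: "vt (mvec R w) = vt w" using t vt_scale[of l "fst w" "snd w"] by (simp del: vt.simps)
    then have "prime N" using pr w by blast
    \<comment> \<open>\<open>u\<close> completes \<open>w\<close> to a basis of the lattice, so the
      determinant of the two images is \<open>N\<close> up to sign and is divisible by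
      \<open>l\<close>.\<close>
    define u :: "int \<times> int" where "u = (if w = (0, 1) then (1, 0) else (0, 1))"
    have wu: "\<bar>vdet w u\<bar> = 1" using w by (auto simp: verts_def u_def)
    have "vdet (mvec (mmul g R) w) (mvec (mmul g R) u) = mdet (mmul g R) * vdet w u" by (rule vdet_mvec)
    moreover have "l dvd vdet (mvec (mmul g R) w) (mvec (mmul g R) u)"
      unfolding e by (cases "mvec (mmul g R) u") (simp add: mult.assoc dvd_diff)
    moreover have "\<bar>mdet (mmul g R) * vdet w u\<bar> = N" using wu g R by (simp add: mdet_mmul abs_mult inW_def)
    ultimately have "l dvd N" by (metis dvd_abs_iff)
    then have "\<bar>l\<bar> dvd N" by simp
    then have "\<bar>l\<bar> = 1 \<or> \<bar>l\<bar> = N" using \<open>prime N\<close> by (metis abs_ge_zero prime_int_iff)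
    moreover have "\<bar>l\<bar> \<noteq> N"
    proof
      assume lN: "\<bar>l\<bar> = N"
      obtain g' where g': "inW g'" "\<And>Z. mmul g' (mmul g Z) = Z" using inW_inverse[OF g] by blast
      have "mvec R w = mvec g' (l * fst w, l * snd w)" by (metis g'(2) mvec_mmul e)
      also have "\<dots> = (l * fst (mvec g' w), l * snd (mvec g' w))" by (cases g'; cases w) (simp add: algebra_simps)
      finally have "N dvd fst (mvec R w)" "N dvd snd (mvec R w)" using lN by auto
      then show False using nb tw w unfolding bad_coset_def by blast
    qed
    ultimately have "\<bar>l\<bar> = 1" by blast
    then have "l\<^sup>2 = 1" by (metis power2_abs power_one)
    then show ?thesis using prime_gt_1_int[OF \<open>prime N\<close>] by blast
  qed
  then show "good_coset N R" unfolding good_coset_def using coset_fixed_form_exists[OF N(1) R] by blast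
qed

lemma cls_nonzero:
  assumes "cls i j k Y" "i = 1 \<and> j = 2 \<or> i = 2 \<and> j = 1" "k = 3 \<or> k = 4" "w \<in> verts"
  shows "vt (mvec Y w) \<noteq> 0"
  using assms cls_fourth[OF assms(1-3)] unfolding verts_def cls_def by (elim insertE emptyE) auto

definition residue_set :: "int \<Rightarrow> int \<Rightarrow> int set" where
  "residue_set c d = {b. 0 \<le> b \<and> b < 4 * d \<and> 4 dvd b - c}"

lemma residue_set: 
  assumes "d > 0" shows "finite (residue_set c d)" "card (residue_set c d) = nat d"
proof -
  have eq: "residue_set c d = (\<lambda>j. 4 * j + c mod 4) ` {0..<d}"
  proof (rule Set.set_eqI, rule iffI)
    fix b assume "b \<in> residue_set c d"
    then have b: "0 \<le> b" "b < 4 * d" "4 dvd b - c" by (auto simp: residue_set_def)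
    then have m: "b mod 4 = c mod 4" by (simp add: mod_eq_dvd_iff)
    have "b = 4 * (b div 4) + c mod 4" using m by (metis mult_div_mod_eq)
    moreover have "b div 4 \<in> {0..<d}" using b by auto
    ultimately show "b \<in> (\<lambda>j. 4 * j + c mod 4) ` {0..<d}" by blast
  next
    fix b assume "b \<in> (\<lambda>j. 4 * j + c mod 4) ` {0..<d}"
    then obtain j where j: "0 \<le> j" "j < d" "b = 4 * j + c mod 4" by auto
    have m: "0 \<le> c mod 4" "c mod 4 < 4" by simp_all
    have "b mod 4 = c mod 4" using j by simp
    then have "4 dvd b - c" by (simp add: mod_eq_dvd_iff)
    then show "b \<in> residue_set c d" using j m by (simp add: residue_set_def)
  qed
  show "finite (residue_set c d)" by (simp add: eq)
  have "inj_on (\<lambda>j. 4 * j + c mod 4) {0..<d}" by (auto simp: inj_on_def)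
  then show "card (residue_set c d) = nat d" by (simp add: eq card_image)
qed

text \<open>Chinese remainder theorem: a fixed residue modulo 4 and any residue modulo the odd
  number \<open>p\<close> meet in exactly one number below \<open>4 * p\<close>.\<close>

lemma residue_set_mod:
  assumes p: "p > 0" "odd p" and S: "S \<subseteq> {0..<p}"
  shows "card {b \<in> residue_set c p. b mod p \<in> S} = card S"
proof -
  have inj: "inj_on (\<lambda>b. b mod p) (residue_set c p)"
  proof (rule inj_onI)
    fix x y assume x: "x \<in> residue_set c p" and y: "y \<in> residue_set c p" and m: "x mod p = y mod p"
    have "p dvd x - y" using m by (simp add: mod_eq_dvd_iff)
    moreover have "4 dvd x - y"
    proof -
      have "4 dvd (x - c) - (y - c)" using x y by (intro dvd_diff[of 4 "x - c" "y - c"]) (auto simp: residue_set_def)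
      then show ?thesis by simp
    qed
    moreover have "coprime (2 ^ 2) p" using p by (simp only: coprime_power_left_iff) simp
    then have "coprime 4 p" by simp
    ultimately have "4 * p dvd x - y" by (simp add: divides_mult)
    moreover have "\<bar>x - y\<bar> < 4 * p" using x y by (auto simp: residue_set_def)
    moreover have "x - y \<noteq> 0 \<Longrightarrow> 4 * p dvd x - y \<Longrightarrow> \<bar>4 * p\<bar> \<le> \<bar>x - y\<bar>" by (rule dvd_imp_le_int)
    ultimately have "x - y = 0" using p(1) by linarith
    then show "x = y" by simp
  qed
  have "card ((\<lambda>b. b mod p) ` residue_set c p) = nat p" using residue_set[OF p(1)] card_image[OF inj] by simp
  moreover have "(\<lambda>b. b mod p) ` residue_set c p \<subseteq> {0..<p}" using p by auto
  ultimately have im: "(\<lambda>b. b mod p) ` residue_set c p = {0..<p}" by (intro card_subset_eq) auto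
  have "(\<lambda>b. b mod p) ` {b \<in> residue_set c p. b mod p \<in> S} = S" using im S by auto
  moreover have "inj_on (\<lambda>b. b mod p) {b \<in> residue_set c p. b mod p \<in> S}" using inj by (rule inj_on_subset) auto
  ultimately show ?thesis by (metis card_image)
qed

text \<open>Types 3 and 4 of the image of \<open>(1, 1)\<close> require values of \<open>b\<close>
  that differ by 2 modulo 4.\<close>

definition shift :: "nat \<Rightarrow> int" where "shift k = (if k = 3 then 0 else 2)"

lemma upper_reps_eq:
  assumes "odd N" "N > 0" "k = 3 \<or> k = 4"
  shows "upper_reps k N = (\<Union>d\<in>{d. d > 0 \<and> d dvd N}. (\<lambda>b. (N div d, b, 0, d)) ` residue_set (d - N div d + shift k) d)"
proof -
  have key: "cls 1 2 k (a, b, 0, d) \<longleftrightarrow> 4 dvd b - (d - a + shift k)" if "odd a" "odd d" for a b d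
  proof -
    have "even b \<and> 4 dvd a + b - d \<longleftrightarrow> 4 dvd b - (d - a)" using that by presburger
    moreover have "even b \<and> \<not> 4 dvd a + b - d \<longleftrightarrow> 4 dvd b - (d - a + 2)" using that by presburger
    ultimately show ?thesis using assms(3) that cls_iff(1,2)[of a b 0 d] by (auto simp: shift_def)
  qed
  show ?thesis
  proof (rule Set.set_eqI, rule iffI)
    fix R assume "R \<in> upper_reps k N"
    then obtain a b d where R: "R = (a, b, 0, d)" "a > 0" "d > 0" "a * d = N" "0 \<le> b" "b < 4 * d" "cls 1 2 k (a, b, 0, d)"
      by (auto simp: upper_reps_def)
    have "odd a" "odd d" using R(4) assms(1) by auto
    moreover have "a = N div d" using R by auto
    ultimately have "b \<in> residue_set (d - N div d + shift k) d" using key R by (simp add: residue_set_def)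
    then show "R \<in> (\<Union>d\<in>{d. d > 0 \<and> d dvd N}. (\<lambda>b. (N div d, b, 0, d)) ` residue_set (d - N div d + shift k) d)"
      using R(1,3,4) \<open>a = N div d\<close> by (intro UN_I[of d] CollectI conjI) (auto intro: dvdI[of _ _ a] simp: mult.commute)
  next
    fix R :: imat assume "R \<in> (\<Union>d\<in>{d. d > 0 \<and> d dvd N}. (\<lambda>b. (N div d, b, 0, d)) ` residue_set (d - N div d + shift k) d)"
    then obtain d b where d: "d > 0" "d dvd N" "b \<in> residue_set (d - N div d + shift k) d" "R = (N div d, b, 0, d)" by auto
    have N: "N div d * d = N" using d by simp
    then have "odd (N div d)" "odd d" using assms(1) by (metis even_mult_iff)+
    moreover have "N div d > 0" using d assms(2) N by (metis zero_less_mult_pos2)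
    ultimately show "R \<in> upper_reps k N" using d N key by (auto simp: upper_reps_def residue_set_def)
  qed
qed

lemma upper_reps_card:
  assumes "odd N" "N > 0" "k = 3 \<or> k = 4"
  shows "finite (upper_reps k N)" "card (upper_reps k N) = (\<Sum>d | d > 0 \<and> d dvd N. nat d)"
proof -
  have fin: "finite {d. d > 0 \<and> d dvd N}"
    by (rule finite_subset[OF _ finite_divisors_int[of N]]) (use assms in auto)
  let ?f = "\<lambda>d. (\<lambda>b. (N div d, b, 0 :: int, d)) ` residue_set (d - N div d + shift k) d"
  show "finite (upper_reps k N)" unfolding upper_reps_eq[OF assms] using fin residue_set by auto
  have "card (upper_reps k N) = (\<Sum>d | d > 0 \<and> d dvd N. card (?f d))"
    unfolding upper_reps_eq[OF assms] by (rule card_UN_disjoint) (use fin residue_set in auto)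
  also have "\<dots> = (\<Sum>d | d > 0 \<and> d dvd N. nat d)"
  proof (rule sum.cong[OF refl])
    fix d assume "d \<in> {d. d > 0 \<and> d dvd N}"
    then have "d > 0" by simp
    moreover have "card (?f d) = card (residue_set (d - N div d + shift k) d)"
      by (rule card_image) (auto simp: inj_on_def)
    ultimately show "card (?f d) = nat d" by (simp only: residue_set(2))
  qed
  finally show "card (upper_reps k N) = (\<Sum>d | d > 0 \<and> d dvd N. nat d)" .
qed

text \<open>The quarter turn exchanges \<open>(1, 0)\<close> with \<open>(0, 1)\<close> and
  \<open>(1, 1)\<close> with \<open>(1, - 1)\<close>, up to sign. It normalises the group and
  carries the classes \<open>2 1 k\<close> to the classes \<open>1 2 (7 - k)\<close>, for which
  upper triangular representatives exist.\<close>

abbreviation "w0 \<equiv> (0 :: int, 1 :: int, - 1 :: int, 0 :: int)"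
abbreviation "w0i \<equiv> (0 :: int, - 1 :: int, 1 :: int, 0 :: int)"

lemma w0_w0i: "mmul w0 (mmul w0i Y) = Y" "mmul w0i (mmul w0 Y) = Y" by (cases Y; simp)+

lemma inW_conj: assumes "inW g" shows "inW (mmul w0i (mmul g w0))" "inW (mmul w0 (mmul g w0i))"
proof -
  obtain a b c d where g: "g = (a, b, c, d)" by (cases g)
  have h: "\<bar>a * d - b * c\<bar> = 1" "odd a" "even b" "even c" "odd d" "4 dvd a + b - c - d" using assms by (auto simp: g inW_iff)
  have "4 dvd d - c - (- b) - a" using h(2-6) by presburger
  moreover have "d * a - (- c) * (- b) = a * d - b * c" by simp
  ultimately show "inW (mmul w0i (mmul g w0))" "inW (mmul w0 (mmul g w0i))"
    using h by (simp_all add: g inW_iff algebra_simps)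
qed

lemma cls_w0:
  assumes "k = 3 \<or> k = 4"
  shows "cls 2 1 k Y \<longleftrightarrow> cls 1 2 (7 - k) (mmul w0 Y)"
proof -
  obtain a b c d where Y: "Y = (a, b, c, d)" by (cases Y)
  have key: "4 dvd c + d - - a - - b \<longleftrightarrow> \<not> 4 dvd a + b - c - d" if "even a" "odd b" "odd c" "even d"
    using that by presburger
  have mm: "mmul w0 Y = (c, d, - a, - b)" by (simp add: Y)
  show ?thesis using assms
  proof
    assume k: "k = 3"
    have k4: "7 - k = 4" by (simp add: k)
    show ?thesis unfolding k4 unfolding mm k unfolding Y cls_iff even_minus using key by blast
  next
    assume k: "k = 4"
    have k3: "7 - k = 3" by (simp add: k)
    show ?thesis unfolding k3 unfolding mm k unfolding Y cls_iff even_minus using key by blast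
  qed
qed

lemma card_fixers_upper:
  assumes "N > 0" "odd N" "k = 3 \<or> k = 4"
  shows "card (fixers 1 2 k N) = 2 * card {R \<in> upper_reps k N. good_coset N R}"
    and "finite (fixers 1 2 k N)"
proof -
  have R: "cls 1 2 k R \<and> \<bar>mdet R\<bar> = N" if "R \<in> upper_reps k N" for R
    using that by (auto simp: upper_reps_def)
  note c = card_fixers[OF assms(1) upper_reps_card(1)[OF assms(2,1,3)], of 1 2 k]
  show "card (fixers 1 2 k N) = 2 * card {R \<in> upper_reps k N. good_coset N R}"
    by (rule c(2)) (use upper_rep_exists[OF assms(1)] upper_rep_unique R in blast)+
  show "finite (fixers 1 2 k N)"
    by (rule c(1)) (use upper_rep_exists[OF assms(1)] upper_rep_unique R in blast)+
qed

lemma card_fixers_lower: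
  assumes "N > 0" "odd N" "k = 3 \<or> k = 4"
  shows "card (fixers 2 1 k N) = 2 * card {R \<in> upper_reps (7 - k) N. good_coset N (mmul w0i R)}"
    and "finite (fixers 2 1 k N)"
proof -
  have k7: "7 - k = 3 \<or> 7 - k = 4" using assms(3) by auto
  let ?\<R> = "mmul w0i ` upper_reps (7 - k) N"
  have inj: "inj_on (mmul w0i) A" for A by (metis inj_onI w0_w0i(1))
  have fin: "finite ?\<R>" using upper_reps_card(1)[OF assms(2,1) k7] by blast
  have ex: "\<exists>R\<in>?\<R>. \<exists>g. inW g \<and> Y = mmul g R" if Y: "cls 2 1 k Y" "\<bar>mdet Y\<bar> = N" for Y
  proof -
    have "cls 1 2 (7 - k) (mmul w0 Y)" "\<bar>mdet (mmul w0 Y)\<bar> = N" using Y cls_w0[OF assms(3)] by (auto simp: mdet_mmul)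
    then obtain R g where R: "R \<in> upper_reps (7 - k) N" "inW g" "mmul w0 Y = mmul g R"
      using upper_rep_exists[OF assms(1)] by blast
    have "Y = mmul w0i (mmul g R)" using R(3) w0_w0i(2)[of Y] by simp
    also have "\<dots> = mmul (mmul w0i (mmul g w0)) (mmul w0i R)" by (simp only: mmul_assoc w0_w0i)
    finally show ?thesis using inW_conj(1)[OF R(2)] R(1) by blast
  qed
  have un: "R = R'" if R: "R \<in> ?\<R>" "R' \<in> ?\<R>" "inW g" "R = mmul g R'" for R R' g
  proof -
    obtain P P' where P: "P \<in> upper_reps (7 - k) N" "P' \<in> upper_reps (7 - k) N" "R = mmul w0i P" "R' = mmul w0i P'"
      using R by blast
    have "P = mmul w0 (mmul g (mmul w0i P'))" using R(4) P(3,4) w0_w0i(1)[of P] by simp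
    also have "\<dots> = mmul (mmul w0 (mmul g w0i)) P'" by (simp only: mmul_assoc)
    finally have "P = P'" using upper_rep_unique[OF P(1,2) inW_conj(2)[OF R(3)]] by blast
    then show ?thesis using P by simp
  qed
  have cl: "cls 2 1 k R \<and> \<bar>mdet R\<bar> = N" if R: "R \<in> ?\<R>" for R
  proof -
    obtain P where P: "P \<in> upper_reps (7 - k) N" "R = mmul w0i P" using R by blast
    have "cls 1 2 (7 - k) P" "\<bar>mdet P\<bar> = N" using P(1) by (auto simp: upper_reps_def)
    then show ?thesis using cls_w0[OF assms(3), of R] by (simp add: P(2) w0_w0i mdet_mmul)
  qed
  have "card (fixers 2 1 k N) = 2 * card {R \<in> ?\<R>. good_coset N R}"
    by (rule card_fixers(2)[OF assms(1) fin ex un cl])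
  also have "{R \<in> ?\<R>. good_coset N R} = mmul w0i ` {R \<in> upper_reps (7 - k) N. good_coset N (mmul w0i R)}" by blast
  also have "card \<dots> = card {R \<in> upper_reps (7 - k) N. good_coset N (mmul w0i R)}" by (rule card_image[OF inj])
  finally show "card (fixers 2 1 k N) = 2 * card {R \<in> upper_reps (7 - k) N. good_coset N (mmul w0i R)}" .
  show "finite (fixers 2 1 k N)" by (rule card_fixers(1)[OF assms(1) fin ex un cl])
qed

text \<open>In the class \<open>2 1 4\<close> no vertex keeps its type, so there are no attracting
  vertices and all cosets are good, for composite \<open>N\<close> as well.\<close>

lemma card_fixers_swap:
  assumes "N > 0" "odd N"
  shows "card (fixers 2 1 4 N) = 2 * (\<Sum>d | d > 0 \<and> d dvd N. nat d)"
proof -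
  have "good_coset N (mmul w0i R)" if R: "R \<in> upper_reps 3 N" for R
  proof -
    have c: "cls 2 1 4 (mmul w0i R)" and d: "\<bar>mdet (mmul w0i R)\<bar> = N"
      using R cls_w0[of 4 "mmul w0i R"] by (auto simp: w0_w0i mdet_mmul upper_reps_def)
    have ne: "vt (mvec (mmul w0i R) w) \<noteq> vt w" if "w \<in> verts" for w
      using that c cls_fourth[OF c] unfolding verts_def cls_def by (elim insertE emptyE) auto
    show ?thesis
      using good_coset_iff[OF assms d cls_nonzero[OF c]] ne unfolding bad_coset_def by blast
  qed
  then have "{R \<in> upper_reps 3 N. good_coset N (mmul w0i R)} = upper_reps 3 N" by blast
  then show ?thesis using card_fixers_lower(1)[OF assms, of 4] upper_reps_card(2)[OF assms(2,1), of 3] by simp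
qed

lemma upper_reps_prime:
  assumes "prime p" "odd p" "k = 3 \<or> k = 4"
  shows "upper_reps k p = (\<lambda>b. (p, b, 0, 1)) ` residue_set (1 - p + shift k) 1 \<union>
      (\<lambda>b. (1, b, 0, p)) ` residue_set (p - 1 + shift k) p"
proof -
  have p: "p > 1" using assms(1) by (rule prime_gt_1_int)
  have "x = 1 \<or> x = p" if "x > 0" "x dvd p" for x
    using assms(1) that unfolding prime_int_iff by (meson less_imp_le)
  then have "{d. d > 0 \<and> d dvd p} = {1, p}" using p by auto
  then show ?thesis using upper_reps_eq[OF assms(2) _ assms(3)] p by simp
qed

text \<open>For a prime there is a single representative with \<open>d = 1\<close>, and for
  \<open>d = p\<close> the entry \<open>b\<close> runs once through the residues modulo
  \<open>p\<close>. A condition \<open>P\<close> of the given kind can thus be counted residue by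
  residue.\<close>

lemma card_prime_reps:
  fixes p :: int
  assumes p: "prime p" "odd p" "k = 3 \<or> k = 4" and S: "S \<subseteq> {0..<p}"
    and P1: "\<And>b. P (p, b, 0, 1) \<longleftrightarrow> Q" and P2: "\<And>b. P (1, b, 0, p) \<longleftrightarrow> b mod p \<in> S"
  shows "card {R \<in> upper_reps k p. P R} = (if Q then 1 else 0) + card S"
proof -
  have p1: "p > 1" using p(1) by (rule prime_gt_1_int)
  let ?A = "if Q then (\<lambda>b. (p, b, 0 :: int, 1 :: int)) ` residue_set (1 - p + shift k) 1 else {}"
  let ?B = "(\<lambda>b. (1 :: int, b, 0 :: int, p)) ` {b \<in> residue_set (p - 1 + shift k) p. b mod p \<in> S}"
  have "{R \<in> upper_reps k p. P R} = ?A \<union> ?B" unfolding upper_reps_prime[OF p] using P1 P2 by auto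
  moreover have "?A \<inter> ?B = {}" using p1 by auto
  moreover have "finite ?A" "finite ?B" using residue_set(1)[of 1] residue_set(1)[of p] p1 by auto
  moreover have "card ?A = (if Q then 1 else 0)"
    using residue_set(2)[of 1] by (simp add: card_image inj_on_def)
  moreover have "card ?B = card {b \<in> residue_set (p - 1 + shift k) p. b mod p \<in> S}"
    by (rule card_image) (auto simp: inj_on_def)
  moreover have "\<dots> = card S" using residue_set_mod[OF _ p(2) S] p1 by simp
  ultimately show ?thesis by (simp add: card_Un_disjoint)
qed

lemma mod_prime_cases:
  fixes p b :: int
  assumes "p > 2"
  shows "p dvd 1 + b \<longleftrightarrow> b mod p = p - 1" "p dvd 1 - b \<longleftrightarrow> b mod p = 1" "p dvd b \<longleftrightarrow> b mod p = 0"
proof -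
  have "p dvd 1 + b \<longleftrightarrow> b mod p = (- 1) mod p" by (simp add: mod_eq_dvd_iff add.commute)
  moreover have "(- 1) mod p = p - 1" using assms by (simp add: zmod_minus1)
  ultimately show "p dvd 1 + b \<longleftrightarrow> b mod p = p - 1" by simp
  have "p dvd 1 - b \<longleftrightarrow> 1 mod p = b mod p" by (simp add: mod_eq_dvd_iff)
  then show "p dvd 1 - b \<longleftrightarrow> b mod p = 1" using assms by (auto simp: mod_pos_pos_trivial)
  show "p dvd b \<longleftrightarrow> b mod p = 0" by (simp add: dvd_eq_mod_eq_0)
qed

text \<open>Of the \<open>p + 1\<close> cosets each vertex that keeps its type spoils exactly one:
  two vertices in \<open>2 1 3\<close>, all four in \<open>1 2 3\<close>, two in
  \<open>1 2 4\<close>. The vertex \<open>(1, 0)\<close> spoils the coset with \<open>d = 1\<close>;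
  the others belong to the residues 0, 1 and \<open>p - 1\<close> of \<open>b\<close>.\<close>

lemma card_fixers_prime:
  fixes p :: int
  assumes "prime p" "odd p"
  shows "card (fixers 2 1 3 p) = 2 * (nat p - 1)"
    "card (fixers 1 2 3 p) = 2 * (nat p - 3)"
    "card (fixers 1 2 4 p) = 2 * (nat p - 1)"
proof -
  have p1: "p > 1" using assms(1) by (rule prime_gt_1_int)
  then have p2: "p > 2" using assms(2) by (cases "p = 2") auto
  have p3: "p \<ge> 3" using p2 by simp
  have np: "\<not> p dvd 1" using p1 by (auto dest: zdvd_imp_le)
  note mc = mod_prime_cases[OF p2]
  let ?U = "{0..<p}"
  have inU: "b mod p \<in> ?U" for b using p1 by simp
  have pp: "p dvd p" by simp
  have bad: "bad_coset p (mmul w0i (a, b, 0, d)) \<longleftrightarrow> p dvd d \<and> (p dvd a + b \<or> p dvd a - b)"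
    if R: "(a, b, 0, d) \<in> upper_reps 4 p" for a b d
  proof -
    have c: "cls 2 1 3 (mmul w0i (a, b, 0, d))"
      using R cls_w0[of 3 "mmul w0i (a, b, 0, d)"] by (auto simp: upper_reps_def)
    have t: "vt (mvec (mmul w0i (a, b, 0, d)) (1, 0)) = 2" "vt (mvec (mmul w0i (a, b, 0, d)) (0, 1)) = 1"
      "vt (mvec (mmul w0i (a, b, 0, d)) (1, 1)) = 3" "vt (mvec (mmul w0i (a, b, 0, d)) (1, - 1)) = 4"
      using c cls_fourth[OF c] unfolding cls_def by auto
    show ?thesis unfolding bad_coset_def verts_def using t by (simp del: vt.simps) (auto simp: dvd_diff_commute)
  qed
  have g1: "good_coset p (mmul w0i R) \<longleftrightarrow> \<not> bad_coset p (mmul w0i R)" if R: "R \<in> upper_reps 4 p" for R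
  proof (rule good_coset_iff)
    have c: "cls 2 1 3 (mmul w0i R)" using R cls_w0[of 3 "mmul w0i R"] by (auto simp: w0_w0i upper_reps_def)
    show "vt (mvec (mmul w0i R) w) \<noteq> 0" if "w \<in> verts" for w using cls_nonzero[OF c _ _ that] by simp
    show "\<bar>mdet (mmul w0i R)\<bar> = p" using R by (auto simp: mdet_mmul upper_reps_def)
  qed (use p1 assms in auto)
  have "card (fixers 2 1 3 p) = 2 * card {R \<in> upper_reps 4 p. good_coset p (mmul w0i R)}"
    using card_fixers_lower(1)[of p 3] p1 assms by simp
  also have "{R \<in> upper_reps 4 p. good_coset p (mmul w0i R)} =
      {R \<in> upper_reps 4 p. case R of (a, b, c, d) \<Rightarrow> \<not> (p dvd d \<and> (p dvd a + b \<or> p dvd a - b))}"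
    using g1 bad by (auto simp: upper_reps_def)
  also have "card \<dots> = (if True then 1 else 0) + card (?U - {1, p - 1})"
  proof (rule card_prime_reps)
    show "(case (p, b, 0, 1) of (a, b, c, d) \<Rightarrow> \<not> (p dvd d \<and> (p dvd a + b \<or> p dvd a - b))) \<longleftrightarrow> True" for b unfolding prod.case using np pp by blast
    show "(case (1, b, 0, p) of (a, b, c, d) \<Rightarrow> \<not> (p dvd d \<and> (p dvd a + b \<or> p dvd a - b))) \<longleftrightarrow> b mod p \<in> ?U - {1, p - 1}" for b
      unfolding prod.case mc(1)[of b] mc(2)[of b] mc(3)[of b] Diff_iff insert_iff empty_iff using inU[of b] np pp by argo
  qed (use assms in auto)
  also have "card (?U - {1, p - 1}) = nat p - 2"
    using p3 by (subst card_Diff_subset) auto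
  finally show "card (fixers 2 1 3 p) = 2 * (nat p - 1)" using p3 by simp
  have gI: "good_coset p R \<longleftrightarrow> \<not> bad_coset p R" if R: "R \<in> upper_reps k p" and k: "k = 3 \<or> k = 4" for R k
  proof (rule good_coset_iff)
    have c: "cls 1 2 k R" using R by (auto simp: upper_reps_def)
    show "vt (mvec R w) \<noteq> 0" if "w \<in> verts" for w using cls_nonzero[OF c _ k that] by simp
    show "\<bar>mdet R\<bar> = p" using R by (auto simp: upper_reps_def)
  qed (use p1 assms in auto)
  have bad3: "bad_coset p (a, b, 0, d) \<longleftrightarrow> p dvd a \<or> p dvd d \<and> (p dvd b \<or> p dvd a + b \<or> p dvd a - b)"
    if R: "(a, b, 0, d) \<in> upper_reps 3 p" for a b d
  proof -
    have c: "cls 1 2 3 (a, b, 0, d)" using R by (auto simp: upper_reps_def)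
    have t: "vt (mvec (a, b, 0, d) (1, 0)) = 1" "vt (mvec (a, b, 0, d) (0, 1)) = 2"
      "vt (mvec (a, b, 0, d) (1, 1)) = 3" "vt (mvec (a, b, 0, d) (1, - 1)) = 4"
      using c cls_fourth[OF c] unfolding cls_def by auto
    show ?thesis unfolding bad_coset_def verts_def using t by (simp del: vt.simps) auto
  qed
  have bad4: "bad_coset p (a, b, 0, d) \<longleftrightarrow> p dvd a \<or> p dvd d \<and> p dvd b"
    if R: "(a, b, 0, d) \<in> upper_reps 4 p" for a b d
  proof -
    have c: "cls 1 2 4 (a, b, 0, d)" using R by (auto simp: upper_reps_def)
    have t: "vt (mvec (a, b, 0, d) (1, 0)) = 1" "vt (mvec (a, b, 0, d) (0, 1)) = 2"
      "vt (mvec (a, b, 0, d) (1, 1)) = 4" "vt (mvec (a, b, 0, d) (1, - 1)) = 3"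
      using c cls_fourth[OF c] unfolding cls_def by auto
    show ?thesis unfolding bad_coset_def verts_def using t by (simp del: vt.simps) auto
  qed
  have "card (fixers 1 2 3 p) = 2 * card {R \<in> upper_reps 3 p. good_coset p R}"
    using card_fixers_upper(1)[of p 3] p1 assms by simp
  also have "{R \<in> upper_reps 3 p. good_coset p R} =
      {R \<in> upper_reps 3 p. case R of (a, b, c, d) \<Rightarrow> \<not> (p dvd a \<or> p dvd d \<and> (p dvd b \<or> p dvd a + b \<or> p dvd a - b))}"
    using gI[of _ 3] bad3 by (auto simp: upper_reps_def)
  also have "card \<dots> = (if False then 1 else 0) + card (?U - {0, 1, p - 1})"
  proof (rule card_prime_reps)
    show "(case (p, b, 0, 1) of (a, b, c, d) \<Rightarrow> \<not> (p dvd a \<or> p dvd d \<and> (p dvd b \<or> p dvd a + b \<or> p dvd a - b))) \<longleftrightarrow> False" for b unfolding prod.case using np pp by blast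
    show "(case (1, b, 0, p) of (a, b, c, d) \<Rightarrow> \<not> (p dvd a \<or> p dvd d \<and> (p dvd b \<or> p dvd a + b \<or> p dvd a - b))) \<longleftrightarrow> b mod p \<in> ?U - {0, 1, p - 1}" for b
      unfolding prod.case mc(1)[of b] mc(2)[of b] mc(3)[of b] Diff_iff insert_iff empty_iff using inU[of b] np pp by argo
  qed (use assms in auto)
  also have "card (?U - {0, 1, p - 1}) = nat p - 3"
    using p3 by (subst card_Diff_subset) auto
  finally show "card (fixers 1 2 3 p) = 2 * (nat p - 3)" by simp
  have "card (fixers 1 2 4 p) = 2 * card {R \<in> upper_reps 4 p. good_coset p R}"
    using card_fixers_upper(1)[of p 4] p1 assms by simp
  also have "{R \<in> upper_reps 4 p. good_coset p R} =
      {R \<in> upper_reps 4 p. case R of (a, b, c, d) \<Rightarrow> \<not> (p dvd a \<or> p dvd d \<and> p dvd b)}"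
    using gI[of _ 4] bad4 by (auto simp: upper_reps_def)
  also have "card \<dots> = (if False then 1 else 0) + card (?U - {0})"
  proof (rule card_prime_reps)
    show "(case (p, b, 0, 1) of (a, b, c, d) \<Rightarrow> \<not> (p dvd a \<or> p dvd d \<and> p dvd b)) \<longleftrightarrow> False" for b unfolding prod.case using np pp by blast
    show "(case (1, b, 0, p) of (a, b, c, d) \<Rightarrow> \<not> (p dvd a \<or> p dvd d \<and> p dvd b)) \<longleftrightarrow> b mod p \<in> ?U - {0}" for b
      unfolding prod.case mc(1)[of b] mc(2)[of b] mc(3)[of b] Diff_iff insert_iff empty_iff using inU[of b] np pp by argo
  qed (use assms in auto)
  also have "card (?U - {0}) = nat p - 1"
    using p3 by (subst card_Diff_subset) auto
  finally show "card (fixers 1 2 4 p) = 2 * (nat p - 1)" by simp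
qed

section \<open>From matrices with a fixed point to weighted triples\<close>

text \<open>The numbers are the values of \<open>lf\<close> at the vertices, related because the
  cusps of \<open>(1, 1)\<close> and \<open>(1, - 1)\<close> add up to twice the sum of the other
  two. The products belong to the sides. The relation excludes that \<open>f1, f2\<close> have one
  sign and \<open>f3, f4\<close> the other, so an axis that separates vertices crosses exactly two
  sides.\<close>

lemma sign_changes:
  fixes f1 f2 f3 f4 :: int
  assumes "f3 + f4 = 2 * (f1 + f2)" "f1 \<noteq> 0" "f2 \<noteq> 0" "f3 \<noteq> 0" "f4 \<noteq> 0"
  shows "(if f2 * f3 < 0 then 1 else 0) + (if f2 * f4 < 0 then 1 else 0) + (if f1 * f3 < 0 then 1 else 0)
      + (if f1 * f4 < 0 then 1 else 0) =
    (if (f1 > 0 \<or> f2 > 0 \<or> f3 > 0 \<or> f4 > 0) \<and> (f1 < 0 \<or> f2 < 0 \<or> f3 < 0 \<or> f4 < 0) then 2 else (0 :: nat))"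
  using assms
  by (cases "f1 > 0"; cases "f2 > 0"; cases "f3 > 0"; cases "f4 > 0") (simp_all add: mult_less_0_iff not_less)

definition pos_fixers :: "nat \<Rightarrow> nat \<Rightarrow> nat \<Rightarrow> int \<Rightarrow> imat set" where
  "pos_fixers i j k N = {(a, b, c, d). cls i j k (a, b, c, d) \<and> a * d - b * c = N \<and> b * c < 0
     \<and> \<bar>a - d\<bar> < 2 * \<bar>b\<bar> \<and> \<bar>a - d\<bar> < 2 * \<bar>c\<bar>}"

text \<open>The limiting case of \<open>pos_fixers\<close>: positive determinant with the fixed
  point on exactly one side of the tile.\<close>

definition wall_fixers :: "nat \<Rightarrow> nat \<Rightarrow> nat \<Rightarrow> int \<Rightarrow> imat set" where
  "wall_fixers i j k N = {(a, b, c, d). cls i j k (a, b, c, d) \<and> a * d - b * c = N \<and> b * c < 0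
     \<and> (\<bar>a - d\<bar> = 2 * \<bar>b\<bar> \<and> \<bar>b\<bar> < \<bar>c\<bar> \<or> \<bar>a - d\<bar> = 2 * \<bar>c\<bar> \<and> \<bar>c\<bar> < \<bar>b\<bar>)}"

text \<open>Reflections whose axis crosses the tile: the four quantities are the values of
  \<open>lf\<close> at the vertices, and both signs must occur.\<close>

definition neg_fixers :: "nat \<Rightarrow> nat \<Rightarrow> nat \<Rightarrow> int \<Rightarrow> imat set" where
  "neg_fixers i j k N = {(a, b, c, d). cls i j k (a, b, c, d) \<and> d = - a \<and> a * d - b * c = - N
     \<and> (c > 0 \<or> b < 0 \<or> c - b - 2 * a > 0 \<or> c - b + 2 * a > 0)
     \<and> (c < 0 \<or> b > 0 \<or> c - b - 2 * a < 0 \<or> c - b + 2 * a < 0)}"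

text \<open>Holds unless some matrix of the class fixes a vertex of the tile.\<close>

definition nondeg :: "nat \<Rightarrow> nat \<Rightarrow> nat \<Rightarrow> int \<Rightarrow> bool" where
  "nondeg i j k N \<longleftrightarrow> (\<forall>a b c. cls i j k (a, b, c, - a) \<longrightarrow> a * a + b * c = N \<longrightarrow>
       b \<noteq> 0 \<and> c \<noteq> 0 \<and> c - b - 2 * a \<noteq> 0 \<and> c - b + 2 * a \<noteq> 0) \<and>
     (\<forall>a c. \<not> (cls i j k (a, 0, c, a) \<and> a * a = N)) \<and>
     (\<forall>a b c d. cls i j k (a, b, c, d) \<longrightarrow> a * d - b * c = N \<longrightarrow> b * c < 0 \<longrightarrow> \<bar>a - d\<bar> = 2 * \<bar>b\<bar> \<longrightarrow> \<bar>b\<bar> \<noteq> \<bar>c\<bar>)"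

lemma fixers_split:
  assumes N: "N > 0" and nd: "nondeg i j k N"
  shows "fixers i j k N = pos_fixers i j k N \<union> neg_fixers i j k N"
proof (rule Set.set_eqI)
  fix Y :: imat
  obtain a b c d where Y: "Y = (a, b, c, d)" by (cases Y)
  have P: "Y \<in> fixers i j k N \<longleftrightarrow> Y \<in> pos_fixers i j k N" if det: "a * d - b * c = N"
  proof (cases "b = 0")
    case False
    show ?thesis using fixed_form_pos_det[OF N det False] det N by (simp add: Y fixers_def pos_fixers_def)
  next
    case True
    have "Y \<notin> fixers i j k N"
    proof
      assume "Y \<in> fixers i j k N"
      then obtain T where c: "cls i j k (a, b, c, d)" and T: "inCi T" "act (a, b, c, d) T = of_int N *\<^sub>R T"
        unfolding fixers_def Y by auto
      obtain p r q where Ts: "T = (p, r, q)" by (cases T)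
      have p: "p > 0" using T(1) by (auto simp: Ts)
      have "of_int N * (a * p) = of_int N * (d * p)"
        using fixed_form_equations(1)[OF T(2)[unfolded Ts], unfolded det] True by simp
      then have "real_of_int a = d" using N p by simp
      then have "a = d" by simp
      then show False using nd c det True unfolding nondeg_def by auto
    qed
    then show ?thesis using True by (simp add: Y pos_fixers_def)
  qed
  have M: "Y \<in> fixers i j k N \<longleftrightarrow> Y \<in> neg_fixers i j k N" if det: "a * d - b * c = - N"
  proof -
    let ?mix = "\<exists>w\<in>verts. \<exists>w'\<in>verts. lf Y (cusp w) > 0 \<and> lf Y (cusp w') < 0"
    have lfv: "lf Y (cusp (1, 0)) = of_int c" "lf Y (cusp (0, 1)) = of_int (- b)"
      "lf Y (cusp (1, 1)) = of_int (c - b - a + d)" "lf Y (cusp (1, - 1)) = of_int (c - b + a - d)"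
      unfolding lf_cusp by (simp_all add: Y)
    have mix: "?mix \<longleftrightarrow> (c > 0 \<or> b < 0 \<or> c - b - a + d > 0 \<or> c - b + a - d > 0)
       \<and> (c < 0 \<or> b > 0 \<or> c - b - a + d < 0 \<or> c - b + a - d < 0)"
    proof -
      have "?mix \<longleftrightarrow> (\<exists>w\<in>verts. lf Y (cusp w) > 0) \<and> (\<exists>w\<in>verts. lf Y (cusp w) < 0)" by blast
      then show ?thesis unfolding verts_def bex_simps lfv of_int_0_less_iff of_int_less_0_iff by auto
    qed
    show ?thesis
    proof
      assume "Y \<in> fixers i j k N"
      then obtain T where c: "cls i j k Y" and T: "inCi T" "act Y T = of_int N *\<^sub>R T"
        unfolding fixers_def by blast
      have mdY: "mdet (a, b, c, d) = - N" using det by simp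
      have d: "d = - a" and l0: "lf Y T = 0"
        using fixed_form_neg_det[OF N mdY T(2)[unfolded Y] inCi_inC[OF T(1)] inCi_fQ[OF T(1)]] by (auto simp: Y)
      have "a * a + b * c = N" using det d by simp
      then have nz: "b \<noteq> 0 \<and> c \<noteq> 0 \<and> c - b - 2 * a \<noteq> 0 \<and> c - b + 2 * a \<noteq> 0"
        using nd c unfolding nondeg_def Y d by blast
      then have "\<forall>w\<in>verts. lf Y (cusp w) \<noteq> 0" using lfv d by (auto simp: verts_def simp del: cusp.simps lf.simps)
      from interior_mixed_signs[OF inCi_inC[OF T(1)] inCi_fQ[OF T(1)] l0 this]
      show "Y \<in> neg_fixers i j k N" using c det d unfolding mix by (simp add: neg_fixers_def Y add.commute)
    next
      assume n: "Y \<in> neg_fixers i j k N"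
      then have d: "d = - a" and c: "cls i j k Y" by (auto simp: neg_fixers_def Y)
      have ?mix unfolding mix using n by (simp add: neg_fixers_def Y add.commute)
      then obtain T where T: "inCi T" "lf Y T = 0" using mixed_signs_interior by blast
      have "mdet (a, b, c, - a) = - N" using det d by simp
      from fixed_form_trace_zero[OF this, of T] T(2) have "act Y T = of_int N *\<^sub>R T" unfolding Y d by blast
      moreover have "\<bar>mdet Y\<bar> = N" using det N by (simp add: Y)
      ultimately show "Y \<in> fixers i j k N" using c T(1) unfolding fixers_def by blast
    qed
  qed
  have O: "Y \<notin> fixers i j k N \<and> Y \<notin> pos_fixers i j k N \<and> Y \<notin> neg_fixers i j k N" if "a * d - b * c \<noteq> N" "a * d - b * c \<noteq> - N"
    using that N by (auto simp: Y fixers_def pos_fixers_def neg_fixers_def abs_if split: if_splits)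
  have D: "Y \<in> pos_fixers i j k N \<Longrightarrow> a * d - b * c = N" "Y \<in> neg_fixers i j k N \<Longrightarrow> a * d - b * c = - N"
    by (auto simp: Y pos_fixers_def neg_fixers_def)
  show "Y \<in> fixers i j k N \<longleftrightarrow> Y \<in> pos_fixers i j k N \<union> neg_fixers i j k N"
  proof (cases "a * d - b * c = N")
    case True
    then have "Y \<notin> neg_fixers i j k N" using D(2) N by linarith
    then show ?thesis using P[OF True] by blast
  next
    case False
    then have "Y \<notin> pos_fixers i j k N" using D(1) by blast
    then show ?thesis using M O[OF False] by blast
  qed
qed

text \<open>A trace zero matrix of determinant \<open>- N\<close> fixes a geodesic, which leaves the tile through two
  walls; composing with the reflections in these walls yields fixed points on the walls.\<close>

lemma card_neg_fixers:
  assumes N: "N > 0" and nd: "nondeg i j k N" and fin: "finite (neg_fixers i j k N)"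
  shows "2 * card (neg_fixers i j k N) = card (wall_fixers i j k N)" "finite (wall_fixers i j k N)"
proof -
  let ?M = "neg_fixers i j k N"
  \<comment> \<open>\<open>X l\<close> says that the axis separates the two ends of wall
    \<open>l\<close>; \<open>Wl l\<close> collects the matrices of determinant \<open>N\<close> with
    fixed point on that wall. Multiplication by the reflection in wall \<open>l\<close> exchanges
    the two.\<close>
  define X where "X l = (\<lambda>(a, b, c, d :: int). if l = 0 then (- b) * (c - b - 2 * a) < 0 else if l = 1 then (- b) * (c - b + 2 * a) < 0
     else if l = 2 then c * (c - b - 2 * a) < 0 else c * (c - b + 2 * a) < (0 :: int))" for l :: nat
  define Wl where "Wl l = {(a, b, c, d). cls i j k (a, b, c, d) \<and> a * d - b * c = N \<and> b * c < 0 \<and>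
     (if l = 0 then a - d = - 2 * b \<and> \<bar>b\<bar> < \<bar>c\<bar> else if l = 1 then a - d = 2 * b \<and> \<bar>b\<bar> < \<bar>c\<bar>
     else if l = 2 then a - d = 2 * c \<and> \<bar>c\<bar> < \<bar>b\<bar> else a - d = - 2 * c \<and> \<bar>c\<bar> < \<bar>b\<bar>)}" for l :: nat
  have nz: "b \<noteq> 0 \<and> c \<noteq> 0 \<and> c - b - 2 * a \<noteq> 0 \<and> c - b + 2 * a \<noteq> 0"
    if "cls i j k (a, b, c, - a)" "a * a + b * c = N" for a b c using nd that unfolding nondeg_def by blast
  have two: "(\<Sum>l<4. if X l Z then 1 else 0 :: nat) = 2" if Z: "Z \<in> ?M" for Z
  proof -
    obtain a b c where Zs: "Z = (a, b, c, - a)" using Z by (auto simp: neg_fixers_def)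
    have "cls i j k (a, b, c, - a)" "a * a + b * c = N" using Z by (auto simp: neg_fixers_def Zs)
    note nz' = nz[OF this]
    have "(if - b * (c - b - 2 * a) < 0 then 1 else 0) + (if - b * (c - b + 2 * a) < 0 then 1 else 0)
      + (if c * (c - b - 2 * a) < 0 then 1 else 0) + (if c * (c - b + 2 * a) < 0 then 1 else 0) =
      (if (c > 0 \<or> - b > 0 \<or> c - b - 2 * a > 0 \<or> c - b + 2 * a > 0) \<and> (c < 0 \<or> - b < 0 \<or> c - b - 2 * a < 0 \<or> c - b + 2 * a < 0)
        then 2 else (0 :: nat))"
      using nz' by (intro sign_changes) auto
    also have "\<dots> = 2" using Z by (auto simp: neg_fixers_def Zs)
    moreover have "(\<Sum>l<4. g l) = g 0 + g 1 + g 2 + g 3" for g :: "nat \<Rightarrow> nat"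
      by (simp add: numeral_eq_Suc)
    ultimately show ?thesis by (simp add: X_def Zs)
  qed
  have bij: "bij_betw (mmul (refl_mat l)) {Z \<in> ?M. X l Z} (Wl l)" if "l < 4" for l
  proof -
    from that have l: "l = 0 \<or> l = 1 \<or> l = 2 \<or> l = 3" by auto
    have cl: "cls i j k (mmul (refl_mat l) Y) \<longleftrightarrow> cls i j k Y" for Y by (rule cls_inW[OF inW_refl])
    have 1: "mmul (refl_mat l) Z \<in> Wl l" if Z: "Z \<in> ?M" "X l Z" for Z
    proof -
      obtain a b c where Zs: "Z = (a, b, c, - a)" using Z by (auto simp: neg_fixers_def)
      have c: "cls i j k Z" and d: "a * a + b * c = N" using Z by (auto simp: neg_fixers_def Zs)
      note cc = cl[of Z] c
      show ?thesis using l
      proof (elim disjE)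
        assume l: "l = 0"
        have m: "mmul (refl_mat l) Z = (a, b, 2 * a - c, 2 * b + a)" by (simp add: l refl_mat_def Zs)
        have "b * (c - b - 2 * a) > 0" using Z(2) by (simp add: X_def Zs l)
        then have "b * (2 * a - c) < 0 \<and> \<bar>b\<bar> < \<bar>2 * a - c\<bar>" by (auto simp: zero_less_mult_iff mult_less_0_iff)
        moreover have "a * (2 * b + a) - b * (2 * a - c) = N" using d by (simp add: algebra_simps)
        ultimately show ?thesis using cc unfolding m by (simp add: Wl_def l)
      next
        assume l: "l = 1"
        have m: "mmul (refl_mat l) Z = (a, b, - 2 * a - c, - 2 * b + a)" by (simp add: l refl_mat_def Zs)
        have "b * (c - b + 2 * a) > 0" using Z(2) by (simp add: X_def Zs l)
        then have "b * (- 2 * a - c) < 0 \<and> \<bar>b\<bar> < \<bar>- 2 * a - c\<bar>" by (auto simp: zero_less_mult_iff mult_less_0_iff)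
        moreover have "a * (- 2 * b + a) - b * (- 2 * a - c) = N" using d by (simp add: algebra_simps)
        ultimately show ?thesis using cc unfolding m by (simp add: Wl_def l)
      next
        assume l: "l = 2"
        have m: "mmul (refl_mat l) Z = (2 * c - a, - b - 2 * a, c, - a)" by (simp add: l refl_mat_def Zs)
        have "c * (c - b - 2 * a) < 0" using Z(2) by (simp add: X_def Zs l)
        then have "(- b - 2 * a) * c < 0 \<and> \<bar>c\<bar> < \<bar>- b - 2 * a\<bar>" by (auto simp: zero_less_mult_iff mult_less_0_iff)
        moreover have "(2 * c - a) * (- a) - (- b - 2 * a) * c = N" using d by (simp add: algebra_simps)
        ultimately show ?thesis using cc unfolding m by (simp add: Wl_def l)
      next
        assume l: "l = 3"
        have m: "mmul (refl_mat l) Z = (- 2 * c - a, - b + 2 * a, c, - a)" by (simp add: l refl_mat_def Zs)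
        have "c * (c - b + 2 * a) < 0" using Z(2) by (simp add: X_def Zs l)
        then have "(- b + 2 * a) * c < 0 \<and> \<bar>c\<bar> < \<bar>- b + 2 * a\<bar>" by (auto simp: zero_less_mult_iff mult_less_0_iff)
        moreover have "(- 2 * c - a) * (- a) - (- b + 2 * a) * c = N" using d by (simp add: algebra_simps)
        ultimately show ?thesis using cc unfolding m by (simp add: Wl_def l)
      qed
    qed
    have 2: "mmul (refl_mat l) Y \<in> ?M \<and> X l (mmul (refl_mat l) Y)" if Y: "Y \<in> Wl l" for Y
    proof -
      obtain a b c d where Ys: "Y = (a, b, c, d)" by (cases Y)
      have c: "cls i j k Y" and dt: "a * d - b * c = N" and bc: "b * c < 0" using Y by (auto simp: Wl_def Ys)
      note cc = cl[of Y] c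
      have neg: "(a', b', c', d') \<in> ?M \<and> X l (a', b', c', d')"
        if "cls i j k (a', b', c', d')" "d' = - a'" "a' * d' - b' * c' = - N" "X l (a', b', c', d')" for a' b' c' d'
        using that by (auto simp: neg_fixers_def X_def mult_less_0_iff zero_less_mult_iff split: if_splits)
      show ?thesis using l
      proof (elim disjE)
        assume l: "l = 0"
        have e: "d = a + 2 * b" "\<bar>b\<bar> < \<bar>c\<bar>" using Y by (auto simp: Wl_def Ys l)
        have m: "mmul (refl_mat l) Y = (a, b, 2 * a - c, 2 * b - d)" by (simp add: l refl_mat_def Ys)
        have "b * (- c - b) > 0" using bc e(2) by (auto simp: zero_less_mult_iff mult_less_0_iff)
        then have "X l (a, b, 2 * a - c, 2 * b - d)" by (simp add: X_def l algebra_simps)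
        moreover have "a * (2 * b - d) - b * (2 * a - c) = - N" using dt e(1) by (simp add: algebra_simps)
        ultimately show ?thesis unfolding m using cc e(1) by (intro neg) (simp_all add: m)
      next
        assume l: "l = 1"
        have e: "d = a - 2 * b" "\<bar>b\<bar> < \<bar>c\<bar>" using Y by (auto simp: Wl_def Ys l)
        have m: "mmul (refl_mat l) Y = (a, b, - 2 * a - c, - 2 * b - d)" by (simp add: l refl_mat_def Ys)
        have "b * (- c - b) > 0" using bc e(2) by (auto simp: zero_less_mult_iff mult_less_0_iff)
        then have "X l (a, b, - 2 * a - c, - 2 * b - d)" by (simp add: X_def l algebra_simps)
        moreover have "a * (- 2 * b - d) - b * (- 2 * a - c) = - N" using dt unfolding e(1) by (simp add: algebra_simps)
        ultimately show ?thesis unfolding m using cc e(1) by (intro neg) (simp_all add: m)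
      next
        assume l: "l = 2"
        have e: "a = d + 2 * c" "\<bar>c\<bar> < \<bar>b\<bar>" using Y by (auto simp: Wl_def Ys l)
        have m: "mmul (refl_mat l) Y = (2 * c - a, 2 * d - b, c, d)" by (simp add: l refl_mat_def Ys)
        have "c * (c + b) < 0" using bc e(2) by (auto simp: mult_less_0_iff)
        then have "X l (2 * c - a, 2 * d - b, c, d)" by (simp add: X_def l e algebra_simps)
        moreover have "(2 * c - a) * d - (2 * d - b) * c = - N" using dt e(1) by (simp add: algebra_simps)
        ultimately show ?thesis unfolding m using cc e(1) by (intro neg) (simp_all add: m)
      next
        assume l: "l = 3"
        have e: "a = d - 2 * c" "\<bar>c\<bar> < \<bar>b\<bar>" using Y by (auto simp: Wl_def Ys l)
        have m: "mmul (refl_mat l) Y = (- 2 * c - a, - 2 * d - b, c, d)" by (simp add: l refl_mat_def Ys)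
        have "c * (c + b) < 0" using bc e(2) by (auto simp: mult_less_0_iff)
        then have "X l (- 2 * c - a, - 2 * d - b, c, d)" by (simp add: X_def l e algebra_simps)
        moreover have "(- 2 * c - a) * d - (- 2 * d - b) * c = - N" using dt unfolding e(1) by (simp add: algebra_simps)
        ultimately show ?thesis unfolding m using cc e(1) by (intro neg) (simp_all add: m)
      qed
    qed
    show ?thesis
      by (rule bij_betwI[of _ _ _ "mmul (refl_mat l)"]) (use 1 2 refl_refl in auto)
  qed
  have finW: "finite (Wl l)" if "l < 4" for l
    using bij_betw_finite[OF bij[OF that]] fin by simp
  have W: "(\<Union>l<4. Wl l) = wall_fixers i j k N"
  proof (rule Set.set_eqI)
    fix Y :: imat
    obtain a b c d where Y: "Y = (a, b, c, d)" by (cases Y)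
    have "Y \<in> (\<Union>l<4. Wl l) \<longleftrightarrow> Y \<in> Wl 0 \<or> Y \<in> Wl 1 \<or> Y \<in> Wl 2 \<or> Y \<in> Wl 3"
      by (auto simp: numeral_eq_Suc less_Suc_eq)
    moreover have "\<bar>a - d\<bar> = 2 * \<bar>x\<bar> \<longleftrightarrow> a - d = - 2 * x \<or> a - d = 2 * x" for x by auto
    ultimately show "Y \<in> (\<Union>l<4. Wl l) \<longleftrightarrow> Y \<in> wall_fixers i j k N"
      by (auto simp: Wl_def wall_fixers_def Y)
  qed
  have "2 * card ?M = (\<Sum>Z\<in>?M. \<Sum>l<4. if X l Z then 1 else 0)" using two by (simp add: mult.commute)
  also have "\<dots> = (\<Sum>l<4. \<Sum>Z\<in>?M. if X l Z then 1 else 0)" by (rule sum.swap)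
  also have "\<dots> = (\<Sum>l<4. card {Z \<in> ?M. X l Z})"
    by (intro sum.cong refl) (use fin in \<open>simp add: sum.If_cases Int_def\<close>)
  also have "\<dots> = (\<Sum>l<4. card (Wl l))"
    by (intro sum.cong refl bij_betw_same_card[OF bij]) auto
  also have "\<dots> = card (\<Union>l<4. Wl l)"
  proof (rule card_UN_disjoint[symmetric])
    have det: "l = (if \<bar>b\<bar> < \<bar>c\<bar> then if a - d = - 2 * b then 0 else 1 else if a - d = 2 * c then 2 else 3)"
      if "(a, b, c, d) \<in> Wl l" "l < 4" for a b c d l
    proof -
      have "l = 0 \<or> l = 1 \<or> l = 2 \<or> l = 3" "b \<noteq> 0" "c \<noteq> 0" using that by (auto simp: Wl_def)
      then show ?thesis using that(1) by (elim disjE) (simp_all add: Wl_def)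
    qed
    show "\<forall>l\<in>{..<4}. \<forall>l'\<in>{..<4}. l \<noteq> l' \<longrightarrow> Wl l \<inter> Wl l' = {}"
    proof (intro ballI impI)
      fix l l' :: nat assume l: "l \<in> {..<4}" "l' \<in> {..<4}" "l \<noteq> l'"
      have "\<not> (Y \<in> Wl l \<and> Y \<in> Wl l')" for Y using l det[of _ _ _ _ l] det[of _ _ _ _ l'] by (cases Y) (metis lessThan_iff)
      then show "Wl l \<inter> Wl l' = {}" by blast
    qed
  qed (use finW in auto)
  also have "(\<Union>l<4. Wl l) = wall_fixers i j k N" by (rule W)
  finally show "2 * card ?M = card (wall_fixers i j k N)" .
  show "finite (wall_fixers i j k N)" unfolding W[symmetric] using finW by blast
qed

definition triples :: "int \<Rightarrow> (int \<times> int \<times> int) set" where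
  "triples n = {(x, y, z). x \<ge> 0 \<and> y \<ge> 0 \<and> z \<ge> 0 \<and> x * y + y * z + z * x = n}"

text \<open>A zero in the first two places puts the fixed form on a side, where it counts half; a
  zero in the third place loses the choice of the sign of \<open>w\<close>.\<close>

fun hw :: "int \<times> int \<times> int \<Rightarrow> real" where
  "hw (x, y, z) = (if x = 0 \<or> y = 0 \<or> z = 0 then 1 / 2 else 1)"

lemma triples_two_nonzero:
  assumes "(x, y, z) \<in> triples n" "n > 0"
  shows "x + y > 0" "y + z > 0" "z + x > 0"
  using assms by (auto simp: triples_def order_le_less)

lemma finite_triples: assumes "n > 0" shows "finite (triples n)"
proof (rule finite_subset)
  show "triples n \<subseteq> {0..n} \<times> {0..n} \<times> {0..n}"
  proof clarify
    fix x y z assume t: "(x, y, z) \<in> triples n"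
    note p = triples_two_nonzero[OF t assms]
    have h: "x \<ge> 0" "y \<ge> 0" "z \<ge> 0" "x * y + y * z + z * x = n" using t by (auto simp: triples_def)
    have "x * 1 \<le> x * (y + z)" "y * 1 \<le> y * (z + x)" "z * 1 \<le> z * (x + y)" using p h by (intro mult_left_mono; linarith)+
    moreover have "y * z \<ge> 0" "z * x \<ge> 0" "x * y \<ge> 0" using h by simp_all
    ultimately have "x \<le> n" "y \<le> n" "z \<le> n" unfolding h(4)[symmetric] by (simp_all add: algebra_simps)
    then show "x \<in> {0..n} \<and> (y, z) \<in> {0..n} \<times> {0..n}" using h by auto
  qed
qed simp

lemma finite_square_less: "finite {s :: int. s\<^sup>2 < N}"
proof (rule finite_subset)
  show "{s. s\<^sup>2 < N} \<subseteq> {- N..N}"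
  proof
    fix s assume s: "s \<in> {s. s\<^sup>2 < N}"
    have "\<bar>s\<bar> \<le> s\<^sup>2" by (cases "s = 0") (use mult_left_mono[of 1 "\<bar>s\<bar>" "\<bar>s\<bar>"] in \<open>auto simp: power2_eq_square\<close>)
    then show "s \<in> {- N..N}" using s by auto
  qed
qed simp

text \<open>The class conditions \<open>cls i j k\<close> in terms of the parameters
  \<open>x\<close>, \<open>y\<close>, \<open>w\<close>; see \<open>cls_tcond\<close>.\<close>

definition tcond :: "nat \<Rightarrow> nat \<Rightarrow> int \<Rightarrow> int \<Rightarrow> int \<Rightarrow> bool" where
  "tcond i k x y z \<longleftrightarrow> even (x + y) \<and> (i = 1 \<longleftrightarrow> even (x + z)) \<and> (k = 3 \<longleftrightarrow> 4 dvd x + y)"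

lemma cls_tcond:
  assumes ij: "i = 1 \<and> j = 2 \<or> i = 2 \<and> j = 1" "k = 3 \<or> k = 4" and N: "odd N" "s\<^sup>2 + x * y + (x + y) * \<bar>w\<bar> = N"
  shows "cls i j k (s + w, - (x + \<bar>w\<bar>), y + \<bar>w\<bar>, s - w) \<longleftrightarrow> tcond i k x y w"
proof -
  have four: "4 dvd s + w + - (x + \<bar>w\<bar>) - (y + \<bar>w\<bar>) - (s - w) \<longleftrightarrow> 4 dvd x + y"
  proof (cases "w \<ge> 0")
    case True
    then have "s + w + - (x + \<bar>w\<bar>) - (y + \<bar>w\<bar>) - (s - w) = - (x + y)" by simp
    then show ?thesis by (simp only: dvd_minus_iff)
  next
    case False
    then have "s + w + - (x + \<bar>w\<bar>) - (y + \<bar>w\<bar>) - (s - w) = 4 * w - (x + y)" by simp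
    then show ?thesis by (simp only: dvd_diff_right_iff dvd_triv_left)
  qed
  have o: "odd (s\<^sup>2 + x * y + (x + y) * \<bar>w\<bar>)" using N by simp
  have 1: "odd (s + w) \<and> even (- (x + \<bar>w\<bar>)) \<and> even (y + \<bar>w\<bar>) \<and> odd (s - w) \<longleftrightarrow> even (x + y) \<and> even (x + w)"
    using o by auto
  have 2: "even (s + w) \<and> odd (- (x + \<bar>w\<bar>)) \<and> odd (y + \<bar>w\<bar>) \<and> even (s - w) \<longleftrightarrow> even (x + y) \<and> odd (x + w)"
    using o by auto
  show ?thesis using ij 1 2 unfolding tcond_def
    by (elim disjE conjE; simp only: cls_iff four) auto
qed

text \<open>The half trace \<open>s\<close> and half the difference \<open>w\<close> of the diagonal
  entries are integers. Subtracting \<bar>w\<bar> from the absolute values of the off-diagonal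
  entries leaves \<open>x, y \<ge> 0\<close>, and the determinant becomes
  \<open>s\<^sup>2 + x * y + (x + y) * \<bar>w\<bar>\<close>.\<close>

lemma card_fixers_sum:
  assumes ij: "i = 1 \<and> j = 2 \<or> i = 2 \<and> j = 1" "k = 3 \<or> k = 4" and N: "N > 0" "odd N"
    and nd: "nondeg i j k N" and fin: "finite (fixers i j k N)"
  shows "real (card (fixers i j k N)) =
     (\<Sum>s | s\<^sup>2 < N. \<Sum>(x, y, z)\<in>{(x, y, z) \<in> triples (N - s\<^sup>2). tcond i k x y z}. 4 * hw (x, y, z))"
proof -
  let ?P = "pos_fixers i j k N" and ?W = "wall_fixers i j k N" and ?M = "neg_fixers i j k N"
  note split = fixers_split[OF N(1) nd]
  have finPM: "finite ?P" "finite ?M" using fin unfolding split by auto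
  have finW: "finite ?W" and cW: "2 * card ?M = card ?W" using card_neg_fixers[OF N(1) nd finPM(2)] by auto
  have dPM: "?P \<inter> ?M = {}" using N by (auto simp: pos_fixers_def neg_fixers_def)
  have dPW: "?P \<inter> ?W = {}" by (auto simp: pos_fixers_def wall_fixers_def)
  \<comment> \<open>Weight 2 inside and 1 on a side. Since there are twice as many wall fixers as
    reflections, the total weight is twice the number of fixers; restricting to \<open>b < 0\<close>
    by the symmetry \<open>Y \<mapsto> - Y\<close> removes this factor.\<close>
  define wt where "wt = (\<lambda>(a :: int, b, c, d). if \<bar>a - d\<bar> = 2 * \<bar>b\<bar> \<or> \<bar>a - d\<bar> = 2 * \<bar>c\<bar> then 1 else 2 :: real)"
  have "sum wt ?P = (\<Sum>Y\<in>?P. 2)" by (rule sum.cong) (auto simp: wt_def pos_fixers_def)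
  moreover have "sum wt ?W = (\<Sum>Y\<in>?W. 1)" by (rule sum.cong) (auto simp: wt_def wall_fixers_def)
  moreover have "sum wt (?P \<union> ?W) = sum wt ?P + sum wt ?W" by (rule sum.union_disjoint[OF finPM(1) finW dPW])
  moreover have "card (fixers i j k N) = card ?P + card ?M" unfolding split by (rule card_Un_disjoint[OF finPM dPM])
  moreover have "real (card ?W) = 2 * real (card ?M)" using cW by linarith
  ultimately have 1: "2 * real (card (fixers i j k N)) = sum wt (?P \<union> ?W)" by simp
  define F where "F = {(a, b, c, d). cls i j k (a, b, c, d) \<and> a * d - b * c = N \<and> b < 0 \<and> c > 0 \<and>
     \<bar>a - d\<bar> \<le> - 2 * b \<and> \<bar>a - d\<bar> \<le> 2 * c}"
  define F' where "F' = {(a, b, c, d). cls i j k (a, b, c, d) \<and> a * d - b * c = N \<and> b > 0 \<and> c < 0 \<and>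
     \<bar>a - d\<bar> \<le> 2 * b \<and> \<bar>a - d\<bar> \<le> - 2 * c}"
  have PW: "?P \<union> ?W = F \<union> F'"
  proof (rule Set.set_eqI)
    fix Y :: imat
    obtain a b c d where Y: "Y = (a, b, c, d)" by (cases Y)
    have "\<bar>a - d\<bar> < 2 * \<bar>b\<bar> \<or> \<bar>a - d\<bar> > 2 * \<bar>b\<bar> \<or> \<bar>b\<bar> < \<bar>c\<bar> \<or> \<bar>c\<bar> < \<bar>b\<bar>"
      if "cls i j k (a, b, c, d)" "a * d - b * c = N" "b * c < 0"
    proof (rule ccontr)
      assume "\<not> ?thesis"
      then have "\<bar>a - d\<bar> = 2 * \<bar>b\<bar>" "\<bar>b\<bar> = \<bar>c\<bar>" by linarith+
      then show False using nd that unfolding nondeg_def by blast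
    qed
    then show "Y \<in> ?P \<union> ?W \<longleftrightarrow> Y \<in> F \<union> F'"
      unfolding Y F_def F'_def pos_fixers_def wall_fixers_def mem_Collect_eq prod.case Un_iff mult_less_0_iff
      by (cases "b < 0"; cases "c < 0") auto
  qed
  then have finF: "finite F" "finite F'" using finPM(1) finW by (metis finite_Un)+
  have cneg: "cls i j k (- a, - b, - c, - d) \<longleftrightarrow> cls i j k (a, b, c, d)" for a b c d
    using cls_inW[OF inW_uminus_one, of i j k "(a, b, c, d)"] by simp
  have "sum wt F' = sum wt F"
    by (rule sum.reindex_bij_witness[of _ "\<lambda>(a, b, c, d). (- a, - b, - c, - d)" "\<lambda>(a, b, c, d). (- a, - b, - c, - d)"])
       (auto simp: F_def F'_def wt_def cneg abs_minus_commute)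
  moreover have "sum wt (F \<union> F') = sum wt F + sum wt F'"
    by (rule sum.union_disjoint[OF finF]) (auto simp: F_def F'_def)
  ultimately have 2: "real (card (fixers i j k N)) = sum wt F" using 1 unfolding PW by simp
  define S where "S = {(s, x, y, w). x \<ge> 0 \<and> y \<ge> 0 \<and> s\<^sup>2 < N \<and> s\<^sup>2 + x * y + (x + y) * \<bar>w\<bar> = N \<and> tcond i k x y w}"
  define v where "v = (\<lambda>(s :: int, x :: int, y :: int, w :: int). if x = 0 \<or> y = 0 then 1 else 2 :: real)"
  define fm where "fm = (\<lambda>(a, b, c, d). ((a + d) div 2, - b - \<bar>(a - d) div 2\<bar>, c - \<bar>(a - d) div 2\<bar>, (a - d) div 2 :: int))"
  define gm where "gm = (\<lambda>(s, x, y, w). (s + w, - (x + \<bar>w\<bar>), y + \<bar>w\<bar>, s - w :: int))"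
  have 3: "sum v S = sum wt F"
  proof (rule sum.reindex_bij_witness[of _ fm gm])
    fix X assume "X \<in> S"
    then obtain s x y w where X: "X = (s, x, y, w)" "x \<ge> 0" "y \<ge> 0" "s\<^sup>2 < N" "s\<^sup>2 + x * y + (x + y) * \<bar>w\<bar> = N" "tcond i k x y w"
      by (auto simp: S_def)
    show "fm (gm X) = X" by (simp add: X fm_def gm_def)
    have "cls i j k (s + w, - (x + \<bar>w\<bar>), y + \<bar>w\<bar>, s - w)" using cls_tcond[OF ij N(2) X(5)] X(6) by blast
    moreover have "(s + w) * (s - w) - - (x + \<bar>w\<bar>) * (y + \<bar>w\<bar>) = N"
    proof -
      have "(s + w) * (s - w) - - (x + \<bar>w\<bar>) * (y + \<bar>w\<bar>) = s\<^sup>2 + x * y + (x + y) * \<bar>w\<bar> + (\<bar>w\<bar> * \<bar>w\<bar> - w * w)"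
        by (simp add: algebra_simps power2_eq_square)
      then show ?thesis using X(5) by simp
    qed
    moreover have "x + \<bar>w\<bar> > 0" "y + \<bar>w\<bar> > 0"
    proof -
      have "x \<noteq> 0 \<or> \<bar>w\<bar> \<noteq> 0" "y \<noteq> 0 \<or> \<bar>w\<bar> \<noteq> 0" using X(4,5) by auto
      then show "x + \<bar>w\<bar> > 0" "y + \<bar>w\<bar> > 0" using X(2,3) by linarith+
    qed
    moreover have "\<bar>s + w - (s - w)\<bar> = 2 * \<bar>w\<bar>" by simp
    ultimately show "gm X \<in> F" using X(2,3) unfolding X(1) gm_def F_def by simp
    show "wt (gm X) = v X" using X(2,3) by (auto simp: X(1) gm_def wt_def v_def)
  next
    fix Y assume "Y \<in> F"
    then obtain a b c d where Y: "Y = (a, b, c, d)" "cls i j k (a, b, c, d)" "a * d - b * c = N" "b < 0" "c > 0"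
      "\<bar>a - d\<bar> \<le> - 2 * b" "\<bar>a - d\<bar> \<le> 2 * c" by (auto simp: F_def)
    have "even (a + d)" using cls_parity(1,2)[OF Y(2) ij] ij(1) by auto
    then have e: "(a + d) div 2 + (a - d) div 2 = a" "(a + d) div 2 - (a - d) div 2 = d" by presburger+
    define s w where "s = (a + d) div 2" and "w = (a - d) div 2"
    define x y where "x = - b - \<bar>w\<bar>" and "y = c - \<bar>w\<bar>"
    have fY: "fm Y = (s, x, y, w)" by (simp add: fm_def Y(1) s_def w_def x_def y_def)
    have E: "a = s + w" "d = s - w" "b = - (x + \<bar>w\<bar>)" "c = y + \<bar>w\<bar>" using e by (auto simp: s_def w_def x_def y_def)
    show gf: "gm (fm Y) = Y" unfolding fY by (simp add: gm_def Y(1) E)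
    have xy: "x \<ge> 0" "y \<ge> 0" using Y(6,7) unfolding E by auto
    have eq: "s\<^sup>2 + x * y + (x + y) * \<bar>w\<bar> = N"
    proof -
      have "(s + w) * (s - w) - - (x + \<bar>w\<bar>) * (y + \<bar>w\<bar>) = s\<^sup>2 + x * y + (x + y) * \<bar>w\<bar> + (\<bar>w\<bar> * \<bar>w\<bar> - w * w)"
        by (simp add: algebra_simps power2_eq_square)
      then show ?thesis using Y(3) unfolding E by simp
    qed
    have tc: "tcond i k x y w" using cls_tcond[OF ij N(2) eq] Y(2) unfolding E by blast
    have "\<not> (x = 0 \<and> y = 0)"
    proof
      assume z: "x = 0 \<and> y = 0"
      have "\<bar>a - d\<bar> = 2 * \<bar>b\<bar>" "\<bar>b\<bar> = \<bar>c\<bar>" using z by (simp_all add: E)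
      moreover have "b * c < 0" using Y(4,5) by (simp add: mult_less_0_iff)
      ultimately show False using nd Y(2,3) unfolding nondeg_def by blast
    qed
    then have "x + y > 0" "x > 0 \<and> y > 0 \<or> \<bar>w\<bar> > 0" using xy Y(4,5) unfolding E by auto
    moreover have "x * y \<ge> 0" "(x + y) * \<bar>w\<bar> \<ge> 0" using xy by simp_all
    moreover have "x > 0 \<and> y > 0 \<Longrightarrow> x * y > 0" "x + y > 0 \<Longrightarrow> \<bar>w\<bar> > 0 \<Longrightarrow> (x + y) * \<bar>w\<bar> > 0" by simp_all
    ultimately have "s\<^sup>2 < N" using eq by linarith
    then show "fm Y \<in> S" unfolding fY S_def using xy eq tc by simp
  qed
  define T where "T = (SIGMA s:{s. s\<^sup>2 < N}. {(x, y, z) \<in> triples (N - s\<^sup>2). tcond i k x y z})"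
  have finT: "finite T" unfolding T_def
  proof (rule finite_SigmaI[OF finite_square_less])
    fix s :: int assume "s \<in> {s. s\<^sup>2 < N}"
    then show "finite {(x, y, z) \<in> triples (N - s\<^sup>2). tcond i k x y z}"
      by (intro finite_subset[OF _ finite_triples[of "N - s\<^sup>2"]]) auto
  qed
  \<comment> \<open>The part with \<open>w \<ge> 0\<close> is the set of triples itself, and the
    part with \<open>w < 0\<close> repeats the triples with \<open>z > 0\<close>, so those are
    counted twice.\<close>
  let ?Sa = "{(s, x, y, w) \<in> S. w \<ge> 0}" and ?Sb = "{(s, x, y, w) \<in> S. w < 0}" and ?Tb = "{(s, x, y, z) \<in> T. z > 0}"
  have Sa: "?Sa = T" by (auto simp: S_def T_def triples_def algebra_simps)
  have tneg: "tcond i k x y (- w) \<longleftrightarrow> tcond i k x y w" for x y w by (simp add: tcond_def)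
  have Tb: "(s, x, y, - w) \<in> ?Sb \<longleftrightarrow> (s, x, y, w) \<in> ?Tb" for s x y w
    by (auto simp: S_def T_def triples_def tneg algebra_simps)
  have Sb: "?Sb = (\<lambda>(s, x, y, z). (s, x, y, - z)) ` ?Tb"
  proof (rule Set.set_eqI, rule iffI)
    fix X assume X: "X \<in> ?Sb"
    obtain s x y w where Xs: "X = (s, x, y, w)" by (cases X)
    have "(s, x, y, - (- w)) \<in> ?Sb" using X Xs by simp
    then have "(s, x, y, - w) \<in> ?Tb" unfolding Tb .
    then show "X \<in> (\<lambda>(s, x, y, z). (s, x, y, - z)) ` ?Tb" by (rule rev_image_eqI) (simp add: Xs)
  next
    fix X assume "X \<in> (\<lambda>(s, x, y, z). (s, x, y, - z)) ` ?Tb"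
    then obtain s x y z where "X = (s, x, y, - z)" "(s, x, y, z) \<in> ?Tb" by auto
    then show "X \<in> ?Sb" using Tb by blast
  qed
  have finTb: "finite ?Tb" by (rule finite_subset[OF _ finT]) auto
  have "S = ?Sa \<union> ?Sb" by auto
  then have "sum v S = sum v (?Sa \<union> ?Sb)" by simp
  also have "\<dots> = sum v ?Sa + sum v ?Sb"
  proof (rule sum.union_disjoint)
    show "finite ?Sa" unfolding Sa by (rule finT)
    show "finite ?Sb" unfolding Sb by (intro finite_imageI finTb)
  qed auto
  also have "sum v ?Sb = sum v ?Tb"
    unfolding Sb by (subst sum.reindex) (auto simp: inj_on_def v_def intro!: sum.cong)
  also have "sum v ?Tb = (\<Sum>X\<in>T. if snd (snd (snd X)) > 0 then v X else 0)"
    by (rule sum.mono_neutral_cong_left) (use finT in auto)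
  also have "sum v ?Sa + \<dots> = (\<Sum>X\<in>T. v X + (if snd (snd (snd X)) > 0 then v X else 0))"
    unfolding Sa by (rule sum.distrib[symmetric])
  also have "\<dots> = (\<Sum>(s, t)\<in>T. 4 * hw t)"
  proof (rule sum.cong[OF refl])
    fix X assume "X \<in> T"
    then obtain s x y z where X: "X = (s, x, y, z)" "(x, y, z) \<in> triples (N - s\<^sup>2)" "N - s\<^sup>2 > 0" by (auto simp: T_def)
    note nz = triples_two_nonzero[OF X(2,3)]
    have "x \<ge> 0" "y \<ge> 0" "z \<ge> 0" using X(2) by (auto simp: triples_def)
    then show "v X + (if snd (snd (snd X)) > 0 then v X else 0) = (case X of (s, t) \<Rightarrow> 4 * hw t)"
      using nz by (auto simp: X(1) v_def)
  qed
  also have "\<dots> = (\<Sum>s | s\<^sup>2 < N. \<Sum>t\<in>{(x, y, z) \<in> triples (N - s\<^sup>2). tcond i k x y z}. 4 * hw t)"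
    unfolding T_def
  proof (rule sum.Sigma[symmetric, OF finite_square_less], intro ballI)
    fix s :: int assume "s \<in> {s. s\<^sup>2 < N}"
    then show "finite {(x, y, z) \<in> triples (N - s\<^sup>2). tcond i k x y z}"
      by (intro finite_subset[OF _ finite_triples[of "N - s\<^sup>2"]]) auto
  qed
  finally show ?thesis unfolding 2 3[symmetric] by (simp add: case_prod_unfold del: hw.simps)
qed

section \<open>Reduced forms and Hurwitz class numbers\<close>

definition red_form :: "bqf \<Rightarrow> bool" where
  "red_form = (\<lambda>(a, b, c). 0 < a \<and> \<bar>b\<bar> \<le> a \<and> a \<le> c \<and> (\<bar>b\<bar> = a \<or> a = c \<longrightarrow> b \<ge> 0))"

text \<open>Off the axes the minimum of a reduced form is its value at \<open>(1, 1)\<close> or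
  \<open>(1, - 1)\<close>: with X = \<bar>x\<bar> and Y = \<bar>y\<bar>, the mixed term is absorbed
  by the square of the larger one.\<close>

lemma bqf_eval_ge:
  assumes "0 < a" "\<bar>b\<bar> \<le> a" "a \<le> c" "x \<noteq> 0" "y \<noteq> 0"
  shows "a - \<bar>b\<bar> + c \<le> bqf_eval (a, b, c) x y"
proof -
  define X Y where "X = \<bar>x\<bar>" and "Y = \<bar>y\<bar>"
  have XY: "X \<ge> 1" "Y \<ge> 1" "x\<^sup>2 = X\<^sup>2" "y\<^sup>2 = Y\<^sup>2" using assms by (auto simp: X_def Y_def)
  have sq: "X\<^sup>2 \<ge> 1" "Y\<^sup>2 \<ge> 1" using XY by simp_all
  have "- (\<bar>b\<bar> * (X * Y)) \<le> b * x * y"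
    unfolding X_def Y_def by (simp add: abs_mult[symmetric] mult.assoc)
  then have "a * X\<^sup>2 - \<bar>b\<bar> * (X * Y) + c * Y\<^sup>2 \<le> bqf_eval (a, b, c) x y" by (simp add: XY)
  moreover have "a - \<bar>b\<bar> + c \<le> a * X\<^sup>2 - \<bar>b\<bar> * (X * Y) + c * Y\<^sup>2"
  proof (cases "X \<ge> Y")
    case True
    have "\<bar>b\<bar> * (X * Y) \<le> \<bar>b\<bar> * X\<^sup>2" using True XY by (intro mult_left_mono) (auto simp: power2_eq_square)
    moreover have "(a - \<bar>b\<bar>) * 1 \<le> (a - \<bar>b\<bar>) * X\<^sup>2" "c * 1 \<le> c * Y\<^sup>2" using sq assms by (intro mult_left_mono; simp)+
    ultimately show ?thesis by (simp add: left_diff_distrib)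
  next
    case False
    have "\<bar>b\<bar> * (X * Y) \<le> \<bar>b\<bar> * Y\<^sup>2" using False XY by (intro mult_left_mono) (auto simp: power2_eq_square)
    moreover have "a * 1 \<le> a * X\<^sup>2" "(c - \<bar>b\<bar>) * 1 \<le> (c - \<bar>b\<bar>) * Y\<^sup>2" using sq assms by (intro mult_left_mono; simp)+
    ultimately show ?thesis by (simp add: left_diff_distrib)
  qed
  ultimately show ?thesis by linarith
qed

lemma bqf_eval_ge_first:
  assumes "0 < a" "\<bar>b\<bar> \<le> a" "a \<le> c" "(x, y) \<noteq> (0, 0)"
  shows "a \<le> bqf_eval (a, b, c) x y"
proof -
  have sq: "u\<^sup>2 \<ge> 1" if "u \<noteq> 0" for u :: int using that zero_less_power2[of u] by linarith
  consider "x = 0" "y \<noteq> 0" | "y = 0" "x \<noteq> 0" | "x \<noteq> 0" "y \<noteq> 0" using assms(4) by auto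
  then show ?thesis
  proof cases
    case 1
    then have "c * 1 \<le> c * y\<^sup>2" using sq assms by (intro mult_left_mono) auto
    then have "a \<le> c * y\<^sup>2" using assms(3) by linarith
    then show ?thesis using 1 by simp
  next
    case 2
    then have "a * 1 \<le> a * x\<^sup>2" using sq assms by (intro mult_left_mono) auto
    then show ?thesis using 2 by simp
  next
    case 3 then show ?thesis using bqf_eval_ge[OF assms(1-3)] assms by fastforce
  qed
qed

lemma red_form_pos_def: "red_form Q \<Longrightarrow> bqf_pos_def Q"
proof -
  assume r: "red_form Q"
  obtain a b c where Q: "Q = (a, b, c)" by (cases Q)
  have h: "0 < a" "\<bar>b\<bar> \<le> a" "a \<le> c" using r by (simp_all add: Q red_form_def)
  show ?thesis unfolding bqf_pos_def_def Q
  proof (intro allI impI)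
    fix x y :: int assume "(x, y) \<noteq> (0, 0)"
    from bqf_eval_ge_first[OF h this] h(1) show "0 < bqf_eval (a, b, c) x y" by linarith
  qed
qed

lemma SL2_equiv_coeffs:
  assumes "bqf_SL2_equiv (a, b, c) (a', b', c')"
  obtains \<alpha> \<beta> \<gamma> \<delta> where "\<alpha> * \<delta> - \<beta> * \<gamma> = 1" "a' = bqf_eval (a, b, c) \<alpha> \<gamma>"
    "b' = 2 * a * \<alpha> * \<beta> + b * (\<alpha> * \<delta> + \<beta> * \<gamma>) + 2 * c * \<gamma> * \<delta>"
proof -
  obtain \<alpha> \<beta> \<gamma> \<delta> where det: "\<alpha> * \<delta> - \<beta> * \<gamma> = 1"
    and e: "\<And>x y. bqf_eval (a', b', c') x y = bqf_eval (a, b, c) (\<alpha> * x + \<beta> * y) (\<gamma> * x + \<delta> * y)"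
    using assms unfolding bqf_SL2_equiv_def by blast
  have "a' = bqf_eval (a, b, c) \<alpha> \<gamma>" using e[of 1 0] by simp
  moreover have "b' = 2 * a * \<alpha> * \<beta> + b * (\<alpha> * \<delta> + \<beta> * \<gamma>) + 2 * c * \<gamma> * \<delta>"
    using e[of 1 0] e[of 0 1] e[of 1 1] by (simp add: algebra_simps power2_eq_square)
  ultimately show ?thesis using that det by blast
qed

lemma small_multiple:
  fixes a k x y :: int
  assumes "y = x + 2 * a * k" "\<bar>x\<bar> \<le> a" "\<bar>y\<bar> \<le> a" "0 < a"
  shows "k = 0 \<or> (k = 1 \<and> x = - a \<and> y = a) \<or> (k = - 1 \<and> x = a \<and> y = - a)"
proof -
  have "\<bar>2 * a * k\<bar> \<le> 2 * a" using assms by linarith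
  then have "\<bar>k\<bar> \<le> 1" using assms(4) by (simp add: abs_mult)
  then have "k = 0 \<or> k = 1 \<or> k = - 1" by auto
  then show ?thesis using assms by auto
qed

text \<open>The first column of the substitution represents the minimum \<open>a\<close>. If
  \<gamma> = 0 it is a translation, if \<alpha> = 0 a swap followed by a translation, and otherwise
  \<open>bqf_eval_ge\<close> forces \<open>a = b = c\<close>. The tie rules of
  \<open>red_form\<close> settle the borderline signs.\<close>

lemma red_form_unique:
  assumes r: "red_form (a, b, c)" "red_form (a', b', c')" and e: "bqf_SL2_equiv (a, b, c) (a', b', c')"
    and aa: "a' = a" and disc: "b'\<^sup>2 - 4 * a' * c' = b\<^sup>2 - 4 * a * c"
  shows "b' = b \<and> c' = c"
proof -
  have h: "0 < a" "\<bar>b\<bar> \<le> a" "a \<le> c" "\<bar>b\<bar> = a \<or> a = c \<Longrightarrow> b \<ge> 0" using r(1) by (auto simp: red_form_def)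
  have h': "\<bar>b'\<bar> \<le> a" "a \<le> c'" "\<bar>b'\<bar> = a \<or> a = c' \<Longrightarrow> b' \<ge> 0" using r(2) by (auto simp: red_form_def aa)
  have cc: "c' = c" if "b' = b"
  proof -
    have "a * c' = a * c" using disc that by (simp add: aa)
    then show ?thesis using h(1) by simp
  qed
  obtain \<alpha> \<beta> \<gamma> \<delta> where det: "\<alpha> * \<delta> - \<beta> * \<gamma> = 1" and a': "a' = bqf_eval (a, b, c) \<alpha> \<gamma>"
    and b': "b' = 2 * a * \<alpha> * \<beta> + b * (\<alpha> * \<delta> + \<beta> * \<gamma>) + 2 * c * \<gamma> * \<delta>"
    using SL2_equiv_coeffs[OF e] by metis
  have "b' = b"
  proof (cases "\<gamma> = 0")
    case True
    then have "\<alpha> * \<delta> = 1" using det by simp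
    then have "b' = b + 2 * a * (\<alpha> * \<beta>)" using b' True by (simp add: mult.assoc)
    from small_multiple[OF this h(2) h'(1) h(1)] show ?thesis using b' True \<open>\<alpha> * \<delta> = 1\<close> h h' by auto
  next
    case \<gamma>: False
    show ?thesis
    proof (cases "\<alpha> = 0")
      case False
      then have "a - \<bar>b\<bar> + c \<le> a" using bqf_eval_ge[OF h(1-3) False \<gamma>] a' aa by simp
      then have ba: "b = a" "c = a" using h by auto
      have "4 * (a * c') = b'\<^sup>2 + 3 * a\<^sup>2" using disc by (simp add: aa ba power2_eq_square)
      moreover have "b'\<^sup>2 \<le> a\<^sup>2" using h'(1) h(1) by (metis abs_le_square_iff abs_of_pos)
      moreover have "a\<^sup>2 \<le> a * c'" using h'(2) h(1) by (simp add: power2_eq_square)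
      ultimately have "b'\<^sup>2 = a\<^sup>2" by linarith
      then have "\<bar>b'\<bar> = a" using h(1) by (auto simp: power2_eq_iff)
      then show ?thesis using h'(3) ba by auto
    next
      case True
      then have bg: "\<beta> * \<gamma> = - 1" using det by simp
      then have "\<gamma> = 1 \<or> \<gamma> = - 1" by (metis dvd_triv_right dvd_minus_iff zdvd1_eq abs_eq_iff abs_1)
      then have ca: "c = a" using a' aa True by auto
      have "b' = - b + 2 * a * (\<gamma> * \<delta>)" using b' True bg by (simp add: ca)
      moreover have "\<bar>- b\<bar> \<le> a" using h by simp
      ultimately have k: "b' = - b \<or> (- b = - a \<and> b' = a) \<or> (- b = a \<and> b' = - a)"
        using small_multiple[of b' "- b" a "\<gamma> * \<delta>"] h'(1) h(1) by auto
      have "b \<ge> 0" using h(4) ca by simp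
      have "c' = a" if "b' = - b"
      proof -
        have "a * c' = a * a" using disc that by (simp add: aa ca)
        then show ?thesis using h(1) by simp
      qed
      then show ?thesis using k \<open>b \<ge> 0\<close> h'(3) h(1) by auto
    qed
  qed
  then show ?thesis using cc by blast
qed

lemma SL2_equiv_translate: "bqf_SL2_equiv (a, b, c) (a, b + 2 * a * k, c + b * k + a * k\<^sup>2)"
  unfolding bqf_SL2_equiv_def
  by (rule exI[of _ 1], rule exI[of _ k], rule exI[of _ 0], rule exI[of _ 1]) (simp add: algebra_simps power2_eq_square)

lemma SL2_equiv_swap: "bqf_SL2_equiv (a, b, c) (c, - b, a)"
  unfolding bqf_SL2_equiv_def
  by (rule exI[of _ 0], rule exI[of _ "- 1"], rule exI[of _ 1], rule exI[of _ 0]) (simp add: algebra_simps power2_eq_square)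

lemma SL2_equiv_disc: "bqf_SL2_equiv Q Q' \<Longrightarrow> bqf_disc Q' = bqf_disc Q"
proof -
  assume e: "bqf_SL2_equiv Q Q'"
  obtain a b c a' b' c' where Q: "Q = (a, b, c)" "Q' = (a', b', c')" by (cases Q; cases Q')
  obtain \<alpha> \<beta> \<gamma> \<delta> where det: "\<alpha> * \<delta> - \<beta> * \<gamma> = 1"
    and e: "\<And>x y. bqf_eval Q' x y = bqf_eval Q (\<alpha> * x + \<beta> * y) (\<gamma> * x + \<delta> * y)"
    using e unfolding bqf_SL2_equiv_def by blast
  have a': "a' = bqf_eval Q \<alpha> \<gamma>" and c': "c' = bqf_eval Q \<beta> \<delta>" using e[of 1 0] e[of 0 1] by (simp_all add: Q)
  have b': "b' = 2 * a * \<alpha> * \<beta> + b * (\<alpha> * \<delta> + \<beta> * \<gamma>) + 2 * c * \<gamma> * \<delta>"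
    using e[of 1 0] e[of 0 1] e[of 1 1] by (simp add: Q algebra_simps power2_eq_square)
  have "b'\<^sup>2 - 4 * a' * c' = (\<alpha> * \<delta> - \<beta> * \<gamma>)\<^sup>2 * (b\<^sup>2 - 4 * a * c)"
    unfolding a' b' c' by (simp add: Q algebra_simps power2_eq_square)
  then show ?thesis by (simp add: Q det)
qed

lemma SL2_equiv_pos_def:
  assumes "bqf_SL2_equiv Q Q'" "bqf_pos_def Q" shows "bqf_pos_def Q'"
proof -
  obtain \<alpha> \<beta> \<gamma> \<delta> where det: "\<alpha> * \<delta> - \<beta> * \<gamma> = 1"
    and e: "\<And>x y. bqf_eval Q' x y = bqf_eval Q (\<alpha> * x + \<beta> * y) (\<gamma> * x + \<delta> * y)"
    using assms(1) unfolding bqf_SL2_equiv_def by blast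
  have "(\<alpha> * x + \<beta> * y, \<gamma> * x + \<delta> * y) \<noteq> (0, 0)" if "(x, y) \<noteq> (0, 0)" for x y
  proof
    assume "(\<alpha> * x + \<beta> * y, \<gamma> * x + \<delta> * y) = (0, 0)"
    then have z: "\<alpha> * x + \<beta> * y = 0" "\<gamma> * x + \<delta> * y = 0" by auto
    have "(\<alpha> * \<delta> - \<beta> * \<gamma>) * x = \<delta> * (\<alpha> * x + \<beta> * y) - \<beta> * (\<gamma> * x + \<delta> * y)"
      "(\<alpha> * \<delta> - \<beta> * \<gamma>) * y = \<alpha> * (\<gamma> * x + \<delta> * y) - \<gamma> * (\<alpha> * x + \<beta> * y)" by (simp_all add: algebra_simps)
    then have "x = 0" "y = 0" unfolding z det by auto
    then show False using \<open>(x, y) \<noteq> (0, 0)\<close> by simp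
  qed
  then show ?thesis using assms(2) unfolding bqf_pos_def_def e by blast
qed

definition SL2_rel :: "int \<Rightarrow> bqf rel" where
  "SL2_rel D = {(Q, Q'). Q \<in> pos_def_forms D \<and> Q' \<in> pos_def_forms D \<and> bqf_SL2_equiv Q Q'}"

lemma equiv_SL2_rel: "equiv (pos_def_forms D) (SL2_rel D)"
  unfolding SL2_rel_def by (rule equiv_bqf_SL2_equiv)

lemma SL2_rel_step: "Q \<in> pos_def_forms D \<Longrightarrow> bqf_SL2_equiv Q Q' \<Longrightarrow> (Q, Q') \<in> SL2_rel D"
  using SL2_equiv_disc SL2_equiv_pos_def unfolding SL2_rel_def pos_def_forms_def by auto

lemma SL2_rel_trans: "(Q, Q') \<in> SL2_rel D \<Longrightarrow> (Q', Q'') \<in> SL2_rel D \<Longrightarrow> (Q, Q'') \<in> SL2_rel D"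
  using equiv_SL2_rel[of D] unfolding equiv_def by (meson transD)

lemma red_form_exists:
  assumes Q: "Q \<in> pos_def_forms D"
  obtains Q' where "(Q, Q') \<in> SL2_rel D" "red_form Q'"
proof -
  have pos: "fst F > 0" "snd (snd F) > 0" if "F \<in> pos_def_forms D" for F
  proof -
    obtain a b c where F: "F = (a, b, c)" by (cases F)
    have "bqf_eval F 1 0 > 0" "bqf_eval F 0 1 > 0" using that unfolding pos_def_forms_def bqf_pos_def_def by auto
    then show "fst F > 0" "snd (snd F) > 0" by (simp_all add: F)
  qed
  have "(Q, Q) \<in> SL2_rel D" using equiv_SL2_rel[of D] Q unfolding equiv_def by (meson refl_onD)
  then obtain F where F: "(Q, F) \<in> SL2_rel D" and min: "\<And>G. (Q, G) \<in> SL2_rel D \<Longrightarrow> nat (fst F) \<le> nat (fst G)"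
    using ex_has_least_nat[of "\<lambda>F. (Q, F) \<in> SL2_rel D" Q "\<lambda>F. nat (fst F)"] by blast
  have inP: "G \<in> pos_def_forms D" if "(Q, G) \<in> SL2_rel D" for G using that unfolding SL2_rel_def by auto
  have step: "(Q, G') \<in> SL2_rel D" if "(Q, G) \<in> SL2_rel D" "bqf_SL2_equiv G G'" for G G'
    using SL2_rel_trans[OF that(1) SL2_rel_step[OF inP[OF that(1)] that(2)]] .
  obtain a b0 c0 where Fs: "F = (a, b0, c0)" by (cases F)
  have a: "a > 0" using pos(1)[OF inP[OF F]] by (simp add: Fs)
  \<comment> \<open>Division with remainder brings the middle coefficient into the half-open
    interval from \<open>- a\<close> to \<open>a\<close>; minimality of \<open>a\<close> in the
    class then gives \<open>a \<le> c\<close>.\<close>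
  define k where "k = (a - b0) div (2 * a)"
  define b c where "b = b0 + 2 * a * k" and "c = c0 + b0 * k + a * k\<^sup>2"
  have G: "(Q, (a, b, c)) \<in> SL2_rel D" using step[OF F] SL2_equiv_translate[of a b0 c0 k] by (simp add: Fs b_def c_def)
  have b: "- a < b" "b \<le> a"
  proof -
    have "a - b0 = 2 * a * k + (a - b0) mod (2 * a)" unfolding k_def by simp
    moreover have "0 \<le> (a - b0) mod (2 * a)" "(a - b0) mod (2 * a) < 2 * a" using a by simp_all
    ultimately show "- a < b" "b \<le> a" unfolding b_def by linarith+
  qed
  have S: "(Q, (c, - b, a)) \<in> SL2_rel D" by (rule step[OF G SL2_equiv_swap])
  have "nat a \<le> nat c" using min[OF S] by (simp add: Fs)
  moreover have "c > 0" using pos(2)[OF inP[OF G]] by simp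
  ultimately have ac: "a \<le> c" using a by simp
  show ?thesis
  proof (cases "a = c \<and> b < 0")
    case False
    then have "red_form (a, b, c)" using a b ac by (auto simp: red_form_def)
    then show ?thesis using that G by blast
  next
    case True
    then have "red_form (c, - b, a)" using a b by (auto simp: red_form_def)
    then show ?thesis using that S by blast
  qed
qed

definition red_forms :: "int \<Rightarrow> bqf set" where
  "red_forms D = {Q. red_form Q \<and> bqf_disc Q = D}"

lemma red_forms_pos_def: "Q \<in> red_forms D \<Longrightarrow> Q \<in> pos_def_forms D"
  using red_form_pos_def by (auto simp: red_forms_def pos_def_forms_def)

lemma red_forms_equiv_eq:
  assumes "Q \<in> red_forms D" "Q' \<in> red_forms D" "(Q, Q') \<in> SL2_rel D"
  shows "Q' = Q"
proof -
  obtain a b c a' b' c' where Q: "Q = (a, b, c)" "Q' = (a', b', c')" by (cases Q; cases Q')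
  have e: "bqf_SL2_equiv Q Q'" using assms(3) by (auto simp: SL2_rel_def)
  have "(Q', Q) \<in> SL2_rel D" using assms(3) equiv_SL2_rel[of D] unfolding equiv_def by (meson symD)
  then have e': "bqf_SL2_equiv Q' Q" by (auto simp: SL2_rel_def)
  have le: "u \<le> u'" if eq: "bqf_SL2_equiv (u, v, w) (u', v', w')" and r: "red_form (u, v, w)" "red_form (u', v', w')" for u v w u' v' w'
  proof -
    obtain \<alpha> \<beta> \<gamma> \<delta> where det: "\<alpha> * \<delta> - \<beta> * \<gamma> = 1" and a': "u' = bqf_eval (u, v, w) \<alpha> \<gamma>"
      using SL2_equiv_coeffs[OF eq] by metis
    have "(\<alpha>, \<gamma>) \<noteq> (0, 0)" using det by auto
    then show ?thesis using bqf_eval_ge_first[of u v w \<alpha> \<gamma>] r(1) a' by (simp add: red_form_def)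
  qed
  have r: "red_form (a, b, c)" "red_form (a', b', c')" using assms by (auto simp: red_forms_def Q)
  have "a' = a" using le[OF e[unfolded Q] r] le[OF e'[unfolded Q] r(2,1)] by simp
  moreover have "b'\<^sup>2 - 4 * a' * c' = b\<^sup>2 - 4 * a * c" using assms by (auto simp: red_forms_def Q)
  ultimately show ?thesis using red_form_unique[OF r e[unfolded Q]] Q by simp
qed

definition red_weight :: "bqf \<Rightarrow> nat" where
  "red_weight = (\<lambda>(a, b, c). if b = 0 \<and> a = c then 2 else if a = b \<and> b = c then 3 else 1)"

text \<open>Every class contains exactly one reduced form, and positive definite forms
  \<open>(a, 0, a)\<close> and \<open>(a, a, a)\<close> are reduced. The weight of a class can
  therefore be read off its reduced form.\<close>

lemma hurwitz_H_red_forms: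
  assumes "n > 0"
  shows "hurwitz_H (4 * n) = (\<Sum>Q\<in>red_forms (- 4 * n). 1 / red_weight Q)"
proof -
  define D where "D = - 4 * n"
  let ?c = "\<lambda>Q. SL2_rel D `` {Q}"
  note eqv = equiv_SL2_rel[of D]
  have fc: "form_classes D = ?c ` red_forms D"
  proof
    show "form_classes D \<subseteq> ?c ` red_forms D"
    proof
      fix C assume "C \<in> form_classes D"
      then obtain Q where Q: "Q \<in> pos_def_forms D" "C = ?c Q"
        unfolding form_classes_def SL2_rel_def[symmetric] by (auto elim: quotientE)
      obtain Q' where Q': "(Q, Q') \<in> SL2_rel D" "red_form Q'" using red_form_exists[OF Q(1)] by blast
      then have "Q' \<in> red_forms D" unfolding red_forms_def SL2_rel_def pos_def_forms_def by auto
      moreover have "C = ?c Q'" using equiv_class_eq[OF eqv Q'(1)] Q(2) by simp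
      ultimately show "C \<in> ?c ` red_forms D" by blast
    qed
    show "?c ` red_forms D \<subseteq> form_classes D"
      unfolding form_classes_def SL2_rel_def[symmetric] using red_forms_pos_def by (auto intro: quotientI)
  qed
  have self: "Q \<in> ?c Q" if "Q \<in> red_forms D" for Q
    using equiv_class_self[OF eqv red_forms_pos_def[OF that]] .
  have only: "Q' = Q" if "Q \<in> red_forms D" "Q' \<in> ?c Q" "red_form Q'" for Q Q'
  proof -
    have "(Q, Q') \<in> SL2_rel D" using that by simp
    moreover from this have "Q' \<in> red_forms D" using that(3) unfolding red_forms_def SL2_rel_def pos_def_forms_def by auto
    ultimately show ?thesis using red_forms_equiv_eq that(1) by blast
  qed
  have inj: "inj_on ?c (red_forms D)"
    by (rule inj_onI) (metis only self red_forms_def mem_Collect_eq)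
  have wt: "class_weight (?c Q) = red_weight Q" if Q: "Q \<in> red_forms D" for Q
  proof -
    have pos: "u > 0" if "(u, v, w) \<in> ?c Q" for u v w
    proof -
      have "bqf_pos_def (u, v, w)" using that unfolding SL2_rel_def pos_def_forms_def by simp
      from this[unfolded bqf_pos_def_def, rule_format, of 1 0] show ?thesis by simp
    qed
    have "(\<exists>a. (a, 0, a) \<in> ?c Q) \<longleftrightarrow> (\<exists>a. Q = (a, 0, a))"
    proof
      assume "\<exists>a. (a, 0, a) \<in> ?c Q"
      then obtain a where a: "(a, 0, a) \<in> ?c Q" by blast
      have "red_form (a, 0, a)" using pos[OF a] by (simp add: red_form_def)
      then show "\<exists>a. Q = (a, 0, a)" using only[OF Q a] by blast
    qed (use self[OF Q] in blast)
    moreover have "(\<exists>a. (a, a, a) \<in> ?c Q) \<longleftrightarrow> (\<exists>a. Q = (a, a, a))"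
    proof
      assume "\<exists>a. (a, a, a) \<in> ?c Q"
      then obtain a where a: "(a, a, a) \<in> ?c Q" by blast
      have "red_form (a, a, a)" using pos[OF a] by (simp add: red_form_def)
      then show "\<exists>a. Q = (a, a, a)" using only[OF Q a] by blast
    qed (use self[OF Q] in blast)
    ultimately show ?thesis unfolding class_weight_def red_weight_def by (cases Q) auto
  qed
  have "hurwitz_H (4 * n) = (\<Sum>C\<in>form_classes D. 1 / real (class_weight C))"
  proof -
    have "\<not> [4 * n = 1] (mod 4)" "\<not> [4 * n = 2] (mod 4)" by (simp_all add: cong_def)
    then show ?thesis using assms by (simp add: hurwitz_H_def D_def)
  qed
  also have "\<dots> = (\<Sum>Q\<in>red_forms D. 1 / red_weight Q)"
    unfolding fc by (subst sum.reindex[OF inj]) (auto simp: wt intro!: sum.cong)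
  finally show ?thesis by (simp add: D_def)
qed

section \<open>Reduced forms as triples of nonnegative integers\<close>

definition sorted_triples :: "int \<Rightarrow> (int \<times> int \<times> int) set" where
  "sorted_triples n = {(z, x, y). 0 \<le> z \<and> z \<le> x \<and> x \<le> y \<and> (x, y, z) \<in> triples n}"

fun srt :: "int \<times> int \<times> int \<Rightarrow> int \<times> int \<times> int" where
  "srt (p, q, r) = (if p \<le> q then (if q \<le> r then (p, q, r) else if p \<le> r then (p, r, q) else (r, p, q))
     else (if p \<le> r then (q, p, r) else if q \<le> r then (q, r, p) else (r, q, p)))"

text \<open>The total of the reciprocal weights of the reduced forms
  \<open>(x + z, \<plusminus> 2 z, y + z)\<close>. Both signs are reduced and different only for
  \<open>0 < z < x < y\<close>; the values 1/2 and 1/3 are the two exceptional shapes.\<close>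

fun orbit_weight :: "int \<times> int \<times> int \<Rightarrow> real" where
  "orbit_weight (z, x, y) = (if 0 < z \<and> z < x \<and> x < y then 2 else if z = 0 \<and> x = y then 1 / 2
     else if z = x \<and> x = y then 1 / 3 else 1)"

lemma triples_perm:
  "(y, x, z) \<in> triples n \<longleftrightarrow> (x, y, z) \<in> triples n" "(x, z, y) \<in> triples n \<longleftrightarrow> (x, y, z) \<in> triples n"
  by (auto simp: triples_def algebra_simps)

lemma srt_triples: "t \<in> triples n \<Longrightarrow> srt t \<in> sorted_triples n"
proof -
  assume t: "t \<in> triples n"
  obtain p q r where pqr: "t = (p, q, r)" by (cases t)
  have "p \<ge> 0" "q \<ge> 0" "r \<ge> 0" "p * q + q * r + r * p = n" using t by (auto simp: triples_def pqr)
  then show ?thesis by (auto simp: pqr sorted_triples_def triples_def algebra_simps)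
qed

lemma finite_sorted_triples: "n > 0 \<Longrightarrow> finite (sorted_triples n)"
proof -
  assume "n > 0"
  have "sorted_triples n \<subseteq> (\<lambda>(x, y, z). (z, x, y)) ` triples n" by (force simp: sorted_triples_def)
  then show ?thesis using finite_triples[OF \<open>n > 0\<close>] finite_subset by blast
qed

text \<open>The factor 3 comes from comparing permutations with reduced forms: six arrangements
  against two forms generically, six of weight 1/2 against one form if only \<open>z\<close>
  vanishes, three against one if just two entries agree and none is zero, and so on.\<close>

lemma sum_hw_orbit:
  assumes n: "n > 0" and t: "(z, x, y) \<in> sorted_triples n"
  shows "(\<Sum>t\<in>{t \<in> triples n. srt t = (z, x, y)}. hw t) = 3 * orbit_weight (z, x, y)"
proof -
  have T: "(x, y, z) \<in> triples n" and h: "0 \<le> z" "z \<le> x" "x \<le> y" using t by (auto simp: sorted_triples_def)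
  have x0: "x > 0" using triples_two_nonzero(3)[OF T n] h by linarith
  have eq: "{t \<in> triples n. srt t = (z, x, y)} = {(x, y, z), (y, x, z), (x, z, y), (z, x, y), (y, z, x), (z, y, x)}"
  proof
    show "{t \<in> triples n. srt t = (z, x, y)} \<subseteq> {(x, y, z), (y, x, z), (x, z, y), (z, x, y), (y, z, x), (z, y, x)}"
    proof
      fix t assume "t \<in> {t \<in> triples n. srt t = (z, x, y)}"
      moreover obtain p q r where t: "t = (p, q, r)" by (cases t)
      ultimately have "srt (p, q, r) = (z, x, y)" by simp
      then show "t \<in> {(x, y, z), (y, x, z), (x, z, y), (z, x, y), (y, z, x), (z, y, x)}"
        by (cases "p \<le> q"; cases "q \<le> r"; cases "p \<le> r") (simp_all add: t)
    qed
    have "(x, y, z) \<in> triples n" "(y, x, z) \<in> triples n" "(x, z, y) \<in> triples n" "(z, x, y) \<in> triples n"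
      "(y, z, x) \<in> triples n" "(z, y, x) \<in> triples n" using T triples_perm by metis+
    moreover have "srt (x, y, z) = (z, x, y)" "srt (y, x, z) = (z, x, y)" "srt (x, z, y) = (z, x, y)" "srt (z, x, y) = (z, x, y)"
      "srt (y, z, x) = (z, x, y)" "srt (z, y, x) = (z, x, y)" using h by simp_all
    ultimately show "{(x, y, z), (y, x, z), (x, z, y), (z, x, y), (y, z, x), (z, y, x)} \<subseteq> {t \<in> triples n. srt t = (z, x, y)}"
      by blast
  qed
  consider "z < x" "x < y" | "z = x" "x < y" | "z < x" "x = y" | "z = x" "x = y" using h by linarith
  then show ?thesis
  proof cases
    case 1
    then have "z \<noteq> x" "x \<noteq> y" "z \<noteq> y" by auto
    then show ?thesis unfolding eq using 1 x0 h by auto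
  next
    case 2
    have "{(x, y, z), (y, x, z), (x, z, y), (z, x, y), (y, z, x), (z, y, x)} = {(x, y, x), (y, x, x), (x, x, y)}"
      unfolding 2 by blast
    then show ?thesis unfolding eq using 2 x0 by simp
  next
    case 3
    have "{(x, y, z), (y, x, z), (x, z, y), (z, x, y), (y, z, x), (z, y, x)} = {(x, x, z), (x, z, x), (z, x, x)}"
      unfolding 3(2)[symmetric] by blast
    then show ?thesis unfolding eq using 3 x0 h by simp
  next
    case 4 then show ?thesis unfolding eq using x0 by auto
  qed
qed

text \<open>The discriminant is divisible by 4, so \<open>b\<close> is even and half of its absolute
  value is the smallest entry of the triple.\<close>

lemma red_forms_cases:
  assumes Q: "(a, b, c) \<in> red_forms (- 4 * n)"
  obtains z x y where "(z, x, y) \<in> sorted_triples n" "a = x + z" "\<bar>b\<bar> = 2 * z" "c = y + z"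
proof -
  have h: "0 < a" "\<bar>b\<bar> \<le> a" "a \<le> c" "b\<^sup>2 = 4 * (a * c - n)" using Q by (auto simp: red_forms_def red_form_def)
  have "even (b\<^sup>2)" unfolding h(4) by simp
  then have "even b" by simp
  then obtain \<beta> where \<beta>: "b = 2 * \<beta>" by (rule evenE)
  have b2: "\<beta>\<^sup>2 = a * c - n" using h(4) by (simp add: \<beta>)
  have "(\<bar>\<beta>\<bar>, a - \<bar>\<beta>\<bar>, c - \<bar>\<beta>\<bar>) \<in> sorted_triples n"
  proof -
    have "(a - \<bar>\<beta>\<bar>) * (c - \<bar>\<beta>\<bar>) + (c - \<bar>\<beta>\<bar>) * \<bar>\<beta>\<bar> + \<bar>\<beta>\<bar> * (a - \<bar>\<beta>\<bar>) = a * c - \<bar>\<beta>\<bar>\<^sup>2"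
      by (simp add: power2_eq_square algebra_simps del: abs_mult_self_eq)
    moreover have "2 * \<bar>\<beta>\<bar> \<le> a" "\<bar>\<beta>\<bar> \<le> a" "\<bar>\<beta>\<bar> \<le> c" using h(2,3) unfolding \<beta> by linarith+
    ultimately show ?thesis using b2 h(3) by (simp add: sorted_triples_def triples_def)
  qed
  then show ?thesis by (rule that) (simp_all add: \<beta>)
qed

lemma sum_red_forms_fibre:
  assumes n: "n > 0" and t: "(z, x, y) \<in> sorted_triples n"
  shows "(\<Sum>Q\<in>{Q \<in> red_forms (- 4 * n). (case Q of (a, b, c) \<Rightarrow> (\<bar>b\<bar> div 2, a - \<bar>b\<bar> div 2, c - \<bar>b\<bar> div 2)) = (z, x, y)}.
     1 / real (red_weight Q)) = orbit_weight (z, x, y)"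
proof -
  have T: "(x, y, z) \<in> triples n" and h: "0 \<le> z" "z \<le> x" "x \<le> y" using t by (auto simp: sorted_triples_def)
  have x0: "x > 0" using triples_two_nonzero(3)[OF T n] h by linarith
  have d: "(2 * z)\<^sup>2 - 4 * (x + z) * (y + z) = - 4 * n"
  proof -
    have "(2 * z)\<^sup>2 - 4 * (x + z) * (y + z) = - 4 * (x * y + y * z + z * x)" by (simp add: algebra_simps power2_eq_square)
    then show ?thesis using T by (simp add: triples_def)
  qed
  have p: "(x + z, 2 * z, y + z) \<in> red_forms (- 4 * n)" using h x0 d by (simp add: red_forms_def red_form_def)
  have m: "(x + z, - 2 * z, y + z) \<in> red_forms (- 4 * n) \<longleftrightarrow> z = 0 \<or> z < x \<and> x < y"
    using h x0 d by (auto simp: red_forms_def red_form_def)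
  let ?F = "{Q \<in> red_forms (- 4 * n). (case Q of (a, b, c) \<Rightarrow> (\<bar>b\<bar> div 2, a - \<bar>b\<bar> div 2, c - \<bar>b\<bar> div 2)) = (z, x, y)}"
  have F: "?F = (if 0 < z \<and> z < x \<and> x < y then {(x + z, 2 * z, y + z), (x + z, - 2 * z, y + z)} else {(x + z, 2 * z, y + z)})"
  proof
    show "?F \<subseteq> (if 0 < z \<and> z < x \<and> x < y then {(x + z, 2 * z, y + z), (x + z, - 2 * z, y + z)} else {(x + z, 2 * z, y + z)})"
    proof
      fix Q assume Q: "Q \<in> ?F"
      obtain a b c where Qs: "Q = (a, b, c)" by (cases Q)
      have R: "(a, b, c) \<in> red_forms (- 4 * n)" and e: "\<bar>b\<bar> div 2 = z" "a - \<bar>b\<bar> div 2 = x" "c - \<bar>b\<bar> div 2 = y" using Q by (auto simp: Qs)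
      obtain z' x' y' where "\<bar>b\<bar> = 2 * z'" using red_forms_cases[OF R] by metis
      then have "\<bar>b\<bar> = 2 * z" using e(1) by simp
      then have "b = 2 * z \<or> b = - 2 * z" by linarith
      moreover have "a = x + z" "c = y + z" using e by auto
      ultimately have "Q = (x + z, 2 * z, y + z) \<or> Q = (x + z, - 2 * z, y + z)" by (auto simp: Qs)
      then show "Q \<in> (if 0 < z \<and> z < x \<and> x < y then {(x + z, 2 * z, y + z), (x + z, - 2 * z, y + z)} else {(x + z, 2 * z, y + z)})"
        using R m h unfolding Qs by (cases "z = 0") auto
    qed
    show "(if 0 < z \<and> z < x \<and> x < y then {(x + z, 2 * z, y + z), (x + z, - 2 * z, y + z)} else {(x + z, 2 * z, y + z)}) \<subseteq> ?F"
      using p m h by auto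
  qed
  show ?thesis unfolding F using h x0 by (auto simp: red_weight_def)
qed

theorem hurwitz_H_triples:
  assumes n: "n > 0"
  shows "3 * hurwitz_H (4 * n) = (\<Sum>t\<in>triples n. hw t)"
proof -
  define \<phi> where "\<phi> = (\<lambda>(a :: int, b :: int, c). (\<bar>b\<bar> div 2, a - \<bar>b\<bar> div 2, c - \<bar>b\<bar> div 2))"
  have img: "\<phi> ` red_forms (- 4 * n) \<subseteq> sorted_triples n"
  proof (rule image_subsetI)
    fix Q assume "Q \<in> red_forms (- 4 * n)"
    moreover obtain a b c where Q: "Q = (a, b, c)" by (cases Q)
    ultimately have R: "(a, b, c) \<in> red_forms (- 4 * n)" by simp
    obtain z x y where "(z, x, y) \<in> sorted_triples n" "a = x + z" "\<bar>b\<bar> = 2 * z" "c = y + z" using red_forms_cases[OF R] by metis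
    then show "\<phi> Q \<in> sorted_triples n" by (simp add: \<phi>_def Q)
  qed
  have fin: "finite (red_forms (- 4 * n))"
  proof (rule finite_subset)
    show "red_forms (- 4 * n) \<subseteq> (\<lambda>(z, x, y). (x + z, 2 * z, y + z)) ` sorted_triples n \<union> (\<lambda>(z, x, y). (x + z, - 2 * z, y + z)) ` sorted_triples n"
    proof
      fix Q assume R: "Q \<in> red_forms (- 4 * n)"
      obtain a b c where Q: "Q = (a, b, c)" by (cases Q)
      obtain z x y where s: "(z, x, y) \<in> sorted_triples n" "a = x + z" "\<bar>b\<bar> = 2 * z" "c = y + z"
        using red_forms_cases[OF R[unfolded Q]] by metis
      then have "Q = (x + z, 2 * z, y + z) \<or> Q = (x + z, - 2 * z, y + z)" by (auto simp: Q abs_if split: if_splits)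
      then show "Q \<in> (\<lambda>(z, x, y). (x + z, 2 * z, y + z)) ` sorted_triples n \<union> (\<lambda>(z, x, y). (x + z, - 2 * z, y + z)) ` sorted_triples n"
        using s(1) by force
    qed
  qed (use finite_sorted_triples[OF n] in simp)
  have "hurwitz_H (4 * n) = (\<Sum>\<tau>\<in>sorted_triples n. \<Sum>Q\<in>{Q \<in> red_forms (- 4 * n). \<phi> Q = \<tau>}. 1 / real (red_weight Q))"
    unfolding hurwitz_H_red_forms[OF n] by (rule sum.group[symmetric, OF fin finite_sorted_triples[OF n] img])
  also have "\<dots> = sum orbit_weight (sorted_triples n)"
    by (rule sum.cong[OF refl]) (use sum_red_forms_fibre[OF n] in \<open>auto simp: \<phi>_def simp del: orbit_weight.simps\<close>)
  finally have "3 * hurwitz_H (4 * n) = (\<Sum>\<tau>\<in>sorted_triples n. 3 * orbit_weight \<tau>)" by (simp only: sum_distrib_left)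
  also have "\<dots> = (\<Sum>\<tau>\<in>sorted_triples n. \<Sum>t\<in>{t \<in> triples n. srt t = \<tau>}. hw t)"
    by (rule sum.cong[OF refl]) (use sum_hw_orbit[OF n] in \<open>auto simp del: orbit_weight.simps srt.simps hw.simps\<close>)
  also have "\<dots> = sum hw (triples n)"
    by (rule sum.group[OF finite_triples[OF n] finite_sorted_triples[OF n]]) (use srt_triples in blast)
  finally show ?thesis .
qed

section \<open>Theta series\<close>

unbundle no vec_syntax
unbundle fps_syntax

text \<open>The generating function of \<open>S\<close> with weight \<open>w\<close> and exponent
  \<phi>. A sum over an infinite fibre would be 0 by convention, which is why the product rules
  require \<open>fin_fib\<close>.\<close>

definition gfs :: "'a set \<Rightarrow> ('a \<Rightarrow> real) \<Rightarrow> ('a \<Rightarrow> nat) \<Rightarrow> real fps" where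
  "gfs S w \<phi> = Abs_fps (\<lambda>n. \<Sum>x\<in>{x \<in> S. \<phi> x = n}. w x)"

definition fin_fib :: "'a set \<Rightarrow> ('a \<Rightarrow> nat) \<Rightarrow> bool" where
  "fin_fib S \<phi> \<longleftrightarrow> (\<forall>n. finite {x \<in> S. \<phi> x \<le> n})"

lemma fin_fib_eq: "fin_fib S \<phi> \<Longrightarrow> finite {x \<in> S. \<phi> x = n}"
  unfolding fin_fib_def by (rule finite_subset[of _ "{x \<in> S. \<phi> x \<le> n}"]) auto

lemma gfs_nth: "gfs S w \<phi> $ n = (\<Sum>x\<in>{x \<in> S. \<phi> x = n}. w x)"
  by (simp add: gfs_def)

lemma mult_gfs_nth:
  assumes "fin_fib S \<phi>"
  shows "(F * gfs S w \<phi>) $ n = (\<Sum>x\<in>{x \<in> S. \<phi> x \<le> n}. w x * F $ (n - \<phi> x))"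
proof -
  have "(F * gfs S w \<phi>) $ n = (gfs S w \<phi> * F) $ n" by (simp add: mult.commute)
  also have "\<dots> = (\<Sum>i = 0..n. \<Sum>x\<in>{x \<in> S. \<phi> x = i}. w x * F $ (n - \<phi> x))"
    unfolding fps_mult_nth gfs_nth sum_distrib_right by (intro sum.cong) auto
  also have "\<dots> = (\<Sum>i = 0..n. \<Sum>x\<in>{x \<in> {x \<in> S. \<phi> x \<le> n}. \<phi> x = i}. w x * F $ (n - \<phi> x))"
    by (intro sum.cong) auto
  also have "\<dots> = (\<Sum>x\<in>{x \<in> S. \<phi> x \<le> n}. w x * F $ (n - \<phi> x))"
    by (rule sum.group) (use assms in \<open>auto simp: fin_fib_def\<close>)
  finally show ?thesis .
qed

lemma fin_fib_prod:
  assumes "fin_fib S \<phi>" "fin_fib S' \<phi>'"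
  shows "fin_fib (S \<times> S') (\<lambda>(x, y). \<phi> x + \<phi>' y)"
  unfolding fin_fib_def
proof
  fix n
  show "finite {x \<in> S \<times> S'. (case x of (x, y) \<Rightarrow> \<phi> x + \<phi>' y) \<le> n}"
    by (rule finite_subset[of _ "{x \<in> S. \<phi> x \<le> n} \<times> {x \<in> S'. \<phi>' x \<le> n}"])
       (use assms in \<open>auto simp: fin_fib_def\<close>)
qed

lemma gfs_mult:
  assumes "fin_fib S \<phi>" "fin_fib S' \<phi>'"
  shows "gfs S w \<phi> * gfs S' w' \<phi>' = gfs (S \<times> S') (\<lambda>(x, y). w x * w' y) (\<lambda>(x, y). \<phi> x + \<phi>' y)"
proof (rule fps_ext)
  fix n
  have "(gfs S w \<phi> * gfs S' w' \<phi>') $ n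
      = (\<Sum>y\<in>{y \<in> S'. \<phi>' y \<le> n}. \<Sum>x\<in>{x \<in> S. \<phi> x = n - \<phi>' y}. w x * w' y)"
    by (simp add: mult_gfs_nth[OF assms(2)] gfs_nth sum_distrib_left mult.commute)
  also have "\<dots> = (\<Sum>(y, x)\<in>(SIGMA y:{y \<in> S'. \<phi>' y \<le> n}. {x \<in> S. \<phi> x = n - \<phi>' y}). w x * w' y)"
    using assms fin_fib_eq by (intro sum.Sigma) (auto simp: fin_fib_def)
  also have "\<dots> = (\<Sum>(x, y)\<in>{x \<in> S \<times> S'. (case x of (x, y) \<Rightarrow> \<phi> x + \<phi>' y) = n}. w x * w' y)"
    by (rule sum.reindex_bij_witness[of _ "\<lambda>(x, y). (y, x)" "\<lambda>(x, y). (y, x)"]) auto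
  finally show "(gfs S w \<phi> * gfs S' w' \<phi>') $ n = gfs (S \<times> S') (\<lambda>(x, y). w x * w' y) (\<lambda>(x, y). \<phi> x + \<phi>' y) $ n"
    by (simp add: gfs_nth)
qed

lemma XD_nth: "fps_XD F $ n = of_nat n * (F :: real fps) $ n"
  by (cases n) (simp_all add: fps_XD_def)

lemma XD_gfs: "fps_XD (gfs S w \<phi>) = gfs S (\<lambda>x. of_nat (\<phi> x) * w x) \<phi>"
  by (rule fps_ext) (simp add: gfs_nth sum_distrib_left XD_nth)

lemma XD_mult: "fps_XD (F * G) = fps_XD F * G + F * fps_XD (G :: real fps)"
  by (simp add: fps_XD_def algebra_simps)

text \<open>Here \<open>m\<close> is the index from which \<open>U\<close> and \<open>V\<close> may
  be nonzero. In coefficient \<open>n + m\<close> of the equation for the difference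
  \<open>W\<close>, all terms but those with \<open>W $ n\<close> vanish by induction, leaving
  \<open>n * U $ m - V $ m\<close> as its factor.\<close>

lemma fps_ode_unique:
  fixes F G U V :: "real fps"
  assumes U: "\<And>i. i < m \<Longrightarrow> U $ i = 0" and V: "\<And>i. i < m \<Longrightarrow> V $ i = 0"
    and nz: "\<And>n. n \<ge> k \<Longrightarrow> of_nat n * U $ m \<noteq> V $ m"
    and F: "fps_XD F * U = F * V" and G: "fps_XD G * U = G * V"
    and init: "\<And>n. n < k \<Longrightarrow> F $ n = G $ n"
  shows "F = G"
proof -
  define W where "W = F - G"
  have W: "fps_XD W * U = W * V" using F G by (simp add: W_def fps_XD_def algebra_simps)
  have "W $ n = 0" for n
  proof (induction n rule: less_induct)
    case (less n)
    show ?case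
    proof (cases "n < k")
      case True then show ?thesis using init by (simp add: W_def)
    next
      case False
      have "(fps_XD W * U) $ (n + m) = of_nat n * W $ n * U $ m"
      proof -
        have "(fps_XD W * U) $ (n + m) = (\<Sum>i = 0..n + m. of_nat i * W $ i * U $ (n + m - i))"
          by (simp add: fps_mult_nth XD_nth)
        also have "\<dots> = (\<Sum>i\<in>{n}. of_nat i * W $ i * U $ (n + m - i))"
        proof (rule sum.mono_neutral_right)
          show "\<forall>i\<in>{0..n + m} - {n}. of_nat i * W $ i * U $ (n + m - i) = 0"
          proof
            fix i assume "i \<in> {0..n + m} - {n}"
            then have "i < n \<or> n + m - i < m" by auto
            then show "of_nat i * W $ i * U $ (n + m - i) = 0" using less U by auto
          qed
        qed auto
        finally show ?thesis by simp
      qed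
      moreover have "(W * V) $ (n + m) = W $ n * V $ m"
      proof -
        have "(W * V) $ (n + m) = (\<Sum>i = 0..n + m. W $ i * V $ (n + m - i))"
          by (simp add: fps_mult_nth)
        also have "\<dots> = (\<Sum>i\<in>{n}. W $ i * V $ (n + m - i))"
        proof (rule sum.mono_neutral_right)
          show "\<forall>i\<in>{0..n + m} - {n}. W $ i * V $ (n + m - i) = 0"
          proof
            fix i assume "i \<in> {0..n + m} - {n}"
            then have "i < n \<or> n + m - i < m" by auto
            then show "W $ i * V $ (n + m - i) = 0" using less V by auto
          qed
        qed auto
        finally show ?thesis by simp
      qed
      ultimately have "of_nat n * W $ n * U $ m = W $ n * V $ m" using W by metis
      then have "W $ n * (of_nat n * U $ m - V $ m) = 0"
        by (simp only: right_diff_distrib mult.assoc mult.left_commute[of "W $ n"])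
      then show ?thesis using nz[of n] False by simp
    qed
  qed
  then show ?thesis by (simp add: W_def fps_eq_iff)
qed

section \<open>Liouville's identity and the theorem on four squares\<close>

definition dsol :: "int \<Rightarrow> (int \<times> int \<times> int) set" where
  "dsol n = {(i, d, e). d > 0 \<and> e > 0 \<and> i\<^sup>2 + d * e = n}"

lemma finite_dsol: "finite (dsol n)"
proof (rule finite_subset)
  show "dsol n \<subseteq> {- n..n} \<times> {0..n} \<times> {0..n}"
  proof clarify
    fix i d e assume "(i, d, e) \<in> dsol n"
    then have h: "d > 0" "e > 0" "i\<^sup>2 + d * e = n" by (auto simp: dsol_def)
    have "\<bar>i\<bar> \<le> i\<^sup>2" by (cases "i = 0") (use mult_left_mono[of 1 "\<bar>i\<bar>" "\<bar>i\<bar>"] in \<open>auto simp: power2_eq_square\<close>)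
    moreover have "d \<le> d * e" "e \<le> d * e" using h by (auto simp: mult_le_cancel_left1 mult_le_cancel_right1)
    moreover have "0 \<le> i\<^sup>2" by simp
    ultimately have "\<bar>i\<bar> \<le> n" "d \<le> n" "e \<le> n" using h mult_pos_pos[OF h(1,2)] by linarith+
    then show "i \<in> {- n..n} \<and> (d, e) \<in> {0..n} \<times> {0..n}" using h by (auto simp: abs_le_iff)
  qed
qed simp

text \<open>Liouville's identity.  The involution \<open>(i, d, e) \<mapsto> (e - i, d + 2 i - e, e)\<close> cancels the terms with
  \<open>e < d + 2 i\<close>; the substitution \<open>(i, d, e) \<mapsto> (i + d, d, e - d - 2 i)\<close> rewrites those with \<open>e > d + 2 i\<close>.\<close>

lemma liouville:
  fixes F :: "int \<Rightarrow> int \<Rightarrow> int \<Rightarrow> int"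
  assumes odd: "\<And>x y z. F (- x) y z = - F x y z" and even: "\<And>x y z. F x (- y) (- z) = F x y z"
  shows "2 * (\<Sum>(i, d, e)\<in>dsol n. F (e - 2 * i) (i + d) (2 * i + 2 * d - e)) =
     (\<Sum>(i, d, e)\<in>dsol n. F (d + e) i (d - e))
     - (\<Sum>(i, d, e)\<in>{(i, d, e) \<in> dsol n. d - e = 2 * i}. F (d + e) i (d - e))
     + 2 * (\<Sum>(i, d, e)\<in>{(i, d, e) \<in> dsol n. e = d + 2 * i}. F (e - 2 * i) (i + d) (2 * i + 2 * d - e))"
proof -
  define L where "L = (\<lambda>(i, d, e). F (e - 2 * i) (i + d) (2 * i + 2 * d - e))"
  define G where "G = (\<lambda>(i, d, e). F (d + e) i (d - e))"
  define A1 A2 A3 where "A1 = {(i, d, e) \<in> dsol n. e < d + 2 * i}"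
    and "A2 = {(i, d, e) \<in> dsol n. e > d + 2 * i}" and "A3 = {(i, d, e) \<in> dsol n. e = d + 2 * i}"
  define B1 B2 B3 where "B1 = {(i, d, e) \<in> dsol n. d - e < 2 * i}"
    and "B2 = {(i, d, e) \<in> dsol n. d - e > 2 * i}" and "B3 = {(i, d, e) \<in> dsol n. d - e = 2 * i}"
  have fin: "finite A1" "finite A2" "finite A3" "finite B1" "finite B2" "finite B3"
    using finite_dsol[of n] by (auto simp: A1_def A2_def A3_def B1_def B2_def B3_def intro: finite_subset[OF _ finite_dsol])
  have split: "sum f (dsol n) = sum f A1 + sum f A2 + sum f A3" for f :: "_ \<Rightarrow> int"
  proof -
    have "dsol n = (A1 \<union> A2) \<union> A3" by (auto simp: A1_def A2_def A3_def)
    moreover have "(A1 \<union> A2) \<inter> A3 = {}" "A1 \<inter> A2 = {}" by (auto simp: A1_def A2_def A3_def)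
    ultimately show ?thesis using fin by (simp add: sum.union_disjoint)
  qed
  have splitB: "sum f (dsol n) = sum f B1 + sum f B2 + sum f B3" for f :: "_ \<Rightarrow> int"
  proof -
    have "dsol n = (B1 \<union> B2) \<union> B3" by (auto simp: B1_def B2_def B3_def)
    moreover have "(B1 \<union> B2) \<inter> B3 = {}" "B1 \<inter> B2 = {}" by (auto simp: B1_def B2_def B3_def)
    ultimately show ?thesis using fin by (simp add: sum.union_disjoint)
  qed
  have "sum L A1 = (\<Sum>x\<in>A1. - L x)"
    by (rule sum.reindex_bij_witness[of _ "\<lambda>(i, d, e). (e - i, d + 2 * i - e, e)" "\<lambda>(i, d, e). (e - i, d + 2 * i - e, e)"])
       (auto simp: A1_def dsol_def L_def odd[symmetric] algebra_simps power2_eq_square)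
  then have "sum L A1 = 0" by (simp add: sum_negf)
  moreover have "sum L A2 = sum G B1"
    by (rule sum.reindex_bij_witness[of _ "\<lambda>(i, d, e). (i - d, d, e - d + 2 * i)" "\<lambda>(i, d, e). (i + d, d, e - d - 2 * i)"])
       (auto simp: A2_def B1_def dsol_def L_def G_def algebra_simps power2_eq_square)
  moreover have "sum G B1 = sum G B2"
    by (rule sum.reindex_bij_witness[of _ "\<lambda>(i, d, e). (- i, e, d)" "\<lambda>(i, d, e). (- i, e, d)"])
       (auto simp: B1_def B2_def dsol_def G_def even[of _ _ "_ - _", simplified] algebra_simps)
  ultimately have "2 * sum L (dsol n) = sum G (dsol n) - sum G B3 + 2 * sum L A3"
    using split[of L] splitB[of G] by simp
  then show ?thesis unfolding L_def G_def A3_def B3_def .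
qed

lemma sum_dsol_uminus: "(\<Sum>(i, d, e)\<in>{(i, d, e) \<in> dsol n. P d e}. f i d e) = (\<Sum>(i, d, e)\<in>{(i, d, e) \<in> dsol n. P d e}. f (- i) d e)"
  by (rule sum.reindex_bij_witness[of _ "\<lambda>(i, d, e). (- i, d, e)" "\<lambda>(i, d, e). (- i, d, e)"])
     (auto simp: dsol_def)

lemma sum_dsol_swap:
  assumes "\<And>d e. P d e = P e d"
  shows "(\<Sum>(i, d, e)\<in>{(i, d, e) \<in> dsol n. P d e}. f i d e) = (\<Sum>(i, d, e)\<in>{(i, d, e) \<in> dsol n. P d e}. f i e d)"
  by (rule sum.reindex_bij_witness[of _ "\<lambda>(i, d, e). (i, e, d)" "\<lambda>(i, d, e). (i, e, d)"])
     (auto simp: dsol_def assms mult.commute)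

lemma sum_if_dsol:
  "(\<Sum>(i, d, e)\<in>dsol n. if P d e then f i d e else 0) = (\<Sum>(i, d, e)\<in>{(i, d, e) \<in> dsol n. P d e}. f i d e :: int)"
  by (rule sum.mono_neutral_cong_right) (auto simp: finite_dsol split: if_splits)

lemma finite_dsolP: "finite {(i, d, e) \<in> dsol n. P i d e}"
  by (rule finite_subset[OF _ finite_dsol[of n]]) auto

text \<open>The cubic form \<open>x (x\<^sup>2 - z\<^sup>2 - 16 y\<^sup>2)\<close> is an eigenvector of Liouville's substitution after
  symmetrisation, so only the boundary terms survive.\<close>

lemma liouville_cubic:
  fixes ev :: bool and n :: int
  defines "P \<equiv> \<lambda>d e :: int. ev \<longrightarrow> even d \<and> even e"
  shows "5 * (\<Sum>(i, d, e)\<in>{(i, d, e) \<in> dsol n. P d e}. (d + e) * (4 * d * e - 16 * i\<^sup>2)) =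
     (\<Sum>(i, d, e)\<in>{(i, d, e) \<in> dsol n. P d e \<and> d - e = 2 * i}. (d + e) * (4 * d * e - 16 * i\<^sup>2))
     + 2 * (\<Sum>(i, d, e)\<in>{(i, d, e) \<in> dsol n. P d e \<and> e = d + 2 * i}. 16 * n * d)"
proof -
  \<comment> \<open>The restriction to even \<open>d\<close> and \<open>e\<close>, expressed in the
    arguments of \<open>F\<close>, so that it is compatible with both substitutions and with the two
    symmetries demanded by Liouville's identity.\<close>
  define c where "c x z \<longleftrightarrow> (ev \<longrightarrow> even x \<and> 4 dvd x + z)" for x z :: int
  define F where "F x y z = (if c x z then x * (x\<^sup>2 - z\<^sup>2 - 16 * y\<^sup>2) else 0)" for x y z :: int
  have c1: "c (- x) z = c x z" for x z
  proof -
    have "even x \<and> 4 dvd - x + z \<longleftrightarrow> even x \<and> 4 dvd x + z" by presburger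
    then show ?thesis by (simp add: c_def)
  qed
  have c2: "c x (- z) = c x z" for x z
  proof -
    have "even x \<and> 4 dvd x - z \<longleftrightarrow> even x \<and> 4 dvd x + z" by presburger
    then show ?thesis by (simp add: c_def)
  qed
  have odd: "F (- x) y z = - F x y z" for x y z by (simp add: F_def c1)
  have even: "F x (- y) (- z) = F x y z" for x y z by (simp add: F_def c2)
  have cG: "c (d + e) (d - e) = P d e" for d e
  proof -
    have "even (d + e) \<and> 4 dvd d + e + (d - e) \<longleftrightarrow> even d \<and> even e" by presburger
    then show ?thesis by (simp add: c_def P_def)
  qed
  have cL: "c (e - 2 * i) (2 * i + 2 * d - e) = P d e" for i d e
  proof -
    have "even (e - 2 * i) \<and> 4 dvd e - 2 * i + (2 * i + 2 * d - e) \<longleftrightarrow> even d \<and> even e" by presburger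
    then show ?thesis by (simp add: c_def P_def)
  qed
  have Psym: "P d e = P e d" for d e by (auto simp: P_def)
  let ?S = "{(i, d, e) \<in> dsol n. P d e}"
  define g where "g i d e = (d + e) * (4 * d * e - 16 * i\<^sup>2)" for i d e :: int
  define l where "l i d e = (e - 2 * i) * (4 * n - 20 * (i + d)\<^sup>2)" for i d e :: int
  have FG: "F (d + e) i (d - e) = (if P d e then g i d e else 0)" for i d e
    by (simp add: F_def cG g_def algebra_simps power2_eq_square)
  have FL: "F (e - 2 * i) (i + d) (2 * i + 2 * d - e) = (if P d e then l i d e else 0)" if "(i, d, e) \<in> dsol n" for i d e
  proof -
    have "n = i\<^sup>2 + d * e" using that by (simp add: dsol_def)
    then show ?thesis unfolding F_def cL l_def by (simp add: algebra_simps power2_eq_square)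
  qed
  have G: "(\<Sum>(i, d, e)\<in>dsol n. F (d + e) i (d - e)) = (\<Sum>(i, d, e)\<in>?S. g i d e)"
    unfolding FG by (rule sum_if_dsol)
  have L: "(\<Sum>(i, d, e)\<in>dsol n. F (e - 2 * i) (i + d) (2 * i + 2 * d - e)) = (\<Sum>(i, d, e)\<in>?S. l i d e)"
  proof -
    have "(\<Sum>(i, d, e)\<in>dsol n. F (e - 2 * i) (i + d) (2 * i + 2 * d - e)) = (\<Sum>(i, d, e)\<in>dsol n. if P d e then l i d e else 0)"
      by (rule sum.cong) (use FL in auto)
    then show ?thesis by (simp only: sum_if_dsol)
  qed
  have B: "(\<Sum>(i, d, e)\<in>{(i, d, e) \<in> dsol n. d - e = 2 * i}. F (d + e) i (d - e)) =
      (\<Sum>(i, d, e)\<in>{(i, d, e) \<in> dsol n. P d e \<and> d - e = 2 * i}. g i d e)"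
    unfolding FG by (rule sum.mono_neutral_cong_right) (auto simp: finite_dsolP split: if_splits)
  have A: "(\<Sum>(i, d, e)\<in>{(i, d, e) \<in> dsol n. e = d + 2 * i}. F (e - 2 * i) (i + d) (2 * i + 2 * d - e)) =
      - (\<Sum>(i, d, e)\<in>{(i, d, e) \<in> dsol n. P d e \<and> e = d + 2 * i}. 16 * n * d)"
  proof -
    have "l i d (d + 2 * i) = - (16 * n * d)" if "(i, d, d + 2 * i) \<in> dsol n" for i d
    proof -
      have "n = (i + d)\<^sup>2" using that by (simp add: dsol_def power2_eq_square algebra_simps)
      then show ?thesis by (simp add: l_def)
    qed
    then have FA: "F d (i + d) d = (if P d (d + 2 * i) then - (16 * n * d) else 0)" if "(i, d, d + 2 * i) \<in> dsol n" for i d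
      using FL[OF that] that by simp
    then have "(\<Sum>(i, d, e)\<in>{(i, d, e) \<in> dsol n. e = d + 2 * i}. F (e - 2 * i) (i + d) (2 * i + 2 * d - e)) =
      (\<Sum>(i, d, e)\<in>{(i, d, e) \<in> dsol n. P d e \<and> e = d + 2 * i}. - (16 * n * d))"
      by (intro sum.mono_neutral_cong_right) (auto simp: finite_dsolP FA split: if_splits)
    then show ?thesis by (simp add: sum_negf case_prod_unfold)
  qed
  \<comment> \<open>Averaging over the sign of \<open>i\<close> and the exchange of \<open>d\<close>
    and \<open>e\<close> turns \<open>l\<close> into \<open>- 2 * g\<close>; moving this multiple to
    the other side produces the factor 5 of the claim.\<close>
  have "4 * (\<Sum>(i, d, e)\<in>?S. l i d e) =
      (\<Sum>(i, d, e)\<in>?S. l i d e) + (\<Sum>(i, d, e)\<in>?S. l (- i) d e) + (\<Sum>(i, d, e)\<in>?S. l i e d) + (\<Sum>(i, d, e)\<in>?S. l (- i) e d)"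
    using sum_dsol_uminus[where f = l and P = P and n = n] sum_dsol_swap[where f = l and P = P and n = n]
      sum_dsol_swap[where f = "\<lambda>i. l (- i)" and P = P and n = n] Psym by simp
  also have "\<dots> = (\<Sum>(i, d, e)\<in>?S. l i d e + l (- i) d e + l i e d + l (- i) e d)"
    by (simp add: sum.distrib case_prod_unfold)
  also have "\<dots> = (\<Sum>(i, d, e)\<in>?S. - 8 * g i d e)"
  proof (intro sum.cong refl, clarify)
    fix i d e assume "(i, d, e) \<in> dsol n"
    then have "n = i\<^sup>2 + d * e" by (simp add: dsol_def)
    then show "l i d e + l (- i) d e + l i e d + l (- i) e d = - 8 * g i d e"
      by (simp add: l_def g_def algebra_simps power2_eq_square)
  qed
  also have "\<dots> = - 8 * (\<Sum>(i, d, e)\<in>?S. g i d e)" by (simp add: sum_distrib_left case_prod_unfold sum_negf)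
  finally have lg: "(\<Sum>(i, d, e)\<in>?S. l i d e) = - 2 * (\<Sum>(i, d, e)\<in>?S. g i d e)" by simp
  from liouville[of F n, OF odd even] have
    "2 * (\<Sum>(i, d, e)\<in>?S. l i d e) = (\<Sum>(i, d, e)\<in>?S. g i d e)
      - (\<Sum>(i, d, e)\<in>{(i, d, e) \<in> dsol n. P d e \<and> d - e = 2 * i}. g i d e)
      + 2 * - (\<Sum>(i, d, e)\<in>{(i, d, e) \<in> dsol n. P d e \<and> e = d + 2 * i}. 16 * n * d)"
    unfolding G L B A .
  then show ?thesis using lg unfolding g_def by simp
qed

lemma sum_squares_below: "3 * (\<Sum>i\<in>{- int m<..<int m}. i\<^sup>2) = int m * (int m - 1) * (2 * int m - 1)"
proof (induction m)
  case (Suc m)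
  have "{- int (Suc m)<..<int (Suc m)} = (if m = 0 then {0} else insert (int m) (insert (- int m) {- int m<..<int m}))"
    by auto
  then show ?case using Suc by (auto simp: algebra_simps power2_eq_square)
qed simp

lemma sum_squares_parity:
  "3 * (\<Sum>i\<in>{i. - int m < i \<and> i < int m \<and> even (int m + i)}. i\<^sup>2) = int m * (int m - 1) * (int m - 2)
   \<and> card {i. - int m < i \<and> i < int m \<and> even (int m + i)} = m - 1"
proof (induction m rule: induct_nat_012)
  case 0
  have "{i :: int. - int 0 < i \<and> i < int 0 \<and> even (int 0 + i)} = {}" by auto
  then show ?case by (simp only:) simp
next
  case 1
  have "\<not> (- int (Suc 0) < i \<and> i < int (Suc 0) \<and> even (int (Suc 0) + i))" for i by presburger
  then have "{i :: int. - int (Suc 0) < i \<and> i < int (Suc 0) \<and> even (int (Suc 0) + i)} = {}" by blast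
  then show ?case by (simp only:) simp
next
  case (ge2 m)
  have fin: "finite {i. - int m < i \<and> i < int m \<and> even (int m + i)}"
    by (rule finite_subset[of _ "{- int m..int m}"]) auto
  have eq: "{i. - int (Suc (Suc m)) < i \<and> i < int (Suc (Suc m)) \<and> even (int (Suc (Suc m)) + i)} =
     (if m = 0 then {0} else insert (int m) (insert (- int m) {i. - int m < i \<and> i < int m \<and> even (int m + i)}))" (is "?A = ?B")
  proof (rule Set.set_eqI)
    fix i :: int
    have "- int m - 2 < i \<and> i < int m + 2 \<and> even (int m + i) \<longleftrightarrow>
      (if m = 0 then i = 0 else i = int m \<or> i = - int m \<or> (- int m < i \<and> i < int m \<and> even (int m + i)))"
      by presburger
    then show "i \<in> ?A \<longleftrightarrow> i \<in> ?B" by auto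
  qed
  show ?case unfolding eq using ge2(1) fin by (auto simp: algebra_simps power2_eq_square)
qed

text \<open>On the boundary \<open>d - e = 2 * i\<close> the equation reads
  \<open>(e + i)\<^sup>2 = n\<close>, so boundary terms exist only for squares and are then
  parametrised by \<open>i\<close> alone.\<close>

lemma dsol_square_diag:
  assumes "m > 0"
  shows "{(i, d, e) \<in> dsol (m\<^sup>2). P d e \<and> d - e = 2 * i} = (\<lambda>i. (i, m + i, m - i)) ` {i. - m < i \<and> i < m \<and> P (m + i) (m - i)}"
proof (rule Set.set_eqI, rule iffI)
  fix x assume "x \<in> {(i, d, e) \<in> dsol (m\<^sup>2). P d e \<and> d - e = 2 * i}"
  then obtain i d e where x: "x = (i, d, e)" "d > 0" "e > 0" "i\<^sup>2 + d * e = m\<^sup>2" "P d e" "d - e = 2 * i"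
    by (auto simp: dsol_def)
  have d: "d = e + 2 * i" using x by simp
  have "(e + i)\<^sup>2 = m\<^sup>2" using x(4) unfolding d by (simp add: power2_eq_square algebra_simps)
  moreover have "e + i > 0" using x(2,3) d by simp
  ultimately have "e + i = m" using assms by (simp add: power2_eq_iff)
  then have "e = m - i" "d = m + i" using x by auto
  then show "x \<in> (\<lambda>i. (i, m + i, m - i)) ` {i. - m < i \<and> i < m \<and> P (m + i) (m - i)}" using x by auto
next
  fix x assume "x \<in> (\<lambda>i. (i, m + i, m - i)) ` {i. - m < i \<and> i < m \<and> P (m + i) (m - i)}"
  then show "x \<in> {(i, d, e) \<in> dsol (m\<^sup>2). P d e \<and> d - e = 2 * i}"
    by (auto simp: dsol_def power2_eq_square algebra_simps)
qed

lemma dsol_square_anti: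
  assumes "m > 0"
  shows "{(i, d, e) \<in> dsol (m\<^sup>2). P d e \<and> e = d + 2 * i} = (\<lambda>d. (m - d, d, 2 * m - d)) ` {d. 0 < d \<and> d < 2 * m \<and> P d (2 * m - d)}"
proof (rule Set.set_eqI, rule iffI)
  fix x assume "x \<in> {(i, d, e) \<in> dsol (m\<^sup>2). P d e \<and> e = d + 2 * i}"
  then obtain i d e where x: "x = (i, d, e)" "d > 0" "e > 0" "i\<^sup>2 + d * e = m\<^sup>2" "P d e" "e = d + 2 * i"
    by (auto simp: dsol_def)
  have "(d + i)\<^sup>2 = m\<^sup>2" using x by (simp add: power2_eq_square algebra_simps)
  moreover have "d + i > 0" using x by simp
  ultimately have "d + i = m" using assms by (simp add: power2_eq_iff)
  then have i: "i = m - d" "e = 2 * m - d" using x by auto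
  show "x \<in> (\<lambda>d. (m - d, d, 2 * m - d)) ` {d. 0 < d \<and> d < 2 * m \<and> P d (2 * m - d)}"
    using x(1,2,3,5) unfolding i by (intro image_eqI[of _ _ d]) auto
next
  fix x assume "x \<in> (\<lambda>d. (m - d, d, 2 * m - d)) ` {d. 0 < d \<and> d < 2 * m \<and> P d (2 * m - d)}"
  then show "x \<in> {(i, d, e) \<in> dsol (m\<^sup>2). P d e \<and> e = d + 2 * i}"
    by (auto simp: dsol_def power2_eq_square algebra_simps)
qed

lemma dsol_nonsquare:
  assumes "\<nexists>m. m > 0 \<and> n = m\<^sup>2"
  shows "{(i, d, e) \<in> dsol n. P d e \<and> d - e = 2 * i} = {}" "{(i, d, e) \<in> dsol n. P d e \<and> e = d + 2 * i} = {}"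
proof -
  have "n = (e + i)\<^sup>2" "e + i > 0" if "(i, d, e) \<in> dsol n" "d - e = 2 * i" for i d e
  proof -
    have d: "d = e + 2 * i" using that by simp
    show "n = (e + i)\<^sup>2" using that(1) by (simp add: d dsol_def power2_eq_square algebra_simps)
    show "e + i > 0" using that(1) by (simp add: d dsol_def)
  qed
  then show "{(i, d, e) \<in> dsol n. P d e \<and> d - e = 2 * i} = {}" using assms by blast
  have "n = (d + i)\<^sup>2" "d + i > 0" if "(i, d, e) \<in> dsol n" "e = d + 2 * i" for i d e
    using that by (simp_all add: dsol_def power2_eq_square algebra_simps)
  then show "{(i, d, e) \<in> dsol n. P d e \<and> e = d + 2 * i} = {}" using assms by blast
qed

lemma sum_below: "(\<Sum>d\<in>{0<..<2 * int m}. d) = int m * (2 * int m - 1)"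
proof (induction m)
  case (Suc m)
  have "{0<..<2 * int (Suc m)} = (if m = 0 then {1} else insert (2 * int m) (insert (2 * int m + 1) {0<..<2 * int m}))" by auto
  then show ?case using Suc by (auto simp: algebra_simps)
qed simp

lemma sum_below_even: "(\<Sum>d\<in>{d. 0 < d \<and> d < 2 * int m \<and> even d}. d) = int m * (int m - 1)"
proof -
  have "(\<Sum>d\<in>{d. 0 < d \<and> d < 2 * int m \<and> even d}. d) = (\<Sum>j\<in>{0<..<int m}. 2 * j)"
    by (rule sum.reindex_bij_witness[of _ "\<lambda>j. 2 * j" "\<lambda>d. d div 2"]) auto
  also have "\<dots> = int m * (int m - 1)"
  proof (induction m)
    case (Suc m)
    have "{0<..<int (Suc m)} = (if m = 0 then {} else insert (int m) {0<..<int m})" by auto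
    then show ?case using Suc by (auto simp: algebra_simps)
  qed simp
  finally show ?thesis .
qed

definition cubsum :: "bool \<Rightarrow> int \<Rightarrow> int" where
  "cubsum ev n = (\<Sum>(i, d, e)\<in>{(i, d, e) \<in> dsol n. ev \<longrightarrow> even d \<and> even e}. (d + e) * (4 * d * e - 16 * i\<^sup>2))"

lemma cubsum_square:
  assumes "m > 0"
  shows "3 * cubsum False ((int m)\<^sup>2) = 8 * (int m)\<^sup>2 * (4 * (int m)\<^sup>2 - 1)"
    and "3 * cubsum True ((int m)\<^sup>2) = 16 * (int m)\<^sup>2 * ((int m)\<^sup>2 - 1)"
proof -
  let ?m = "int m"
  have m: "?m > 0" using assms by simp
  define g where "g = (\<lambda>(i, d, e). (d + e) * (4 * d * e - 16 * i\<^sup>2) :: int)"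
  have B: "(\<Sum>x\<in>{(i, d, e) \<in> dsol (?m\<^sup>2). P d e \<and> d - e = 2 * i}. g x) =
     8 * ?m * (?m\<^sup>2 * int (card {i. - ?m < i \<and> i < ?m \<and> P (?m + i) (?m - i)})
       - 5 * (\<Sum>i\<in>{i. - ?m < i \<and> i < ?m \<and> P (?m + i) (?m - i)}. i\<^sup>2))" for P
  proof -
    have "(\<Sum>x\<in>{(i, d, e) \<in> dsol (?m\<^sup>2). P d e \<and> d - e = 2 * i}. g x) =
      (\<Sum>i\<in>{i. - ?m < i \<and> i < ?m \<and> P (?m + i) (?m - i)}. g (i, ?m + i, ?m - i))"
      unfolding dsol_square_diag[OF m] by (rule sum.reindex[unfolded o_def]) (auto simp: inj_on_def)
    also have "\<dots> = (\<Sum>i\<in>{i. - ?m < i \<and> i < ?m \<and> P (?m + i) (?m - i)}. 8 * ?m * (?m\<^sup>2 - 5 * i\<^sup>2))"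
      by (rule sum.cong) (auto simp: g_def algebra_simps power2_eq_square)
    also have "\<dots> = 8 * ?m * (?m\<^sup>2 * int (card {i. - ?m < i \<and> i < ?m \<and> P (?m + i) (?m - i)})
       - 5 * (\<Sum>i\<in>{i. - ?m < i \<and> i < ?m \<and> P (?m + i) (?m - i)}. i\<^sup>2))"
      unfolding sum_distrib_left[symmetric] sum_subtractf by (simp add: mult.commute)
    finally show ?thesis .
  qed
  have A: "(\<Sum>(i, d, e)\<in>{(i, d, e) \<in> dsol (?m\<^sup>2). P d e \<and> e = d + 2 * i}. 16 * ?m\<^sup>2 * d) =
     16 * ?m\<^sup>2 * (\<Sum>d\<in>{d. 0 < d \<and> d < 2 * ?m \<and> P d (2 * ?m - d)}. d)" for P
    unfolding dsol_square_anti[OF m] by (subst sum.reindex) (auto simp: inj_on_def sum_distrib_left)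
  have c1: "5 * cubsum False (?m\<^sup>2) = 8 * ?m * (?m\<^sup>2 * (2 * ?m - 1) - 5 * (\<Sum>i\<in>{- ?m<..<?m}. i\<^sup>2))
     + 2 * (16 * ?m\<^sup>2 * (?m * (2 * ?m - 1)))"
  proof -
    have s: "{i. - ?m < i \<and> i < ?m} = {- ?m<..<?m}" "{d. 0 < d \<and> d < 2 * ?m} = {0<..<2 * ?m}" by auto
    have "int (card {- ?m<..<?m}) = 2 * ?m - 1" using assms by simp
    then show ?thesis
      using liouville_cubic[of "?m\<^sup>2" False] B[of "\<lambda>_ _. True"] A[of "\<lambda>_ _. True"] sum_below[of m]
      by (simp add: cubsum_def g_def s)
  qed
  then have "15 * cubsum False (?m\<^sup>2) = 8 * ?m * (3 * ?m\<^sup>2 * (2 * ?m - 1) - 5 * (3 * (\<Sum>i\<in>{- ?m<..<?m}. i\<^sup>2)))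
     + 96 * ?m\<^sup>2 * (?m * (2 * ?m - 1))" by (simp add: algebra_simps)
  also have "\<dots> = 5 * (8 * ?m\<^sup>2 * (4 * ?m\<^sup>2 - 1))"
    unfolding sum_squares_below by (simp add: algebra_simps power2_eq_square)
  finally show "3 * cubsum False (?m\<^sup>2) = 8 * ?m\<^sup>2 * (4 * ?m\<^sup>2 - 1)" by simp
  let ?E = "{i. - ?m < i \<and> i < ?m \<and> even (?m + i)}"
  have c2: "5 * cubsum True (?m\<^sup>2) = 8 * ?m * (?m\<^sup>2 * (?m - 1) - 5 * (\<Sum>i\<in>?E. i\<^sup>2))
     + 2 * (16 * ?m\<^sup>2 * (?m * (?m - 1)))"
  proof -
    have s: "{i. - ?m < i \<and> i < ?m \<and> even (?m + i) \<and> even (?m - i)} = ?E"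
      "{d. 0 < d \<and> d < 2 * ?m \<and> even d \<and> even (2 * ?m - d)} = {d. 0 < d \<and> d < 2 * ?m \<and> even d}" by auto
    have "int (card ?E) = ?m - 1" using sum_squares_parity[of m] assms by (simp add: of_nat_diff)
    then show ?thesis
      using liouville_cubic[of "?m\<^sup>2" True] B[of "\<lambda>d e. even d \<and> even e"] A[of "\<lambda>d e. even d \<and> even e"] sum_below_even[of m]
      unfolding s by (simp add: cubsum_def g_def conj_assoc)
  qed
  then have "15 * cubsum True (?m\<^sup>2) = 8 * ?m * (3 * ?m\<^sup>2 * (?m - 1) - 5 * (3 * (\<Sum>i\<in>?E. i\<^sup>2)))
     + 96 * ?m\<^sup>2 * (?m * (?m - 1))" by (simp add: algebra_simps)
  also have "\<dots> = 5 * (16 * ?m\<^sup>2 * (?m\<^sup>2 - 1))"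
    unfolding conjunct1[OF sum_squares_parity] by (simp add: algebra_simps power2_eq_square)
  finally show "3 * cubsum True (?m\<^sup>2) = 16 * ?m\<^sup>2 * (?m\<^sup>2 - 1)" by simp
qed

lemma cubsum_nonsquare:
  assumes "\<nexists>m. m > 0 \<and> n = m\<^sup>2" shows "cubsum ev n = 0"
  using liouville_cubic[of n ev] unfolding dsol_nonsquare[OF assms] cubsum_def by simp

text \<open>The terms with \<open>4 dvd d\<close> correspond under (d, e) \<mapsto> (d / 2, 2 e) to
  pairs of even numbers at the price of a factor 2. The two evaluated cubic sums thus give the sum
  over the remaining \<open>d\<close>.\<close>

lemma divisor_recurrence:
  "(\<Sum>(i, d, e)\<in>{(i, d, e) \<in> dsol n. \<not> 4 dvd d}. d * (d * e - 4 * i\<^sup>2)) = (if \<exists>m > 0. n = m\<^sup>2 then n else 0)"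
proof -
  define h where "h = (\<lambda>(i, d, e). d * (d * e - 4 * i\<^sup>2) :: int)"
  have half: "8 * (\<Sum>(i, d, e)\<in>{(i, d, e) \<in> dsol n. ev \<longrightarrow> even d \<and> even e}. d * (d * e - 4 * i\<^sup>2)) = cubsum ev n" for ev
  proof -
    let ?S = "{(i, d, e) \<in> dsol n. ev \<longrightarrow> even d \<and> even e}"
    have "cubsum ev n = 4 * ((\<Sum>(i, d, e)\<in>?S. d * (d * e - 4 * i\<^sup>2)) + (\<Sum>(i, d, e)\<in>?S. e * (e * d - 4 * i\<^sup>2)))"
      unfolding cubsum_def sum.distrib[symmetric] sum_distrib_left by (intro sum.cong) (auto simp: algebra_simps)
    also have "(\<Sum>(i, d, e)\<in>?S. e * (e * d - 4 * i\<^sup>2)) = (\<Sum>(i, d, e)\<in>?S. d * (d * e - 4 * i\<^sup>2))"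
      by (rule sum_dsol_swap[of "\<lambda>d e. ev \<longrightarrow> even d \<and> even e", symmetric]) auto
    finally show ?thesis by simp
  qed
  have split: "sum h (dsol n) = sum h {(i, d, e) \<in> dsol n. \<not> 4 dvd d} + sum h {(i, d, e) \<in> dsol n. 4 dvd d}"
  proof -
    have "dsol n = {(i, d, e) \<in> dsol n. \<not> 4 dvd d} \<union> {(i, d, e) \<in> dsol n. 4 dvd d}" by auto
    then show ?thesis by (subst (1) \<open>dsol n = _\<close>, intro sum.union_disjoint finite_dsolP) auto
  qed
  have four: "sum h {(i, d, e) \<in> dsol n. 4 dvd d} = (\<Sum>(i, d, e)\<in>{(i, d, e) \<in> dsol n. even d \<and> even e}. 2 * (d * (d * e - 4 * i\<^sup>2)))"
    by (rule sum.reindex_bij_witness[of _ "\<lambda>(i, d, e). (i, 2 * d, e div 2)" "\<lambda>(i, d, e). (i, d div 2, 2 * e)"])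
       (auto simp: h_def dsol_def elim!: evenE dvdE)
  have "8 * sum h {(i, d, e) \<in> dsol n. \<not> 4 dvd d} = cubsum False n - 2 * cubsum True n"
    using split four half[of False] half[of True] by (simp add: h_def sum_distrib_left[symmetric] case_prod_unfold)
  moreover have "cubsum False n - 2 * cubsum True n = 8 * (if \<exists>m > 0. n = m\<^sup>2 then n else 0)"
  proof (cases "\<exists>m > 0. n = m\<^sup>2")
    case True
    then obtain m where "m > 0" "n = m\<^sup>2" by blast
    then obtain k where k: "k > 0" "n = (int k)\<^sup>2" by (metis pos_int_cases)
    have "3 * (cubsum False n - 2 * cubsum True n) = 3 * (8 * n)"
      using cubsum_square[OF k(1)] unfolding k(2) by (simp add: algebra_simps)
    then show ?thesis using True by simp
  next
    case False then show ?thesis using cubsum_nonsquare[of n] by auto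
  qed
  ultimately have "sum h {(i, d, e) \<in> dsol n. \<not> 4 dvd d} = (if \<exists>m > 0. n = m\<^sup>2 then n else 0)" by linarith
  then show ?thesis unfolding h_def .
qed

text \<open>Jacobi's formula for the number of representations as a sum of four squares; the value 1
  at 0 counts the zero vector.\<close>

definition dsum4 :: "nat \<Rightarrow> int" where
  "dsum4 n = (if n = 0 then 1 else 8 * (\<Sum>d | d > 0 \<and> d dvd int n \<and> \<not> 4 dvd d. d))"

definition theta :: "real fps" where "theta = gfs UNIV (\<lambda>_. 1) (\<lambda>k :: int. nat (k\<^sup>2))"

definition theta_odd :: "real fps" where "theta_odd = gfs {k :: int. odd k} (\<lambda>_. 1) (\<lambda>k. nat (k\<^sup>2))"

definition theta_even :: "real fps" where "theta_even = gfs UNIV (\<lambda>_. 1) (\<lambda>k :: int. nat (4 * k\<^sup>2))"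

lemma abs_le_square: "\<bar>k\<bar> \<le> (k :: int)\<^sup>2"
  by (cases "k = 0") (use mult_left_mono[of 1 "\<bar>k\<bar>" "\<bar>k\<bar>"] in \<open>auto simp: power2_eq_square\<close>)

lemma fin_fib_square: "c > 0 \<Longrightarrow> fin_fib S (\<lambda>k :: int. nat (c * k\<^sup>2))"
  unfolding fin_fib_def
proof
  fix n assume c: "c > 0"
  show "finite {k \<in> S. nat (c * k\<^sup>2) \<le> n}"
  proof (rule finite_subset)
    show "{k \<in> S. nat (c * k\<^sup>2) \<le> n} \<subseteq> {- int n..int n}"
    proof
      fix k assume "k \<in> {k \<in> S. nat (c * k\<^sup>2) \<le> n}"
      then have "c * k\<^sup>2 \<le> int n" by (simp add: nat_le_iff)
      moreover have "k\<^sup>2 \<le> c * k\<^sup>2" using c by (simp add: mult_le_cancel_right1)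
      ultimately show "k \<in> {- int n..int n}" using abs_le_square[of k] by (auto simp: abs_le_iff)
    qed
  qed simp
qed

lemmas fin_fib_square1 = fin_fib_square[of 1, simplified]

lemma theta_0: "theta $ 0 = 1"
proof -
  have "{x :: int. nat (x\<^sup>2) = 0} = {0}" by (auto simp: nat_eq_iff)
  then show ?thesis by (simp add: theta_def gfs_nth)
qed

text \<open>With \<open>e\<close> the complementary divisor, \<open>d * e = n - k\<^sup>2\<close>,
  and hence \<open>n - 5 * k\<^sup>2 = d * e - 4 * k\<^sup>2\<close>.\<close>

lemma dsol_dsum4:
  assumes "n > 0"
  shows "(\<Sum>k | nat (k\<^sup>2) < n. (int n - 5 * k\<^sup>2) * dsum4 (n - nat (k\<^sup>2))) =
     8 * (\<Sum>(i, d, e)\<in>{(i, d, e) \<in> dsol (int n). \<not> 4 dvd d}. d * (d * e - 4 * i\<^sup>2))"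
proof -
  let ?K = "{k :: int. nat (k\<^sup>2) < n}"
  have K: "finite ?K"
    by (rule finite_subset[OF _ fin_fib_square1[of UNIV, unfolded fin_fib_def, rule_format, of n]]) auto
  have D: "finite {d. d > 0 \<and> d dvd l \<and> \<not> 4 dvd d}" if "l > 0" for l :: int
    by (rule finite_subset[of _ "{0..l}"]) (use that in \<open>auto dest: zdvd_imp_le\<close>)
  have "(\<Sum>k\<in>?K. (int n - 5 * k\<^sup>2) * dsum4 (n - nat (k\<^sup>2))) =
     (\<Sum>k\<in>?K. \<Sum>d | d > 0 \<and> d dvd int n - k\<^sup>2 \<and> \<not> 4 dvd d. 8 * (d * (int n - 5 * k\<^sup>2)))"
  proof (rule sum.cong[OF refl])
    fix k :: int assume "k \<in> ?K"
    then have "int (n - nat (k\<^sup>2)) = int n - k\<^sup>2" "n - nat (k\<^sup>2) \<noteq> 0" by (auto simp: of_nat_diff)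
    then show "(int n - 5 * k\<^sup>2) * dsum4 (n - nat (k\<^sup>2)) = (\<Sum>d | d > 0 \<and> d dvd int n - k\<^sup>2 \<and> \<not> 4 dvd d. 8 * (d * (int n - 5 * k\<^sup>2)))"
      unfolding dsum4_def by (simp add: sum_distrib_left mult_ac)
  qed
  also have "\<dots> = (\<Sum>(k, d)\<in>(SIGMA k:?K. {d. d > 0 \<and> d dvd int n - k\<^sup>2 \<and> \<not> 4 dvd d}). 8 * (d * (int n - 5 * k\<^sup>2)))"
    by (intro sum.Sigma) (use K D in \<open>auto simp: nat_less_iff\<close>)
  also have "\<dots> = (\<Sum>(i, d, e)\<in>{(i, d, e) \<in> dsol (int n). \<not> 4 dvd d}. 8 * (d * (d * e - 4 * i\<^sup>2)))"
  proof (rule sum.reindex_bij_witness[of _ "\<lambda>(i, d, e). (i, d)" "\<lambda>(k, d). (k, d, (int n - k\<^sup>2) div d)"], goal_cases)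
    case (2 x)
    then obtain k d where x: "x = (k, d)" "nat (k\<^sup>2) < n" "d > 0" "d dvd int n - k\<^sup>2" "\<not> 4 dvd d" by auto
    then have q: "int n - k\<^sup>2 > 0" by (simp add: nat_less_iff)
    have e: "d * ((int n - k\<^sup>2) div d) = int n - k\<^sup>2" using x by simp
    then have "(int n - k\<^sup>2) div d > 0" using q x(3) by (metis zero_less_mult_pos)
    then show ?case using x e by (simp add: dsol_def)
  next
    case (5 x)
    then obtain k d where x: "x = (k, d)" "d dvd int n - k\<^sup>2" by auto
    then have e: "d * ((int n - k\<^sup>2) div d) = int n - k\<^sup>2" by simp
    show ?case unfolding x(1) prod.case e by (simp add: algebra_simps)
  next
    case (4 x)
    then obtain i d e where x: "x = (i, d, e)" "d > 0" "e > 0" "i\<^sup>2 + d * e = int n" "\<not> 4 dvd d" by (auto simp: dsol_def)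
    have "int n - i\<^sup>2 = d * e" using x(4) by simp
    moreover have "d * e > 0" using x by simp
    ultimately show ?case using x(1,2,5) by (simp add: nat_less_iff)
  next
    case (3 x)
    then obtain i d e where x: "x = (i, d, e)" "d > 0" "i\<^sup>2 + d * e = int n" by (auto simp: dsol_def)
    have "int n - i\<^sup>2 = d * e" using x(3) by simp
    then show ?case using x(1,2) by simp
  qed auto
  finally show ?thesis by (simp add: sum_distrib_left case_prod_unfold)
qed

text \<open>The fourth power of \<open>theta\<close> is determined by its constant term and by
  \<open>fps_XD F * theta = 4 * F * fps_XD theta\<close>. On coefficients this is the recurrence
  \<open>key\<close>; its terms with \<open>k\<^sup>2 = n\<close> cancel the value of
  \<open>divisor_recurrence\<close>.\<close>

lemma theta_power_4: "theta * theta * theta * theta = Abs_fps (\<lambda>n. real_of_int (dsum4 n))"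
proof -
  define F where "F = Abs_fps (\<lambda>n. real_of_int (dsum4 n))"
  let ?T = "fps_XD theta"
  have key: "(\<Sum>k | nat (k\<^sup>2) \<le> n. (int n - 5 * k\<^sup>2) * dsum4 (n - nat (k\<^sup>2))) = 0" for n
  proof (cases "n = 0")
    case True
    have "{k :: int. nat (k\<^sup>2) \<le> 0} = {0}" by (auto simp: nat_eq_iff)
    then show ?thesis using True by simp
  next
    case False
    let ?g = "\<lambda>k :: int. (int n - 5 * k\<^sup>2) * dsum4 (n - nat (k\<^sup>2))"
    have "{k :: int. nat (k\<^sup>2) \<le> n} = {k. nat (k\<^sup>2) < n} \<union> {k. nat (k\<^sup>2) = n}" by auto
    moreover have "finite {k :: int. nat (k\<^sup>2) < n}" "finite {k :: int. nat (k\<^sup>2) = n}"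
      by (rule finite_subset[OF _ fin_fib_square1[of UNIV, unfolded fin_fib_def, rule_format, of n]]; auto)+
    ultimately have "(\<Sum>k | nat (k\<^sup>2) \<le> n. ?g k) = (\<Sum>k | nat (k\<^sup>2) < n. ?g k) + (\<Sum>k | nat (k\<^sup>2) = n. ?g k)"
      by (simp add: sum.union_disjoint disjoint_iff)
    also have "(\<Sum>k | nat (k\<^sup>2) < n. ?g k) = 8 * (if \<exists>m > 0. int n = m\<^sup>2 then int n else 0)"
      using dsol_dsum4[of n] divisor_recurrence[of "int n"] False by simp
    also have "(\<Sum>k | nat (k\<^sup>2) = n. ?g k) = - 8 * (if \<exists>m > 0. int n = m\<^sup>2 then int n else 0)"
    proof (cases "\<exists>m > 0. int n = m\<^sup>2")
      case True
      then obtain m where m: "m > 0" "int n = m\<^sup>2" by blast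
      have "nat (k\<^sup>2) = n \<longleftrightarrow> k = m \<or> k = - m" for k
      proof -
        have "nat (k\<^sup>2) = n \<longleftrightarrow> k\<^sup>2 = m\<^sup>2" using m(2) by auto
        then show ?thesis by (simp add: power2_eq_iff)
      qed
      then have "{k. nat (k\<^sup>2) = n} = {m, - m}" by auto
      then show ?thesis using m True by (simp add: dsum4_def nat_power_eq flip: m(2))
    next
      case F: False
      have "{k :: int. nat (k\<^sup>2) = n} = {}"
      proof (rule ccontr)
        assume "{k :: int. nat (k\<^sup>2) = n} \<noteq> {}"
        then obtain k :: int where "nat (k\<^sup>2) = n" by auto
        then have "int n = \<bar>k\<bar>\<^sup>2" "k \<noteq> 0" using False by auto
        then show False using F by (metis zero_less_abs_iff)
      qed
      then show ?thesis unfolding if_not_P[OF F] by simp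
    qed
    finally show ?thesis by simp
  qed
  have ode: "fps_XD F * theta = F * (?T + ?T + ?T + ?T)"
  proof (rule fps_ext)
    fix n
    have "(fps_XD F * theta) $ n = (\<Sum>k | nat (k\<^sup>2) \<le> n. (real n - real_of_int (k\<^sup>2)) * of_int (dsum4 (n - nat (k\<^sup>2))))"
      unfolding theta_def mult_gfs_nth[OF fin_fib_square1]
      by (simp, intro sum.cong refl) (auto simp: XD_nth F_def of_nat_diff nat_le_iff)
    moreover have "(F * ?T) $ n = (\<Sum>k | nat (k\<^sup>2) \<le> n. of_int (k\<^sup>2) * of_int (dsum4 (n - nat (k\<^sup>2))))"
      unfolding theta_def XD_gfs mult_gfs_nth[OF fin_fib_square1] by (simp add: F_def)
    then have "(F * (?T + ?T + ?T + ?T)) $ n = 4 * (\<Sum>k | nat (k\<^sup>2) \<le> n. of_int (k\<^sup>2) * of_int (dsum4 (n - nat (k\<^sup>2))))"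
      unfolding distrib_left fps_add_nth by simp
    ultimately have "(fps_XD F * theta) $ n - (F * (?T + ?T + ?T + ?T)) $ n =
      of_int (\<Sum>k | nat (k\<^sup>2) \<le> n. (int n - 5 * k\<^sup>2) * dsum4 (n - nat (k\<^sup>2)))"
      by (simp add: sum_distrib_left sum_subtractf[symmetric] algebra_simps)
    then show "(fps_XD F * theta) $ n = (F * (?T + ?T + ?T + ?T)) $ n" unfolding key by simp
  qed
  have "theta * theta * theta * theta = F"
  proof (rule fps_ode_unique[where m = 0 and k = 1])
    show "fps_XD (theta * theta * theta * theta) * theta = theta * theta * theta * theta * (?T + ?T + ?T + ?T)"
      by (simp add: XD_mult algebra_simps)
    show "fps_XD F * theta = F * (?T + ?T + ?T + ?T)" by (rule ode)
  qed (simp_all add: theta_0 XD_nth F_def dsum4_def)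
  then show ?thesis by (simp add: F_def)
qed

lemma theta_split: "theta = theta_odd + theta_even"
proof (rule fps_ext)
  fix n
  have fin: "finite {k \<in> S. nat (k\<^sup>2) = n}" for S :: "int set" by (rule fin_fib_eq[OF fin_fib_square1])
  have u: "{k \<in> UNIV. nat (k\<^sup>2) = n} = {k \<in> {k. odd k}. nat (k\<^sup>2) = n} \<union> {k \<in> {k. even k}. nat (k\<^sup>2) = n}"
    by auto
  have "theta $ n = (\<Sum>x\<in>{k \<in> {k :: int. odd k}. nat (k\<^sup>2) = n}. 1) + (\<Sum>x\<in>{k \<in> {k :: int. even k}. nat (k\<^sup>2) = n}. 1)"
    unfolding theta_def gfs_nth u by (rule sum.union_disjoint[OF fin fin]) auto
  also have "(\<Sum>x\<in>{k \<in> {k :: int. even k}. nat (k\<^sup>2) = n}. 1 :: real) = (\<Sum>x\<in>{k :: int. nat (4 * k\<^sup>2) = n}. 1)"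
    by (rule sum.reindex_bij_witness[of _ "\<lambda>k. 2 * k" "\<lambda>k. k div 2"]) (auto simp: power_mult_distrib elim!: evenE)
  finally show "theta $ n = (theta_odd + theta_even) $ n" by (simp add: theta_odd_def theta_even_def gfs_nth)
qed

section \<open>Theta products sorted by exponents modulo 4\<close>

definition supp4 :: "nat \<Rightarrow> real fps \<Rightarrow> bool" where
  "supp4 r F \<longleftrightarrow> (\<forall>n. n mod 4 \<noteq> r mod 4 \<longrightarrow> F $ n = 0)"

lemma supp4_mult: "supp4 r F \<Longrightarrow> supp4 s G \<Longrightarrow> supp4 (r + s) (F * G)"
  unfolding supp4_def
proof (intro allI impI)
  fix n
  assume F: "\<forall>n. n mod 4 \<noteq> r mod 4 \<longrightarrow> F $ n = 0" and G: "\<forall>n. n mod 4 \<noteq> s mod 4 \<longrightarrow> G $ n = 0"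
    and n: "n mod 4 \<noteq> (r + s) mod 4"
  have "F $ i * G $ (n - i) = 0" if "i \<in> {0..n}" for i
  proof -
    have "i mod 4 \<noteq> r mod 4 \<or> (n - i) mod 4 \<noteq> s mod 4"
    proof (rule ccontr)
      assume "\<not> ?thesis"
      then have "(i + (n - i)) mod 4 = (r + s) mod 4" by (intro mod_add_cong) auto
      then show False using n that by simp
    qed
    then show ?thesis using F G by auto
  qed
  then show "(F * G) $ n = 0" unfolding fps_mult_nth by (intro sum.neutral) auto
qed

lemma odd_square_mod_8: "odd k \<Longrightarrow> (k :: int)\<^sup>2 mod 8 = 1"
proof -
  assume "odd k"
  then obtain l where k: "k = 2 * l + 1" by (rule oddE)
  have "even (l * (l + 1))" by simp
  then obtain h where "l * (l + 1) = 2 * h" by (rule evenE)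
  then have "k\<^sup>2 = 1 + h * 8" using k by (simp add: power2_eq_square algebra_simps)
  then show ?thesis by simp
qed

lemma supp4_theta_odd: "supp4 1 theta_odd"
  unfolding supp4_def theta_odd_def gfs_nth
proof (intro allI impI)
  fix n :: nat assume n: "n mod 4 \<noteq> 1 mod 4"
  have "{x \<in> {k :: int. odd k}. nat (x\<^sup>2) = n} = {}"
  proof (rule ccontr)
    assume "\<not> ?thesis"
    then obtain k :: int where "odd k" "nat (k\<^sup>2) = n" by auto
    then have "int n = k\<^sup>2" "k\<^sup>2 mod 8 = 1" using odd_square_mod_8 by auto
    then have "int (n mod 8) = 1" by (simp add: zmod_int)
    then have "n mod 8 = 1" by simp
    then have "n mod 4 = 1" by presburger
    then show False using n by simp
  qed
  then show "(\<Sum>x\<in>{x \<in> {k :: int. odd k}. nat (x\<^sup>2) = n}. 1 :: real) = 0" by (simp only: sum.empty)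
qed

lemma supp4_theta_even: "supp4 0 theta_even"
  unfolding supp4_def theta_even_def gfs_nth
proof (intro allI impI)
  fix n :: nat assume n: "n mod 4 \<noteq> 0 mod 4"
  have "{x :: int. nat (4 * x\<^sup>2) = n} = {}"
  proof (rule ccontr)
    assume "\<not> ?thesis"
    then obtain k :: int where "nat (4 * k\<^sup>2) = n" by auto
    then have "int n = 4 * k\<^sup>2" by auto
    then have "int 4 dvd int n" by simp
    then show False using n by (simp only: int_dvd_int_iff) auto
  qed
  then show "(\<Sum>x\<in>{x \<in> UNIV. nat (4 * x\<^sup>2) = n}. 1 :: real) = 0" by simp
qed

text \<open>Odd squares are 1 and even squares 0 modulo 4, so for such \<open>n\<close> exactly one
  of the four squares is odd. The four positions of the odd one account for the factor between 2 and
  8.\<close>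

lemma theta_odd_even_cube:
  assumes "n mod 4 = 1"
  shows "(theta_odd * theta_even * theta_even * theta_even) $ n = 2 * real_of_int (\<Sum>d | d > 0 \<and> d dvd int n. d)"
proof -
  let ?A = theta_odd and ?P = theta_even
  note s = supp4_theta_odd supp4_theta_even
  have "supp4 (0 + 0 + 0 + 0) (?P * ?P * ?P * ?P)" "supp4 (1 + 1 + 0 + 0) (?A * ?A * ?P * ?P)"
    "supp4 (1 + 1 + 1 + 0) (?A * ?A * ?A * ?P)" "supp4 (1 + 1 + 1 + 1) (?A * ?A * ?A * ?A)"
    by (intro supp4_mult s)+
  then have z: "(?P * ?P * ?P * ?P) $ n = 0" "(?A * ?A * ?P * ?P) $ n = 0" "(?A * ?A * ?A * ?P) $ n = 0"
    "(?A * ?A * ?A * ?A) $ n = 0"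
    using assms unfolding supp4_def by auto
  let ?X = "?A * ?P * ?P * ?P" and ?Y = "?A * ?A * ?P * ?P" and ?Z = "?A * ?A * ?A * ?P"
  have "theta * theta * theta * theta = (?A + ?P) * (?A + ?P) * (?A + ?P) * (?A + ?P)" by (simp only: theta_split)
  also have "\<dots> = ?X + ?X + ?X + ?X + (?P * ?P * ?P * ?P + (?Y + ?Y + ?Y + ?Y + ?Y + ?Y) + (?Z + ?Z + ?Z + ?Z) + ?A * ?A * ?A * ?A)"
    by (simp add: algebra_simps)
  finally have eq: "theta * theta * theta * theta = \<dots>" .
  have "(theta * theta * theta * theta) $ n = 4 * ?X $ n" unfolding eq fps_add_nth z by simp
  moreover have "(theta * theta * theta * theta) $ n = 8 * real_of_int (\<Sum>d | d > 0 \<and> d dvd int n. d)"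
  proof -
    have "odd (int n)" using assms by presburger
    then have "\<not> 4 dvd d" if "d dvd int n" for d using that by (meson dvd_trans even_numeral)
    then have "{d. d > 0 \<and> d dvd int n \<and> \<not> 4 dvd d} = {d. d > 0 \<and> d dvd int n}" by blast
    moreover have "n \<noteq> 0" using assms by presburger
    ultimately show ?thesis by (simp add: theta_power_4 dsum4_def)
  qed
  ultimately show ?thesis by simp
qed

lemma gfs_mult3_nth:
  assumes "fin_fib S \<phi>" "fin_fib S' \<phi>'" "fin_fib S'' \<phi>''"
  shows "(gfs S w \<phi> * (gfs S' w' \<phi>' * gfs S'' w'' \<phi>'')) $ n =
    (\<Sum>(x, y, z)\<in>{(x, y, z). x \<in> S \<and> y \<in> S' \<and> z \<in> S'' \<and> \<phi> x + (\<phi>' y + \<phi>'' z) = n}. w x * (w' y * w'' z))"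
  unfolding gfs_mult[OF assms(2,3)] gfs_mult[OF assms(1) fin_fib_prod[OF assms(2,3)]] gfs_nth
  by (rule sum.cong) auto

section \<open>Jacobi's identity and its coefficient at a prime\<close>

definition theta_alt :: "int \<Rightarrow> real fps" where
  "theta_alt c = gfs UNIV (\<lambda>u. (- 1) powi u) (\<lambda>u :: int. nat (c * u\<^sup>2))"

text \<open>Twice the cube of the eta function with argument multiplied by 8; each summand is an
  even function of \<open>m\<close>, whence the factor 2.\<close>

definition theta_chi :: "real fps" where
  "theta_chi = gfs {m :: int. odd m} (\<lambda>m. of_int (chi_m4 m * m)) (\<lambda>m. nat (m\<^sup>2))"

lemma chi_m4_minus: "chi_m4 (- m) = - chi_m4 m"
proof -
  have "- m mod 4 = 1 \<longleftrightarrow> m mod 4 = 3" "- m mod 4 = 3 \<longleftrightarrow> m mod 4 = 1" by presburger+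
  then show ?thesis by (simp add: chi_m4_def cong_def)
qed

lemma powi_minus_one: "(- 1 :: real) powi u = (if even u then 1 else - 1)"
  by (simp add: power_int_minus_left)

lemma chi_m4_shift: "odd p \<Longrightarrow> real_of_int (chi_m4 (p + 2 * w)) = of_int (chi_m4 p) * (- 1) powi w"
proof -
  assume "odd p"
  then have p: "p mod 4 = 1 \<or> p mod 4 = 3" by presburger
  show ?thesis
  proof (cases "even w")
    case True
    then obtain v where "w = 2 * v" by (rule evenE)
    then have "(p + 2 * w) mod 4 = p mod 4" by presburger
    then show ?thesis using True p by (auto simp: chi_m4_def cong_def powi_minus_one)
  next
    case False
    then obtain v where "w = 2 * v + 1" by (rule oddE)
    then have "(p + 2 * w) mod 4 = (p + 2) mod 4" by presburger
    moreover have "(p + 2) mod 4 = 4 - p mod 4" using p by presburger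
    ultimately have "(p + 2 * w) mod 4 = 4 - p mod 4" by simp
    then show ?thesis using False p by (auto simp: chi_m4_def cong_def powi_minus_one)
  qed
qed

text \<open>The sum is a coefficient of the difference of the two sides of the differential equation
  for \<open>theta_chi\<close>. After rotation of the variables (m, a) and symmetrisation it becomes
  antisymmetric under the exchange of \<open>w\<close> and \<open>u\<close>.\<close>

lemma chi_theta_cancel:
  assumes "finite {(m, a, u). odd m \<and> odd a \<and> m\<^sup>2 + a\<^sup>2 + 8 * u\<^sup>2 = n}"
  shows "(\<Sum>(m, a, u)\<in>{(m :: int, a, u). odd m \<and> odd a \<and> m\<^sup>2 + a\<^sup>2 + 8 * u\<^sup>2 = n}.
    of_int (chi_m4 m) * of_int m * (- 1) powi u * real_of_int (m\<^sup>2 - a\<^sup>2 - 16 * u\<^sup>2)) = 0"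
proof -
  let ?T = "{(m :: int, a, u). odd m \<and> odd a \<and> m\<^sup>2 + a\<^sup>2 + 8 * u\<^sup>2 = n}"
  let ?T1 = "{(m :: int, a, u). odd m \<and> odd a \<and> m\<^sup>2 + a\<^sup>2 + 8 * u\<^sup>2 = n \<and> 4 dvd m - a}"
  let ?T2 = "{(m :: int, a, u). odd m \<and> odd a \<and> m\<^sup>2 + a\<^sup>2 + 8 * u\<^sup>2 = n \<and> \<not> 4 dvd m - a}"
  let ?P = "{(p :: int, w, u). odd p \<and> 2 * p\<^sup>2 + 8 * w\<^sup>2 + 8 * u\<^sup>2 = n}"
  define g where "g = (\<lambda>(m, a, u). of_int (chi_m4 m) * of_int m * (- 1) powi u * real_of_int (m\<^sup>2 - a\<^sup>2 - 16 * u\<^sup>2))"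
  define h where "h = (\<lambda>(p, w, u). of_int (chi_m4 (p + 2 * w)) * of_int (p + 2 * w) * (- 1) powi u * real_of_int (8 * p * w - 16 * u\<^sup>2))"
  define k where "k = (\<lambda>(p, w, u). of_int (chi_m4 p) * (- 1) powi w * (- 1) powi u * real_of_int (32 * p * (w\<^sup>2 - u\<^sup>2)))"
  have fin: "finite ?T1" "finite ?T2" by (rule finite_subset[OF _ assms]; auto)+
  have d4: "4 dvd m + a \<longleftrightarrow> \<not> 4 dvd m - a" if "odd m" "odd a" for m a :: int using that by presburger
  have "?T = ?T1 \<union> ?T2" by blast
  then have "sum g ?T = sum g ?T1 + sum g ?T2" using fin by (simp only: sum.union_disjoint[OF fin]) (subst sum.union_disjoint[OF fin], auto)
  also have "sum g ?T2 = sum g ?T1"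
    by (rule sum.reindex_bij_witness[of _ "\<lambda>(m, a, u). (m, - a, u)" "\<lambda>(m, a, u). (m, - a, u)"])
       (auto simp: g_def d4)
  \<comment> \<open>Put \<open>m = p + 2 * w\<close> and \<open>a = p - 2 * w\<close>: then
    \<open>m\<^sup>2 + a\<^sup>2 = 2 * p\<^sup>2 + 8 * w\<^sup>2\<close>, which puts
    \<open>w\<close> on the same footing as \<open>u\<close>, and \<open>chi_m4 m\<close> becomes
    \<open>chi_m4 p\<close> times the sign of \<open>w\<close> modulo 2.\<close>
  also have "sum g ?T1 = sum h ?P"
  proof (rule sum.reindex_bij_witness[of _ "\<lambda>(p, w, u). (p + 2 * w, p - 2 * w, u)" "\<lambda>(m, a, u). ((m + a) div 2, (m - a) div 4, u)"], goal_cases)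
    case (1 x)
    then obtain m a u where x: "x = (m, a, u)" "odd m" "odd a" "4 dvd m - a" by auto
    then have "(m + a) div 2 + 2 * ((m - a) div 4) = m" "(m + a) div 2 - 2 * ((m - a) div 4) = a" by presburger+
    then show ?case using x by simp
  next
    case (2 x)
    then obtain m a u where x: "x = (m, a, u)" "odd m" "odd a" "4 dvd m - a" "m\<^sup>2 + a\<^sup>2 + 8 * u\<^sup>2 = n" by auto
    define w where "w = (m - a) div 4"
    define p where "p = (m + a) div 2"
    have e: "m = p + 2 * w" "a = p - 2 * w" "odd p" using x(2-4) unfolding w_def p_def by presburger+
    show ?case unfolding x(1) prod.case p_def[symmetric] w_def[symmetric]
      using x(5) e(3) unfolding e(1,2) by (simp add: power2_eq_square algebra_simps)
  next
    case (3 x) then show ?case by auto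
  next
    case (4 x) then show ?case by (auto simp: power2_eq_square algebra_simps)
  next
    case (5 x)
    then obtain m a u where x: "x = (m, a, u)" "odd m" "odd a" "4 dvd m - a" by auto
    define w where "w = (m - a) div 4"
    define p where "p = (m + a) div 2"
    have e: "m = p + 2 * w" "a = p - 2 * w" using x(2-4) unfolding w_def p_def by presburger+
    have "m\<^sup>2 - a\<^sup>2 = 8 * p * w" unfolding e by (simp add: power2_eq_square algebra_simps)
    then show ?case unfolding x(1) g_def h_def prod.case p_def[symmetric] w_def[symmetric] e(1)[symmetric] by simp
  qed
  also have "sum h ?P = 0"
  proof -
    have "sum h ?P = (\<Sum>(p, w, u)\<in>?P. h (p, - w, u))"
      by (rule sum.reindex_bij_witness[of _ "\<lambda>(p, w, u). (p, - w, u)" "\<lambda>(p, w, u). (p, - w, u)"]) auto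
    then have "2 * sum h ?P = (\<Sum>x\<in>?P. h x + (case x of (p, w, u) \<Rightarrow> h (p, - w, u)))" by (simp add: sum.distrib)
    also have "\<dots> = sum k ?P"
    proof (rule sum.cong[OF refl], clarify)
      fix p w u :: int assume "odd p"
      have *: "real_of_int (chi_m4 (p + 2 * (- w))) = of_int (chi_m4 p) * (- 1) powi w"
        using chi_m4_shift[OF \<open>odd p\<close>, of "- w"] by (simp add: powi_minus_one)
      show "h (p, w, u) + h (p, - w, u) = k (p, w, u)"
        unfolding h_def k_def prod.case * chi_m4_shift[OF \<open>odd p\<close>, of w] by (simp add: algebra_simps power2_eq_square)
    qed
    also have "sum k ?P = 0"
    proof -
      have "sum k ?P = (\<Sum>x\<in>?P. - k x)"
        by (rule sum.reindex_bij_witness[of _ "\<lambda>(p, w, u). (p, u, w)" "\<lambda>(p, w, u). (p, u, w)"])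
           (auto simp: k_def algebra_simps)
      then show ?thesis by (simp add: sum_negf)
    qed
    finally show ?thesis by simp
  qed
  finally show ?thesis by (simp add: g_def)
qed

lemma fin_fib_theta: "fin_fib {m. odd m} (\<lambda>m :: int. nat (m\<^sup>2))" "fin_fib UNIV (\<lambda>m :: int. nat (8 * m\<^sup>2))"
  "fin_fib UNIV (\<lambda>m :: int. nat (4 * m\<^sup>2))"
  using fin_fib_square1 fin_fib_square[of 8] fin_fib_square[of 4] by auto

text \<open>Jacobi's identity for the cube of the eta function: both sides satisfy the same linear
  differential equation.\<close>

lemma theta_odd_alt_square: "theta_odd * theta_alt 8 * theta_alt 8 = theta_chi"
proof -
  let ?A = theta_odd and ?M = "theta_alt 8" and ?R = theta_chi
  have tri: "{(x :: int, y, z). x \<in> {m. odd m} \<and> y \<in> {m. odd m} \<and> z \<in> UNIV \<and> nat (x\<^sup>2) + (nat (y\<^sup>2) + nat (8 * z\<^sup>2)) = n} =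
    {(m, a, u). odd m \<and> odd a \<and> m\<^sup>2 + a\<^sup>2 + 8 * u\<^sup>2 = int n}" for n
  proof -
    have "nat (x\<^sup>2) + (nat (y\<^sup>2) + nat (8 * z\<^sup>2)) = n \<longleftrightarrow> x\<^sup>2 + y\<^sup>2 + 8 * z\<^sup>2 = int n" for x y z :: int
      by (simp flip: nat_add_distrib) (simp add: nat_eq_iff algebra_simps)
    then show ?thesis by auto
  qed
  note g3 = gfs_mult3_nth[OF fin_fib_theta(1) fin_fib_theta(1) fin_fib_theta(2), unfolded tri]
  have fin: "finite {(m :: int, a, u). odd m \<and> odd a \<and> m\<^sup>2 + a\<^sup>2 + 8 * u\<^sup>2 = int n}" for n
  proof -
    have "finite {x \<in> {m. odd m} \<times> {m. odd m} \<times> UNIV. (case x of (x, y) \<Rightarrow> nat (x\<^sup>2) + (case y of (y, z) \<Rightarrow> nat (y\<^sup>2) + nat (8 * z\<^sup>2))) = n}"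
      by (rule fin_fib_eq[OF fin_fib_prod[OF fin_fib_theta(1) fin_fib_prod[OF fin_fib_theta(1,2)]]])
    also have "{x \<in> {m. odd m} \<times> {m. odd m} \<times> UNIV. (case x of (x, y) \<Rightarrow> nat (x\<^sup>2) + (case y of (y, z) \<Rightarrow> nat (y\<^sup>2) + nat (8 * z\<^sup>2))) = n} =
      {(x :: int, y, z). x \<in> {m. odd m} \<and> y \<in> {m. odd m} \<and> z \<in> UNIV \<and> nat (x\<^sup>2) + (nat (y\<^sup>2) + nat (8 * z\<^sup>2)) = n}" by auto
    finally show ?thesis unfolding tri .
  qed
  have ode: "fps_XD ?R * (?A * ?M) = ?R * (fps_XD ?A * ?M + ?A * fps_XD ?M + ?A * fps_XD ?M)"
  proof (rule fps_ext)
    fix n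
    let ?T = "{(m :: int, a, u). odd m \<and> odd a \<and> m\<^sup>2 + a\<^sup>2 + 8 * u\<^sup>2 = int n}"
    have "(fps_XD ?R * (?A * ?M)) $ n - (?R * (fps_XD ?A * ?M + ?A * fps_XD ?M + ?A * fps_XD ?M)) $ n =
      (fps_XD ?R * (?A * ?M)) $ n - (?R * (fps_XD ?A * ?M)) $ n - (?R * (?A * fps_XD ?M)) $ n - (?R * (?A * fps_XD ?M)) $ n"
      unfolding distrib_left fps_add_nth by simp
    also have "\<dots> = (\<Sum>(m, a, u)\<in>?T. of_int (chi_m4 m) * of_int m * (- 1) powi u * real_of_int (m\<^sup>2 - a\<^sup>2 - 16 * u\<^sup>2))"
      unfolding theta_chi_def theta_odd_def theta_alt_def XD_gfs g3 sum_subtractf[symmetric]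
      by (rule sum.cong) (auto simp: algebra_simps)
    also have "\<dots> = 0" by (rule chi_theta_cancel[OF fin])
    finally show "(fps_XD ?R * (?A * ?M)) $ n = (?R * (fps_XD ?A * ?M + ?A * fps_XD ?M + ?A * fps_XD ?M)) $ n" by simp
  qed
  have M0: "?M $ 0 = 1"
  proof -
    have "{x :: int. nat (8 * x\<^sup>2) = 0} = {0}" by (auto simp: nat_eq_iff)
    then show ?thesis by (simp add: theta_alt_def gfs_nth)
  qed
  have s0: "{x \<in> {m :: int. odd m}. nat (x\<^sup>2) = 0} = {}" by (auto simp: nat_eq_iff)
  have s1: "{x \<in> {m :: int. odd m}. nat (x\<^sup>2) = 1} = {1, - 1}"
    by (auto simp: nat_eq_iff power2_eq_1_iff)
  have A0: "?A $ 0 = 0" and R0: "?R $ 0 = 0" unfolding theta_odd_def theta_chi_def gfs_nth s0 by simp_all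
  have A1: "?A $ 1 = 2" unfolding theta_odd_def gfs_nth s1 by simp
  have "chi_m4 1 = 1" "chi_m4 (- 1) = - 1" unfolding chi_m4_def cong_def by auto
  then have R1: "?R $ 1 = 2" unfolding theta_chi_def gfs_nth s1 by simp
  show ?thesis
  \<comment> \<open>\<open>theta_odd\<close> starts with twice the first power, so \<open>U\<close>
    has order 1. Both leading coefficients are 2, so the recursion determines coefficient
    \<open>n\<close> only from 2 onwards, and two initial coefficients are compared.\<close>
  proof (rule fps_ode_unique[where m = 1 and k = 2 and U = "?A * ?M"])
    show "fps_XD (?A * ?M * ?M) * (?A * ?M) = ?A * ?M * ?M * (fps_XD ?A * ?M + ?A * fps_XD ?M + ?A * fps_XD ?M)"
      by (simp add: XD_mult algebra_simps)
    show "fps_XD ?R * (?A * ?M) = ?R * (fps_XD ?A * ?M + ?A * fps_XD ?M + ?A * fps_XD ?M)" by (rule ode)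
    show "(?A * ?M * ?M) $ n = ?R $ n" if "n < 2" for n
    proof -
      have "n = 0 \<or> n = 1" using that by auto
      then show ?thesis using A0 A1 M0 R0 R1 by (auto simp: fps_mult_nth)
    qed
    show "of_nat n * (?A * ?M) $ 1 \<noteq> (fps_XD ?A * ?M + ?A * fps_XD ?M + ?A * fps_XD ?M) $ 1" if "n \<ge> 2" for n
      using that A0 A1 M0 by (simp add: fps_mult_nth XD_nth)
  qed (use A0 in \<open>auto simp: fps_mult_nth XD_nth\<close>)
qed

text \<open>In (k, s) the terms with \<open>k + s\<close> odd cancel under exchanging
  \<open>k\<close> and \<open>s\<close>; the others are rotated by k = u + v, s = u - v.\<close>

lemma theta_alt_double: "theta_even * theta_alt 4 = theta_alt 8 * theta_alt 8"
proof (rule fps_ext)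
  fix n
  let ?S = "{(k :: int, s). 4 * k\<^sup>2 + 4 * s\<^sup>2 = int n}"
  let ?S1 = "{(k :: int, s). 4 * k\<^sup>2 + 4 * s\<^sup>2 = int n \<and> even (k + s)}"
  let ?S2 = "{(k :: int, s). 4 * k\<^sup>2 + 4 * s\<^sup>2 = int n \<and> odd (k + s)}"
  define g where "g = (\<lambda>(k :: int, s :: int). (- 1 :: real) powi s)"
  have S: "{x \<in> UNIV \<times> UNIV. (case x of (x, y) \<Rightarrow> nat (4 * x\<^sup>2) + nat (4 * y\<^sup>2)) = n} = ?S"
  proof -
    have "nat (4 * x\<^sup>2) + nat (4 * y\<^sup>2) = n \<longleftrightarrow> 4 * x\<^sup>2 + 4 * y\<^sup>2 = int n" for x y :: int
      by (simp flip: nat_add_distrib) (simp add: nat_eq_iff)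
    then show ?thesis by auto
  qed
  have S': "{x \<in> UNIV \<times> UNIV. (case x of (x, y) \<Rightarrow> nat (8 * x\<^sup>2) + nat (8 * y\<^sup>2)) = n} = {(u :: int, v). 8 * u\<^sup>2 + 8 * v\<^sup>2 = int n}"
  proof -
    have "nat (8 * x\<^sup>2) + nat (8 * y\<^sup>2) = n \<longleftrightarrow> 8 * x\<^sup>2 + 8 * y\<^sup>2 = int n" for x y :: int
      by (simp flip: nat_add_distrib) (simp add: nat_eq_iff)
    then show ?thesis by auto
  qed
  have "finite ?S" using fin_fib_eq[OF fin_fib_prod[OF fin_fib_theta(3,3)], of n] unfolding S .
  then have fin: "finite ?S1" "finite ?S2" by (auto intro: finite_subset[of _ ?S])
  have "(theta_even * theta_alt 4) $ n = sum g ?S"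
    unfolding theta_even_def theta_alt_def gfs_mult[OF fin_fib_theta(3,3)] gfs_nth S g_def by simp
  also have "?S = ?S1 \<union> ?S2" by blast
  also have "sum g (?S1 \<union> ?S2) = sum g ?S1 + sum g ?S2" by (rule sum.union_disjoint[OF fin]) auto
  also have "sum g ?S2 = (\<Sum>x\<in>?S2. - g x)"
    by (rule sum.reindex_bij_witness[of _ "\<lambda>(k, s). (s, k)" "\<lambda>(k, s). (s, k)"])
       (auto simp: g_def powi_minus_one)
  then have "sum g ?S2 = 0" by (simp add: sum_negf)
  also have "sum g ?S1 = (\<Sum>(u, v)\<in>{(u :: int, v). 8 * u\<^sup>2 + 8 * v\<^sup>2 = int n}. (- 1) powi u * (- 1) powi v)"
  proof (rule sum.reindex_bij_witness[of _ "\<lambda>(u, v). (u + v, u - v)" "\<lambda>(k, s). ((k + s) div 2, (k - s) div 2)"], goal_cases)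
    case (1 x)
    then obtain k s where x: "x = (k, s)" "even (k + s)" by auto
    have "(k + s) div 2 + (k - s) div 2 = k" "(k + s) div 2 - (k - s) div 2 = s" using x(2) by presburger+
    then show ?case using x by simp
  next
    case (2 x)
    then obtain k s where x: "x = (k, s)" "even (k + s)" "4 * k\<^sup>2 + 4 * s\<^sup>2 = int n" by auto
    define u v where "u = (k + s) div 2" and "v = (k - s) div 2"
    have e: "k = u + v" "s = u - v" using x(2) unfolding u_def v_def by presburger+
    show ?case unfolding x(1) prod.case u_def[symmetric] v_def[symmetric]
      using x(3) unfolding e by (simp add: power2_eq_square algebra_simps)
  next
    case (3 x) then show ?case by auto
  next
    case (4 x) then show ?case by (auto simp: power2_eq_square algebra_simps)
  next
    case (5 x)
    then obtain k s where x: "x = (k, s)" "even (k + s)" by auto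
    have "even s \<longleftrightarrow> (even ((k + s) div 2) \<longleftrightarrow> even ((k - s) div 2))" using x(2) by presburger
    then show ?case unfolding x(1) g_def prod.case powi_minus_one by auto
  qed
  finally show "(theta_even * theta_alt 4) $ n = (theta_alt 8 * theta_alt 8) $ n"
    unfolding theta_alt_def gfs_mult[OF fin_fib_theta(2,2)] gfs_nth S' by simp
qed

lemma theta_chi_product: "theta_odd * theta_even * theta_even * theta_alt 4 = theta_chi * theta_even"
  unfolding theta_odd_alt_square[symmetric] using theta_alt_double by (simp add: mult_ac)

text \<open>One of \<open>x * v - u * y\<close> and \<open>x * v + u * y\<close> is divisible by
  \<open>p\<close>. The composition identity for the two representations, with value
  \<open>p * p\<close>, contains 4 times its square, so it must vanish.\<close>

lemma prime_two_squares_unique: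
  fixes p x y u v :: int
  assumes p: "prime p" and 1: "p = x\<^sup>2 + 4 * y\<^sup>2" and 2: "p = u\<^sup>2 + 4 * v\<^sup>2"
  shows "u\<^sup>2 = x\<^sup>2 \<and> v\<^sup>2 = y\<^sup>2"
proof -
  have p0: "p > 0" using p by (rule prime_gt_0_int)
  have "(x * v - u * y) * (x * v + u * y) = p * (v\<^sup>2 - y\<^sup>2)"
  proof -
    have "(x * v - u * y) * (x * v + u * y) = x\<^sup>2 * v\<^sup>2 - u\<^sup>2 * y\<^sup>2" by (simp add: power2_eq_square algebra_simps)
    also have "\<dots> = (p - 4 * y\<^sup>2) * v\<^sup>2 - (p - 4 * v\<^sup>2) * y\<^sup>2" using 1 2 by simp
    also have "\<dots> = p * (v\<^sup>2 - y\<^sup>2)" by (simp add: algebra_simps)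
    finally show ?thesis .
  qed
  then have "p dvd x * v - u * y \<or> p dvd x * v + u * y" using p by (metis dvd_triv_left prime_dvd_mult_iff)
  then obtain e :: int where e: "e = 1 \<or> e = - 1" and d: "p dvd x * v - e * u * y" by force
  have id: "p * p = (x * u + 4 * e * y * v)\<^sup>2 + 4 * (x * v - e * u * y)\<^sup>2"
  proof -
    have "p * p = (x\<^sup>2 + 4 * y\<^sup>2) * (u\<^sup>2 + 4 * v\<^sup>2)" using 1 2 by simp
    then show ?thesis using e by (auto simp: power2_eq_square algebra_simps)
  qed
  have z: "x * v - e * u * y = 0"
  proof (rule ccontr)
    assume "x * v - e * u * y \<noteq> 0"
    then have "\<bar>p\<bar> \<le> \<bar>x * v - e * u * y\<bar>" using d by (rule dvd_imp_le_int)
    then have "p\<^sup>2 \<le> (x * v - e * u * y)\<^sup>2" by (rule abs_le_square_iff[THEN iffD1])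
    moreover have "0 \<le> (x * u + 4 * e * y * v)\<^sup>2" by simp
    ultimately have "p\<^sup>2 \<le> 0" using id unfolding power2_eq_square by linarith
    then show False using p0 by simp
  qed
  then have "(x * v)\<^sup>2 = (e * u * y)\<^sup>2" by simp
  then have "x\<^sup>2 * v\<^sup>2 = u\<^sup>2 * y\<^sup>2" using e by (auto simp: power_mult_distrib)
  then have "(x\<^sup>2 + 4 * y\<^sup>2) * v\<^sup>2 = (u\<^sup>2 + 4 * v\<^sup>2) * y\<^sup>2" by (simp only: distrib_right) simp
  then have "p * v\<^sup>2 = p * y\<^sup>2" by (simp only: 1[symmetric] 2[symmetric])
  then have "v\<^sup>2 = y\<^sup>2" using p0 by simp
  then show ?thesis using 1 2 by simp
qed

text \<open>The product equals \<open>theta_chi * theta_even\<close>, whose coefficient at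
  \<open>p\<close> involves only the four representations with signs of \<open>x\<close> and
  \<open>y\<close>; \<open>chi_m4 m * m\<close> has the same value at all of them.\<close>

lemma theta_chi_even_prime:
  assumes p: "prime p" "int p = x\<^sup>2 + 4 * y\<^sup>2" "odd p"
  shows "(theta_odd * theta_even * theta_even * theta_alt 4) $ p = 4 * real_of_int (chi_m4 x * x)"
proof -
  have pi: "prime (int p)" "odd (int p)" using p(1,3) by simp_all
  have "y \<noteq> 0"
  proof
    assume "y = 0"
    then have "int p = x * x" using p(2) by (simp add: power2_eq_square)
    moreover have "irreducible (int p)" using pi(1) by (simp add: prime_elem_imp_irreducible)
    ultimately have "x dvd 1" using irreducibleD[of "int p" x x] by auto
    then have "int p dvd 1" by (simp only: \<open>int p = x * x\<close> is_unit_mult_iff)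
    then show False using pi(1) not_prime_unit by blast
  qed
  have ox: "odd x"
  proof
    assume "even x"
    then have "even (x\<^sup>2 + 4 * y\<^sup>2)" by simp
    then show False using pi(2) unfolding p(2) by blast
  qed
  then have "x \<noteq> 0" by auto
  have "{z \<in> {m. odd m} \<times> UNIV. (case z of (m, k) \<Rightarrow> nat (m\<^sup>2) + nat (4 * k\<^sup>2)) = p} = {x, - x} \<times> {y, - y}"
  proof -
    have "nat (m\<^sup>2) + nat (4 * k\<^sup>2) = p \<longleftrightarrow> int p = m\<^sup>2 + 4 * k\<^sup>2" for m k :: int
      by (simp flip: nat_add_distrib) (auto simp: nat_eq_iff)
    moreover have "int p = m\<^sup>2 + 4 * k\<^sup>2 \<longleftrightarrow> (m = x \<or> m = - x) \<and> (k = y \<or> k = - y)" for m k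
      using prime_two_squares_unique[OF pi(1) p(2), of m k] p(2) by (auto simp: power2_eq_iff)
    ultimately show ?thesis using ox by auto
  qed
  then have "(theta_chi * theta_even) $ p = (\<Sum>(m, k)\<in>{x, - x} \<times> {y, - y}. of_int (chi_m4 m * m))"
    unfolding theta_chi_def theta_even_def gfs_mult[OF fin_fib_theta(1,3)] gfs_nth by simp
  also have "\<dots> = (\<Sum>m\<in>{x, - x}. \<Sum>k\<in>{y, - y}. of_int (chi_m4 m * m))" by (rule sum.cartesian_product[symmetric])
  also have "\<dots> = 4 * real_of_int (chi_m4 x * x)" using \<open>x \<noteq> 0\<close> \<open>y \<noteq> 0\<close> by (simp add: chi_m4_minus)
  finally show ?thesis unfolding theta_chi_product .
qed

section \<open>Class number sums\<close>

text \<open>The weighted number of triples in which the third entry is the one of differing parity.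
  It is the part of the triple count seen by the classes \<open>2 1 k\<close>; \<open>vsum\<close>
  is the part seen by the classes \<open>1 2 k\<close>.\<close>

definition usum :: "int \<Rightarrow> real" where
  "usum n = (\<Sum>(x, y, z)\<in>{(x, y, z) \<in> triples n. even (x + y) \<and> odd (x + z)}. hw (x, y, z))"

definition vsum :: "int \<Rightarrow> real" where
  "vsum n = (\<Sum>(x, y, z)\<in>{(x, y, z) \<in> triples n. even (x + y) \<and> even (x + z)}. hw (x, y, z))"

lemma finite_triplesP: "n > 0 \<Longrightarrow> finite {(x, y, z) \<in> triples n. P x y z}"
  by (rule finite_subset[OF _ finite_triples[of n]]) auto

lemma hw_perm: "hw (y, x, z) = hw (x, y, z)" "hw (x, z, y) = hw (x, y, z)" "hw (z, y, x) = hw (x, y, z)" by auto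

text \<open>Either all parities agree or exactly one entry differs; its three positions are
  equivalent by symmetry.\<close>

lemma sum_hw_usum_vsum:
  assumes "n > 0"
  shows "(\<Sum>t\<in>triples n. hw t) = 3 * usum n + vsum n"
proof -
  let ?V = "{(x, y, z) \<in> triples n. even (x + y) \<and> even (x + z)}"
  let ?U1 = "{(x, y, z) \<in> triples n. even (x + y) \<and> odd (x + z)}"
  let ?U2 = "{(x, y, z) \<in> triples n. odd (x + y) \<and> even (x + z)}"
  let ?U3 = "{(x, y, z) \<in> triples n. odd (x + y) \<and> odd (x + z)}"
  note f = finite_triplesP[OF assms]
  have s: "triples n = (?V \<union> ?U1) \<union> (?U2 \<union> ?U3)" by auto
  have "sum hw (triples n) = sum hw (?V \<union> ?U1) + sum hw (?U2 \<union> ?U3)"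
    by (subst s, rule sum.union_disjoint) (use f in auto)
  also have "sum hw (?V \<union> ?U1) = sum hw ?V + sum hw ?U1" by (rule sum.union_disjoint) (use f in auto)
  also have "sum hw (?U2 \<union> ?U3) = sum hw ?U2 + sum hw ?U3" by (rule sum.union_disjoint) (use f in auto)
  also have "sum hw ?U2 = sum hw ?U1"
    by (rule sum.reindex_bij_witness[of _ "\<lambda>(x, y, z). (x, z, y)" "\<lambda>(x, y, z). (x, z, y)"])
       (auto simp: triples_perm hw_perm simp del: hw.simps)
  also have "sum hw ?U3 = sum hw ?U1"
  proof (rule sum.reindex_bij_witness[of _ "\<lambda>(x, y, z). (z, y, x)" "\<lambda>(x, y, z). (z, y, x)"])
    have p: "(z, y, x) \<in> triples n \<longleftrightarrow> (x, y, z) \<in> triples n" for x y z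
      using triples_perm by metis
    show "(case t of (x, y, z) \<Rightarrow> (z, y, x)) \<in> ?U1" if "t \<in> ?U3" for t using that by (auto simp: p)
    show "(case t of (x, y, z) \<Rightarrow> (z, y, x)) \<in> ?U3" if "t \<in> ?U1" for t using that by (auto simp: p)
  qed (auto simp: hw_perm simp del: hw.simps)
  finally have "sum hw (triples n) = 3 * sum hw ?U1 + sum hw ?V" by simp
  then show ?thesis by (simp add: usum_def vsum_def case_prod_unfold del: hw.simps)
qed

text \<open>With \<open>x + y = 2 * w\<close> one gets n \<equiv> 2 w - 1 or n \<equiv> 2 w modulo
  4. Hence each \<open>n\<close> contributes to only one of the classes \<open>2 1 3\<close> and
  \<open>2 1 4\<close>, which separates the even from the odd \<open>s\<close>.\<close>

lemma triples_mod_4: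
  assumes "(x, y, z) \<in> triples n" "even (x + y)" "odd (x + z)"
  shows "4 dvd x + y \<longleftrightarrow> n mod 4 = 0 \<or> n mod 4 = 3"
proof -
  have n: "n = x * y + z * (x + y)" using assms(1) by (simp add: triples_def algebra_simps)
  obtain w where w: "x + y = 2 * w" using assms(2) by (rule evenE)
  have dw: "4 dvd x + y \<longleftrightarrow> even w" unfolding w by presburger
  show ?thesis
  proof (cases "even z")
    case True
    then obtain z' where z': "z = 2 * z'" by (rule evenE)
    have "odd x" using assms(3) True by simp
    then obtain x' where x': "x = 2 * x' + 1" by (rule oddE)
    have y: "y = 2 * w - x" using w by simp
    have "n = 2 * w - 1 + 4 * (w * x' + z' * w - x' * x' - x')" unfolding n w y by (simp add: x' z' algebra_simps)
    then have "n mod 4 = (2 * w - 1) mod 4" by (simp only: mod_mult_self2)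
    then show ?thesis unfolding dw by presburger
  next
    case False
    then obtain z' where z': "z = 2 * z' + 1" by (rule oddE)
    have "even x" using assms(3) False by simp
    then obtain x' where x': "x = 2 * x'" by (rule evenE)
    have y: "y = 2 * w - x" using w by simp
    have "n = 2 * w + 4 * (x' * w - x' * x' + z' * w)" unfolding n w y by (simp add: x' z' algebra_simps)
    then have "n mod 4 = (2 * w) mod 4" by (simp only: mod_mult_self2)
    then show ?thesis unfolding dw by presburger
  qed
qed

text \<open>If all entries have the same parity, then \<open>n\<close> is congruent to
  \<open>3 * x\<^sup>2\<close> modulo 4.\<close>

lemma vsum_eq_0:
  assumes "n mod 4 = 1 \<or> n mod 4 = 2" shows "vsum n = 0"
proof -
  have False if t: "(x, y, z) \<in> triples n" "even (x + y)" "even (x + z)" for x y z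
  proof -
    have n: "n = x * y + y * z + z * x" using t(1) by (simp add: triples_def)
    obtain u v where uv: "y = x + 2 * u" "z = x + 2 * v"
    proof -
      have "even (y - x)" "even (z - x)" using t by simp_all
      then show ?thesis using that by (metis evenE diff_add_cancel add.commute)
    qed
    have "n = 3 * x\<^sup>2 + 4 * (x * u + x * v + u * v)" unfolding n uv by (simp add: power2_eq_square algebra_simps)
    then have "n mod 4 = (3 * x\<^sup>2) mod 4" by (simp only: mod_mult_self2)
    moreover have "(3 * x\<^sup>2) mod 4 = 0 \<or> (3 * x\<^sup>2) mod 4 = 3"
    proof (cases "even x")
      case True
      then obtain x' where "x = 2 * x'" by (rule evenE)
      then have "3 * x\<^sup>2 = 4 * (3 * x' * x')" by (simp add: power2_eq_square)
      then show ?thesis by simp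
    next
      case False
      then obtain x' where "x = 2 * x' + 1" by (rule oddE)
      then have "3 * x\<^sup>2 = 3 + 4 * (3 * x' * x' + 3 * x')" by (simp add: power2_eq_square algebra_simps)
      then have "(3 * x\<^sup>2) mod 4 = 3 mod 4" by (simp only: mod_mult_self2)
      then show ?thesis by simp
    qed
    ultimately show False using assms by auto
  qed
  then have "{(x, y, z) \<in> triples n. even (x + y) \<and> even (x + z)} = {}" by blast
  then show ?thesis by (simp only: vsum_def sum.empty)
qed

lemma sum_tcond:
  "(\<Sum>(x, y, z)\<in>{(x, y, z) \<in> triples n. tcond 2 4 x y z}. hw (x, y, z)) = (if n mod 4 = 1 \<or> n mod 4 = 2 then usum n else 0)"
  "(\<Sum>(x, y, z)\<in>{(x, y, z) \<in> triples n. tcond 2 3 x y z}. hw (x, y, z)) = (if n mod 4 = 0 \<or> n mod 4 = 3 then usum n else 0)"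
proof -
  have m: "n mod 4 = 0 \<or> n mod 4 = 3 \<longleftrightarrow> \<not> (n mod 4 = 1 \<or> n mod 4 = 2)" by presburger
  have 1: "{(x, y, z) \<in> triples n. tcond 2 4 x y z} =
    (if n mod 4 = 1 \<or> n mod 4 = 2 then {(x, y, z) \<in> triples n. even (x + y) \<and> odd (x + z)} else {})"
    using triples_mod_4[of _ _ _ n] m by (auto simp: tcond_def)
  have 2: "{(x, y, z) \<in> triples n. tcond 2 3 x y z} =
    (if n mod 4 = 0 \<or> n mod 4 = 3 then {(x, y, z) \<in> triples n. even (x + y) \<and> odd (x + z)} else {})"
    using triples_mod_4[of _ _ _ n] by (auto simp: tcond_def)
  show "(\<Sum>(x, y, z)\<in>{(x, y, z) \<in> triples n. tcond 2 4 x y z}. hw (x, y, z)) = (if n mod 4 = 1 \<or> n mod 4 = 2 then usum n else 0)"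
    unfolding 1 usum_def by simp
  show "(\<Sum>(x, y, z)\<in>{(x, y, z) \<in> triples n. tcond 2 3 x y z}. hw (x, y, z)) = (if n mod 4 = 0 \<or> n mod 4 = 3 then usum n else 0)"
    unfolding 2 usum_def by simp
qed

lemma sum_tcond_same:
  assumes "n > 0"
  shows "(\<Sum>(x, y, z)\<in>{(x, y, z) \<in> triples n. tcond 1 3 x y z}. hw (x, y, z)) +
    (\<Sum>(x, y, z)\<in>{(x, y, z) \<in> triples n. tcond 1 4 x y z}. hw (x, y, z)) = vsum n"
proof -
  have u: "{(x, y, z) \<in> triples n. even (x + y) \<and> even (x + z)} =
     {(x, y, z) \<in> triples n. tcond 1 3 x y z} \<union> {(x, y, z) \<in> triples n. tcond 1 4 x y z}"
    by (auto simp: tcond_def)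
  show ?thesis unfolding vsum_def u
    by (rule sum.union_disjoint[symmetric, OF finite_triplesP[OF assms] finite_triplesP[OF assms]]) (auto simp: tcond_def)
qed

text \<open>In this class every degenerate configuration contradicts the parities or the congruence
  modulo 4, so no assumption on \<open>N\<close> enters; squares are included.\<close>

lemma nondeg_swap: "nondeg 2 1 4 N"
  unfolding nondeg_def cls_iff(4)
proof (intro conjI allI impI notI)
  fix a b c :: int
  assume h: "even a \<and> odd b \<and> odd c \<and> even (- a) \<and> \<not> 4 dvd a + b - c - - a"
  show "b = 0 \<Longrightarrow> False" "c = 0 \<Longrightarrow> False" using h by auto
  show "c - b - 2 * a = 0 \<Longrightarrow> False"
  proof -
    assume "c - b - 2 * a = 0"
    then have "a + b - c - - a = 0" by simp
    then show False using h by simp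
  qed
  show "c - b + 2 * a = 0 \<Longrightarrow> False"
  proof -
    assume "c - b + 2 * a = 0"
    then have "a + b - c - - a = 4 * a" by simp
    then show False using h by simp
  qed
next
  fix a b c d :: int
  assume h: "even a \<and> odd b \<and> odd c \<and> even d \<and> \<not> 4 dvd a + b - c - d" "b * c < 0" "\<bar>a - d\<bar> = 2 * \<bar>b\<bar>" "\<bar>b\<bar> = \<bar>c\<bar>"
  have "c = - b" using h(2,4) by (auto simp: mult_less_0_iff)
  moreover have "a - d = 2 * b \<or> a - d = - 2 * b" using h(3) by linarith
  ultimately have "a + b - c - d = 4 * b \<or> a + b - c - d = 0" by linarith
  then show False using h(1) by (metis dvd_triv_left dvd_0_right)
qed auto

text \<open>A matrix that fixes a vertex, or a fixed point at the end of two walls, would exhibit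
  \<open>N\<close> as the square of \<open>a\<close>, \<open>a + b\<close> or
  \<open>a - b\<close>.\<close>

lemma nondeg_nonsquare:
  assumes "\<And>l. l * l \<noteq> N"
  shows "nondeg i j k N"
  unfolding nondeg_def
proof (intro conjI allI impI notI)
  fix a b c :: int
  assume h: "a * a + b * c = N"
  show "b = 0 \<Longrightarrow> False" "c = 0 \<Longrightarrow> False" using h assms[of a] by auto
  show "c - b - 2 * a = 0 \<Longrightarrow> False"
  proof -
    assume "c - b - 2 * a = 0"
    then have "c = b + 2 * a" by simp
    then have "(a + b) * (a + b) = N" using h by (simp add: algebra_simps)
    then show False using assms by blast
  qed
  show "c - b + 2 * a = 0 \<Longrightarrow> False"
  proof -
    assume "c - b + 2 * a = 0"
    then have c: "c = b - 2 * a" by simp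
    have "(a - b) * (a - b) = N" using h unfolding c by (simp add: algebra_simps)
    then show False using assms by blast
  qed
next
  fix a b c d :: int
  assume h: "a * d - b * c = N" "b * c < 0" "\<bar>a - d\<bar> = 2 * \<bar>b\<bar>" "\<bar>b\<bar> = \<bar>c\<bar>"
  have c: "c = - b" using h(2,4) by (auto simp: mult_less_0_iff)
  have "a - d = 2 * b \<or> a - d = - 2 * b" using h(3) by linarith
  then have "d = a - 2 * b \<or> d = a + 2 * b" by linarith
  then have "(a - b) * (a - b) = N \<or> (a + b) * (a + b) = N" using h(1) unfolding c by (auto simp: algebra_simps)
  then show False using assms by blast
qed (use assms in auto)

text \<open>The class \<open>2 1 4\<close> counted both ways, by cosets and by triples. Its validity
  for every positive odd \<open>N\<close> is what the induction in
  \<open>theta_odd_even_even\<close> uses.\<close>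

lemma usum_divisor_sum:
  assumes "N > 0" "odd N"
  shows "2 * (\<Sum>s | s\<^sup>2 < N. if (N - s\<^sup>2) mod 4 = 1 \<or> (N - s\<^sup>2) mod 4 = 2 then usum (N - s\<^sup>2) else 0) =
    real_of_int (\<Sum>d | d > 0 \<and> d dvd N. d)"
proof -
  have "real (card (fixers 2 1 4 N)) =
     (\<Sum>s | s\<^sup>2 < N. 4 * (\<Sum>(x, y, z)\<in>{(x, y, z) \<in> triples (N - s\<^sup>2). tcond 2 4 x y z}. hw (x, y, z)))"
    using card_fixers_sum[OF _ _ assms nondeg_swap card_fixers_lower(2)[OF assms]]
    by (simp add: sum_distrib_left case_prod_unfold del: hw.simps)
  also have "\<dots> = 4 * (\<Sum>s | s\<^sup>2 < N. if (N - s\<^sup>2) mod 4 = 1 \<or> (N - s\<^sup>2) mod 4 = 2 then usum (N - s\<^sup>2) else 0)"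
    unfolding sum_tcond by (simp only: sum_distrib_left)
  also have "real (card (fixers 2 1 4 N)) = 2 * real_of_int (\<Sum>d | d > 0 \<and> d dvd N. d)"
    unfolding card_fixers_swap[OF assms] by simp
  finally show ?thesis by simp
qed

text \<open>The class \<open>2 1 3\<close> counted both ways gives the first equation. The classes
  \<open>1 2 3\<close> and \<open>1 2 4\<close> together give the second: their numbers of fixers,
  \<open>2 * (p - 3)\<close> and \<open>2 * (p - 1)\<close>, add up to
  \<open>4 * (p - 2)\<close>.\<close>

lemma prime_sums:
  assumes p: "prime (p :: int)" "odd p"
  shows "2 * (\<Sum>s | s\<^sup>2 < p. if (p - s\<^sup>2) mod 4 = 0 \<or> (p - s\<^sup>2) mod 4 = 3 then usum (p - s\<^sup>2) else 0) = real_of_int p - 1"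
    and "(\<Sum>s | s\<^sup>2 < p. vsum (p - s\<^sup>2)) = real_of_int p - 2"
proof -
  have p0: "p > 0" using p(1) by (rule prime_gt_0_int)
  have p3: "p \<ge> 3" using prime_ge_2_int[OF p(1)] p(2) by (cases "p = 2") auto
  have sq: "l * l \<noteq> p" for l
  proof
    assume l: "l * l = p"
    have "irreducible p" using p(1) prime_elem_imp_irreducible prime_imp_prime_elem by blast
    then have "l dvd 1" using irreducibleD[OF _ l[symmetric]] by blast
    then have "p dvd 1" by (simp only: l[symmetric] is_unit_mult_iff)
    then show False using p(1) not_prime_unit by blast
  qed
  note nd = nondeg_nonsquare[of p, OF sq]
  have c: "real (card (fixers i j k p)) =
     4 * (\<Sum>s | s\<^sup>2 < p. \<Sum>(x, y, z)\<in>{(x, y, z) \<in> triples (p - s\<^sup>2). tcond i k x y z}. hw (x, y, z))"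
    if "i = 1 \<and> j = 2 \<or> i = 2 \<and> j = 1" "k = 3 \<or> k = 4" "finite (fixers i j k p)" for i j k
    using card_fixers_sum[OF that(1,2) p0 p(2) nd that(3)]
    by (simp add: sum_distrib_left case_prod_unfold del: hw.simps)
  have "real (card (fixers 2 1 3 p)) = 4 * (\<Sum>s | s\<^sup>2 < p. if (p - s\<^sup>2) mod 4 = 0 \<or> (p - s\<^sup>2) mod 4 = 3 then usum (p - s\<^sup>2) else 0)"
    using c[of 2 1 3] card_fixers_lower(2)[OF p0 p(2)] unfolding sum_tcond by simp
  moreover have "real (card (fixers 2 1 3 p)) = 2 * (real_of_int p - 1)"
    using card_fixers_prime(1)[OF p] p3 by (simp add: of_nat_diff)
  ultimately show "2 * (\<Sum>s | s\<^sup>2 < p. if (p - s\<^sup>2) mod 4 = 0 \<or> (p - s\<^sup>2) mod 4 = 3 then usum (p - s\<^sup>2) else 0) = real_of_int p - 1" by simp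
  have "real (card (fixers 1 2 3 p)) + real (card (fixers 1 2 4 p)) = 4 * (\<Sum>s | s\<^sup>2 < p. vsum (p - s\<^sup>2))"
  proof -
    have "real (card (fixers 1 2 3 p)) + real (card (fixers 1 2 4 p)) = 4 * (\<Sum>s | s\<^sup>2 < p.
       (\<Sum>(x, y, z)\<in>{(x, y, z) \<in> triples (p - s\<^sup>2). tcond 1 3 x y z}. hw (x, y, z)) +
       (\<Sum>(x, y, z)\<in>{(x, y, z) \<in> triples (p - s\<^sup>2). tcond 1 4 x y z}. hw (x, y, z)))"
      using c[of 1 2 3] c[of 1 2 4] card_fixers_upper(2)[OF p0 p(2)] by (simp add: sum.distrib del: hw.simps)
    also have "\<dots> = 4 * (\<Sum>s | s\<^sup>2 < p. vsum (p - s\<^sup>2))"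
    proof -
      have "(\<Sum>s | s\<^sup>2 < p. (\<Sum>(x, y, z)\<in>{(x, y, z) \<in> triples (p - s\<^sup>2). tcond 1 3 x y z}. hw (x, y, z)) +
         (\<Sum>(x, y, z)\<in>{(x, y, z) \<in> triples (p - s\<^sup>2). tcond 1 4 x y z}. hw (x, y, z))) = (\<Sum>s | s\<^sup>2 < p. vsum (p - s\<^sup>2))"
        by (rule sum.cong[OF refl], rule sum_tcond_same) simp
      then show ?thesis by simp
    qed
    finally show ?thesis .
  qed
  moreover have "real (card (fixers 1 2 3 p)) = 2 * (real_of_int p - 3)" "real (card (fixers 1 2 4 p)) = 2 * (real_of_int p - 1)"
    using card_fixers_prime(2,3)[OF p] p3 by (simp_all add: of_nat_diff)
  ultimately show "(\<Sum>s | s\<^sup>2 < p. vsum (p - s\<^sup>2)) = real_of_int p - 2" by simp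
qed

section \<open>The sums \<open>usum\<close> and \<open>vsum\<close> at arguments 3 and 7 modulo
  8\<close>

definition odd_triples :: "int \<Rightarrow> (int \<times> int \<times> int) set" where
  "odd_triples n = {(u, v, h) \<in> triples n. odd u \<and> odd v \<and> odd h}"

lemma vsum_odd:
  assumes "odd n" shows "vsum n = card (odd_triples n)"
proof -
  have "{(x, y, z) \<in> triples n. even (x + y) \<and> even (x + z)} = odd_triples n"
    using assms by (auto simp: odd_triples_def triples_def)
  then have "vsum n = (\<Sum>(x, y, z)\<in>odd_triples n. hw (x, y, z))" by (simp only: vsum_def)
  also have "\<dots> = (\<Sum>t\<in>odd_triples n. 1)" by (rule sum.cong) (auto simp: odd_triples_def)
  finally show ?thesis by simp
qed

text \<open>The substitution (u, v, h) \<mapsto> (2 u + v, v, (h - v) / 2) preserves the quadratic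
  expression. It sends the odd triples with 4 | v - h and v \<le> h to the triples of
  \<open>usum\<close> with \<open>x > y\<close>.\<close>

lemma usum_odd:
  assumes n: "n > 0" "n mod 4 = 3"
  shows "usum n = card {(u, v, h) \<in> odd_triples n. 4 dvd v - h}"
proof -
  have on: "odd n" using n(2) by presburger
  let ?X = "{(x, y, z) \<in> triples n. odd x \<and> odd y \<and> even z}"
  let ?P = "{(x, y, z) \<in> triples n. odd x \<and> odd y \<and> even z \<and> x > y}"
  let ?M = "{(x, y, z) \<in> triples n. odd x \<and> odd y \<and> even z \<and> x < y}"
  let ?Z = "{(x, y, z) \<in> triples n. odd x \<and> odd y \<and> even z \<and> x > y \<and> z > 0}"
  note f = finite_triplesP[OF n(1)]
  have four: "4 dvd x + y" if "(x, y, z) \<in> ?X" for x y z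
    using that triples_mod_4[of x y z n] n(2) by auto
  have ne: "x \<noteq> y" if "(x, y, z) \<in> ?X" for x y z
  proof
    assume "x = y"
    then have "4 dvd 2 * x" "odd x" using four[OF that] that by auto
    then show False by presburger
  qed
  have "{(x, y, z) \<in> triples n. even (x + y) \<and> odd (x + z)} = ?X"
    using on by (auto simp: triples_def)
  also have "?X = ?P \<union> ?M" using ne by force
  finally have "usum n = (\<Sum>(x, y, z)\<in>?P \<union> ?M. hw (x, y, z))" by (simp only: usum_def)
  also have "\<dots> = sum hw (?P \<union> ?M)" by (simp add: case_prod_unfold del: hw.simps)
  also have "\<dots> = sum hw ?P + sum hw ?M" by (rule sum.union_disjoint[OF f f]) auto
  also have "sum hw ?M = sum hw ?P"
    by (rule sum.reindex_bij_witness[of _ "\<lambda>(x, y, z). (y, x, z)" "\<lambda>(x, y, z). (y, x, z)"])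
       (auto simp: triples_perm hw_perm simp del: hw.simps)
  also have "sum hw ?P + sum hw ?P = (\<Sum>t\<in>?P. 2 * hw t)" by (simp add: sum_distrib_left[symmetric])
  \<comment> \<open>After folding \<open>x < y\<close> onto \<open>x > y\<close> a triple counts 1
    if \<open>z = 0\<close> and 2 otherwise. On the other side \<open>z = 0\<close> is
    \<open>v = h\<close>, and the second unit is the odd triple with \<open>v\<close> and
    \<open>h\<close> exchanged.\<close>
  also have "\<dots> = (\<Sum>t\<in>?P. 1 + (if t \<in> ?Z then 1 else 0))"
  proof (rule sum.cong[OF refl])
    fix t assume a: "t \<in> ?P"
    obtain x y z where t: "t = (x, y, z)" by (cases t)
    have "x \<noteq> 0" "y \<noteq> 0" "z \<ge> 0" using a by (auto simp: t triples_def)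
    then show "2 * hw t = 1 + (if t \<in> ?Z then 1 else 0)" using a by (cases "z = 0") (simp_all add: t)
  qed
  also have "\<dots> = real (card ?P) + (\<Sum>t\<in>?P. if t \<in> ?Z then 1 else 0 :: real)" by (simp add: sum.distrib)
  also have "(\<Sum>t\<in>?P. if t \<in> ?Z then 1 else 0 :: real) = (\<Sum>t\<in>?Z. 1)"
    by (rule sum.mono_neutral_cong_right) (use f in auto)
  finally have U: "usum n = card ?P + card ?Z" by simp
  let ?O1 = "{(u, v, h) \<in> odd_triples n. 4 dvd v - h \<and> v \<le> h}" and ?O2 = "{(u, v, h) \<in> odd_triples n. 4 dvd v - h \<and> v > h}"
  have fO: "finite (odd_triples n)" unfolding odd_triples_def by (rule f)
  have fin: "finite ?O1" "finite ?O2" by (rule finite_subset[OF _ fO]; auto)+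
  have T: "(u, v, h) \<in> odd_triples n \<longleftrightarrow> (2 * u + v, v, (h - v) div 2) \<in> triples n \<and> odd u \<and> odd v \<and> odd h \<and> u \<ge> 0"
    if hv: "even (h - v)" "v \<le> h" "v \<ge> 0" for u v h
  proof -
    obtain z where "h - v = 2 * z" using hv(1) by (rule evenE)
    then have z: "h = v + 2 * z" "z \<ge> 0" using hv(2) by auto
    have "u * v + v * h + h * u = (2 * u + v) * v + v * z + z * (2 * u + v)" unfolding z by (simp add: algebra_simps)
    then show ?thesis using z hv by (auto simp: odd_triples_def triples_def)
  qed
  have inv: "x \<in> ?P \<Longrightarrow> (case x of (x, y, z) \<Rightarrow> ((x - y) div 2, y, y + 2 * z)) \<in> ?O1" for x
  proof -
    assume a: "x \<in> ?P"
    obtain p q z where x: "x = (p, q, z)" by (cases x)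
    have h: "(p, q, z) \<in> triples n" "odd p" "odd q" "even z" "p > q" using a by (auto simp: x)
    then have h0: "q \<ge> 0" "z \<ge> 0" by (auto simp: triples_def)
    have "4 dvd p + q" using four[of p q z] h by auto
    then have o: "odd ((p - q) div 2)" and e: "2 * ((p - q) div 2) + q = p" using h(2,3) by presburger+
    have ev: "even (q + 2 * z - q)" by simp
    have "((p - q) div 2, q, q + 2 * z) \<in> odd_triples n"
      using T[OF ev, of "(p - q) div 2"] h h0 o e by simp
    then show ?thesis using h(4) h0 by (auto simp: x)
  qed
  have fwd: "x \<in> ?O1 \<Longrightarrow> (case x of (u, v, h) \<Rightarrow> (2 * u + v, v, (h - v) div 2)) \<in> ?P" for x
  proof -
    assume a: "x \<in> ?O1"
    obtain u v h where x: "x = (u, v, h)" by (cases x)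
    have b: "(u, v, h) \<in> odd_triples n" "4 dvd v - h" "v \<le> h" using a by (auto simp: x)
    then have c: "odd u" "odd v" "odd h" "u \<ge> 0" "v \<ge> 0" by (auto simp: odd_triples_def triples_def)
    have e: "even (h - v)" "even ((h - v) div 2)" using b(2) by presburger+
    have "u > 0" using c(1,4) by (cases "u = 0") auto
    then show ?thesis using T[OF e(1) b(3) c(5)] b(1) c e(2) by (simp add: x)
  qed
  have B1: "bij_betw (\<lambda>(u, v, h). (2 * u + v, v, (h - v) div 2)) ?O1 ?P"
  proof (rule bij_betwI[of _ _ _ "\<lambda>(x, y, z). ((x - y) div 2, y, y + 2 * z)"])
    show "(case (case x of (u, v, h) \<Rightarrow> (2 * u + v, v, (h - v) div 2)) of (x, y, z) \<Rightarrow> ((x - y) div 2, y, y + 2 * z)) = x"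
      if "x \<in> ?O1" for x
    proof -
      obtain u v h where x: "x = (u, v, h)" by (cases x)
      have "4 dvd v - h" using that by (auto simp: x)
      then have "v + 2 * ((h - v) div 2) = h" by presburger
      then show ?thesis by (simp add: x)
    qed
    show "(case (case x of (x, y, z) \<Rightarrow> ((x - y) div 2, y, y + 2 * z)) of (u, v, h) \<Rightarrow> (2 * u + v, v, (h - v) div 2)) = x"
      if "x \<in> ?P" for x
    proof -
      obtain p q z where x: "x = (p, q, z)" by (cases x)
      have "odd p" "odd q" using that by (auto simp: x)
      then have "2 * ((p - q) div 2) + q = p" by presburger
      then show ?thesis by (simp add: x)
    qed
  qed (rule Pi_I, erule fwd, rule Pi_I, erule inv)
  have cO1: "card ?O1 = card ?P" by (rule bij_betw_same_card[OF B1])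
  have "card ?O2 = card {(u, v, h) \<in> ?O1. v < h}"
    by (rule bij_betw_same_card[of "\<lambda>(u, v, h). (u, h, v)"], rule bij_betwI[of _ _ _ "\<lambda>(u, v, h). (u, h, v)"])
       (auto simp: odd_triples_def triples_perm dvd_diff_commute)
  moreover have "bij_betw (\<lambda>(u, v, h). (2 * u + v, v, (h - v) div 2)) {(u, v, h) \<in> ?O1. v < h} ?Z"
  proof -
    have "(\<lambda>(u, v, h). (2 * u + v, v, (h - v) div 2)) ` {(u, v, h) \<in> ?O1. v < h} = ?Z"
    proof
      show "(\<lambda>(u, v, h). (2 * u + v, v, (h - v) div 2)) ` {(u, v, h) \<in> ?O1. v < h} \<subseteq> ?Z"
      proof (rule image_subsetI)
        fix x assume a: "x \<in> {(u, v, h) \<in> ?O1. v < h}"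
        obtain u v h where x: "x = (u, v, h)" by (cases x)
        have "x \<in> ?O1" "4 dvd v - h" "v < h" using a by (auto simp: x)
        moreover from this(2,3) have "(h - v) div 2 > 0" by presburger
        ultimately show "(case x of (u, v, h) \<Rightarrow> (2 * u + v, v, (h - v) div 2)) \<in> ?Z" using fwd[of x] by (simp add: x)
      qed
      show "?Z \<subseteq> (\<lambda>(u, v, h). (2 * u + v, v, (h - v) div 2)) ` {(u, v, h) \<in> ?O1. v < h}"
      proof
        fix x assume a: "x \<in> ?Z"
        obtain p q z where x: "x = (p, q, z)" by (cases x)
        have h: "odd p" "odd q" "z > 0" "(p, q, z) \<in> ?P" using a by (auto simp: x)
        have e: "2 * ((p - q) div 2) + q = p" using h(1,2) by presburger
        show "x \<in> (\<lambda>(u, v, h). (2 * u + v, v, (h - v) div 2)) ` {(u, v, h) \<in> ?O1. v < h}"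
          by (rule rev_image_eqI[of "((p - q) div 2, q, q + 2 * z)"]) (use inv[OF h(4)] h(3) e in \<open>auto simp: x\<close>)
      qed
    qed
    moreover have "inj_on (\<lambda>(u, v, h). (2 * u + v, v, (h - v) div 2)) {(u, v, h) \<in> ?O1. v < h}"
      by (rule inj_on_subset[OF bij_betw_imp_inj_on[OF B1]]) auto
    ultimately show ?thesis by (simp add: bij_betw_def)
  qed
  then have "card {(u, v, h) \<in> ?O1. v < h} = card ?Z" by (rule bij_betw_same_card)
  ultimately have cO2: "card ?O2 = card ?Z" by simp
  have "{(u, v, h) \<in> odd_triples n. 4 dvd v - h} = ?O1 \<union> ?O2" by auto
  moreover have "?O1 \<inter> ?O2 = {}" by auto
  ultimately have "card {(u, v, h) \<in> odd_triples n. 4 dvd v - h} = card ?O1 + card ?O2"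
    using card_Un_disjoint[OF fin] by simp
  then show ?thesis using U cO1 cO2 by simp
qed

text \<open>With \<open>v = u + 2 * i\<close> and \<open>h = u + 2 * j\<close>, the residue of
  \<open>n\<close> modulo 8 is 3 if \<open>i\<close> and \<open>j\<close> are even and 7 otherwise.
  In the latter case exactly one of the three differences is divisible by 4.\<close>

lemma odd_triples_mod_8:
  assumes "(u, v, h) \<in> odd_triples n"
  shows "n mod 8 = 3 \<Longrightarrow> 4 dvd v - h"
    and "n mod 8 = 7 \<Longrightarrow> (4 dvd v - h \<and> \<not> 4 dvd u - v \<and> \<not> 4 dvd h - u) \<or> (\<not> 4 dvd v - h \<and> 4 dvd u - v \<and> \<not> 4 dvd h - u)
      \<or> (\<not> 4 dvd v - h \<and> \<not> 4 dvd u - v \<and> 4 dvd h - u)"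
proof -
  have o: "odd u" "odd v" "odd h" and n: "n = u * v + v * h + h * u" using assms by (auto simp: odd_triples_def triples_def)
  obtain i j where ij: "v = u + 2 * i" "h = u + 2 * j"
  proof -
    have "v = u + 2 * ((v - u) div 2)" "h = u + 2 * ((h - u) div 2)" using o by presburger+
    then show ?thesis using that by blast
  qed
  obtain w where w: "u = 2 * w + 1" using o(1) by (rule oddE)
  have "u\<^sup>2 mod 8 = 1" by (rule odd_square_mod_8[OF o(1)])
  then obtain q where q: "u\<^sup>2 = 1 + 8 * q" by (metis mult_div_mod_eq add.commute)
  have "n = 3 * u\<^sup>2 + 4 * (u * (i + j) + i * j)" unfolding n ij by (simp add: power2_eq_square algebra_simps)
  also have "\<dots> = 3 + 4 * (i + j + i * j) + 8 * (3 * q + w * (i + j))" unfolding q by (simp add: w algebra_simps)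
  finally have "n mod 8 = (3 + 4 * (i + j + i * j)) mod 8" by (simp only: mod_mult_self2)
  moreover have "(3 + 4 * l) mod 8 = (if even l then 3 else 7)" for l :: int by presburger
  moreover have "even (i + j + i * j) \<longleftrightarrow> even i \<and> even j" by auto
  ultimately have m: "n mod 8 = (if even i \<and> even j then 3 else 7)" by (simp only:)
  have d: "4 dvd u - v \<longleftrightarrow> even i" "4 dvd h - u \<longleftrightarrow> even j" "4 dvd v - h \<longleftrightarrow> (even i \<longleftrightarrow> even j)"
    unfolding ij by presburger+
  show "n mod 8 = 3 \<Longrightarrow> 4 dvd v - h" unfolding d m by (auto split: if_splits)
  show "n mod 8 = 7 \<Longrightarrow> (4 dvd v - h \<and> \<not> 4 dvd u - v \<and> \<not> 4 dvd h - u) \<or> (\<not> 4 dvd v - h \<and> 4 dvd u - v \<and> \<not> 4 dvd h - u)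
      \<or> (\<not> 4 dvd v - h \<and> \<not> 4 dvd u - v \<and> 4 dvd h - u)" unfolding d m by (auto split: if_splits)
qed

text \<open>Both sums count odd triples, \<open>usum\<close> only those with 4 | v - h. Modulo 8
  this holds always for 3, while for 7 it holds for one third of the triples by cyclic
  symmetry.\<close>

lemma vsum_usum_mod_8:
  assumes n: "n > 0"
  shows "n mod 8 = 3 \<Longrightarrow> vsum n = usum n" and "n mod 8 = 7 \<Longrightarrow> vsum n = 3 * usum n"
proof -
  assume m: "n mod 8 = 3"
  have "n mod 4 = 3" "odd n" using m by presburger+
  moreover have "{(u, v, h) \<in> odd_triples n. 4 dvd v - h} = odd_triples n" using odd_triples_mod_8(1)[OF _ m] by auto
  ultimately show "vsum n = usum n" using vsum_odd usum_odd[OF n] by simp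
next
  assume m: "n mod 8 = 7"
  have n4: "n mod 4 = 3" "odd n" using m by presburger+
  let ?A = "{(u, v, h) \<in> odd_triples n. 4 dvd v - h}" and ?B = "{(u, v, h) \<in> odd_triples n. 4 dvd u - v}"
    and ?C = "{(u, v, h) \<in> odd_triples n. 4 dvd h - u}"
  have fO: "finite (odd_triples n)" unfolding odd_triples_def by (rule finite_triplesP[OF n])
  have fin: "finite ?A" "finite ?B" "finite ?C" by (rule finite_subset[OF _ fO]; auto)+
  note ex = odd_triples_mod_8(2)[OF _ m]
  have "odd_triples n = (?A \<union> ?B) \<union> ?C" using ex by auto
  then have "card (odd_triples n) = card ((?A \<union> ?B) \<union> ?C)" by simp
  also have "\<dots> = card (?A \<union> ?B) + card ?C" by (rule card_Un_disjoint) (use fin ex in auto)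
  also have "card (?A \<union> ?B) = card ?A + card ?B" by (rule card_Un_disjoint) (use fin ex in auto)
  also have "card ?B = card ?A"
    by (rule bij_betw_same_card[of "\<lambda>(u, v, h). (h, u, v)"], rule bij_betwI[of _ _ _ "\<lambda>(u, v, h). (v, h, u)"])
       (auto simp: odd_triples_def triples_def algebra_simps)
  also have "card ?C = card ?A"
    by (rule bij_betw_same_card[of "\<lambda>(u, v, h). (v, h, u)"], rule bij_betwI[of _ _ _ "\<lambda>(u, v, h). (h, u, v)"])
       (auto simp: odd_triples_def triples_def algebra_simps)
  finally show "vsum n = 3 * usum n" using vsum_odd[OF n4(2)] usum_odd[OF n n4(1)] by simp
qed

lemma square_mod_4: "(s :: int)\<^sup>2 mod 4 = (if even s then 0 else 1)"
proof (cases "even s")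
  case True
  then obtain k where "s = 2 * k" by (rule evenE)
  then have "s\<^sup>2 = 4 * k\<^sup>2" by (simp add: power2_eq_square)
  then show ?thesis using True by simp
next
  case False
  then obtain k where "s = 2 * k + 1" by (rule oddE)
  then have "s\<^sup>2 = 1 + 4 * (k\<^sup>2 + k)" by (simp add: power2_eq_square algebra_simps)
  then have "s\<^sup>2 mod 4 = 1 mod 4" by (simp only: mod_mult_self2)
  then show ?thesis using False by simp
qed

lemma diff_square_mod_4: "(N - s\<^sup>2) mod 4 = (if even s then N mod 4 else (N - 1) mod (4 :: int))"
proof -
  have "(N - s\<^sup>2) mod 4 = (N mod 4 - s\<^sup>2 mod 4) mod 4" by (simp only: mod_diff_eq)
  then show ?thesis unfolding square_mod_4 by (simp add: mod_diff_left_eq)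
qed

lemma sum_even_squares:
  fixes f :: "int \<Rightarrow> real"
  assumes "odd N" "N > 0"
  shows "(\<Sum>s | s\<^sup>2 < N \<and> even s. f s) = (\<Sum>k | nat (4 * k\<^sup>2) \<le> nat N. f (2 * k))"
proof (rule sum.reindex_bij_witness[of _ "\<lambda>k. 2 * k" "\<lambda>s. s div 2"])
  have le: "nat (4 * k\<^sup>2) \<le> nat N \<longleftrightarrow> 4 * k\<^sup>2 < N" for k :: int
  proof -
    have "4 * k\<^sup>2 \<noteq> N" using assms(1) by auto
    moreover have "nat (4 * k\<^sup>2) \<le> nat N \<longleftrightarrow> 4 * k\<^sup>2 \<le> N" using assms(2) by (simp add: nat_le_eq_zle)
    ultimately show ?thesis by auto
  qed
  show "s div 2 \<in> {k. nat (4 * k\<^sup>2) \<le> nat N}" if "s \<in> {s. s\<^sup>2 < N \<and> even s}" for s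
    using that by (auto simp: le power_mult_distrib elim!: evenE)
  show "2 * k \<in> {s. s\<^sup>2 < N \<and> even s}" if "k \<in> {k. nat (4 * k\<^sup>2) \<le> nat N}" for k
    using that by (auto simp: le power_mult_distrib)
qed auto

text \<open>Both sides have the same convolution with the squares \<open>4 k\<^sup>2\<close>, namely the divisor sum.\<close>

lemma theta_odd_even_even:
  assumes "n mod 4 = 1"
  shows "(theta_odd * theta_even * theta_even) $ n = 4 * usum (int n)"
  using assms
proof (induction n rule: less_induct)
  case (less n)
  let ?\<rho> = "theta_odd * theta_even * theta_even"
  let ?K = "{k :: int. nat (4 * k\<^sup>2) \<le> n}"
  have m: "int n mod 4 = 1" using less.prems by (metis of_nat_1 of_nat_mod of_nat_numeral)
  have on: "odd (int n)" "int n > 0" using m less.prems by (presburger, cases n, auto)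
  have K: "finite ?K" using fin_fib_square[of 4 UNIV] by (simp add: fin_fib_def)
  have sub: "int (n - nat (4 * k\<^sup>2)) = int n - (2 * k)\<^sup>2" if "k \<in> ?K" for k
    using that by (simp add: of_nat_diff power_mult_distrib)
  have "(?\<rho> * theta_even) $ n = (\<Sum>k\<in>?K. ?\<rho> $ (n - nat (4 * k\<^sup>2)))"
    unfolding theta_even_def mult_gfs_nth[OF fin_fib_theta(3)] by simp
  then have 1: "(\<Sum>k\<in>?K. ?\<rho> $ (n - nat (4 * k\<^sup>2))) = 2 * real_of_int (\<Sum>d | d > 0 \<and> d dvd int n. d)"
    using theta_odd_even_cube[OF less.prems] by simp
  have "(\<Sum>s | s\<^sup>2 < int n. if (int n - s\<^sup>2) mod 4 = 1 \<or> (int n - s\<^sup>2) mod 4 = 2 then usum (int n - s\<^sup>2) else 0)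
    = (\<Sum>s | s\<^sup>2 < int n \<and> even s. usum (int n - s\<^sup>2))"
  proof (rule sum.mono_neutral_cong_right[OF finite_square_less])
    have "(int n - 1) mod 4 = 0" using m by presburger
    then show "\<forall>i\<in>{s. s\<^sup>2 < int n} - {s. s\<^sup>2 < int n \<and> even s}.
       (if (int n - i\<^sup>2) mod 4 = 1 \<or> (int n - i\<^sup>2) mod 4 = 2 then usum (int n - i\<^sup>2) else 0) = 0"
      by (simp add: diff_square_mod_4)
  qed (use m in \<open>auto simp: diff_square_mod_4\<close>)
  also have "\<dots> = (\<Sum>k\<in>?K. usum (int n - (2 * k)\<^sup>2))" using sum_even_squares[OF on] by simp
  finally have 2: "2 * (\<Sum>k\<in>?K. usum (int n - (2 * k)\<^sup>2)) = real_of_int (\<Sum>d | d > 0 \<and> d dvd int n. d)"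
    using usum_divisor_sum[OF on(2,1)] by simp
  have IH: "?\<rho> $ (n - nat (4 * k\<^sup>2)) = 4 * usum (int n - (2 * k)\<^sup>2)" if k: "k \<in> ?K - {0}" for k
  proof -
    have "nat (4 * k\<^sup>2) > 0" "nat (4 * k\<^sup>2) \<le> n" using k by auto
    then have lt: "n - nat (4 * k\<^sup>2) < n" by linarith
    have "k \<in> ?K" using k by blast
    have "int (n - nat (4 * k\<^sup>2)) mod 4 = 1" unfolding sub[OF \<open>k \<in> ?K\<close>] diff_square_mod_4 using m by simp
    then have "int ((n - nat (4 * k\<^sup>2)) mod 4) = 1" by (simp only: of_nat_mod of_nat_numeral)
    then have "(n - nat (4 * k\<^sup>2)) mod 4 = 1" by simp
    from less.IH[OF lt this] show ?thesis using sub[of k] k by simp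
  qed
  \<comment> \<open>The term \<open>k = 0\<close> carries the unknown coefficient and all others are
    known by induction, so equality of the two convolutions gives the claim.\<close>
  have "(\<Sum>k\<in>?K. ?\<rho> $ (n - nat (4 * k\<^sup>2))) = ?\<rho> $ n + (\<Sum>k\<in>?K - {0}. 4 * usum (int n - (2 * k)\<^sup>2))"
    using K IH by (simp add: sum.remove[of ?K 0])
  moreover have "(\<Sum>k\<in>?K. 4 * usum (int n - (2 * k)\<^sup>2)) = 4 * usum (int n) + (\<Sum>k\<in>?K - {0}. 4 * usum (int n - (2 * k)\<^sup>2))"
    using K by (simp add: sum.remove[of ?K 0])
  moreover have "(\<Sum>k\<in>?K. 4 * usum (int n - (2 * k)\<^sup>2)) = 4 * (\<Sum>k\<in>?K. usum (int n - (2 * k)\<^sup>2))" by (simp add: sum_distrib_left)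
  ultimately show ?case using 1 2 by linarith
qed

section \<open>Separation of the residues modulo 4\<close>

definition rsum :: "(int \<Rightarrow> real) \<Rightarrow> int \<Rightarrow> int \<Rightarrow> real" where
  "rsum f p r = (\<Sum>s | s\<^sup>2 < p \<and> s mod 4 = r. f (p - s\<^sup>2))"

lemma sum_squares_residues:
  fixes g :: "int \<Rightarrow> real"
  shows "(\<Sum>s | s\<^sup>2 < p. g s) = (\<Sum>s | s\<^sup>2 < p \<and> s mod 4 = 0. g s) + (\<Sum>s | s\<^sup>2 < p \<and> s mod 4 = 1. g s)
     + (\<Sum>s | s\<^sup>2 < p \<and> s mod 4 = 2. g s) + (\<Sum>s | s\<^sup>2 < p \<and> s mod 4 = 3. g s)"
proof -
  have "(\<Sum>r\<in>{0, 1, 2, 3}. \<Sum>s\<in>{s \<in> {s. s\<^sup>2 < p}. s mod 4 = r}. g s) = (\<Sum>s | s\<^sup>2 < p. g s)"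
  proof (rule sum.group[OF finite_square_less])
    show "(\<lambda>s. s mod 4) ` {s. s\<^sup>2 < p} \<subseteq> {0, 1, 2, 3 :: int}"
    proof (rule image_subsetI)
      fix s :: int
      have "s mod 4 = 0 \<or> s mod 4 = 1 \<or> s mod 4 = 2 \<or> s mod 4 = 3" by presburger
      then show "s mod 4 \<in> {0, 1, 2, 3}" by simp
    qed
  qed simp
  then show ?thesis by simp
qed

lemma rsum_0:
  assumes "\<And>s. s mod 4 = r \<Longrightarrow> f (p - s\<^sup>2) = 0" shows "rsum f p r = 0"
  using assms by (simp add: rsum_def)

lemma rsum_3: "rsum f p 3 = rsum f p 1"
  unfolding rsum_def
proof (rule sum.reindex_bij_witness[of _ uminus uminus])
  have "- s mod 4 = 1" if "s mod 4 = 3" for s :: int using that by presburger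
  then show "- s \<in> {s. s\<^sup>2 < p \<and> s mod 4 = 1}" if "s \<in> {s. s\<^sup>2 < p \<and> s mod 4 = 3}" for s using that by simp
  have "- s mod 4 = 3" if "s mod 4 = 1" for s :: int using that by presburger
  then show "- s \<in> {s. s\<^sup>2 < p \<and> s mod 4 = 3}" if "s \<in> {s. s\<^sup>2 < p \<and> s mod 4 = 1}" for s using that by simp
qed auto

lemma residue_parity: "(s :: int) mod 4 = 0 \<Longrightarrow> even s" "s mod 4 = 2 \<Longrightarrow> even s" "s mod 4 = 1 \<Longrightarrow> odd s" "s mod 4 = 3 \<Longrightarrow> odd s"
  by presburger+

lemma rsum_cases:
  assumes "\<And>s. even s \<Longrightarrow> g s = f (p - s\<^sup>2)" "\<And>s. odd s \<Longrightarrow> g s = h (p - s\<^sup>2)"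
  shows "(\<Sum>s | s\<^sup>2 < p. g s) = rsum f p 0 + rsum h p 1 + rsum f p 2 + rsum h p 3"
  unfolding sum_squares_residues rsum_def using assms residue_parity
  by (intro arg_cong2[of _ _ _ _ "(+)"] sum.cong refl) auto

text \<open>The index is \<open>t = 2 * s\<close> with \<open>s\<close> congruent to
  \<open>r\<close> modulo 4. Terms with \<open>s\<^sup>2 > p\<close> have a negative argument and
  vanish; \<open>s\<^sup>2 = p\<close>, which would bring in the exceptional value at 0, cannot
  occur for a prime.\<close>

lemma hurwitz_sum_rsum:
  assumes p: "prime p" "odd p" and m: "m mod 8 = 2 * r"
  shows "hurwitz_sum m 8 p = rsum usum (int p) r + rsum vsum (int p) r / 3"
proof -
  let ?A = "{t :: int. [t = m] (mod int 8)}" and ?S = "{s :: int. s\<^sup>2 < int p \<and> s mod 4 = r}"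
  let ?f = "\<lambda>t. hurwitz_H (4 * int p - t\<^sup>2)"
  have fin: "finite ?S" by (rule finite_subset[OF _ finite_square_less[of "int p"]]) auto
  have A: "t \<in> ?A \<longleftrightarrow> (\<exists>s. t = 2 * s \<and> s mod 4 = r)" for t
  proof -
    have "0 \<le> m mod 8" "m mod 8 < 8" by simp_all
    then have "r = 0 \<or> r = 1 \<or> r = 2 \<or> r = 3" unfolding m by presburger
    then have "t mod 8 = 2 * r \<longleftrightarrow> even t \<and> (t div 2) mod 4 = r" by (elim disjE; hypsubst; presburger)
    moreover have "even t \<and> (t div 2) mod 4 = r \<longleftrightarrow> (\<exists>s. t = 2 * s \<and> s mod 4 = r)" by auto
    ultimately show ?thesis using m by (simp add: cong_def)
  qed
  have nsq: "s\<^sup>2 \<noteq> int p" for s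
  proof
    assume l: "s\<^sup>2 = int p"
    have pp: "prime (int p)" using p(1) by simp
    then have "irreducible (int p)" using prime_elem_imp_irreducible prime_imp_prime_elem by blast
    then have "s dvd 1" using irreducibleD[of "int p" s s] l[symmetric] by (simp only: power2_eq_square) blast
    then have "int p dvd 1" by (simp only: l[symmetric] power2_eq_square is_unit_mult_iff)
    then show False using pp not_prime_unit by blast
  qed
  have "hurwitz_sum m 8 p = infsum ?f ?A" by (simp add: hurwitz_sum_def)
  also have "\<dots> = infsum ?f ((\<lambda>s. 2 * s) ` ?S)"
  proof (rule infsum_cong_neutral)
    fix t assume t: "t \<in> ?A - (\<lambda>s. 2 * s) ` ?S"
    then obtain s where s: "t = 2 * s" "s mod 4 = r" using A by blast
    then have "\<not> s\<^sup>2 < int p" using t by blast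
    then have "s\<^sup>2 > int p" using nsq[of s] by linarith
    then have "4 * int p - t\<^sup>2 < 0" by (simp add: s power_mult_distrib)
    then show "?f t = 0" by (simp add: hurwitz_H_def)
  next
    fix t assume "t \<in> (\<lambda>s. 2 * s) ` ?S - ?A"
    then show "?f t = 0" using A by blast
  qed simp
  also have "\<dots> = sum ?f ((\<lambda>s. 2 * s) ` ?S)" using fin by simp
  also have "\<dots> = (\<Sum>s\<in>?S. ?f (2 * s))" by (rule sum.reindex[unfolded o_def]) (auto simp: inj_on_def)
  also have "\<dots> = (\<Sum>s\<in>?S. usum (int p - s\<^sup>2) + vsum (int p - s\<^sup>2) / 3)"
  proof (rule sum.cong[OF refl])
    fix s assume "s \<in> ?S"
    then have "int p - s\<^sup>2 > 0" by simp
    then have "3 * hurwitz_H (4 * (int p - s\<^sup>2)) = 3 * usum (int p - s\<^sup>2) + vsum (int p - s\<^sup>2)"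
      by (simp only: hurwitz_H_triples sum_hw_usum_vsum)
    moreover have "4 * int p - (2 * s)\<^sup>2 = 4 * (int p - s\<^sup>2)" by (simp add: power_mult_distrib)
    ultimately show "?f (2 * s) = usum (int p - s\<^sup>2) + vsum (int p - s\<^sup>2) / 3" by simp
  qed
  also have "\<dots> = rsum usum (int p) r + rsum vsum (int p) r / 3"
    by (simp add: rsum_def sum.distrib sum_divide_distrib)
  finally show ?thesis .
qed

text \<open>For \<open>s\<close> divisible by 4 the square is 0 modulo 8, and for \<open>s\<close>
  congruent to 2 it is 4, which exchanges the residues 3 and 7.\<close>

lemma rsum_mod_8:
  assumes p: "p mod 8 = 3 \<or> p mod 8 = 7"
  shows "rsum vsum p 0 = (if p mod 8 = 3 then 1 else 3) * rsum usum p 0"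
    and "rsum vsum p 2 = (if p mod 8 = 3 then 3 else 1) * rsum usum p 2"
proof -
  have sq: "(p - s\<^sup>2) mod 8 = p mod 8" if s: "s mod 4 = 0" for s
  proof -
    obtain k where "s = 4 * k" using s by auto
    then have "p - s\<^sup>2 = p + 8 * (- 2 * k\<^sup>2)" by (simp add: power2_eq_square)
    then show ?thesis by (simp only: mod_mult_self2)
  qed
  have sq2: "(p - s\<^sup>2) mod 8 = (p - 4) mod 8" if s: "s mod 4 = 2" for s
  proof -
    have "s = 2 + 4 * (s div 4)" using s by presburger
    then obtain k where "s = 2 + 4 * k" by blast
    then have "p - s\<^sup>2 = (p - 4) + 8 * (- 2 * k\<^sup>2 - 2 * k)" by (simp add: power2_eq_square algebra_simps)
    then show ?thesis by (simp only: mod_mult_self2)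
  qed
  have p4: "(p - 4) mod 8 = (if p mod 8 = 3 then 7 else 3)" using p by presburger
  show "rsum vsum p 0 = (if p mod 8 = 3 then 1 else 3) * rsum usum p 0"
    unfolding rsum_def sum_distrib_left using p
    by (intro sum.cong refl) (auto simp: sq vsum_usum_mod_8)
  show "rsum vsum p 2 = (if p mod 8 = 3 then 3 else 1) * rsum usum p 2"
    unfolding rsum_def sum_distrib_left using p
    by (intro sum.cong refl) (auto simp: sq2 p4 vsum_usum_mod_8)
qed

lemma prime_divisor_sum: "prime (p :: int) \<Longrightarrow> (\<Sum>d | d > 0 \<and> d dvd p. d) = p + 1"
proof -
  assume p: "prime p"
  have p1: "p > 1" using p by (rule prime_gt_1_int)
  have "x = 1 \<or> x = p" if "x > 0" "x dvd p" for x
    using p that unfolding prime_int_iff by (meson less_imp_le)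
  then have "{d. d > 0 \<and> d dvd p} = {1, p}" using p1 by auto
  then show ?thesis using p1 by simp
qed

text \<open>Here \<open>p - s\<^sup>2\<close> is 1 modulo 4 for even \<open>s\<close> and 0 for odd
  \<open>s\<close>. Thus \<open>usum_divisor_sum\<close> sees the even and \<open>prime_sums\<close>
  the odd \<open>s\<close>, and \<open>vsum\<close> survives only at odd \<open>s\<close>.\<close>

lemma rsum_1_mod_4:
  assumes p: "prime (p :: int)" "p mod 4 = 1"
  shows "2 * (rsum usum p 0 + rsum usum p 2) = of_int p + 1" "4 * rsum usum p 1 = of_int p - 1"
    "rsum vsum p 0 = 0" "rsum vsum p 2 = 0" "2 * rsum vsum p 1 = of_int p - 2"
proof -
  have o: "odd p" "p > 0" and p1: "(p - 1) mod 4 = 0" using p(2) prime_gt_0_int[OF p(1)] by presburger+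
  have ev: "(p - s\<^sup>2) mod 4 = 1" if "even s" for s using that p(2) by (simp add: diff_square_mod_4)
  have od: "(p - s\<^sup>2) mod 4 = 0" if "odd s" for s using that p1 by (simp add: diff_square_mod_4)
  have "(\<Sum>s | s\<^sup>2 < p. if (p - s\<^sup>2) mod 4 = 1 \<or> (p - s\<^sup>2) mod 4 = 2 then usum (p - s\<^sup>2) else 0)
    = rsum usum p 0 + rsum (\<lambda>_. 0) p 1 + rsum usum p 2 + rsum (\<lambda>_. 0) p 3"
    by (rule rsum_cases) (simp_all add: ev od)
  then show "2 * (rsum usum p 0 + rsum usum p 2) = of_int p + 1"
    using usum_divisor_sum[OF o(2,1)] prime_divisor_sum[OF p(1)] by (simp add: rsum_def)
  have "(\<Sum>s | s\<^sup>2 < p. if (p - s\<^sup>2) mod 4 = 0 \<or> (p - s\<^sup>2) mod 4 = 3 then usum (p - s\<^sup>2) else 0)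
    = rsum (\<lambda>_. 0) p 0 + rsum usum p 1 + rsum (\<lambda>_. 0) p 2 + rsum usum p 3"
    by (rule rsum_cases) (simp_all add: ev od)
  then show "4 * rsum usum p 1 = of_int p - 1"
    using prime_sums(1)[OF p(1) o(1)] by (simp add: rsum_3) (simp add: rsum_def)
  show v: "rsum vsum p 0 = 0" "rsum vsum p 2 = 0"
    by (rule rsum_0, rule vsum_eq_0, simp add: ev residue_parity)+
  have "(\<Sum>s | s\<^sup>2 < p. vsum (p - s\<^sup>2)) = rsum vsum p 0 + rsum vsum p 1 + rsum vsum p 2 + rsum vsum p 3"
    by (rule rsum_cases) simp_all
  then show "2 * rsum vsum p 1 = of_int p - 2"
    using prime_sums(2)[OF p(1) o(1)] v by (simp add: rsum_3)
qed

text \<open>Now \<open>p - s\<^sup>2\<close> is 3 modulo 4 for even \<open>s\<close> and 2 for odd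
  \<open>s\<close>, so the two counts exchange their roles and \<open>vsum\<close> survives only at
  even \<open>s\<close>.\<close>

lemma rsum_3_mod_4:
  assumes p: "prime (p :: int)" "p mod 4 = 3"
  shows "2 * (rsum usum p 0 + rsum usum p 2) = of_int p - 1" "4 * rsum usum p 1 = of_int p + 1"
    "rsum vsum p 1 = 0" "rsum vsum p 0 + rsum vsum p 2 = of_int p - 2"
proof -
  have o: "odd p" "p > 0" and p1: "(p - 1) mod 4 = 2" using p(2) prime_gt_0_int[OF p(1)] by presburger+
  have ev: "(p - s\<^sup>2) mod 4 = 3" if "even s" for s using that p(2) by (simp add: diff_square_mod_4)
  have od: "(p - s\<^sup>2) mod 4 = 2" if "odd s" for s using that p1 by (simp add: diff_square_mod_4)
  have "(\<Sum>s | s\<^sup>2 < p. if (p - s\<^sup>2) mod 4 = 1 \<or> (p - s\<^sup>2) mod 4 = 2 then usum (p - s\<^sup>2) else 0)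
    = rsum (\<lambda>_. 0) p 0 + rsum usum p 1 + rsum (\<lambda>_. 0) p 2 + rsum usum p 3"
    by (rule rsum_cases) (simp_all add: ev od)
  then show "4 * rsum usum p 1 = of_int p + 1"
    using usum_divisor_sum[OF o(2,1)] prime_divisor_sum[OF p(1)] by (simp add: rsum_3) (simp add: rsum_def)
  have "(\<Sum>s | s\<^sup>2 < p. if (p - s\<^sup>2) mod 4 = 0 \<or> (p - s\<^sup>2) mod 4 = 3 then usum (p - s\<^sup>2) else 0)
    = rsum usum p 0 + rsum (\<lambda>_. 0) p 1 + rsum usum p 2 + rsum (\<lambda>_. 0) p 3"
    by (rule rsum_cases) (simp_all add: ev od)
  then show "2 * (rsum usum p 0 + rsum usum p 2) = of_int p - 1"
    using prime_sums(1)[OF p(1) o(1)] by (simp add: rsum_def)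
  show v: "rsum vsum p 1 = 0"
    by (rule rsum_0, rule vsum_eq_0) (simp add: od residue_parity)
  have "(\<Sum>s | s\<^sup>2 < p. vsum (p - s\<^sup>2)) = rsum vsum p 0 + rsum vsum p 1 + rsum vsum p 2 + rsum vsum p 3"
    by (rule rsum_cases) simp_all
  then show "rsum vsum p 0 + rsum vsum p 2 = of_int p - 2"
    using prime_sums(2)[OF p(1) o(1)] v by (simp add: rsum_3)
qed

text \<open>Convolution with \<open>theta_alt 4\<close> weights \<open>s = 2 * k\<close> by the sign
  of \<open>k\<close>, which is exactly what distinguishes the residues 0 and 2;
  \<open>theta_chi_even_prime\<close> evaluates the result.\<close>

lemma rsum_usum_chi:
  assumes p: "prime p" "int p = x\<^sup>2 + 4 * y\<^sup>2" "p mod 4 = 1"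
  shows "rsum usum (int p) 0 - rsum usum (int p) 2 = real_of_int (chi_m4 x * x)"
proof -
  let ?\<rho> = "theta_odd * theta_even * theta_even"
  let ?K = "{k :: int. nat (4 * k\<^sup>2) \<le> p}"
  have m: "int p mod 4 = 1" using p(3) by (metis of_nat_1 of_nat_mod of_nat_numeral)
  have "odd p" using p(3) by presburger
  then have o: "odd p" "odd (int p)" "int p > 0" using prime_gt_0_nat[OF p(1)] by simp_all
  have "4 * real_of_int (chi_m4 x * x) = (?\<rho> * theta_alt 4) $ p"
    using theta_chi_even_prime[OF p(1,2) o(1)] by simp
  also have "\<dots> = (\<Sum>k\<in>?K. (- 1) powi k * ?\<rho> $ (p - nat (4 * k\<^sup>2)))"
    unfolding theta_alt_def mult_gfs_nth[OF fin_fib_theta(3)] by simp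
  also have "\<dots> = (\<Sum>k\<in>?K. 4 * ((- 1) powi k * usum (int p - (2 * k)\<^sup>2)))"
  proof (rule sum.cong[OF refl])
    fix k assume k: "k \<in> ?K"
    have sub: "int (p - nat (4 * k\<^sup>2)) = int p - (2 * k)\<^sup>2" using k by (simp add: of_nat_diff power_mult_distrib)
    have "int (p - nat (4 * k\<^sup>2)) mod 4 = 1" unfolding sub diff_square_mod_4 using m by simp
    then have "int ((p - nat (4 * k\<^sup>2)) mod 4) = 1" by (simp only: of_nat_mod of_nat_numeral)
    then have "(p - nat (4 * k\<^sup>2)) mod 4 = 1" by simp
    from theta_odd_even_even[OF this]
    show "(- 1) powi k * ?\<rho> $ (p - nat (4 * k\<^sup>2)) = 4 * ((- 1) powi k * usum (int p - (2 * k)\<^sup>2))" unfolding sub by simp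
  qed
  also have "\<dots> = 4 * (\<Sum>k\<in>?K. (- 1) powi k * usum (int p - (2 * k)\<^sup>2))" by (simp only: sum_distrib_left)
  also have "(\<Sum>k\<in>?K. (- 1) powi k * usum (int p - (2 * k)\<^sup>2)) =
      (\<Sum>s | s\<^sup>2 < int p \<and> even s. (- 1) powi (s div 2) * usum (int p - s\<^sup>2))"
    using sum_even_squares[OF o(2,3), of "\<lambda>s. (- 1) powi (s div 2) * usum (int p - s\<^sup>2)"] by simp
  also have "\<dots> = rsum usum (int p) 0 - rsum usum (int p) 2"
  proof -
    let ?S = "\<lambda>r. {s :: int. s\<^sup>2 < int p \<and> s mod 4 = r}"
    have fin: "finite (?S r)" for r by (rule finite_subset[OF _ finite_square_less[of "int p"]]) auto
    have ev: "even s \<longleftrightarrow> s mod 4 = 0 \<or> s mod 4 = 2" for s :: int by presburger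
    have "{s. s\<^sup>2 < int p \<and> even s} = ?S 0 \<union> ?S 2" unfolding ev by blast
    then have "(\<Sum>s | s\<^sup>2 < int p \<and> even s. (- 1) powi (s div 2) * usum (int p - s\<^sup>2)) =
      (\<Sum>s\<in>?S 0. (- 1) powi (s div 2) * usum (int p - s\<^sup>2)) + (\<Sum>s\<in>?S 2. (- 1) powi (s div 2) * usum (int p - s\<^sup>2))"
      using fin by (simp add: sum.union_disjoint disjoint_iff)
    also have "(\<Sum>s\<in>?S 0. (- 1) powi (s div 2) * usum (int p - s\<^sup>2)) = rsum usum (int p) 0"
      unfolding rsum_def
    proof (rule sum.cong[OF refl])
      fix s assume "s \<in> ?S 0"
      then have "even (s div 2)" by simp presburger
      then show "(- 1) powi (s div 2) * usum (int p - s\<^sup>2) = usum (int p - s\<^sup>2)" by (simp add: powi_minus_one)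
    qed
    also have "(\<Sum>s\<in>?S 2. (- 1) powi (s div 2) * usum (int p - s\<^sup>2)) = (\<Sum>s\<in>?S 2. - usum (int p - s\<^sup>2))"
    proof (rule sum.cong[OF refl])
      fix s assume "s \<in> ?S 2"
      then have "s mod 4 = 2" by simp
      then have "odd (s div 2)" by presburger
      then show "(- 1) powi (s div 2) * usum (int p - s\<^sup>2) = - usum (int p - s\<^sup>2)" by (simp add: powi_minus_one)
    qed
    finally show ?thesis by (simp add: rsum_def sum_negf)
  qed
  finally show ?thesis by simp
qed

theorem theorem4p6:
  fixes p :: nat and m x y :: int
  assumes "prime p" and "p \<ge> 3"
    and "[p = 1] (mod 4) \<Longrightarrow> int p = x\<^sup>2 + 4 * y\<^sup>2"
  shows
    "([m = 0] (mod 8) \<and> [p = 1] (mod 4) \<longrightarrow>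
        hurwitz_sum m 8 p = (real p + 1) / 4 + 1 / 2 * real_of_int (chi_m4 x) * real_of_int x) \<and>
     ([m = 0] (mod 8) \<and> [p = 3] (mod 8) \<longrightarrow>
        hurwitz_sum m 8 p = (real p + 1) / 3) \<and>
     ([m = 0] (mod 8) \<and> [p = 7] (mod 8) \<longrightarrow>
        hurwitz_sum m 8 p = (real p - 3) / 2) \<and>
     (([m = 2] (mod 8) \<or> [m = 6] (mod 8)) \<and> [p = 1] (mod 4) \<longrightarrow>
        hurwitz_sum m 8 p = (5 * real p - 7) / 12) \<and>
     (([m = 2] (mod 8) \<or> [m = 6] (mod 8)) \<and> [p = 3] (mod 4) \<longrightarrow>
        hurwitz_sum m 8 p = (real p + 1) / 4) \<and>
     ([m = 4] (mod 8) \<and> [p = 1] (mod 4) \<longrightarrow>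
        hurwitz_sum m 8 p = (real p + 1) / 4 - 1 / 2 * real_of_int (chi_m4 x) * real_of_int x) \<and>
     ([m = 4] (mod 8) \<and> [p = 3] (mod 8) \<longrightarrow>
        hurwitz_sum m 8 p = (real p - 3) / 2) \<and>
     ([m = 4] (mod 8) \<and> [p = 7] (mod 8) \<longrightarrow>
        hurwitz_sum m 8 p = (real p + 1) / 3)"
proof -
  have op: "odd p" using assms(1,2) prime_odd_nat[of p] by simp
  have pp: "prime (int p)" using assms(1) by simp
  have H: "hurwitz_sum m 8 p = rsum usum (int p) r + rsum vsum (int p) r / 3" if "m mod 8 = 2 * r" for r
    by (rule hurwitz_sum_rsum[OF assms(1) op that])
  have cm: "[m = c] (mod 8) \<longleftrightarrow> m mod 8 = c" if "0 \<le> c" "c < 8" for c using that by (simp add: cong_def)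
  have H0: "hurwitz_sum m 8 p = rsum usum (int p) 0 + rsum vsum (int p) 0 / 3" if "[m = 0] (mod 8)"
    using H[of 0] that cm[of 0] by simp
  have H2: "hurwitz_sum m 8 p = rsum usum (int p) 2 + rsum vsum (int p) 2 / 3" if "[m = 4] (mod 8)"
    using H[of 2] that cm[of 4] by simp
  have H1: "hurwitz_sum m 8 p = rsum usum (int p) 1 + rsum vsum (int p) 1 / 3" if "[m = 2] (mod 8) \<or> [m = 6] (mod 8)"
    using H[of 1] H[of 3] that cm[of 2] cm[of 6] rsum_3 by auto
  have c1: "int p mod 4 = 1" if "[p = 1] (mod 4)"
  proof -
    have "p mod 4 = 1" using that by (simp add: cong_def)
    then show ?thesis by (metis of_nat_1 of_nat_mod of_nat_numeral)
  qed
  have c3: "int p mod 4 = 3" if "[p = 3] (mod 4)"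
  proof -
    have "p mod 4 = 3" using that by (simp add: cong_def)
    then show ?thesis by (metis of_nat_numeral of_nat_mod)
  qed
  have c8: "int p mod 8 = 3" "int p mod 4 = 3" if "[p = 3] (mod 8)"
  proof -
    have "p mod 8 = 3" using that by (simp add: cong_def)
    then show "int p mod 8 = 3" by (metis of_nat_numeral of_nat_mod)
    then show "int p mod 4 = 3" by presburger
  qed
  have c7: "int p mod 8 = 7" "int p mod 4 = 3" if "[p = 7] (mod 8)"
  proof -
    have "p mod 8 = 7" using that by (simp add: cong_def)
    then show "int p mod 8 = 7" by (metis of_nat_numeral of_nat_mod)
    then show "int p mod 4 = 3" by presburger
  qed
  have chi: "rsum usum (int p) 0 - rsum usum (int p) 2 = real_of_int (chi_m4 x) * real_of_int x" if "[p = 1] (mod 4)"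
    using rsum_usum_chi[OF assms(1) assms(3)[OF that]] that by (simp add: cong_def)
  note R1 = rsum_1_mod_4[OF pp c1, unfolded of_int_of_nat_eq]
  note R3 = rsum_3_mod_4[OF pp, unfolded of_int_of_nat_eq]
  show ?thesis
  proof (intro conjI impI; elim conjE)
    assume m: "[m = 0] (mod 8)" and q: "[p = 1] (mod 4)"
    show "hurwitz_sum m 8 p = (real p + 1) / 4 + 1 / 2 * real_of_int (chi_m4 x) * real_of_int x"
      using H0[OF m] chi[OF q] R1[OF q] by (simp add: field_simps)
  next
    assume m: "[m = 4] (mod 8)" and q: "[p = 1] (mod 4)"
    show "hurwitz_sum m 8 p = (real p + 1) / 4 - 1 / 2 * real_of_int (chi_m4 x) * real_of_int x"
      using H2[OF m] chi[OF q] R1[OF q] by (simp add: field_simps)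
  next
    assume m: "[m = 2] (mod 8) \<or> [m = 6] (mod 8)" and q: "[p = 1] (mod 4)"
    show "hurwitz_sum m 8 p = (5 * real p - 7) / 12"
      unfolding H1[OF m] using R1(2,5)[OF q] by (simp add: field_simps)
  next
    assume m: "[m = 2] (mod 8) \<or> [m = 6] (mod 8)" and q: "[p = 3] (mod 4)"
    show "hurwitz_sum m 8 p = (real p + 1) / 4"
      unfolding H1[OF m] using R3(2,3)[OF c3[OF q]] by (simp add: field_simps)
  next
    assume m: "[m = 0] (mod 8)" and q: "[p = 3] (mod 8)"
    \<comment> \<open>With A and B for \<open>rsum usum\<close> at the residues 0 and 2, the
      equations are \<open>2 * (A + B) = p - 1\<close> and \<open>A + 3 * B = p - 2\<close>, so
      \<open>A = (p + 1) / 4\<close> and \<open>B = (p - 3) / 4\<close>. For p \<equiv> 7 (mod 8)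
      the roles of A and B are exchanged.\<close>
    show "hurwitz_sum m 8 p = (real p + 1) / 3"
      using H0[OF m] R3[OF c8(2)[OF q]] rsum_mod_8[of "int p"] c8(1)[OF q] by simp
  next
    assume m: "[m = 0] (mod 8)" and q: "[p = 7] (mod 8)"
    show "hurwitz_sum m 8 p = (real p - 3) / 2"
      using H0[OF m] R3[OF c7(2)[OF q]] rsum_mod_8[of "int p"] c7(1)[OF q] by simp
  next
    assume m: "[m = 4] (mod 8)" and q: "[p = 3] (mod 8)"
    show "hurwitz_sum m 8 p = (real p - 3) / 2"
      using H2[OF m] R3[OF c8(2)[OF q]] rsum_mod_8[of "int p"] c8(1)[OF q] by simp
  next
    assume m: "[m = 4] (mod 8)" and q: "[p = 7] (mod 8)"
    show "hurwitz_sum m 8 p = (real p + 1) / 3"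
      using H2[OF m] R3[OF c7(2)[OF q]] rsum_mod_8[of "int p"] c7(1)[OF q] by simp
  qed
qed

end
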